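(* Let $f\colon X\to Y$ be a c-proper map between finite spaces. For every $p\in X$, let $G_p$ denote the closure of $\{p\}$ in $f^{-1}(f(p))$ and set $\partial G_p=G_p-\{p\}$. One has a natural isomorphism $$\mathbb R f_*\mathbb Z_{\{p\}}=\mathbb Z_{\{f(p)\}}\otimes_{\mathbb Z}\mathbb R\Gamma_{\mathrm{red}}(\partial G_p,\mathbb Z)[-1].$$ In particular, $\mathbb R f_*\mathbb Z_{\{p\}}=\mathbb Z_{\{f(p)\}}$ if $p$ is $f$-closed (i.e. it is a closed point of the fibre $f^{-1}(f(p))$).
   Context: A finite space is a finite $T_0$ topological space, equivalently a finite poset with $p\le q$ iff $\overline{\{p\}}\subseteq\overline{\{q\}}$; open subsets are upper sets; continuous maps are the order-preserving maps. $C_p=\{x\le p\}$ is the closure of $\{p\}$. $\mathbb Z_{\{p\}}$ is the constant sheaf $\mathbb Z$ supported in $\{p\}$ (zero elsewhere). $\mathbb R\Gamma_{\mathrm{red}}(X,\mathbb Z)$ is the cone of $\mathbb Z\to\mathbb R\Gamma(X,\mathbb Z)$ (so $\mathbb R\Gamma_{\mathrm{red}}(\emptyset,\mathbb Z)=\mathbb Z[1]$). $X$ is cohomologically trivial if $\mathbb R\Gamma_{\mathrm{red}}(X,\mathbb Z)=0$. A continuous map $f\colon X\to Y$ is c-proper if for every $p\in X$ the map $f|_{C_p}\colon C_p\to C_{f(p)}$ has cohomologically trivial fibres. The isomorphisms are in the derived category $\mathrm D(Y)$ of complexes of sheaves of abelian groups on $Y$. *)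

theory Defs
  imports
    "HOL-Analysis.Abstract_Topological_Spaces"
    "HOL-Algebra.Free_Abelian_Groups"
    "HOL-Library.Infinite_Typeclass"
begin

text \<open>
  Abelian groups are groups in the sense of HOL-Algebra and are written multiplicatively, as
  there. Sheaves and complexes of sheaves live on an arbitrary
  \<^typ>\<open>'s topology\<close>; finiteness is used where a construction refers to the smallest open
  neighbourhood of a point, namely for stalks and for sheafification.

  The type \<^typ>\<open>'a\<close> of the values of injective sheaves plays the role of a universe and is
  required to be infinite. For a finite space the category of sheaves of abelian groups with
  values in an infinite type is abelian with enough injectives, and by Baer's criterion its
  injective objects are injective with respect to sheaves of any size.
\<close>

subsection \<open>Finite spaces\<close>

definition finite_space :: "'s topology \<Rightarrow> bool" where
  "finite_space X \<longleftrightarrow> finite (topspace X) \<and> t0_space X"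

definition min_nbhd :: "'s topology \<Rightarrow> 's \<Rightarrow> 's set" where
  "min_nbhd X x = \<Inter>{U. openin X U \<and> x \<in> U}"


subsection \<open>Complexes of abelian groups\<close>

record 'a group_complex =
  Ob :: "int \<Rightarrow> 'a monoid"
  Df :: "int \<Rightarrow> 'a \<Rightarrow> 'a"

definition cocycles :: "'a group_complex \<Rightarrow> int \<Rightarrow> 'a set" where
  "cocycles A n = {a \<in> carrier (Ob A n). Df A n a = \<one>\<^bsub>Ob A (n + 1)\<^esub>}"

definition coboundaries :: "'a group_complex \<Rightarrow> int \<Rightarrow> 'a set" where
  "coboundaries A n = Df A (n - 1) ` carrier (Ob A (n - 1))"

definition cohomology :: "'a group_complex \<Rightarrow> int \<Rightarrow> 'a set monoid" where
  "cohomology A n = (Ob A n)\<lparr>carrier := cocycles A n\<rparr> Mod coboundaries A n"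

text \<open>The map induced in cohomology sends the class of a cocycle \<open>a\<close>, which is a coset \<open>S\<close>,
  to the coset of \<open>\<phi> a\<close>, which is the product of the coboundaries with the image of \<open>S\<close>.\<close>

definition cohomology_map ::
  "'b group_complex \<Rightarrow> (int \<Rightarrow> 'a \<Rightarrow> 'b) \<Rightarrow> int \<Rightarrow> 'a set \<Rightarrow> 'b set" where
  "cohomology_map B \<phi> n S = coboundaries B n <#>\<^bsub>Ob B n\<^esub> (\<phi> n ` S)"

definition acyclic_complex :: "'a group_complex \<Rightarrow> bool" where
  "acyclic_complex A \<longleftrightarrow> (\<forall>n. trivial_group (cohomology A n))"

definition chain_homotopic ::
  "'a group_complex \<Rightarrow> 'b group_complex \<Rightarrow> (int \<Rightarrow> 'a \<Rightarrow> 'b) \<Rightarrow> (int \<Rightarrow> 'a \<Rightarrow> 'b) \<Rightarrow> bool" where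
  "chain_homotopic A B \<phi> \<psi> \<longleftrightarrow>
    (\<exists>h. (\<forall>n. h n \<in> hom (Ob A n) (Ob B (n - 1))) \<and>
         (\<forall>n. \<forall>a\<in>carrier (Ob A n).
            \<phi> n a = \<psi> n a \<otimes>\<^bsub>Ob B n\<^esub> (Df B (n - 1) (h n a) \<otimes>\<^bsub>Ob B n\<^esub> h (n + 1) (Df A n a))))"

definition group_deg0 :: "'a monoid \<Rightarrow> 'a group_complex" where
  "group_deg0 G = \<lparr>Ob = (\<lambda>n. if n = 0 then G else singleton_group \<one>\<^bsub>G\<^esub>), Df = (\<lambda>n a. \<one>\<^bsub>G\<^esub>)\<rparr>"

text \<open>Sign conventions: the cone has differential \<open>(a, b) \<mapsto> (- d a, \<phi> a + d b)\<close>, and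
  the shift by \<open>k\<close> has differential \<open>(-1)\<^sup>k d\<close>.\<close>

definition group_cone ::
  "(int \<Rightarrow> 'a \<Rightarrow> 'b) \<Rightarrow> 'a group_complex \<Rightarrow> 'b group_complex \<Rightarrow> ('a \<times> 'b) group_complex" where
  "group_cone \<phi> A B =
    \<lparr>Ob = (\<lambda>n. Ob A (n + 1) \<times>\<times> Ob B n),
     Df = (\<lambda>n (a, b). (inv\<^bsub>Ob A (n + 2)\<^esub> Df A (n + 1) a, \<phi> (n + 1) a \<otimes>\<^bsub>Ob B (n + 1)\<^esub> Df B n b))\<rparr>"

definition group_shift :: "int \<Rightarrow> 'a group_complex \<Rightarrow> 'a group_complex" where
  "group_shift k A =
    \<lparr>Ob = (\<lambda>n. Ob A (n + k)),
     Df = (\<lambda>n a. if even k then Df A (n + k) a else inv\<^bsub>Ob A (n + k + 1)\<^esub> Df A (n + k) a)\<rparr>"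


subsection \<open>Sheaves of abelian groups\<close>

record ('s, 'a) presheaf_data =
  sect :: "'s set \<Rightarrow> 'a monoid"
  rest :: "'s set \<Rightarrow> 's set \<Rightarrow> 'a \<Rightarrow> 'a"   \<comment> \<open>\<open>rest F U V\<close> restricts from \<open>U\<close> to \<open>V\<close>\<close>

definition presheaf :: "'s topology \<Rightarrow> ('s, 'a) presheaf_data \<Rightarrow> bool" where
  "presheaf X F \<longleftrightarrow>
    (\<forall>U. openin X U \<longrightarrow> comm_group (sect F U)) \<and>
    (\<forall>U V. openin X U \<and> openin X V \<and> V \<subseteq> U \<longrightarrow> rest F U V \<in> hom (sect F U) (sect F V)) \<and>
    (\<forall>U. openin X U \<longrightarrow> (\<forall>s\<in>carrier (sect F U). rest F U U s = s)) \<and>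
    (\<forall>U V W. openin X U \<and> openin X V \<and> openin X W \<and> W \<subseteq> V \<and> V \<subseteq> U \<longrightarrow>
       (\<forall>s\<in>carrier (sect F U). rest F V W (rest F U V s) = rest F U W s))"

definition sheaf :: "'s topology \<Rightarrow> ('s, 'a) presheaf_data \<Rightarrow> bool" where
  "sheaf X F \<longleftrightarrow> presheaf X F \<and>
    (\<forall>\<U> s. (\<forall>U\<in>\<U>. openin X U \<and> s U \<in> carrier (sect F U)) \<and>
           (\<forall>U\<in>\<U>. \<forall>V\<in>\<U>. rest F U (U \<inter> V) (s U) = rest F V (U \<inter> V) (s V)) \<longrightarrow>
       (\<exists>!t. t \<in> carrier (sect F (\<Union>\<U>)) \<and> (\<forall>U\<in>\<U>. rest F (\<Union>\<U>) U t = s U)))"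

definition sheaf_morphism ::
  "'s topology \<Rightarrow> ('s, 'a) presheaf_data \<Rightarrow> ('s, 'b) presheaf_data \<Rightarrow> ('s set \<Rightarrow> 'a \<Rightarrow> 'b) \<Rightarrow> bool"
  where
  "sheaf_morphism X F G \<phi> \<longleftrightarrow>
    (\<forall>U. openin X U \<longrightarrow> \<phi> U \<in> hom (sect F U) (sect G U)) \<and>
    (\<forall>U V. openin X U \<and> openin X V \<and> V \<subseteq> U \<longrightarrow>
       (\<forall>s\<in>carrier (sect F U). \<phi> V (rest F U V s) = rest G U V (\<phi> U s)))"

definition injective_sheaf :: "'s topology \<Rightarrow> ('s, 'a::infinite) presheaf_data \<Rightarrow> bool" where
  "injective_sheaf X I \<longleftrightarrow> sheaf X I \<and>
    (\<forall>(A :: ('s, 'a) presheaf_data) (B :: ('s, 'a) presheaf_data) \<iota> g.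
       sheaf X A \<and> sheaf X B \<and>
       sheaf_morphism X A B \<iota> \<and> (\<forall>U. openin X U \<longrightarrow> inj_on (\<iota> U) (carrier (sect A U))) \<and>
       sheaf_morphism X A I g \<longrightarrow>
       (\<exists>h. sheaf_morphism X B I h \<and>
            (\<forall>U. openin X U \<longrightarrow> (\<forall>s\<in>carrier (sect A U). h U (\<iota> U s) = g U s))))"

text \<open>
  The sheaf \<open>\<int>\<^sub>S\<close> for a locally closed set \<open>S\<close>: the constant sheaf \<open>\<int>\<close> on \<open>S\<close>, extended
  by zero. Its sections over \<open>U\<close> are the locally constant integer functions on \<open>U \<inter> S\<close> whose
  support is closed in \<open>U\<close>. They are represented by functions on the whole type that vanish
  outside \<open>U \<inter> S\<close>. For \<open>S = topspace X\<close> this is the constant sheaf.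
\<close>

definition const_sheaf :: "'s topology \<Rightarrow> 's set \<Rightarrow> ('s, 's \<Rightarrow> int) presheaf_data" where
  "const_sheaf X S =
    \<lparr>sect = (\<lambda>U. \<lparr>carrier = {s. (\<forall>x. x \<notin> U \<inter> S \<longrightarrow> s x = 0) \<and>
                      continuous_map (subtopology X (U \<inter> S)) (discrete_topology UNIV) s \<and>
                      closedin (subtopology X U) {x \<in> U. s x \<noteq> 0}},
                  monoid.mult = (\<lambda>s t x. s x + t x),
                  one = (\<lambda>x. 0)\<rparr>),
     rest = (\<lambda>U V s x. if x \<in> V then s x else 0)\<rparr>"


subsection \<open>Complexes of sheaves\<close>

record ('s, 'a) sheaf_complex =
  Sh :: "int \<Rightarrow> ('s, 'a) presheaf_data"
  Dsh :: "int \<Rightarrow> 's set \<Rightarrow> 'a \<Rightarrow> 'a"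

definition is_sheaf_complex :: "'s topology \<Rightarrow> ('s, 'a) sheaf_complex \<Rightarrow> bool" where
  "is_sheaf_complex X K \<longleftrightarrow>
    (\<forall>n. sheaf X (Sh K n)) \<and>
    (\<forall>n. sheaf_morphism X (Sh K n) (Sh K (n + 1)) (Dsh K n)) \<and>
    (\<forall>n U. openin X U \<longrightarrow> (\<forall>s\<in>carrier (sect (Sh K n) U).
       Dsh K (n + 1) U (Dsh K n U s) = \<one>\<^bsub>sect (Sh K (n + 2)) U\<^esub>))"

definition sections :: "('s, 'a) sheaf_complex \<Rightarrow> 's set \<Rightarrow> 'a group_complex" where
  "sections K U = \<lparr>Ob = (\<lambda>n. sect (Sh K n) U), Df = (\<lambda>n. Dsh K n U)\<rparr>"

definition complex_morphism ::
  "'s topology \<Rightarrow> ('s, 'a) sheaf_complex \<Rightarrow> ('s, 'b) sheaf_complex \<Rightarrow>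
   (int \<Rightarrow> 's set \<Rightarrow> 'a \<Rightarrow> 'b) \<Rightarrow> bool" where
  "complex_morphism X K L \<phi> \<longleftrightarrow>
    is_sheaf_complex X K \<and> is_sheaf_complex X L \<and>
    (\<forall>n. sheaf_morphism X (Sh K n) (Sh L n) (\<phi> n)) \<and>
    (\<forall>n U. openin X U \<longrightarrow> (\<forall>s\<in>carrier (sect (Sh K n) U).
       \<phi> (n + 1) U (Dsh K n U s) = Dsh L n U (\<phi> n U s)))"

text \<open>On a finite space the stalk at \<open>x\<close> is the group of sections over the smallest open
  neighbourhood of \<open>x\<close>.\<close>

definition quasi_isomorphism ::
  "'s topology \<Rightarrow> ('s, 'a) sheaf_complex \<Rightarrow> ('s, 'b) sheaf_complex \<Rightarrow>
   (int \<Rightarrow> 's set \<Rightarrow> 'a \<Rightarrow> 'b) \<Rightarrow> bool" where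
  "quasi_isomorphism X K L \<phi> \<longleftrightarrow> complex_morphism X K L \<phi> \<and>
    (\<forall>x\<in>topspace X. \<forall>n. let U = min_nbhd X x in
       cohomology_map (sections L U) (\<lambda>m. \<phi> m U) n
         \<in> iso (cohomology (sections K U) n) (cohomology (sections L U) n))"

text \<open>
  An isomorphism \<open>L \<rightarrow> K\<close> in the derived category is represented by a roof
  \<open>L \<rightarrow> P \<leftarrow> K\<close> of quasi-isomorphisms. For bounded below \<open>K\<close> the complex \<open>P\<close> can be taken to be an
  injective resolution of \<open>K\<close>, so there is no loss in letting \<open>P\<close> have values in the same
  (infinite) type as \<open>K\<close>.
\<close>

definition derived_iso_roof ::
  "'s topology \<Rightarrow> ('s, 'b) sheaf_complex \<Rightarrow> ('s, 'a) sheaf_complex \<Rightarrow> ('s, 'a) sheaf_complex \<Rightarrow>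
   (int \<Rightarrow> 's set \<Rightarrow> 'b \<Rightarrow> 'a) \<Rightarrow> (int \<Rightarrow> 's set \<Rightarrow> 'a \<Rightarrow> 'a) \<Rightarrow> bool" where
  "derived_iso_roof X L P K \<beta> \<alpha> \<longleftrightarrow> quasi_isomorphism X L P \<beta> \<and> quasi_isomorphism X K P \<alpha>"

definition derived_isomorphic ::
  "'s topology \<Rightarrow> ('s, 'b) sheaf_complex \<Rightarrow> ('s, 'a::infinite) sheaf_complex \<Rightarrow> bool" where
  "derived_isomorphic X L K \<longleftrightarrow> (\<exists>P \<beta> \<alpha>. derived_iso_roof X L P K \<beta> \<alpha>)"

definition sheaf_deg0 :: "('s, 'a) presheaf_data \<Rightarrow> ('s, 'a) sheaf_complex" where
  "sheaf_deg0 F =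
    \<lparr>Sh = (\<lambda>n. \<lparr>sect = (\<lambda>U. Ob (group_deg0 (sect F U)) n), rest = rest F\<rparr>),
     Dsh = (\<lambda>n U. Df (group_deg0 (sect F U)) n)\<rparr>"

definition sheaf_cone ::
  "(int \<Rightarrow> 's set \<Rightarrow> 'a \<Rightarrow> 'b) \<Rightarrow> ('s, 'a) sheaf_complex \<Rightarrow> ('s, 'b) sheaf_complex \<Rightarrow>
   ('s, 'a \<times> 'b) sheaf_complex" where
  "sheaf_cone \<phi> K L =
    \<lparr>Sh = (\<lambda>n. \<lparr>sect = (\<lambda>U. Ob (group_cone (\<lambda>m. \<phi> m U) (sections K U) (sections L U)) n),
                rest = (\<lambda>U V (s, t). (rest (Sh K (n + 1)) U V s, rest (Sh L n) U V t))\<rparr>),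
     Dsh = (\<lambda>n U. Df (group_cone (\<lambda>m. \<phi> m U) (sections K U) (sections L U)) n)\<rparr>"

definition sheaf_shift :: "int \<Rightarrow> ('s, 'a) sheaf_complex \<Rightarrow> ('s, 'a) sheaf_complex" where
  "sheaf_shift k K =
    \<lparr>Sh = (\<lambda>n. Sh K (n + k)), Dsh = (\<lambda>n U. Df (group_shift k (sections K U)) n)\<rparr>"


subsection \<open>Derived direct images and reduced cohomology\<close>

text \<open>
  Derived functors are computed by injective resolutions: if \<open>I\<close> is an injective resolution of
  \<open>F\<close>, then \<open>pushforward X f I\<close> is \<open>Rf\<^sub>* F\<close> and \<open>sections I (topspace X)\<close> is \<open>R\<Gamma>(X, F)\<close>.
\<close>

definition augmentation ::
  "('s, 'a) sheaf_complex \<Rightarrow> ('s set \<Rightarrow> 'b \<Rightarrow> 'a) \<Rightarrow> int \<Rightarrow> 's set \<Rightarrow> 'b \<Rightarrow> 'a" where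
  "augmentation I \<epsilon> n U s = (if n = 0 then \<epsilon> U s else \<one>\<^bsub>sect (Sh I n) U\<^esub>)"

definition injective_resolution ::
  "'s topology \<Rightarrow> ('s, 'b) presheaf_data \<Rightarrow> ('s, 'a::infinite) sheaf_complex \<Rightarrow>
   ('s set \<Rightarrow> 'b \<Rightarrow> 'a) \<Rightarrow> bool" where
  "injective_resolution X F I \<epsilon> \<longleftrightarrow>
    (\<forall>n. injective_sheaf X (Sh I n)) \<and>
    (\<forall>n<0. \<forall>U. openin X U \<longrightarrow> trivial_group (sect (Sh I n) U)) \<and>
    quasi_isomorphism X (sheaf_deg0 F) I (augmentation I \<epsilon>)"

definition pushforward ::
  "'x topology \<Rightarrow> ('x \<Rightarrow> 'y) \<Rightarrow> ('x, 'a) sheaf_complex \<Rightarrow> ('y, 'a) sheaf_complex" where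
  "pushforward X f K =
    (let pre = (\<lambda>V. {x \<in> topspace X. f x \<in> V}) in
    \<lparr>Sh = (\<lambda>n. \<lparr>sect = (\<lambda>V. sect (Sh K n) (pre V)),
                rest = (\<lambda>V W. rest (Sh K n) (pre V) (pre W))\<rparr>),
     Dsh = (\<lambda>n V. Dsh K n (pre V))\<rparr>)"

text \<open>The cone of \<open>\<int> \<rightarrow> R\<Gamma>(S, \<int>)\<close>, where \<open>(J, \<eta>)\<close> is an injective resolution of the
  constant sheaf on \<open>S\<close>.\<close>

definition RGamma_red ::
  "'s topology \<Rightarrow> ('s, 'a) sheaf_complex \<Rightarrow> ('s set \<Rightarrow> ('s \<Rightarrow> int) \<Rightarrow> 'a) \<Rightarrow>
   (int \<times> 'a) group_complex" where
  "RGamma_red S J \<eta> =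
    group_cone
      (\<lambda>n k. augmentation J \<eta> n (topspace S) (\<lambda>x. if x \<in> topspace S then k else 0))
      (group_deg0 integer_group) (sections J (topspace S))"

definition cohomologically_trivial :: "'a::infinite itself \<Rightarrow> 's topology \<Rightarrow> bool" where
  "cohomologically_trivial T S \<longleftrightarrow>
    (\<exists>(J :: ('s, 'a) sheaf_complex) \<eta>.
       injective_resolution S (const_sheaf S (topspace S)) J \<eta> \<and>
       acyclic_complex (RGamma_red S J \<eta>))"

definition c_proper ::
  "'a::infinite itself \<Rightarrow> 'x topology \<Rightarrow> 'y topology \<Rightarrow> ('x \<Rightarrow> 'y) \<Rightarrow> bool" where
  "c_proper T X Y f \<longleftrightarrow> continuous_map X Y f \<and>
    (\<forall>p\<in>topspace X. \<forall>y \<in> Y closure_of {f p}.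
       cohomologically_trivial T (subtopology X {x \<in> X closure_of {p}. f x = y}))"


subsection \<open>Tensor product of a sheaf with a complex of abelian groups\<close>

definition tensor_relations :: "'a monoid \<Rightarrow> 'b monoid \<Rightarrow> ('a \<times> 'b \<Rightarrow>\<^sub>0 int) set" where
  "tensor_relations A B = generate (free_Abelian_group (carrier A \<times> carrier B))
    ({frag_of (a \<otimes>\<^bsub>A\<^esub> a', b) - frag_of (a, b) - frag_of (a', b) | a a' b.
        a \<in> carrier A \<and> a' \<in> carrier A \<and> b \<in> carrier B} \<union>
     {frag_of (a, b \<otimes>\<^bsub>B\<^esub> b') - frag_of (a, b) - frag_of (a, b') | a b b'.
        a \<in> carrier A \<and> b \<in> carrier B \<and> b' \<in> carrier B})"

definition tensor_group :: "'a monoid \<Rightarrow> 'b monoid \<Rightarrow> ('a \<times> 'b \<Rightarrow>\<^sub>0 int) set monoid" where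
  "tensor_group A B = free_Abelian_group (carrier A \<times> carrier B) Mod tensor_relations A B"

definition pure_tensor :: "'a monoid \<Rightarrow> 'b monoid \<Rightarrow> 'a \<Rightarrow> 'b \<Rightarrow> ('a \<times> 'b \<Rightarrow>\<^sub>0 int) set" where
  "pure_tensor A B a b =
    tensor_relations A B #>\<^bsub>free_Abelian_group (carrier A \<times> carrier B)\<^esub> frag_of (a, b)"

text \<open>The homomorphism \<open>g \<otimes> h\<close> with target \<open>A \<otimes> B\<close>; as for cohomology, the class given by a coset
  \<open>S\<close> goes to the product of the relations with the image of \<open>S\<close>.\<close>

definition tensor_map ::
  "'a monoid \<Rightarrow> 'b monoid \<Rightarrow> ('c \<Rightarrow> 'a) \<Rightarrow> ('d \<Rightarrow> 'b) \<Rightarrow>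
   ('c \<times> 'd \<Rightarrow>\<^sub>0 int) set \<Rightarrow> ('a \<times> 'b \<Rightarrow>\<^sub>0 int) set" where
  "tensor_map A B g h S =
    tensor_relations A B <#>\<^bsub>free_Abelian_group (carrier A \<times> carrier B)\<^esub>
      (frag_extend (\<lambda>(c, d). frag_of (g c, h d)) ` S)"

text \<open>Sheafification on a finite space: a section over \<open>U\<close> is a family of germs, one for every
  point of \<open>U\<close>, that is compatible with the restrictions between smallest neighbourhoods.\<close>

definition sheafify ::
  "'s topology \<Rightarrow> ('s, 'a) presheaf_data \<Rightarrow> ('s, 's \<Rightarrow> 'a) presheaf_data" where
  "sheafify X F =
    \<lparr>sect = (\<lambda>U. let G = product_group U (\<lambda>x. sect F (min_nbhd X x)) in
               G\<lparr>carrier := {s \<in> carrier G. \<forall>x\<in>U. \<forall>y\<in>min_nbhd X x.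
                   rest F (min_nbhd X x) (min_nbhd X y) (s x) = s y}\<rparr>),
     rest = (\<lambda>U V s. restrict s V)\<rparr>"

definition tensor_presheaf ::
  "('s, 'a) presheaf_data \<Rightarrow> 'b monoid \<Rightarrow> ('s, ('a \<times> 'b \<Rightarrow>\<^sub>0 int) set) presheaf_data" where
  "tensor_presheaf F A =
    \<lparr>sect = (\<lambda>U. tensor_group (sect F U) A),
     rest = (\<lambda>U V. tensor_map (sect F V) A (rest F U V) id)\<rparr>"

text \<open>This computes the derived tensor product when the stalks of \<open>F\<close> are flat, in particular
  for \<open>F = \<int>\<^sub>{\<^sub>c\<^sub>}\<close>.\<close>

definition sheaf_tensor ::
  "'s topology \<Rightarrow> ('s, 'a) presheaf_data \<Rightarrow> 'b group_complex \<Rightarrow>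
   ('s, 's \<Rightarrow> ('a \<times> 'b \<Rightarrow>\<^sub>0 int) set) sheaf_complex" where
  "sheaf_tensor X F M =
    \<lparr>Sh = (\<lambda>n. sheafify X (tensor_presheaf F (Ob M n))),
     Dsh = (\<lambda>n U s. \<lambda>x\<in>U. tensor_map (sect F (min_nbhd X x)) (Ob M (n + 1)) id (Df M n) (s x))\<rparr>"

text \<open>The section \<open>t \<otimes> m\<close> over \<open>U\<close>, for a section \<open>t\<close> of \<open>F\<close> over \<open>U\<close>.\<close>

definition tensor_section ::
  "'s topology \<Rightarrow> ('s, 'a) presheaf_data \<Rightarrow> 'b monoid \<Rightarrow> 's set \<Rightarrow> 'a \<Rightarrow> 'b \<Rightarrow>
   's \<Rightarrow> ('a \<times> 'b \<Rightarrow>\<^sub>0 int) set" where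
  "tensor_section X F A U t m =
    (\<lambda>x\<in>U. pure_tensor (sect F (min_nbhd X x)) A (rest F U (min_nbhd X x) t) m)"


subsection \<open>Naturality\<close>

definition fibre_closure :: "'x topology \<Rightarrow> ('x \<Rightarrow> 'y) \<Rightarrow> 'x \<Rightarrow> 'x set" where
  "fibre_closure X f p = subtopology X {x \<in> topspace X. f x = f p} closure_of {p}"

definition fibre_boundary :: "'x topology \<Rightarrow> ('x \<Rightarrow> 'y) \<Rightarrow> 'x \<Rightarrow> 'x topology" where
  "fibre_boundary X f p = subtopology X (fibre_closure X f p - {p})"

text \<open>
  Write \<open>G\<close> for the closure of \<open>p\<close> in its fibre, \<open>\<partial>G = G - {p}\<close>, \<open>i : \<partial>G \<rightarrow> X\<close> for the
  inclusion, \<open>c = f p\<close>, and \<open>V\<close> for the inverse image of the smallest open neighbourhood of \<open>c\<close>.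
  If \<open>f\<close> is continuous, \<open>G\<close> is closed in \<open>V\<close>: it is the closure of \<open>p\<close> in \<open>V\<close>. The exact sequence
  \<open>0 \<rightarrow> \<int>\<^sub>{\<^sub>p\<^sub>} \<rightarrow> \<int>\<^sub>G \<rightarrow> i\<^sub>* \<int> \<rightarrow> 0\<close> on \<open>V\<close> gives a quasi-isomorphism from \<open>\<int>\<^sub>{\<^sub>p\<^sub>}\<close> to the complex
  \<open>(cone (\<int>\<^sub>G \<rightarrow> i\<^sub>* J))[-1]\<close>, called \<open>relative_complex\<close> below.
\<close>

definition relative_complex ::
  "'x topology \<Rightarrow> 'x set \<Rightarrow> 'x topology \<Rightarrow> ('x, 'a) sheaf_complex \<Rightarrow>
   ('x set \<Rightarrow> ('x \<Rightarrow> int) \<Rightarrow> 'a) \<Rightarrow> ('x, ('x \<Rightarrow> int) \<times> 'a) sheaf_complex" where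
  "relative_complex XV G dG J \<eta> =
    sheaf_shift (-1)
      (sheaf_cone
        (\<lambda>n U s. augmentation J \<eta> n (U \<inter> topspace dG) (\<lambda>x. if x \<in> topspace dG then s x else 0))
        (sheaf_deg0 (const_sheaf XV G))
        (pushforward dG id J))"

text \<open>
  Since \<open>I\<close> is a complex of injective sheaves, \<open>\<epsilon>\<close> extends from \<open>\<int>\<^sub>{\<^sub>p\<^sub>}\<close> to a morphism
  \<open>\<theta>\<close> from the relative complex to \<open>I\<close> on \<open>V\<close>, uniquely up to homotopy. On sections over \<open>V\<close>
  this is the canonical morphism from \<open>R\<Gamma>\<^sub>r\<^sub>e\<^sub>d(\<partial>G, \<int>)[-1]\<close> to the stalk \<open>R\<Gamma>(V, \<int>\<^sub>{\<^sub>p\<^sub>})\<close> of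
  \<open>Rf\<^sub>* \<int>\<^sub>{\<^sub>p\<^sub>}\<close> at \<open>c\<close>. A morphism \<open>\<int>\<^sub>{\<^sub>c\<^sub>} \<otimes> R\<Gamma>\<^sub>r\<^sub>e\<^sub>d(\<partial>G, \<int>)[-1] \<rightarrow> Rf\<^sub>* \<int>\<^sub>{\<^sub>p\<^sub>}\<close>, given by a roof
  \<open>(P, \<beta>, \<alpha>)\<close>, is the natural one if it induces this canonical morphism on the stalks at \<open>c\<close>.
\<close>

definition natural_roof ::
  "'x topology \<Rightarrow> 'y topology \<Rightarrow> ('x \<Rightarrow> 'y) \<Rightarrow> 'x \<Rightarrow>
   ('x, 'a) sheaf_complex \<Rightarrow> ('x set \<Rightarrow> ('x \<Rightarrow> int) \<Rightarrow> 'a) \<Rightarrow>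
   ('x, 'a) sheaf_complex \<Rightarrow> ('x set \<Rightarrow> ('x \<Rightarrow> int) \<Rightarrow> 'a) \<Rightarrow>
   ('y, 'a) sheaf_complex \<Rightarrow>
   (int \<Rightarrow> 'y set \<Rightarrow> ('y \<Rightarrow> (('y \<Rightarrow> int) \<times> (int \<times> 'a) \<Rightarrow>\<^sub>0 int) set) \<Rightarrow> 'a) \<Rightarrow>
   (int \<Rightarrow> 'y set \<Rightarrow> 'a \<Rightarrow> 'a) \<Rightarrow> bool" where
  "natural_roof X Y f p I \<epsilon> J \<eta> P \<beta> \<alpha> \<longleftrightarrow>
    (let c = f p;
         Uc = min_nbhd Y c;
         V = {x \<in> topspace X. f x \<in> Uc};
         XV = subtopology X V;
         G = fibre_closure X f p;
         dG = fibre_boundary X f p;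
         M = group_shift (-1) (RGamma_red dG J \<eta>)
     in \<exists>\<theta>. complex_morphism XV (relative_complex XV G dG J \<eta>) I \<theta> \<and>
          (\<forall>U. openin XV U \<longrightarrow> (\<forall>s\<in>carrier (sect (const_sheaf XV {p}) U).
             \<theta> 0 U (s, \<one>\<^bsub>sect (Sh J (-1)) (U \<inter> topspace dG)\<^esub>) = \<epsilon> U s)) \<and>
          chain_homotopic M (sections P Uc)
            (\<lambda>n m. \<beta> n Uc
               (tensor_section Y (const_sheaf Y {c}) (Ob M n) Uc (\<lambda>y. if y = c then 1 else 0) m))
            (\<lambda>n (k, b). \<alpha> n Uc (\<theta> n V (\<lambda>x. if x \<in> G then k else 0, b))))"

end

theory Submission
 imports
  Defs
  "HOL-Algebra.Weak_Morphisms"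
  "HOL-Analysis.Finite_Cartesian_Product"
begin

text \<open>
 A morphism of complexes of sheaves on \<open>Y\<close> whose source lives only at the point \<open>c = f p\<close> is the same as
 a chain map on stalks at \<open>c\<close> with trivial restriction to the points above \<open>c\<close>. It is a
 quasi-isomorphism once it is one at \<open>c\<close> and the target is exact at all other points.

 Exactness away from \<open>c\<close>: at \<open>y\<close> the stalk of the direct image is computed by the cohomology of
 \<open>f\<^sup>-\<^sup>1(U\<^sub>y)\<close> with coefficients in the point sheaf, hence by alternating cochains on chains of points
 of \<open>f\<^sup>-\<^sup>1(U\<^sub>y) \<inter> C\<^sub>p\<close> relative to \<open>p\<close>. This vanishes by a cohomological form of Quillen's fibre lemma,
 whose hypothesis is that the fibres of \<open>C\<^sub>p \<rightarrow> C\<^bsub>f p\<^esub>\<close> are cohomologically trivial.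

 The stalk at \<open>c\<close>: on the inverse image \<open>V\<close> of the smallest neighbourhood of \<open>c\<close> the relative complex is a
 flasque resolution of the point sheaf, so its comparison map to the given injective resolution
 is a quasi-isomorphism on sections over \<open>V\<close>. When \<open>p\<close> is closed in its fibre, the point sheaf on \<open>V\<close> is
 itself flasque.
\<close>

text \<open>Sheaves are handled through their values on smallest neighbourhoods, where a sheaf is a
  functor on the specialisation order; morphisms are built stalk by stalk and then glued. An
  obstacle is the type \<open>'a\<close> of values: injectivity is tested only against sheaves with
  values in \<open>'a\<close>, whereas constant sheaves, cochains and the relative complex have
  other types. Such sheaves are carried into \<open>'a\<close> by injections, which exist because
  the stalks are countable or built from \<open>'a\<close>, and \<open>'a\<close> is infinite.
  Exactness on stalks passes to sections for flasque complexes that are bounded below; hence the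
  auxiliary resolutions are all flasque. Cochains on chains of points turn cohomology into finite
  combinatorics, where a reduced cochain may mix all degrees. Nonemptiness of the fibres is
  contained in their triviality, since the empty space has reduced cohomology in degree -1. The apex
  of the roof is \<open>pushforward X f I\<close> itself, and the comparison on stalks at
  \<open>f p\<close> commutes on the nose, so the required homotopy is zero.\<close>

abbreviation stalk :: "'s topology \<Rightarrow> ('s, 'a) presheaf_data \<Rightarrow> 's \<Rightarrow> 'a monoid" where
 "stalk X F x \<equiv> sect F (min_nbhd X x)"

abbreviation secs :: "('s, 'a) presheaf_data \<Rightarrow> 's set \<Rightarrow> 'a set" where
 "secs F U \<equiv> carrier (sect F U)"

abbreviation one_sect :: "('s, 'a) presheaf_data \<Rightarrow> 's set \<Rightarrow> 'a" where
 "one_sect F U \<equiv> \<one>\<^bsub>sect F U\<^esub>"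

abbreviation germs :: "'s topology \<Rightarrow> ('s, 'a) presheaf_data \<Rightarrow> 's \<Rightarrow> 'a set" where
 "germs X F x \<equiv> carrier (stalk X F x)"

abbreviation germ :: "'s topology \<Rightarrow> ('s, 'a) presheaf_data \<Rightarrow> 's \<Rightarrow> 's \<Rightarrow> 'a \<Rightarrow> 'a" where
 "germ X F x y \<equiv> rest F (min_nbhd X x) (min_nbhd X y)"

abbreviation stalks :: "'s topology \<Rightarrow> ('s, 'a) sheaf_complex \<Rightarrow> 's \<Rightarrow> 'a group_complex" where
 "stalks X K x \<equiv> sections K (min_nbhd X x)"

abbreviation obs :: "'a group_complex \<Rightarrow> int \<Rightarrow> 'a set" where
 "obs A n \<equiv> carrier (Ob A n)"

abbreviation one_ob :: "'a group_complex \<Rightarrow> int \<Rightarrow> 'a" where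
 "one_ob A n \<equiv> \<one>\<^bsub>Ob A n\<^esub>"

subsection \<open>Complexes of abelian groups\<close>

definition group_complex :: "'a group_complex \<Rightarrow> bool" where
 "group_complex A \<longleftrightarrow>
  (\<forall>n. comm_group (Ob A n)) \<and>
  (\<forall>n. Df A n \<in> hom (Ob A n) (Ob A (n + 1))) \<and>
  (\<forall>n. \<forall>a\<in>obs A n. Df A (n + 1) (Df A n a) = one_ob A (n + 2))"

definition chain_map :: "'a group_complex \<Rightarrow> 'b group_complex \<Rightarrow> (int \<Rightarrow> 'a \<Rightarrow> 'b) \<Rightarrow> bool" where
 "chain_map A B \<phi> \<longleftrightarrow>
  (\<forall>n. \<phi> n \<in> hom (Ob A n) (Ob B n)) \<and>
  (\<forall>n. \<forall>a\<in>obs A n. \<phi> (n + 1) (Df A n a) = Df B n (\<phi> n a))"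

definition exact_complex :: "'a group_complex \<Rightarrow> bool" where
 "exact_complex A \<longleftrightarrow> (\<forall>n. cocycles A n \<subseteq> coboundaries A n)"

text \<open>Injectivity and surjectivity on cohomology in terms of representatives. Diagram chases
  in this form involve no quotient groups, and \<open>quasi_iso_iff_cohomology\<close> translates to
  the coset form.\<close>

definition quasi_iso :: "'a group_complex \<Rightarrow> 'b group_complex \<Rightarrow> (int \<Rightarrow> 'a \<Rightarrow> 'b) \<Rightarrow> bool" where
 "quasi_iso A B \<phi> \<longleftrightarrow> (\<forall>n.
  (\<forall>a\<in>cocycles A n. \<phi> n a \<in> coboundaries B n \<longrightarrow> a \<in> coboundaries A n) \<and>
  (\<forall>b\<in>cocycles B n. \<exists>a\<in>cocycles A n. \<exists>c\<in>coboundaries B n. b = \<phi> n a \<otimes>\<^bsub>Ob B n\<^esub> c))"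

lemma complexD:
 assumes "group_complex A"
 shows "comm_group (Ob A n)" "group (Ob A n)" "monoid (Ob A n)"
  and "Df A n \<in> hom (Ob A n) (Ob A (n + 1))"
  and "a \<in> obs A n \<Longrightarrow> Df A (n + 1) (Df A n a) = one_ob A (n + 2)"
 using assms unfolding group_complex_def
 by (auto simp: comm_group.axioms(2) group.is_monoid)

lemma chain_mapD:
 assumes "chain_map A B \<phi>"
 shows "\<phi> n \<in> hom (Ob A n) (Ob B n)"
  and "a \<in> obs A n \<Longrightarrow> \<phi> (n + 1) (Df A n a) = Df B n (\<phi> n a)"
 using assms unfolding chain_map_def by auto

lemma coboundaries_alt:
 "coboundaries A (n + 1) = Df A n ` obs A n"
 by (simp add: coboundaries_def)

lemma subgroup_kernel:
 assumes "group G" "group H" "h \<in> hom G H"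
 shows "subgroup {a \<in> carrier G. h a = \<one>\<^bsub>H\<^esub>} G"
 using group_hom.subgroup_kernel[of G H h] assms
 by (simp add: group_hom_def group_hom_axioms_def kernel_def)

lemma subgroup_image:
 assumes "group G" "group H" "h \<in> hom G H"
 shows "subgroup (h ` carrier G) H"
 using group_hom.img_is_subgroup[of G H h] assms
 by (simp add: group_hom_def group_hom_axioms_def)

lemma subgroup_cocycles: "group_complex A \<Longrightarrow> subgroup (cocycles A n) (Ob A n)"
 unfolding cocycles_def by (rule subgroup_kernel) (auto simp: complexD)

lemma subgroup_coboundaries: "group_complex A \<Longrightarrow> subgroup (coboundaries A n) (Ob A n)"
 unfolding coboundaries_def
 by (rule subgroup_image)
   (auto simp: complexD intro: complexD(4)[of A "n - 1", simplified])

lemma chain_map_cocycles: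
 assumes "group_complex A" "group_complex B" "chain_map A B \<phi>" "a \<in> cocycles A n"
 shows "\<phi> n a \<in> cocycles B n"
proof -
 have "\<phi> (n + 1) (one_ob A (n + 1)) = one_ob B (n + 1)"
  by (meson assms chain_mapD(1) complexD(2) hom_one)
 then show ?thesis
  using assms(4) chain_mapD(1)[OF assms(3), of n] chain_mapD(2)[OF assms(3), where a = a and n = n]
  by (auto simp: cocycles_def hom_def)
qed

lemma chain_map_coboundaries:
 assumes "chain_map A B \<phi>" "a \<in> coboundaries A n"
 shows "\<phi> n a \<in> coboundaries B n"
 using assms(2) chain_mapD(2)[OF assms(1), where n = "n - 1"] chain_mapD(1)[OF assms(1), of "n - 1"]
 by (force simp: coboundaries_def hom_def)

lemma acyclic_complex_imp_exact:
 assumes "group_complex A" "acyclic_complex A"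
 shows "exact_complex A"
 unfolding exact_complex_def
proof (intro allI subsetI)
 fix n a assume a: "a \<in> cocycles A n"
 interpret comm_group "Ob A n" using complexD(1)[OF assms(1)] .
 have sub: "subgroup (coboundaries A n) (Ob A n)"
  using subgroup_coboundaries[OF assms(1)] .
 have "carrier (cohomology A n) = {coboundaries A n}"
  using assms(2) by (auto simp: acyclic_complex_def trivial_group_def cohomology_def FactGroup_def)
 moreover have "coboundaries A n #>\<^bsub>Ob A n\<^esub> a \<in> carrier (cohomology A n)"
  using a by (auto simp: cohomology_def FactGroup_def RCOSETS_def r_coset_def)
 ultimately have "coboundaries A n #>\<^bsub>Ob A n\<^esub> a = coboundaries A n" by auto
 moreover have "a \<in> coboundaries A n #>\<^bsub>Ob A n\<^esub> a"
  using a sub by (intro rcos_self) (auto simp: cocycles_def)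
 ultimately show "a \<in> coboundaries A n" by simp
qed

lemma carrier_cohomology:
 "carrier (cohomology A n) = (\<lambda>a. coboundaries A n #>\<^bsub>Ob A n\<^esub> a) ` cocycles A n"
 by (auto simp: cohomology_def FactGroup_def RCOSETS_def r_coset_def)

text \<open>The image of a coset under \<open>\<phi> n\<close> is in general only part of a coset of
  \<open>B\<close>. Multiplying by \<open>coboundaries B n\<close> fills it up, and adds nothing
  else because \<open>\<phi>\<close> maps coboundaries to coboundaries.\<close>

lemma cohomology_map_coset:
 assumes "group_complex A" "group_complex B" "chain_map A B \<phi>" "a \<in> obs A n"
 shows "cohomology_map B \<phi> n (coboundaries A n #>\<^bsub>Ob A n\<^esub> a) = coboundaries B n #>\<^bsub>Ob B n\<^esub> \<phi> n a"
  (is "?l = ?r")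
proof -
 interpret A: comm_group "Ob A n" using complexD(1)[OF assms(1)] .
 interpret B: comm_group "Ob B n" using complexD(1)[OF assms(2)] .
 have hom: "\<phi> n \<in> hom (Ob A n) (Ob B n)" by (rule chain_mapD(1)[OF assms(3)])
 have sA: "subgroup (coboundaries A n) (Ob A n)" and sB: "subgroup (coboundaries B n) (Ob B n)"
  using subgroup_coboundaries assms by auto
 note sAc = subgroup.mem_carrier[OF sA] and sBc = subgroup.mem_carrier[OF sB]
 have fa: "\<phi> n a \<in> obs B n" using hom assms(4) by (auto simp: hom_def)
 show ?thesis
 proof (rule Set.set_eqI, rule iffI)
  fix z assume "z \<in> ?l"
  then obtain c h where c: "c \<in> coboundaries B n" and h: "h \<in> coboundaries A n"
   and z: "z = c \<otimes>\<^bsub>Ob B n\<^esub> \<phi> n (h \<otimes>\<^bsub>Ob A n\<^esub> a)"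
   unfolding cohomology_map_def set_mult_def r_coset_def by auto
  have fh: "\<phi> n h \<in> coboundaries B n" using chain_map_coboundaries[OF assms(3) h] .
  have "z = (c \<otimes>\<^bsub>Ob B n\<^esub> \<phi> n h) \<otimes>\<^bsub>Ob B n\<^esub> \<phi> n a"
   using z hom_mult[OF hom sAc[OF h] assms(4)] sBc[OF c] sBc[OF fh] fa by (simp add: B.m_assoc)
  moreover have "c \<otimes>\<^bsub>Ob B n\<^esub> \<phi> n h \<in> coboundaries B n"
   using subgroup.m_closed[OF sB c fh] .
  ultimately show "z \<in> ?r" unfolding r_coset_def by auto
 next
  fix z assume "z \<in> ?r"
  then obtain c where c: "c \<in> coboundaries B n" and z: "z = c \<otimes>\<^bsub>Ob B n\<^esub> \<phi> n a"
   unfolding r_coset_def by auto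
  have "a \<in> coboundaries A n #>\<^bsub>Ob A n\<^esub> a" using A.rcos_self[OF assms(4) sA] .
  with c z show "z \<in> ?l" unfolding cohomology_map_def set_mult_def by auto
 qed
qed

lemma coset_eq_iff:
 fixes G (structure)
 assumes "comm_group G" "subgroup H G" "a \<in> carrier G" "b \<in> carrier G"
 shows "H #>\<^bsub>G\<^esub> a = H #>\<^bsub>G\<^esub> b \<longleftrightarrow> a \<otimes>\<^bsub>G\<^esub> inv\<^bsub>G\<^esub> b \<in> H"
proof -
 interpret comm_group G by fact
 show ?thesis
 proof
  assume "H #> a = H #> b"
  then obtain h where "h \<in> H" "a = h \<otimes> b"
   using rcos_self[OF assms(3,2)] unfolding r_coset_def by auto
  then show "a \<otimes> inv b \<in> H"
   using assms subgroup.mem_carrier[OF assms(2)] by (simp add: m_assoc)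
 next
  assume h: "a \<otimes> inv b \<in> H"
  have "a = (a \<otimes> inv b) \<otimes> b" using assms by (simp add: m_assoc)
  then have "a \<in> H #> b" using h unfolding r_coset_def by blast
  then show "H #> a = H #> b" using repr_independence[OF _ assms(4,2)] by simp
 qed
qed

lemma cohomology_map_hom:
 assumes "group_complex A" "group_complex B" "chain_map A B \<phi>"
 shows "cohomology_map B \<phi> n \<in> hom (cohomology A n) (cohomology B n)"
proof (rule homI)
 fix S assume "S \<in> carrier (cohomology A n)"
 then show "cohomology_map B \<phi> n S \<in> carrier (cohomology B n)"
  using chain_map_cocycles[OF assms]
  by (auto simp: carrier_cohomology cocycles_def cohomology_map_coset[OF assms])
next
 fix S T assume S: "S \<in> carrier (cohomology A n)" and T: "T \<in> carrier (cohomology A n)"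
 obtain a b where a: "a \<in> cocycles A n" "S = coboundaries A n #>\<^bsub>Ob A n\<^esub> a"
  and b: "b \<in> cocycles A n" "T = coboundaries A n #>\<^bsub>Ob A n\<^esub> b"
  using S T by (auto simp: carrier_cohomology)
 have ac: "a \<in> obs A n" and bc: "b \<in> obs A n"
  using a b by (auto simp: cocycles_def)
 have hom: "\<phi> n \<in> hom (Ob A n) (Ob B n)" by (rule chain_mapD(1)[OF assms(3)])
 have fac: "\<phi> n a \<in> obs B n" and fbc: "\<phi> n b \<in> obs B n"
  using hom ac bc by (auto simp: hom_def)
 have nA: "coboundaries A n \<lhd> Ob A n" and nB: "coboundaries B n \<lhd> Ob B n"
  using assms subgroup_coboundaries comm_group.subgroup_imp_normal complexD(1) by metis+
 have multA: "U \<otimes>\<^bsub>cohomology A n\<^esub> W = U <#>\<^bsub>Ob A n\<^esub> W" for U W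
  by (simp add: cohomology_def FactGroup_def set_mult_def)
 have multB: "U \<otimes>\<^bsub>cohomology B n\<^esub> W = U <#>\<^bsub>Ob B n\<^esub> W" for U W
  by (simp add: cohomology_def FactGroup_def set_mult_def)
 have "S \<otimes>\<^bsub>cohomology A n\<^esub> T = coboundaries A n #>\<^bsub>Ob A n\<^esub> (a \<otimes>\<^bsub>Ob A n\<^esub> b)"
  using normal.rcos_sum[OF nA ac bc] a b by (simp add: multA)
 then have "cohomology_map B \<phi> n (S \<otimes>\<^bsub>cohomology A n\<^esub> T)
   = coboundaries B n #>\<^bsub>Ob B n\<^esub> (\<phi> n a \<otimes>\<^bsub>Ob B n\<^esub> \<phi> n b)"
  using cohomology_map_coset[OF assms] hom_mult[OF hom ac bc]
   monoid.m_closed[OF complexD(3)[OF assms(1)] ac bc] by simp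
 also have "\<dots> = cohomology_map B \<phi> n S \<otimes>\<^bsub>cohomology B n\<^esub> cohomology_map B \<phi> n T"
  using normal.rcos_sum[OF nB fac fbc] cohomology_map_coset[OF assms] a b ac bc by (simp add: multB)
 finally show "cohomology_map B \<phi> n (S \<otimes>\<^bsub>cohomology A n\<^esub> T)
   = cohomology_map B \<phi> n S \<otimes>\<^bsub>cohomology B n\<^esub> cohomology_map B \<phi> n T" .
qed

text \<open>Injectivity of the induced map amounts to a trivial kernel, and surjectivity to the
  equality of two cosets of \<open>coboundaries B n\<close>; \<open>coset_eq_iff\<close> turns both
  into membership of a quotient of representatives in the coboundaries.\<close>

lemma quasi_iso_iff_cohomology:
 assumes "group_complex A" "group_complex B" "chain_map A B \<phi>"
 shows "quasi_iso A B \<phi> \<longleftrightarrow> (\<forall>n. cohomology_map B \<phi> n \<in> iso (cohomology A n) (cohomology B n))"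
proof -
 have "((\<forall>a\<in>cocycles A n. \<phi> n a \<in> coboundaries B n \<longrightarrow> a \<in> coboundaries A n) \<and>
   (\<forall>b\<in>cocycles B n. \<exists>a\<in>cocycles A n. \<exists>c\<in>coboundaries B n. b = \<phi> n a \<otimes>\<^bsub>Ob B n\<^esub> c)) \<longleftrightarrow>
   cohomology_map B \<phi> n \<in> iso (cohomology A n) (cohomology B n)" (is "?q \<longleftrightarrow> _") for n
 proof -
  interpret A: comm_group "Ob A n" using complexD(1)[OF assms(1)] .
  interpret B: comm_group "Ob B n" using complexD(1)[OF assms(2)] .
  have hom: "\<phi> n \<in> hom (Ob A n) (Ob B n)" by (rule chain_mapD(1)[OF assms(3)])
  interpret h: group_hom "Ob A n" "Ob B n" "\<phi> n"
   using hom by unfold_locales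
  have sA: "subgroup (coboundaries A n) (Ob A n)" and sB: "subgroup (coboundaries B n) (Ob B n)"
   using subgroup_coboundaries assms by auto
  have zA: "subgroup (cocycles A n) (Ob A n)" using subgroup_cocycles assms by auto
  have cA: "a \<in> cocycles A n \<Longrightarrow> a \<in> obs A n" for a by (simp add: cocycles_def)
  have cB: "a \<in> cocycles B n \<Longrightarrow> a \<in> obs B n" for a by (simp add: cocycles_def)
  have map: "cohomology_map B \<phi> n (coboundaries A n #>\<^bsub>Ob A n\<^esub> a) = coboundaries B n #>\<^bsub>Ob B n\<^esub> \<phi> n a"
   if "a \<in> cocycles A n" for a
   using cohomology_map_coset[OF assms cA[OF that]] .
  have inj: "inj_on (cohomology_map B \<phi> n) (carrier (cohomology A n)) \<longleftrightarrow>
    (\<forall>a\<in>cocycles A n. \<phi> n a \<in> coboundaries B n \<longrightarrow> a \<in> coboundaries A n)" (is "?i \<longleftrightarrow> ?j")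
  proof
   assume i: ?i
   show ?j
   proof (intro ballI impI)
    fix a assume a: "a \<in> cocycles A n" and fa: "\<phi> n a \<in> coboundaries B n"
    have one: "(one_ob A n) \<in> cocycles A n" using subgroup.one_closed[OF zA] .
    have "coboundaries B n #>\<^bsub>Ob B n\<^esub> \<phi> n a = coboundaries B n #>\<^bsub>Ob B n\<^esub> \<phi> n (one_ob A n)"
     using fa cA[OF a] by (subst coset_eq_iff) (auto simp: sB B.comm_group_axioms)
    then have "coboundaries A n #>\<^bsub>Ob A n\<^esub> a = coboundaries A n #>\<^bsub>Ob A n\<^esub> (one_ob A n)"
     using i map[OF a] map[OF one] a one unfolding inj_on_def carrier_cohomology by fastforce
    then show "a \<in> coboundaries A n"
     using cA[OF a] by (subst (asm) coset_eq_iff) (auto simp: sA A.comm_group_axioms)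
   qed
  next
   assume j: ?j
   show ?i
   proof (rule inj_onI)
    fix S T assume S: "S \<in> carrier (cohomology A n)" and T: "T \<in> carrier (cohomology A n)"
     and eq: "cohomology_map B \<phi> n S = cohomology_map B \<phi> n T"
    obtain a b where a: "a \<in> cocycles A n" "S = coboundaries A n #>\<^bsub>Ob A n\<^esub> a"
     and b: "b \<in> cocycles A n" "T = coboundaries A n #>\<^bsub>Ob A n\<^esub> b"
     using S T by (auto simp: carrier_cohomology)
    have ab: "a \<otimes>\<^bsub>Ob A n\<^esub> inv\<^bsub>Ob A n\<^esub> b \<in> cocycles A n"
     using a b zA by (meson subgroup.m_closed subgroup.m_inv_closed)
    have "\<phi> n a \<otimes>\<^bsub>Ob B n\<^esub> inv\<^bsub>Ob B n\<^esub> \<phi> n b \<in> coboundaries B n"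
     using eq a b map cA by (subst (asm) (1 2) a b) (simp add: coset_eq_iff sB B.comm_group_axioms)
    then have "\<phi> n (a \<otimes>\<^bsub>Ob A n\<^esub> inv\<^bsub>Ob A n\<^esub> b) \<in> coboundaries B n"
     using a b cA by simp
    then have "a \<otimes>\<^bsub>Ob A n\<^esub> inv\<^bsub>Ob A n\<^esub> b \<in> coboundaries A n" using j ab by blast
    then show "S = T" using a b cA by (simp add: coset_eq_iff sA A.comm_group_axioms)
   qed
  qed
  have surj: "carrier (cohomology B n) \<subseteq> cohomology_map B \<phi> n ` carrier (cohomology A n) \<longleftrightarrow>
    (\<forall>b\<in>cocycles B n. \<exists>a\<in>cocycles A n. \<exists>c\<in>coboundaries B n. b = \<phi> n a \<otimes>\<^bsub>Ob B n\<^esub> c)"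
  proof -
   have *: "coboundaries B n #>\<^bsub>Ob B n\<^esub> b = coboundaries B n #>\<^bsub>Ob B n\<^esub> \<phi> n a \<longleftrightarrow>
     (\<exists>c\<in>coboundaries B n. b = \<phi> n a \<otimes>\<^bsub>Ob B n\<^esub> c)"
    if "a \<in> cocycles A n" "b \<in> cocycles B n" for a b
   proof -
    have "b = \<phi> n a \<otimes>\<^bsub>Ob B n\<^esub> c \<longleftrightarrow> c = b \<otimes>\<^bsub>Ob B n\<^esub> inv\<^bsub>Ob B n\<^esub> \<phi> n a"
     if "c \<in> obs B n" for c
     using that cB[OF \<open>b \<in> _\<close>] cA[OF \<open>a \<in> _\<close>]
     using B.inv_solve_right[of c b "\<phi> n a"] B.m_comm[of c "\<phi> n a"] by auto
    moreover have "coboundaries B n #>\<^bsub>Ob B n\<^esub> b = coboundaries B n #>\<^bsub>Ob B n\<^esub> \<phi> n a \<longleftrightarrow>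
      b \<otimes>\<^bsub>Ob B n\<^esub> inv\<^bsub>Ob B n\<^esub> \<phi> n a \<in> coboundaries B n"
     using that cA cB by (intro coset_eq_iff) (auto simp: sB B.comm_group_axioms)
    ultimately show ?thesis using subgroup.mem_carrier[OF sB] by metis
   qed
   have "carrier (cohomology B n) \<subseteq> cohomology_map B \<phi> n ` carrier (cohomology A n) \<longleftrightarrow>
     (\<forall>b\<in>cocycles B n. \<exists>a\<in>cocycles A n.
      coboundaries B n #>\<^bsub>Ob B n\<^esub> b = coboundaries B n #>\<^bsub>Ob B n\<^esub> \<phi> n a)"
    unfolding carrier_cohomology image_image using map by (simp add: image_subset_iff image_iff)
   also have "\<dots> \<longleftrightarrow> (\<forall>b\<in>cocycles B n. \<exists>a\<in>cocycles A n. \<exists>c\<in>coboundaries B n. b = \<phi> n a \<otimes>\<^bsub>Ob B n\<^esub> c)"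
    using * by (intro ball_cong bex_cong refl) auto
   finally show ?thesis .
  qed
  have "cohomology_map B \<phi> n ` carrier (cohomology A n) \<subseteq> carrier (cohomology B n)"
   using cohomology_map_hom[OF assms] by (auto simp: hom_def)
  then show ?thesis
   using inj surj cohomology_map_hom[OF assms, of n] unfolding iso_def bij_betw_def by auto
 qed
 then show ?thesis unfolding quasi_iso_def by simp
qed

subsection \<open>Finite spaces\<close>

lemma min_nbhd_refl: "x \<in> min_nbhd X x"
 by (simp add: min_nbhd_def)

lemma min_nbhd_subset: "openin X U \<Longrightarrow> x \<in> U \<Longrightarrow> min_nbhd X x \<subseteq> U"
 by (auto simp: min_nbhd_def)

lemma openin_min_nbhd:
 assumes "finite_space X" "x \<in> topspace X"
 shows "openin X (min_nbhd X x)"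
proof -
 have "{U. openin X U \<and> x \<in> U} \<subseteq> Pow (topspace X)"
  using openin_subset by auto
 then have "finite {U. openin X U \<and> x \<in> U}"
  using assms finite_subset by (auto simp: finite_space_def)
 then show ?thesis
  unfolding min_nbhd_def using assms by (intro openin_Inter) auto
qed

lemma min_nbhd_topspace: "x \<in> topspace X \<Longrightarrow> min_nbhd X x \<subseteq> topspace X"
 by (rule min_nbhd_subset) auto

lemma min_nbhd_in_topspace: "x \<in> topspace X \<Longrightarrow> y \<in> min_nbhd X x \<Longrightarrow> y \<in> topspace X"
 using min_nbhd_topspace by fastforce

lemma min_nbhd_mono:
 assumes "finite_space X" "x \<in> topspace X" "y \<in> min_nbhd X x"
 shows "min_nbhd X y \<subseteq> min_nbhd X x"
 using assms openin_min_nbhd min_nbhd_subset by metis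

text \<open>The T0 axiom in the form used throughout: an open set containing exactly one of the two
  points would contain the smallest neighbourhood of that point and hence the other point.\<close>

lemma min_nbhd_antisym:
 assumes "finite_space X" "x \<in> topspace X" "y \<in> min_nbhd X x" "x \<in> min_nbhd X y"
 shows "x = y"
proof (rule ccontr)
 assume "x \<noteq> y"
 moreover have "y \<in> topspace X" using assms min_nbhd_topspace by fastforce
 ultimately obtain U where "openin X U" "x \<in> U \<longleftrightarrow> y \<notin> U"
  using assms by (auto simp: finite_space_def t0_space_def)
 then show False using assms min_nbhd_subset by (metis subsetD)
qed

lemma min_nbhd_inj:
 assumes "finite_space X" "x \<in> topspace X" "min_nbhd X x = min_nbhd X y"
 shows "x = y"
 using assms min_nbhd_antisym min_nbhd_refl by metis

lemma openin_iff_min_nbhd: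
 assumes "finite_space X"
 shows "openin X U \<longleftrightarrow> U \<subseteq> topspace X \<and> (\<forall>x\<in>U. min_nbhd X x \<subseteq> U)"
proof
 assume "openin X U"
 then show "U \<subseteq> topspace X \<and> (\<forall>x\<in>U. min_nbhd X x \<subseteq> U)"
  using min_nbhd_subset openin_subset by metis
next
 assume *: "U \<subseteq> topspace X \<and> (\<forall>x\<in>U. min_nbhd X x \<subseteq> U)"
 then have "U = \<Union>(min_nbhd X ` U)" using min_nbhd_refl by fastforce
 moreover have "openin X (\<Union>(min_nbhd X ` U))"
  using * openin_min_nbhd[OF assms] by (intro openin_Union) auto
 ultimately show "openin X U" by simp
qed

lemma Union_min_nbhd: "openin X U \<Longrightarrow> \<Union>(min_nbhd X ` U) = U"
 using min_nbhd_refl min_nbhd_subset by fastforce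

lemma finite_space_subtopology: "finite_space X \<Longrightarrow> finite_space (subtopology X S)"
 by (auto simp: finite_space_def t0_space_subtopology)

lemma min_nbhd_subtopology:
 assumes "finite_space X" "x \<in> topspace X" "x \<in> S"
 shows "min_nbhd (subtopology X S) x = min_nbhd X x \<inter> S"
proof
 have "openin (subtopology X S) (min_nbhd X x \<inter> S)"
  using openin_min_nbhd[OF assms(1,2)] by (auto simp: openin_subtopology)
 then show "min_nbhd (subtopology X S) x \<subseteq> min_nbhd X x \<inter> S"
  using assms min_nbhd_refl by (intro min_nbhd_subset) auto
 show "min_nbhd X x \<inter> S \<subseteq> min_nbhd (subtopology X S) x"
  using assms by (auto simp: min_nbhd_def openin_subtopology)
qed

lemma min_nbhd_open_subtopology:
 assumes "finite_space X" "openin X V" "x \<in> V"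
 shows "min_nbhd (subtopology X V) x = min_nbhd X x"
 using assms min_nbhd_subtopology[OF assms(1), of x V] min_nbhd_subset[OF assms(2,3)] openin_subset
 by blast

text \<open>This fixes the direction of the order: \<open>x\<close> lies below \<open>p\<close> when
  \<open>p\<close> is in the smallest neighbourhood of \<open>x\<close>. Going up in the order,
  smallest neighbourhoods shrink.\<close>

lemma in_closure_of_iff_min_nbhd:
 assumes "finite_space X" "p \<in> topspace X"
 shows "x \<in> X closure_of {p} \<longleftrightarrow> x \<in> topspace X \<and> p \<in> min_nbhd X x"
 using assms by (auto simp: in_closure_of min_nbhd_def)

subsection \<open>Sheaves on finite spaces\<close>

lemma presheafD:
 assumes "presheaf X F"
 shows "openin X U \<Longrightarrow> comm_group (sect F U)"
  and "openin X U \<Longrightarrow> group (sect F U)"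
  and "openin X U \<Longrightarrow> monoid (sect F U)"
  and "openin X U \<Longrightarrow> openin X V \<Longrightarrow> V \<subseteq> U \<Longrightarrow> rest F U V \<in> hom (sect F U) (sect F V)"
  and "openin X U \<Longrightarrow> openin X V \<Longrightarrow> V \<subseteq> U \<Longrightarrow> s \<in> secs F U \<Longrightarrow>
   rest F U V s \<in> secs F V"
  and "openin X U \<Longrightarrow> s \<in> secs F U \<Longrightarrow> rest F U U s = s"
  and "openin X U \<Longrightarrow> openin X V \<Longrightarrow> openin X W \<Longrightarrow> W \<subseteq> V \<Longrightarrow> V \<subseteq> U \<Longrightarrow> s \<in> secs F U \<Longrightarrow>
   rest F V W (rest F U V s) = rest F U W s"
proof -
 show "openin X U \<Longrightarrow> openin X V \<Longrightarrow> V \<subseteq> U \<Longrightarrow> s \<in> secs F U \<Longrightarrow>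
   rest F U V s \<in> secs F V"
  using assms unfolding presheaf_def by (metis hom_in_carrier)
qed (use assms in \<open>auto simp: presheaf_def comm_group.axioms(2) group.is_monoid\<close>)

lemma presheaf_rest_one:
 assumes "presheaf X F" "openin X U" "openin X V" "V \<subseteq> U"
 shows "rest F U V (one_sect F U) = one_sect F V"
 using hom_one[OF presheafD(4)[OF assms]] presheafD(2)[OF assms(1)] assms by auto

lemma sheaf_imp_presheaf: "sheaf X F \<Longrightarrow> presheaf X F"
 by (simp add: sheaf_def)

lemma morphismD:
 assumes "sheaf_morphism X F G \<phi>"
 shows "openin X U \<Longrightarrow> \<phi> U \<in> hom (sect F U) (sect G U)"
  and "openin X U \<Longrightarrow> s \<in> secs F U \<Longrightarrow> \<phi> U s \<in> secs G U"
  and "openin X U \<Longrightarrow> openin X V \<Longrightarrow> V \<subseteq> U \<Longrightarrow> s \<in> secs F U \<Longrightarrow>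
   \<phi> V (rest F U V s) = rest G U V (\<phi> U s)"
 using assms unfolding sheaf_morphism_def hom_def by auto

text \<open>A section reduced to its values on smallest neighbourhoods. Every open cover of
  \<open>U\<close> is refined by these neighbourhoods, so such families carry the whole content of
  gluing on a finite space.\<close>

definition compatible_germs ::
 "'s topology \<Rightarrow> ('s, 'a) presheaf_data \<Rightarrow> 's set \<Rightarrow> ('s \<Rightarrow> 'a) \<Rightarrow> bool" where
 "compatible_germs X F U t \<longleftrightarrow>
  (\<forall>x\<in>U. t x \<in> germs X F x) \<and>
  (\<forall>x\<in>U. \<forall>y\<in>min_nbhd X x. germ X F x y (t x) = t y)"

definition has_germs ::
 "'s topology \<Rightarrow> ('s, 'a) presheaf_data \<Rightarrow> 's set \<Rightarrow> ('s \<Rightarrow> 'a) \<Rightarrow> 'a \<Rightarrow> bool" where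
 "has_germs X F U t s \<longleftrightarrow>
  s \<in> secs F U \<and> (\<forall>x\<in>U. rest F U (min_nbhd X x) s = t x)"

lemma sheaf_eqI:
 assumes fin: "finite_space X" and F: "sheaf X F" and U: "openin X U"
  and s: "s \<in> secs F U" and t: "t \<in> secs F U"
  and eq: "\<And>x. x \<in> U \<Longrightarrow> rest F U (min_nbhd X x) s = rest F U (min_nbhd X x) t"
 shows "s = t"
proof -
 note P = sheaf_imp_presheaf[OF F]
 let ?\<U> = "min_nbhd X ` U"
 have UU: "\<Union>?\<U> = U" by (rule Union_min_nbhd[OF U])
 have op: "openin X N" "N \<subseteq> U" if "N \<in> ?\<U>" for N
  using that U openin_min_nbhd[OF fin] min_nbhd_subset[OF U] openin_subset by blast+
 have "\<exists>!r. r \<in> secs F (\<Union>?\<U>) \<and> (\<forall>N\<in>?\<U>. rest F (\<Union>?\<U>) N r = rest F U N s)"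
 proof (rule mp[OF spec[OF spec[OF conjunct2[OF F[unfolded sheaf_def]]], of ?\<U> "\<lambda>N. rest F U N s"]], intro conjI ballI)
  fix N assume N: "N \<in> ?\<U>"
  then show "openin X N" "rest F U N s \<in> secs F N"
   using op[OF N] presheafD(5)[OF P U _ _ s] by auto
  fix N' assume N': "N' \<in> ?\<U>"
  show "rest F N (N \<inter> N') (rest F U N s) = rest F N' (N \<inter> N') (rest F U N' s)"
   using op[OF N] op[OF N'] presheafD(7)[OF P U _ _ _ _ s] by (simp add: openin_Int)
 qed
 moreover have "rest F U N s = rest F U N t" if "N \<in> ?\<U>" for N using that eq by auto
 ultimately show ?thesis using s t unfolding UU by metis
qed

lemma sheaf_glue:
 assumes fin: "finite_space X" and F: "sheaf X F" and U: "openin X U"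
  and t: "compatible_germs X F U t"
 obtains s where "has_germs X F U t s"
proof -
 note P = sheaf_imp_presheaf[OF F]
 let ?\<U> = "min_nbhd X ` U"
 have UU: "\<Union>?\<U> = U" by (rule Union_min_nbhd[OF U])
 have Ut: "U \<subseteq> topspace X" using U openin_subset by auto
 \<comment> \<open>The sheaf axiom indexes its family by open sets rather than by points. The
   inverse of \<open>min_nbhd X\<close> recovers the point, which is unique by the T0 axiom.\<close>
 define r where "r N = t (inv_into U (min_nbhd X) N)" for N
 have r: "r (min_nbhd X x) = t x" if "x \<in> U" for x
  unfolding r_def using that Ut
  by (metis (no_types, lifting) f_inv_into_f fin image_eqI inv_into_into min_nbhd_inj subsetD)
 have op: "openin X (min_nbhd X x)" if "x \<in> U" for x
  using that Ut openin_min_nbhd[OF fin] by blast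
 have "\<exists>!s. s \<in> secs F (\<Union>?\<U>) \<and> (\<forall>N\<in>?\<U>. rest F (\<Union>?\<U>) N s = r N)"
 proof (rule mp[OF spec[OF spec[OF conjunct2[OF F[unfolded sheaf_def]]], of ?\<U> r]], intro conjI ballI)
  fix N assume N: "N \<in> ?\<U>"
  then obtain x where x: "x \<in> U" "N = min_nbhd X x" by auto
  show "openin X N" using op x by auto
  show "r N \<in> secs F N" using t x r[OF x(1)] by (auto simp: compatible_germs_def)
  fix N' assume N': "N' \<in> ?\<U>"
  then obtain x' where x': "x' \<in> U" "N' = min_nbhd X x'" by auto
  have opi: "openin X (N \<inter> N')" using op x x' by auto
  have tx: "t x \<in> secs F N" "t x' \<in> secs F N'"
   using t x x' by (auto simp: compatible_germs_def)
  \<comment> \<open>The intersection need not be a smallest neighbourhood, so agreement there is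
    tested on the germs at all its points, where both sides restrict to \<open>t z\<close>.\<close>
  have "rest F N (N \<inter> N') (t x) = rest F N' (N \<inter> N') (t x')"
  proof (rule sheaf_eqI[OF fin F opi])
   show "rest F N (N \<inter> N') (t x) \<in> secs F (N \<inter> N')"
    using presheafD(5)[OF P _ opi _ tx(1)] op x by auto
   show "rest F N' (N \<inter> N') (t x') \<in> secs F (N \<inter> N')"
    using presheafD(5)[OF P _ opi _ tx(2)] op x' by auto
   fix z assume z: "z \<in> N \<inter> N'"
   have zU: "z \<in> U" using z x min_nbhd_subset[OF U] by auto
   have sub: "min_nbhd X z \<subseteq> N \<inter> N'" using opi z by (rule min_nbhd_subset)
   have "rest F (N \<inter> N') (min_nbhd X z) (rest F N (N \<inter> N') (t x)) = t z"
    using presheafD(7)[OF P _ opi op[OF zU] sub _ tx(1)] op x z t by (auto simp: compatible_germs_def)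
   moreover have "rest F (N \<inter> N') (min_nbhd X z) (rest F N' (N \<inter> N') (t x')) = t z"
    using presheafD(7)[OF P _ opi op[OF zU] sub _ tx(2)] op x' z t by (auto simp: compatible_germs_def)
   ultimately show "rest F (N \<inter> N') (min_nbhd X z) (rest F N (N \<inter> N') (t x)) =
     rest F (N \<inter> N') (min_nbhd X z) (rest F N' (N \<inter> N') (t x'))" by simp
  qed
  then show "rest F N (N \<inter> N') (r N) = rest F N' (N \<inter> N') (r N')"
   using r x x' by simp
 qed
 then obtain s where "s \<in> secs F U" "\<forall>N\<in>?\<U>. rest F U N s = r N"
  unfolding UU by blast
 then have "has_germs X F U t s" using r by (auto simp: has_germs_def)
 then show thesis by (rule that)
qed

text \<open>Each point of a union lies in some member of the cover, and then so does its smallest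
  neighbourhood. Hence separation and gluing along smallest neighbourhoods imply the axiom for
  arbitrary covers.\<close>

lemma sheafI:
 assumes fin: "finite_space X" and P: "presheaf X F"
  and eq: "\<And>U s t. openin X U \<Longrightarrow> s \<in> secs F U \<Longrightarrow> t \<in> secs F U \<Longrightarrow>
   (\<And>x. x \<in> U \<Longrightarrow> rest F U (min_nbhd X x) s = rest F U (min_nbhd X x) t) \<Longrightarrow> s = t"
  and glue: "\<And>U t. openin X U \<Longrightarrow> compatible_germs X F U t \<Longrightarrow> \<exists>s. has_germs X F U t s"
 shows "sheaf X F"
 unfolding sheaf_def
proof (intro conjI P allI impI)
 fix \<U> s
 assume "(\<forall>U\<in>\<U>. openin X U \<and> s U \<in> secs F U) \<and>
      (\<forall>U\<in>\<U>. \<forall>V\<in>\<U>. rest F U (U \<inter> V) (s U) = rest F V (U \<inter> V) (s V))"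
 then have op: "\<And>U. U \<in> \<U> \<Longrightarrow> openin X U" and s: "\<And>U. U \<in> \<U> \<Longrightarrow> s U \<in> secs F U"
  and agree: "\<And>U V. U \<in> \<U> \<Longrightarrow> V \<in> \<U> \<Longrightarrow> rest F U (U \<inter> V) (s U) = rest F V (U \<inter> V) (s V)"
  by auto
 let ?W = "\<Union>\<U>"
 have W: "openin X ?W" using op by blast
 have opn: "openin X (min_nbhd X x)" if "x \<in> ?W" for x
  using that W openin_min_nbhd[OF fin] openin_subset by blast
 define c where "c x = (SOME U. U \<in> \<U> \<and> x \<in> U)" for x
 have c: "c x \<in> \<U>" "x \<in> c x" if "x \<in> ?W" for x
  using that someI_ex[of "\<lambda>U. U \<in> \<U> \<and> x \<in> U"] unfolding c_def by auto
 define t where "t x = rest F (c x) (min_nbhd X x) (s (c x))" for x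
 \<comment> \<open>The germ at \<open>x\<close> does not depend on the member of the cover from
   which it is taken: the intersection of two members is open and contains the smallest
   neighbourhood of \<open>x\<close>.\<close>
 have t: "rest F U (min_nbhd X x) (s U) = t x" if "U \<in> \<U>" "x \<in> U" for U x
 proof -
  have x: "x \<in> ?W" using that by auto
  note cx = c[OF x]
  have I: "openin X (U \<inter> c x)" using op that cx by auto
  have sub: "min_nbhd X x \<subseteq> U \<inter> c x" using I that cx by (intro min_nbhd_subset) auto
  have "rest F U (min_nbhd X x) (s U) = rest F (U \<inter> c x) (min_nbhd X x) (rest F U (U \<inter> c x) (s U))"
   using presheafD(7)[OF P op[OF that(1)] I opn[OF x] sub _ s[OF that(1)]] by simp
  also have "\<dots> = rest F (U \<inter> c x) (min_nbhd X x) (rest F (c x) (U \<inter> c x) (s (c x)))"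
   using agree[OF that(1) cx(1)] by simp
  also have "\<dots> = t x"
   using presheafD(7)[OF P op[OF cx(1)] I opn[OF x] sub _ s[OF cx(1)]] by (simp add: t_def)
  finally show ?thesis .
 qed
 have "compatible_germs X F ?W t"
  unfolding compatible_germs_def
 proof (intro conjI ballI)
  fix x assume x: "x \<in> ?W"
  note cx = c[OF x]
  have sub: "min_nbhd X x \<subseteq> c x" using op[OF cx(1)] cx(2) by (rule min_nbhd_subset)
  show "t x \<in> germs X F x"
   unfolding t_def using presheafD(5)[OF P op[OF cx(1)] opn[OF x] sub s[OF cx(1)]] .
  fix y assume y: "y \<in> min_nbhd X x"
  have yW: "y \<in> ?W" using y sub cx by auto
  have "germ X F x y (t x) = rest F (c x) (min_nbhd X y) (s (c x))"
   unfolding t_def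
   using presheafD(7)[OF P op[OF cx(1)] opn[OF x] opn[OF yW] _ sub s[OF cx(1)]]
    min_nbhd_subset[OF opn[OF x] y] by simp
  also have "\<dots> = t y" using t[OF cx(1)] y sub by auto
  finally show "germ X F x y (t x) = t y" .
 qed
 from glue[OF W this] obtain r where r: "r \<in> secs F ?W"
  "\<And>x. x \<in> ?W \<Longrightarrow> rest F ?W (min_nbhd X x) r = t x"
  by (auto simp: has_germs_def)
 show "\<exists>!t. t \<in> secs F ?W \<and> (\<forall>U\<in>\<U>. rest F ?W U t = s U)"
 proof (rule ex1I[of _ r], intro conjI ballI)
  show "r \<in> secs F ?W" by (rule r)
  fix U assume U: "U \<in> \<U>"
  have sub: "U \<subseteq> ?W" using U by auto
  show "rest F ?W U r = s U"
  proof (rule eq[OF op[OF U]])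
   show "rest F ?W U r \<in> secs F U" using presheafD(5)[OF P W op[OF U] sub r(1)] .
   show "s U \<in> secs F U" using s U by auto
   fix x assume x: "x \<in> U"
   have xW: "x \<in> ?W" using x U by auto
   show "rest F U (min_nbhd X x) (rest F ?W U r) = rest F U (min_nbhd X x) (s U)"
    using presheafD(7)[OF P W op[OF U] opn[OF xW] min_nbhd_subset[OF op[OF U] x] sub r(1)]
     t[OF U x] r(2)[OF xW] by simp
  qed
 next
  fix q assume q: "q \<in> secs F ?W \<and> (\<forall>U\<in>\<U>. rest F ?W U q = s U)"
  show "q = r"
  proof (rule eq[OF W])
   fix x assume x: "x \<in> ?W"
   note cx = c[OF x]
   have sub: "min_nbhd X x \<subseteq> c x" using op[OF cx(1)] cx(2) by (rule min_nbhd_subset)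
   have cW: "c x \<subseteq> ?W" using cx by auto
   have "rest F ?W (min_nbhd X x) q = rest F (c x) (min_nbhd X x) (rest F ?W (c x) q)"
    using presheafD(7)[OF P W op[OF cx(1)] opn[OF x] sub cW] q by simp
   also have "\<dots> = t x" using q cx by (simp add: t_def)
   finally show "rest F ?W (min_nbhd X x) q = rest F ?W (min_nbhd X x) r" using r(2)[OF x] by simp
  qed (use q r in auto)
 qed
qed

lemma sheaf_empty_trivial:
 assumes "finite_space X" "sheaf X F" "s \<in> carrier (sect F {})"
 shows "s = \<one>\<^bsub>sect F {}\<^esub>"
 by (rule sheaf_eqI[OF assms(1,2) openin_empty])
   (use assms presheafD(3)[OF sheaf_imp_presheaf[OF assms(2)] openin_empty] monoid.one_closed in auto)

text \<open>A functor from the specialisation order to abelian groups. Only the values on smallest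
  neighbourhoods are constrained, so constructions such as tensor products or extension by zero can
  be made there, with sheafification supplying the other open sets.\<close>

definition stalk_functor :: "'s topology \<Rightarrow> ('s, 'a) presheaf_data \<Rightarrow> bool" where
 "stalk_functor X F \<longleftrightarrow>
  (\<forall>x\<in>topspace X. comm_group (stalk X F x)) \<and>
  (\<forall>x\<in>topspace X. \<forall>y\<in>min_nbhd X x.
   germ X F x y \<in> hom (stalk X F x) (stalk X F y)) \<and>
  (\<forall>x\<in>topspace X. \<forall>s\<in>germs X F x. germ X F x x s = s) \<and>
  (\<forall>x\<in>topspace X. \<forall>y\<in>min_nbhd X x. \<forall>z\<in>min_nbhd X y. \<forall>s\<in>germs X F x.
   germ X F y z (germ X F x y s)
    = germ X F x z s)"

definition stalk_map ::
 "'s topology \<Rightarrow> ('s, 'a) presheaf_data \<Rightarrow> ('s, 'b) presheaf_data \<Rightarrow> ('s \<Rightarrow> 'a \<Rightarrow> 'b) \<Rightarrow> bool" where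
 "stalk_map X F G h \<longleftrightarrow>
  (\<forall>x\<in>topspace X. h x \<in> hom (stalk X F x) (stalk X G x)) \<and>
  (\<forall>x\<in>topspace X. \<forall>y\<in>min_nbhd X x. \<forall>s\<in>germs X F x.
   h y (germ X F x y s) = germ X G x y (h x s))"

lemma stalk_functorD:
 assumes "stalk_functor X F" "x \<in> topspace X"
 shows "comm_group (stalk X F x)" "group (stalk X F x)"
  and "y \<in> min_nbhd X x \<Longrightarrow>
   germ X F x y \<in> hom (stalk X F x) (stalk X F y)"
  and "y \<in> min_nbhd X x \<Longrightarrow> s \<in> germs X F x \<Longrightarrow>
   germ X F x y s \<in> germs X F y"
  and "s \<in> germs X F x \<Longrightarrow> germ X F x x s = s"
  and "y \<in> min_nbhd X x \<Longrightarrow> z \<in> min_nbhd X y \<Longrightarrow> s \<in> germs X F x \<Longrightarrow>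
   germ X F y z (germ X F x y s)
    = germ X F x z s"
 using assms unfolding stalk_functor_def hom_def by (auto simp: comm_group.axioms(2))

lemma stalk_mapD:
 assumes "stalk_map X F G h" "x \<in> topspace X"
 shows "h x \<in> hom (stalk X F x) (stalk X G x)"
  and "s \<in> germs X F x \<Longrightarrow> h x s \<in> germs X G x"
  and "y \<in> min_nbhd X x \<Longrightarrow> s \<in> germs X F x \<Longrightarrow>
   h y (germ X F x y s) = germ X G x y (h x s)"
 using assms unfolding stalk_map_def hom_def by auto

lemma presheaf_imp_stalk_functor:
 assumes fin: "finite_space X" and P: "presheaf X F"
 shows "stalk_functor X F"
 unfolding stalk_functor_def
proof (intro conjI ballI)
 note o = openin_min_nbhd[OF fin]
 fix x assume x: "x \<in> topspace X"
 show "comm_group (stalk X F x)" using presheafD(1)[OF P] o x by auto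
 show "germ X F x x s = s" if "s \<in> germs X F x" for s
  using presheafD(6)[OF P] o x that by auto
 fix y assume y: "y \<in> min_nbhd X x"
 have yX: "y \<in> topspace X" using min_nbhd_in_topspace[OF x y] .
 have yx: "min_nbhd X y \<subseteq> min_nbhd X x" using min_nbhd_mono[OF fin x y] .
 show "germ X F x y \<in> hom (stalk X F x) (stalk X F y)"
  using presheafD(4)[OF P] o x yX yx by auto
 fix z assume z: "z \<in> min_nbhd X y"
 have zX: "z \<in> topspace X" using min_nbhd_in_topspace[OF yX z] .
 have zy: "min_nbhd X z \<subseteq> min_nbhd X y" using min_nbhd_mono[OF fin yX z] .
 show "germ X F y z (germ X F x y s)
    = germ X F x z s" if "s \<in> germs X F x" for s
  using presheafD(7)[OF P o[OF x] o[OF yX] o[OF zX] zy yx that] .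
qed

lemma compatible_germs_section:
 assumes fin: "finite_space X" and P: "presheaf X F" and U: "openin X U" and s: "s \<in> secs F U"
 shows "compatible_germs X F U (\<lambda>x. rest F U (min_nbhd X x) s)"
 unfolding compatible_germs_def
proof (intro conjI ballI)
 note o = openin_min_nbhd[OF fin]
 fix x assume x: "x \<in> U"
 have xX: "x \<in> topspace X" using x U openin_subset by auto
 have xU: "min_nbhd X x \<subseteq> U" using min_nbhd_subset[OF U x] .
 show "rest F U (min_nbhd X x) s \<in> germs X F x"
  using presheafD(5)[OF P U o[OF xX] xU s] .
 fix y assume y: "y \<in> min_nbhd X x"
 have yX: "y \<in> topspace X" using min_nbhd_in_topspace[OF xX y] .
 show "germ X F x y (rest F U (min_nbhd X x) s) = rest F U (min_nbhd X y) s"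
  using presheafD(7)[OF P U o[OF xX] o[OF yX] min_nbhd_mono[OF fin xX y] xU s] .
qed

lemma compatible_germs_map:
 assumes "stalk_map X F G h" "U \<subseteq> topspace X" "compatible_germs X F U t"
 shows "compatible_germs X G U (\<lambda>x. h x (t x))"
 unfolding compatible_germs_def
proof (intro conjI ballI)
 fix x assume x: "x \<in> U"
 have xX: "x \<in> topspace X" using x assms by auto
 have tx: "t x \<in> germs X F x" using assms x by (auto simp: compatible_germs_def)
 show "h x (t x) \<in> germs X G x" using stalk_mapD(2)[OF assms(1) xX tx] .
 fix y assume y: "y \<in> min_nbhd X x"
 show "germ X G x y (h x (t x)) = h y (t y)"
  using stalk_mapD(3)[OF assms(1) xX y tx] assms x y by (auto simp: compatible_germs_def)
qed

lemma has_germs_mult: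
 assumes P: "presheaf X F" and fin: "finite_space X" and U: "openin X U"
  and s: "has_germs X F U t s" and s': "has_germs X F U t' s'"
 shows "has_germs X F U (\<lambda>x. t x \<otimes>\<^bsub>stalk X F x\<^esub> t' x) (s \<otimes>\<^bsub>sect F U\<^esub> s')"
proof -
 have "rest F U (min_nbhd X x) (s \<otimes>\<^bsub>sect F U\<^esub> s') = t x \<otimes>\<^bsub>stalk X F x\<^esub> t' x" if x: "x \<in> U" for x
 proof -
  have "rest F U (min_nbhd X x) \<in> hom (sect F U) (stalk X F x)"
   using presheafD(4)[OF P U openin_min_nbhd[OF fin] min_nbhd_subset[OF U x]] x U openin_subset by auto
  then show ?thesis using s s' x by (auto simp: has_germs_def hom_def)
 qed
 then show ?thesis
  using s s' monoid.m_closed[OF presheafD(3)[OF P U]] by (auto simp: has_germs_def)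
qed

lemma has_germs_unique:
 assumes "finite_space X" "sheaf X F" "openin X U" "has_germs X F U t s" "has_germs X F U t' s'"
  and "\<And>x. x \<in> U \<Longrightarrow> t x = t' x"
 shows "s = s'"
 by (rule sheaf_eqI[OF assms(1-3)]) (use assms in \<open>auto simp: has_germs_def\<close>)

lemma has_germs_rest:
 assumes fin: "finite_space X" and P: "presheaf X F" and U: "openin X U" and V: "openin X V" "V \<subseteq> U"
  and s: "has_germs X F U t s"
 shows "has_germs X F V t (rest F U V s)"
proof -
 have s': "s \<in> secs F U" using s by (simp add: has_germs_def)
 have "rest F V (min_nbhd X x) (rest F U V s) = t x" if x: "x \<in> V" for x
 proof -
  have o: "openin X (min_nbhd X x)" using openin_min_nbhd[OF fin] x openin_subset[OF V(1)] by auto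
  show ?thesis
   using presheafD(7)[OF P U V(1) o min_nbhd_subset[OF V(1) x] V(2) s'] s x V by (auto simp: has_germs_def)
 qed
 then show ?thesis using presheafD(5)[OF P U V s'] by (auto simp: has_germs_def)
qed

text \<open>Apply \<open>h\<close> to the germs of a section of \<open>F\<close> and glue the
  resulting compatible family in \<open>G\<close>. Additivity and compatibility with restriction
  follow because germs determine the sections of \<open>G\<close>.\<close>

lemma stalk_map_extends:
 fixes F :: "('s, 'a) presheaf_data" and G :: "('s, 'b) presheaf_data"
 assumes fin: "finite_space X" and F: "presheaf X F" and G: "sheaf X G" and h: "stalk_map X F G h"
 obtains \<phi> where "sheaf_morphism X F G \<phi>"
  and "\<And>x s. x \<in> topspace X \<Longrightarrow> s \<in> germs X F x \<Longrightarrow> \<phi> (min_nbhd X x) s = h x s"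
proof -
 note PG = sheaf_imp_presheaf[OF G]
 define t where "t U s x = h x (rest F U (min_nbhd X x) s)" for U s x
 define \<phi> where "\<phi> U s = (SOME r. has_germs X G U (t U s) r)" for U s
 have \<phi>: "has_germs X G U (t U s) (\<phi> U s)" if U: "openin X U" and s: "s \<in> secs F U" for U s
 proof -
  have "compatible_germs X G U (t U s)"
   unfolding t_def
   using compatible_germs_map[OF h openin_subset[OF U] compatible_germs_section[OF fin F U s]] .
  then show ?thesis unfolding \<phi>_def by (metis sheaf_glue[OF fin G U] someI_ex)
 qed
 have nX: "x \<in> topspace X" "min_nbhd X x \<subseteq> U" "openin X (min_nbhd X x)"
   if "openin X U" "x \<in> U" for x U
  using that openin_subset[OF that(1)] min_nbhd_subset[OF that] openin_min_nbhd[OF fin] by auto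
 have mor: "sheaf_morphism X F G \<phi>"
  unfolding sheaf_morphism_def
 proof (intro conjI allI impI ballI)
  fix U assume U: "openin X U"
  show "\<phi> U \<in> hom (sect F U) (sect G U)"
  proof (rule homI)
   fix s assume s: "s \<in> secs F U"
   show "\<phi> U s \<in> secs G U" using \<phi>[OF U s] by (simp add: has_germs_def)
   fix s' assume s': "s' \<in> secs F U"
   have ss: "s \<otimes>\<^bsub>sect F U\<^esub> s' \<in> secs F U"
    using monoid.m_closed[OF presheafD(3)[OF F U] s s'] .
   show "\<phi> U (s \<otimes>\<^bsub>sect F U\<^esub> s') = \<phi> U s \<otimes>\<^bsub>sect G U\<^esub> \<phi> U s'"
   proof (rule has_germs_unique[OF fin G U \<phi>[OF U ss] has_germs_mult[OF PG fin U \<phi>[OF U s] \<phi>[OF U s']]])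
    fix x assume x: "x \<in> U"
    note nx = nX[OF U x]
    have r: "rest F U (min_nbhd X x) \<in> hom (sect F U) (stalk X F x)"
     using presheafD(4)[OF F U nx(3,2)] .
    have "rest F U (min_nbhd X x) s \<in> germs X F x"
     "rest F U (min_nbhd X x) s' \<in> germs X F x"
     using r s s' by (auto simp: hom_def)
    then show "t U (s \<otimes>\<^bsub>sect F U\<^esub> s') x = t U s x \<otimes>\<^bsub>stalk X G x\<^esub> t U s' x"
     unfolding t_def using hom_mult[OF r s s'] hom_mult[OF stalk_mapD(1)[OF h nx(1)]] by simp
   qed
  qed
 next
  fix U V s assume UV: "openin X U \<and> openin X V \<and> V \<subseteq> U" and s: "s \<in> secs F U"
  then have U: "openin X U" and V: "openin X V" "V \<subseteq> U" by auto
  have rs: "rest F U V s \<in> secs F V" using presheafD(5)[OF F U V s] .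
  show "\<phi> V (rest F U V s) = rest G U V (\<phi> U s)"
  proof (rule has_germs_unique[OF fin G V(1) \<phi>[OF V(1) rs] has_germs_rest[OF fin PG U V \<phi>[OF U s]]])
   fix x assume x: "x \<in> V"
   note nx = nX[OF V(1) x]
   show "t V (rest F U V s) x = t U s x"
    unfolding t_def using presheafD(7)[OF F U V(1) nx(3,2) V(2) s] by simp
  qed
 qed
 have "\<phi> (min_nbhd X x) s = h x s" if x: "x \<in> topspace X" and s: "s \<in> germs X F x" for x s
 proof -
  note o = openin_min_nbhd[OF fin x]
  have "germ X G x x (\<phi> (min_nbhd X x) s) = t (min_nbhd X x) s x"
   using \<phi>[OF o s] min_nbhd_refl[of x X] by (auto simp: has_germs_def)
  moreover have "\<phi> (min_nbhd X x) s \<in> germs X G x"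
   using morphismD(2)[OF mor o s] .
  ultimately show ?thesis
   using presheafD(6)[OF PG o] presheafD(6)[OF F o s] by (simp add: t_def)
 qed
 with mor show thesis by (rule that)
qed

subsection \<open>Sheafification\<close>

lemma carrier_sheafify:
 "s \<in> secs (sheafify X F) U \<longleftrightarrow> s \<in> extensional U \<and> compatible_germs X F U s"
 by (auto simp: sheafify_def Let_def compatible_germs_def PiE_iff)

lemma mult_sheafify:
 "s \<otimes>\<^bsub>sect (sheafify X F) U\<^esub> t = (\<lambda>x\<in>U. s x \<otimes>\<^bsub>stalk X F x\<^esub> t x)"
 by (simp add: sheafify_def Let_def)

lemma one_sheafify: "(one_sect (sheafify X F) U) = (\<lambda>x\<in>U. (one_sect F (min_nbhd X x)))"
 by (simp add: sheafify_def Let_def)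

lemma rest_sheafify: "rest (sheafify X F) U V s = restrict s V"
 by (simp add: sheafify_def)

lemma comm_group_sheafify:
 assumes fin: "finite_space X" and F: "stalk_functor X F" and U: "openin X U"
 shows "comm_group (sect (sheafify X F) U)"
proof -
 define G where "G = product_group U (\<lambda>x. stalk X F x)"
 define K where "K = {s \<in> carrier G. compatible_germs X F U s}"
 have UX: "x \<in> topspace X" if "x \<in> U" for x using that U openin_subset by auto
 have nU: "y \<in> U" if "x \<in> U" "y \<in> min_nbhd X x" for x y using that min_nbhd_subset[OF U] by auto
 have gr: "group (stalk X F x)" if "x \<in> U" for x
  using stalk_functorD(2)[OF F UX[OF that]] .
 have G: "group G" unfolding G_def using gr by (rule product_group)
 have hom: "group_hom (stalk X F x) (stalk X F y) (germ X F x y)"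
  if "x \<in> U" "y \<in> min_nbhd X x" for x y
  using stalk_functorD(3)[OF F UX[OF that(1)] that(2)] gr that nU
  by (simp add: group_hom_def group_hom_axioms_def)
 have K: "subgroup K G"
 proof (rule group.subgroupI[OF G])
  show "K \<subseteq> carrier G" by (auto simp: K_def)
  have "\<one>\<^bsub>G\<^esub> \<in> K"
   using gr nU group_hom.hom_one[OF hom]
   by (auto simp: K_def G_def compatible_germs_def PiE_iff group.is_monoid)
  then show "K \<noteq> {}" by auto
 next
  fix s assume s: "s \<in> K"
  then have "inv\<^bsub>G\<^esub> s = (\<lambda>x\<in>U. inv\<^bsub>stalk X F x\<^esub> s x)"
   unfolding G_def K_def using gr by (intro inv_product_group) auto
  then show "inv\<^bsub>G\<^esub> s \<in> K"
   using s gr nU group_hom.hom_inv[OF hom]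
   by (auto simp: K_def G_def compatible_germs_def PiE_iff)
 next
  fix s t assume s: "s \<in> K" and t: "t \<in> K"
  then show "s \<otimes>\<^bsub>G\<^esub> t \<in> K"
   using gr nU group_hom.hom_mult[OF hom]
   by (auto simp: K_def G_def compatible_germs_def PiE_iff group.is_monoid monoid.m_closed)
 qed
 have eq: "sect (sheafify X F) U = G\<lparr>carrier := K\<rparr>"
 proof -
  have "K = {s \<in> carrier G. \<forall>x\<in>U. \<forall>y\<in>min_nbhd X x. germ X F x y (s x) = s y}"
   by (auto simp: K_def compatible_germs_def G_def)
  then show ?thesis by (simp add: sheafify_def Let_def G_def)
 qed
 have "group (sect (sheafify X F) U)"
  unfolding eq using subgroup.subgroup_is_group[OF K G] .
 then show ?thesis
 proof (rule group.group_comm_groupI)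
  fix s t assume s: "s \<in> secs (sheafify X F) U" and t: "t \<in> secs (sheafify X F) U"
  show "s \<otimes>\<^bsub>sect (sheafify X F) U\<^esub> t = t \<otimes>\<^bsub>sect (sheafify X F) U\<^esub> s"
   unfolding mult_sheafify
  proof (rule restrict_ext)
   fix x assume x: "x \<in> U"
   show "s x \<otimes>\<^bsub>stalk X F x\<^esub> t x = t x \<otimes>\<^bsub>stalk X F x\<^esub> s x"
    using s t x stalk_functorD(1)[OF F UX[OF x]]
    by (auto simp: carrier_sheafify compatible_germs_def comm_groupE(4))
  qed
 qed
qed

lemma sheaf_sheafify:
 assumes fin: "finite_space X" and F: "stalk_functor X F"
 shows "sheaf X (sheafify X F)"
proof (rule sheafI[OF fin])
 have nU: "y \<in> U" if "openin X U" "x \<in> U" "y \<in> min_nbhd X x" for x y U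
  using that min_nbhd_subset[OF that(1)] by auto
 have gr: "group (stalk X F x)" if "openin X U" "x \<in> U" for x U
  using stalk_functorD(2)[OF F] that openin_subset by blast
 show P: "presheaf X (sheafify X F)"
  unfolding presheaf_def
 proof (intro conjI allI impI ballI)
  fix U assume U: "openin X U"
  then show "comm_group (sect (sheafify X F) U)" using comm_group_sheafify[OF fin F] by auto
 next
  fix U V assume UV: "openin X U \<and> openin X V \<and> V \<subseteq> U"
  then show "rest (sheafify X F) U V \<in> hom (sect (sheafify X F) U) (sect (sheafify X F) V)"
   using nU[of V]
   by (intro homI) (auto simp: carrier_sheafify mult_sheafify rest_sheafify compatible_germs_def
      fun_eq_iff restrict_def extensional_def)
 next
  fix U s assume "openin X U" "s \<in> secs (sheafify X F) U"
  then show "rest (sheafify X F) U U s = s"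
   by (auto simp: carrier_sheafify rest_sheafify extensional_restrict)
 next
  fix U V W s assume "openin X U \<and> openin X V \<and> openin X W \<and> W \<subseteq> V \<and> V \<subseteq> U"
  then show "rest (sheafify X F) V W (rest (sheafify X F) U V s) = rest (sheafify X F) U W s"
   by (auto simp: rest_sheafify Int_absorb1)
 qed
next
 fix U s t
 assume s: "s \<in> secs (sheafify X F) U" and t: "t \<in> secs (sheafify X F) U"
  and eq: "\<And>x. x \<in> U \<Longrightarrow> rest (sheafify X F) U (min_nbhd X x) s = rest (sheafify X F) U (min_nbhd X x) t"
 have "s x = t x" if "x \<in> U" for x
  using fun_cong[OF eq[OF that], of x] by (simp add: rest_sheafify min_nbhd_refl)
 then show "s = t" using s t by (auto simp: carrier_sheafify intro: extensionalityI)
next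
 fix U t assume U: "openin X U" and t: "compatible_germs X (sheafify X F) U t"
 \<comment> \<open>A compatible family of sections of the sheafification is itself a family of
   families of germs; the section it glues to is the diagonal.\<close>
 define s where "s = (\<lambda>x\<in>U. t x x)"
 have tx: "t x \<in> extensional (min_nbhd X x)" "compatible_germs X F (min_nbhd X x) (t x)" if "x \<in> U" for x
  using t that by (auto simp: compatible_germs_def[of X "sheafify X F"] carrier_sheafify)
 have tt: "t x y = t y y" if "x \<in> U" "y \<in> min_nbhd X x" for x y
 proof -
  have "restrict (t x) (min_nbhd X y) = t y"
   using t that by (auto simp: compatible_germs_def[of X "sheafify X F"] rest_sheafify)
  then show ?thesis by (metis min_nbhd_refl restrict_apply')
 qed
 have nU: "y \<in> U" if "x \<in> U" "y \<in> min_nbhd X x" for x y using that min_nbhd_subset[OF U] by auto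
 have "compatible_germs X F U s"
  unfolding compatible_germs_def
 proof (intro conjI ballI)
  fix x assume x: "x \<in> U"
  show "s x \<in> germs X F x"
   using tx(2)[OF x] x min_nbhd_refl by (force simp: compatible_germs_def s_def)
  fix y assume y: "y \<in> min_nbhd X x"
  have "germ X F x y (t x x) = t x y"
   using tx(2)[OF x] y min_nbhd_refl by (force simp: compatible_germs_def)
  then show "germ X F x y (s x) = s y"
   using x nU[OF x y] tt[OF x y] by (simp add: s_def)
 qed
 then have s: "s \<in> secs (sheafify X F) U" by (auto simp: carrier_sheafify s_def)
 have "restrict s (min_nbhd X x) = t x" if x: "x \<in> U" for x
  by (rule extensionalityI[where A = "min_nbhd X x"]) (use x tx tt nU in \<open>auto simp: s_def\<close>)
 with s have "has_germs X (sheafify X F) U t s" by (auto simp: has_germs_def rest_sheafify)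
 then show "\<exists>s. has_germs X (sheafify X F) U t s" by blast
qed

text \<open>The unit of sheafification on stalks. Evaluation at \<open>x\<close> is its inverse,
  because a compatible family over the smallest neighbourhood of \<open>x\<close> is determined by
  its member at \<open>x\<close>.\<close>

definition germ_section :: "'s topology \<Rightarrow> ('s, 'a) presheaf_data \<Rightarrow> 's \<Rightarrow> 'a \<Rightarrow> 's \<Rightarrow> 'a" where
 "germ_section X F x b = (\<lambda>y\<in>min_nbhd X x. germ X F x y b)"

lemma germ_section_carrier:
 assumes fin: "finite_space X" and F: "stalk_functor X F" and x: "x \<in> topspace X"
  and b: "b \<in> germs X F x"
 shows "germ_section X F x b \<in> germs X (sheafify X F) x"
 unfolding carrier_sheafify
proof
 show "germ_section X F x b \<in> extensional (min_nbhd X x)" by (simp add: germ_section_def)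
 show "compatible_germs X F (min_nbhd X x) (germ_section X F x b)"
  unfolding compatible_germs_def
 proof (intro conjI ballI)
  fix y assume y: "y \<in> min_nbhd X x"
  show "germ_section X F x b y \<in> germs X F y"
   using stalk_functorD(4)[OF F x y b] y by (simp add: germ_section_def)
  fix z assume z: "z \<in> min_nbhd X y"
  then have "z \<in> min_nbhd X x" using min_nbhd_mono[OF fin x y] by auto
  then show "germ X F y z (germ_section X F x b y) = germ_section X F x b z"
   using stalk_functorD(6)[OF F x y z b] y by (simp add: germ_section_def)
 qed
qed

lemma germ_section_hom:
 assumes fin: "finite_space X" and F: "stalk_functor X F" and x: "x \<in> topspace X"
 shows "germ_section X F x \<in> hom (stalk X F x) (stalk X (sheafify X F) x)"
proof (rule homI)
 fix b assume b: "b \<in> germs X F x"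
 show "germ_section X F x b \<in> germs X (sheafify X F) x"
  using germ_section_carrier[OF fin F x b] .
 fix c assume c: "c \<in> germs X F x"
 have "germ X F x y (b \<otimes>\<^bsub>stalk X F x\<^esub> c) =
   germ X F x y b \<otimes>\<^bsub>stalk X F y\<^esub> germ X F x y c"
  if "y \<in> min_nbhd X x" for y
  using hom_mult[OF stalk_functorD(3)[OF F x that] b c] .
 then show "germ_section X F x (b \<otimes>\<^bsub>stalk X F x\<^esub> c) =
   germ_section X F x b \<otimes>\<^bsub>stalk X (sheafify X F) x\<^esub> germ_section X F x c"
  by (simp add: germ_section_def mult_sheafify fun_eq_iff restrict_def)
qed

lemma germ_section_self:
 assumes "stalk_functor X F" "x \<in> topspace X" "b \<in> germs X F x"
 shows "germ_section X F x b x = b"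
 using stalk_functorD(5)[OF assms] by (simp add: germ_section_def min_nbhd_refl)

lemma germ_section_eq:
 assumes "s \<in> germs X (sheafify X F) x"
 shows "germ_section X F x (s x) = s"
proof (rule extensionalityI[where A = "min_nbhd X x"])
 show "germ_section X F x (s x) \<in> extensional (min_nbhd X x)" by (simp add: germ_section_def)
 show "s \<in> extensional (min_nbhd X x)" using assms by (simp add: carrier_sheafify)
 fix y assume "y \<in> min_nbhd X x"
 then show "germ_section X F x (s x) y = s y"
  using assms min_nbhd_refl[of x X] by (auto simp: carrier_sheafify compatible_germs_def germ_section_def)
qed

lemma germ_section_rest:
 assumes fin: "finite_space X" and F: "stalk_functor X F" and x: "x \<in> topspace X"
  and y: "y \<in> min_nbhd X x" and b: "b \<in> germs X F x"
 shows "germ_section X F y (germ X F x y b)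
  = germ X (sheafify X F) x y (germ_section X F x b)"
proof -
 have "z \<in> min_nbhd X x" if "z \<in> min_nbhd X y" for z using min_nbhd_mono[OF fin x y] that by auto
 then show ?thesis
  using stalk_functorD(6)[OF F x y _ b] by (auto simp: rest_sheafify germ_section_def fun_eq_iff restrict_def)
qed

subsection \<open>Injective sheaves\<close>

text \<open>An infinite set is equinumerous with its square. Together with the finiteness of the
  space this keeps groups of sections small enough to embed into \<open>'a\<close> once the stalks
  do.\<close>

lemma lepoll_infinite_type_Times:
 assumes "A \<lesssim> (UNIV :: 'a::infinite set)" "B \<lesssim> (UNIV :: 'a set)"
 shows "A \<times> B \<lesssim> (UNIV :: 'a set)"
proof -
 have "A \<times> B \<lesssim> (UNIV :: 'a set) \<times> (UNIV :: 'a set)" using assms by (rule times_lepoll_mono)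
 also have "(UNIV :: 'a set) \<times> (UNIV :: 'a set) \<lesssim> (UNIV :: 'a set)"
  unfolding lepoll_def card_of_ordLeq
  by (rule ordIso_imp_ordLeq[OF card_of_Times_same_infinite[OF infinite_UNIV]])
 finally show ?thesis .
qed

lemma lepoll_infinite_type_PiE:
 assumes "finite U" "\<And>x. x \<in> U \<Longrightarrow> C x \<lesssim> (UNIV :: 'a::infinite set)"
 shows "(\<Pi>\<^sub>E x\<in>U. C x) \<lesssim> (UNIV :: 'a set)"
 using assms
proof (induction U rule: finite_induct)
 case empty
 then show ?case by (simp add: finite_lepoll_infinite infinite_UNIV)
next
 case (insert x U)
 have "(\<Pi>\<^sub>E x\<in>insert x U. C x) \<lesssim> C x \<times> (\<Pi>\<^sub>E x\<in>U. C x)"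
  unfolding PiE_insert_eq by (rule image_lepoll)
 also have "\<dots> \<lesssim> (UNIV :: 'a set)" using insert by (intro lepoll_infinite_type_Times) auto
 finally show ?case .
qed

lemma countable_lepoll_infinite_type: "countable A \<Longrightarrow> A \<lesssim> (UNIV :: 'a::infinite set)"
 by (metis UNIV_I countable_def infinite_UNIV infinite_le_lepoll lepoll_def lepoll_trans subset_UNIV)

text \<open>Injectivity is tested against sheaves with values in \<open>'a\<close> only. A sheaf
  with other values is renamed along injections \<open>e U\<close>, chosen for each open set
  separately; restriction goes back to \<open>F\<close>, restricts there and renames again.\<close>

definition transport_presheaf ::
 "('s set \<Rightarrow> 'b \<Rightarrow> 'a) \<Rightarrow> ('s, 'b) presheaf_data \<Rightarrow> ('s, 'a) presheaf_data" where
 "transport_presheaf e F =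
  \<lparr>sect = (\<lambda>U. image_group (e U) (sect F U)),
   rest = (\<lambda>U V a. e V (rest F U V (inv_into (secs F U) (e U) a)))\<rparr>"

lemma transport_presheaf:
 assumes F: "sheaf X F" and e: "\<And>U. openin X U \<Longrightarrow> inj_on (e U) (secs F U)"
 shows "sheaf X (transport_presheaf e F)"
  and "sheaf_morphism X F (transport_presheaf e F) e"
  and "sheaf_morphism X (transport_presheaf e F) F (\<lambda>U. inv_into (secs F U) (e U))"
proof -
 note P = sheaf_imp_presheaf[OF F]
 let ?T = "transport_presheaf e F"
 let ?i = "\<lambda>U. inv_into (secs F U) (e U)"
 have car: "secs ?T U = e U ` secs F U" for U
  by (simp add: transport_presheaf_def image_group_def)
 have ie: "?i U (e U s) = s" if "openin X U" "s \<in> secs F U" for U s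
  using e that by auto
 have rest: "rest ?T U V (e U s) = e V (rest F U V s)" if "openin X U" "s \<in> secs F U" for U V s
  using ie[OF that] by (simp add: transport_presheaf_def)
 have iso: "e U \<in> iso (sect F U) (sect ?T U)" if "openin X U" for U
  using inj_imp_image_group_iso[OF e[OF that]] by (simp add: transport_presheaf_def)
 have mult: "e U s \<otimes>\<^bsub>sect ?T U\<^esub> e U t = e U (s \<otimes>\<^bsub>sect F U\<^esub> t)"
  if "openin X U" "s \<in> secs F U" "t \<in> secs F U" for U s t
  using iso[OF that(1)] that by (auto simp: iso_def hom_def)
 have comm: "comm_group (sect ?T U)" if "openin X U" for U
 proof -
  interpret G: comm_group "sect F U" using presheafD(1)[OF P that] .
  have "group (sect ?T U)"
   using G.inj_imp_image_group_is_group[OF e[OF that]] by (simp add: transport_presheaf_def)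
  then show ?thesis
   by (rule group.group_comm_groupI) (auto simp: car mult that G.m_comm)
 qed
 have pT: "presheaf X ?T"
  unfolding presheaf_def
 proof (intro conjI allI impI ballI)
  fix U V assume UV: "openin X U \<and> openin X V \<and> V \<subseteq> U"
  then show "rest ?T U V \<in> hom (sect ?T U) (sect ?T V)"
   using presheafD(5)[OF P, of U V] hom_mult[OF presheafD(4)[OF P, of U V]] monoid.m_closed[OF presheafD(3)[OF P]]
   by (intro homI) (auto simp: car rest mult)
 next
  fix U s assume "openin X U" "s \<in> secs ?T U"
  then show "rest ?T U U s = s" using presheafD(6)[OF P] by (auto simp: car rest)
 next
  fix U V W s assume "openin X U \<and> openin X V \<and> openin X W \<and> W \<subseteq> V \<and> V \<subseteq> U" "s \<in> secs ?T U"
  then show "rest ?T V W (rest ?T U V s) = rest ?T U W s"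
   using presheafD(5)[OF P, of U V] presheafD(7)[OF P, of U V W] by (auto simp: car rest)
 qed (rule comm)
 show mor: "sheaf_morphism X F ?T e"
  unfolding sheaf_morphism_def using iso rest by (auto simp: iso_def)
 show mor': "sheaf_morphism X ?T F ?i"
  unfolding sheaf_morphism_def
 proof (intro conjI allI impI ballI)
  fix U assume "openin X U"
  then show "?i U \<in> hom (sect ?T U) (sect F U)"
   using monoid.m_closed[OF presheafD(3)[OF P]] by (intro homI) (auto simp: car ie mult)
 next
  fix U V s assume "openin X U \<and> openin X V \<and> V \<subseteq> U" "s \<in> secs ?T U"
  then show "?i V (rest ?T U V s) = rest F U V (?i U s)"
   using presheafD(5)[OF P, of U V] by (auto simp: car rest ie)
 qed
 show "sheaf X ?T"
  unfolding sheaf_def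
 proof (intro conjI pT allI impI)
  fix \<U> s
  assume *: "(\<forall>U\<in>\<U>. openin X U \<and> s U \<in> secs ?T U) \<and>
      (\<forall>U\<in>\<U>. \<forall>V\<in>\<U>. rest ?T U (U \<inter> V) (s U) = rest ?T V (U \<inter> V) (s V))"
  have W: "openin X (\<Union>\<U>)" using * by auto
  define s' where "s' U = ?i U (s U)" for U
  have s': "s' U \<in> secs F U" "e U (s' U) = s U" if "U \<in> \<U>" for U
   using * that by (auto simp: s'_def car ie)
  have "rest F U (U \<inter> V) (s' U) = rest F V (U \<inter> V) (s' V)" if "U \<in> \<U>" "V \<in> \<U>" for U V
  proof -
   have o: "openin X U" "openin X V" "openin X (U \<inter> V)" using * that by auto
   have "e (U \<inter> V) (rest F U (U \<inter> V) (s' U)) = e (U \<inter> V) (rest F V (U \<inter> V) (s' V))"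
    using * that s' rest[OF o(1), of "s' U" "U \<inter> V"] rest[OF o(2), of "s' V" "U \<inter> V"] by auto
   then show ?thesis
    using e[OF o(3)] presheafD(5)[OF P o(1,3) _ s'(1)[OF that(1)]]
     presheafD(5)[OF P o(2,3) _ s'(1)[OF that(2)]] by (auto dest: inj_onD)
  qed
  then have "\<exists>!t. t \<in> secs F (\<Union>\<U>) \<and> (\<forall>U\<in>\<U>. rest F (\<Union>\<U>) U t = s' U)"
   using s' * by (intro mp[OF spec[OF spec[OF conjunct2[OF F[unfolded sheaf_def]]], of \<U> s']]) auto
  then obtain t where t: "t \<in> secs F (\<Union>\<U>)" "\<And>U. U \<in> \<U> \<Longrightarrow> rest F (\<Union>\<U>) U t = s' U"
   and uniq: "\<And>r. r \<in> secs F (\<Union>\<U>) \<Longrightarrow> (\<And>U. U \<in> \<U> \<Longrightarrow> rest F (\<Union>\<U>) U r = s' U) \<Longrightarrow> r = t"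
   by metis
  show "\<exists>!t. t \<in> secs ?T (\<Union>\<U>) \<and> (\<forall>U\<in>\<U>. rest ?T (\<Union>\<U>) U t = s U)"
  proof (rule ex1I[of _ "e (\<Union>\<U>) t"], intro conjI ballI)
   show "e (\<Union>\<U>) t \<in> secs ?T (\<Union>\<U>)" using t by (auto simp: car)
   show "rest ?T (\<Union>\<U>) U (e (\<Union>\<U>) t) = s U" if "U \<in> \<U>" for U
    using that t s' by (simp add: rest[OF W])
  next
   fix q assume q: "q \<in> secs ?T (\<Union>\<U>) \<and> (\<forall>U\<in>\<U>. rest ?T (\<Union>\<U>) U q = s U)"
   then obtain r where r: "r \<in> secs F (\<Union>\<U>)" "q = e (\<Union>\<U>) r" by (auto simp: car)
   have "r = t"
   proof (rule uniq[OF r(1)])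
    fix U assume U: "U \<in> \<U>"
    have "e U (rest F (\<Union>\<U>) U r) = e U (s' U)"
     using q U r s' by (simp add: rest[OF W, symmetric])
    then show "rest F (\<Union>\<U>) U r = s' U"
     using U * e[of U] s'(1)[OF U] presheafD(5)[OF P W _ _ r(1), of U] by (auto dest: inj_onD)
   qed
   then show "q = e (\<Union>\<U>) t" using r by simp
  qed
 qed
qed

text \<open>On smallest neighbourhoods this is the extension by zero \<open>j_!\<close> from the
  open set \<open>V\<close>, as the smallest neighbourhood of \<open>x\<close> lies in
  \<open>V\<close> exactly if \<open>x\<close> does. The result is used as a stalk functor and
  sheafified afterwards.\<close>

definition extension_by_zero :: "'s set \<Rightarrow> ('s, 'a) presheaf_data \<Rightarrow> ('s, 'a) presheaf_data" where
 "extension_by_zero V F =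
  \<lparr>sect = (\<lambda>N. if N \<subseteq> V then sect F N else singleton_group undefined),
   rest = (\<lambda>N N' s. if N \<subseteq> V then rest F N N' s else if N' \<subseteq> V then (one_sect F N') else undefined)\<rparr>"

lemma stalk_functor_extension_by_zero:
 assumes fin: "finite_space X" and V: "openin X V" and F: "stalk_functor (subtopology X V) F"
 shows "stalk_functor X (extension_by_zero V F)"
proof -
 have VX: "V \<subseteq> topspace X" using V openin_subset by auto
 have top: "topspace (subtopology X V) = V" using VX by auto
 have nV: "min_nbhd (subtopology X V) x = min_nbhd X x" if "x \<in> V" for x
  using min_nbhd_open_subtopology[OF fin V that] .
 have sub: "min_nbhd X x \<subseteq> V \<longleftrightarrow> x \<in> V" for x
  using min_nbhd_refl min_nbhd_subset[OF V] by fast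
 have V1: "y \<in> V" if "x \<in> V" "y \<in> min_nbhd X x" for x y using sub that by blast
 note D = stalk_functorD[OF F, unfolded top]
 have one: "h \<one>\<^bsub>G\<^esub> = \<one>\<^bsub>H\<^esub>" if "h \<in> hom G H" "group G" "group H" for h and G :: "'b monoid" and H :: "'b monoid"
  using that by (rule hom_one)
 have D3: "germ X F x y \<in> hom (stalk X F x) (stalk X F y)"
  if "x \<in> V" "y \<in> min_nbhd X x" for x y
  using D(3)[OF that(1)] that nV[OF that(1)] nV[OF V1[OF that]] by (metis)
 have D2: "comm_group (stalk X F x)" "group (stalk X F x)" if "x \<in> V" for x
  using D(1,2)[OF that] nV[OF that] by auto
 show ?thesis
  unfolding stalk_functor_def
 proof (intro conjI ballI)
  fix x assume x: "x \<in> topspace X"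
  show "comm_group (stalk X (extension_by_zero V F) x)"
   using D2 by (simp add: extension_by_zero_def sub)
  show "germ X (extension_by_zero V F) x x s = s"
   if "s \<in> germs X (extension_by_zero V F) x" for s
   using that D(5)[of x s] nV[of x]
   by (auto simp: extension_by_zero_def sub split: if_splits)
  fix y assume y: "y \<in> min_nbhd X x"
  show "germ X (extension_by_zero V F) x y
    \<in> hom (stalk X (extension_by_zero V F) x) (stalk X (extension_by_zero V F) y)"
  proof (cases "x \<in> V")
   case True
   then show ?thesis using D3[OF True y] V1[OF True y] by (simp add: extension_by_zero_def sub)
  next
   case False
   have "monoid (stalk X F y)" if "y \<in> V" using D2(2)[OF that] by (simp add: group.is_monoid)
   then show ?thesis using False by (auto simp: extension_by_zero_def sub hom_def singleton_group_def)
  qed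
  fix z s assume z: "z \<in> min_nbhd X y" and s: "s \<in> germs X (extension_by_zero V F) x"
  show "germ X (extension_by_zero V F) y z
     (germ X (extension_by_zero V F) x y s)
    = germ X (extension_by_zero V F) x z s"
  proof (cases "x \<in> V")
   case True
   have yV: "y \<in> V" using V1[OF True y] .
   have zV: "z \<in> V" using V1[OF yV z] .
   show ?thesis
    using D(6)[OF True, of y z s] True y z s yV zV nV
    by (simp add: extension_by_zero_def sub)
  next
   case False
   have "z \<in> V" if "y \<in> V" using V1[OF that z] .
   moreover have "germ X F y z (one_sect F (min_nbhd X y)) = one_sect F (min_nbhd X z)"
    if "y \<in> V"
    using one[OF D3[OF that z] D2(2)[OF that] D2(2)[OF V1[OF that z]]] .
   ultimately show ?thesis using False by (auto simp: extension_by_zero_def sub)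
  qed
 qed
qed

lemma injective_sheafD:
 fixes I A B :: "('s, 'a::infinite) presheaf_data"
 assumes "injective_sheaf X I" "sheaf X A" "sheaf X B" "sheaf_morphism X A B \<iota>"
  and "\<And>U. openin X U \<Longrightarrow> inj_on (\<iota> U) (secs A U)" and "sheaf_morphism X A I g"
 obtains h where "sheaf_morphism X B I h"
  and "\<And>U s. openin X U \<Longrightarrow> s \<in> secs A U \<Longrightarrow> h U (\<iota> U s) = g U s"
proof -
 have "\<exists>h. sheaf_morphism X B I h \<and>
   (\<forall>U. openin X U \<longrightarrow> (\<forall>s\<in>secs A U. h U (\<iota> U s) = g U s))"
  by (rule conjunct2[OF assms(1)[unfolded injective_sheaf_def], THEN spec[of _ A], THEN spec[of _ B],
     THEN spec[of _ \<iota>], THEN spec[of _ g], THEN mp])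
    (intro conjI allI impI assms)
 then show thesis using that by (elim exE conjE) simp
qed

text \<open>The extension property for a subfunctor \<open>A\<close> of a stalk functor
  \<open>B\<close> whose values may have another type: sheafify both, rename the sections into
  \<open>'a\<close>, extend there by injectivity, and pull the result back along the unit
  \<open>germ_section\<close>.\<close>

lemma injective_extension_global:
 fixes I :: "('s, 'a::infinite) presheaf_data" and B :: "('s, 'b) presheaf_data"
 assumes fin: "finite_space X" and I: "injective_sheaf X I" and B: "stalk_functor X B"
  and small: "\<And>x. x \<in> topspace X \<Longrightarrow> germs X B x \<lesssim> (UNIV :: 'a set)"
  and A: "\<And>x. x \<in> topspace X \<Longrightarrow> subgroup (A x) (stalk X B x)"
  and A_rest: "\<And>x y a. x \<in> topspace X \<Longrightarrow> y \<in> min_nbhd X x \<Longrightarrow> a \<in> A x \<Longrightarrow>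
   germ X B x y a \<in> A y"
  and g: "\<And>x. x \<in> topspace X \<Longrightarrow>
   g x \<in> hom ((stalk X B x)\<lparr>carrier := A x\<rparr>) (stalk X I x)"
  and g_rest: "\<And>x y a. x \<in> topspace X \<Longrightarrow> y \<in> min_nbhd X x \<Longrightarrow> a \<in> A x \<Longrightarrow>
   g y (germ X B x y a) = germ X I x y (g x a)"
 obtains h where "stalk_map X B I h" and "\<And>x a. x \<in> topspace X \<Longrightarrow> a \<in> A x \<Longrightarrow> h x a = g x a"
proof -
 have I': "sheaf X I" using I by (simp add: injective_sheaf_def)
 \<comment> \<open>The subgroups \<open>A\<close> are indexed by points, a presheaf record by sets;
   \<open>pt\<close> recovers the point from its smallest neighbourhood.\<close>
 define pt where "pt = inv_into (topspace X) (min_nbhd X)"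
 have pt: "pt (min_nbhd X x) = x" if "x \<in> topspace X" for x
 proof -
  have "inj_on (min_nbhd X) (topspace X)" using min_nbhd_inj[OF fin] by (auto intro: inj_onI)
  then show ?thesis using that by (simp add: pt_def)
 qed
 define A0 where "A0 = \<lparr>sect = (\<lambda>N. (sect B N)\<lparr>carrier := A (pt N)\<rparr>), rest = rest B\<rparr>"
 have A0: "stalk X A0 x = (stalk X B x)\<lparr>carrier := A x\<rparr>" if "x \<in> topspace X" for x
  using that by (simp add: A0_def pt)
 have A0c: "germs X A0 x = A x" if "x \<in> topspace X" for x using A0[OF that] by simp
 have A0r: "rest A0 = rest B" by (simp add: A0_def)
 have AB: "a \<in> germs X B x" if "x \<in> topspace X" "a \<in> A x" for x a
  using subgroup.mem_carrier[OF A[OF that(1)] that(2)] .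
 have nX: "y \<in> topspace X" if "x \<in> topspace X" "y \<in> min_nbhd X x" for x y
  using min_nbhd_in_topspace[OF that] .
 have FA: "stalk_functor X A0"
  unfolding stalk_functor_def A0r
 proof (intro conjI ballI)
  fix x assume x: "x \<in> topspace X"
  interpret G: comm_group "stalk X B x" using stalk_functorD(1)[OF B x] .
  have "group (stalk X A0 x)"
   unfolding A0[OF x] using subgroup.subgroup_is_group[OF A[OF x] G.is_group] .
  then show "comm_group (stalk X A0 x)"
   by (rule group.group_comm_groupI) (use x AB in \<open>auto simp: A0 G.m_comm\<close>)
  show "germ X B x x s = s" if "s \<in> germs X A0 x" for s
   using stalk_functorD(5)[OF B x] AB[OF x] that x by (simp add: A0)
  fix y assume y: "y \<in> min_nbhd X x"
  show "germ X B x y \<in> hom (stalk X A0 x) (stalk X A0 y)"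
   using A_rest[OF x y] hom_mult[OF stalk_functorD(3)[OF B x y] AB[OF x] AB[OF x]]
   by (intro homI) (auto simp: A0[OF x] A0[OF nX[OF x y]])
  fix z s assume z: "z \<in> min_nbhd X y" and s: "s \<in> germs X A0 x"
  show "germ X B y z (germ X B x y s)
    = germ X B x z s"
   using stalk_functorD(6)[OF B x y z] AB[OF x] s by (simp add: A0[OF x])
 qed
 let ?BB = "sheafify X B" and ?AA = "sheafify X A0"
 have sB: "sheaf X ?BB" and sA: "sheaf X ?AA" using sheaf_sheafify[OF fin] B FA by auto
 have sub: "secs ?AA U \<subseteq> secs ?BB U" if "openin X U" for U
  using openin_subset[OF that] AB by (auto simp: carrier_sheafify compatible_germs_def A0c A0r subset_iff)
 have multA: "s \<otimes>\<^bsub>sect ?AA U\<^esub> t = s \<otimes>\<^bsub>sect ?BB U\<^esub> t" for U s t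
  by (simp add: mult_sheafify A0_def)
 have restA: "rest ?AA U W s = rest ?BB U W s" for U W s by (simp add: rest_sheafify)
 have sm: "stalk_map X ?AA I (\<lambda>x s. g x (s x))"
  unfolding stalk_map_def
 proof (intro conjI ballI)
  fix x assume x: "x \<in> topspace X"
  have gx: "g x a \<in> germs X I x" if "a \<in> A x" for a
   using g[OF x] that by (auto simp: hom_def)
  have sx: "s x \<in> A x" if "s \<in> germs X ?AA x" for s
   using that min_nbhd_refl[of x X] x by (auto simp: carrier_sheafify compatible_germs_def A0c)
  show "(\<lambda>s. g x (s x)) \<in> hom (stalk X ?AA x) (stalk X I x)"
   using gx sx hom_mult[OF g[OF x]] min_nbhd_refl[of x X] x
   by (intro homI) (auto simp: mult_sheafify A0)
  fix y s assume y: "y \<in> min_nbhd X x" and s: "s \<in> germs X ?AA x"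
  have "s y = germ X B x y (s x)"
   using s y min_nbhd_refl[of x X] by (auto simp: carrier_sheafify compatible_germs_def A0r)
  then show "g y (germ X ?AA x y s y) =
    germ X I x y (g x (s x))"
   using g_rest[OF x y sx[OF s]] min_nbhd_refl[of y X] by (simp add: rest_sheafify)
 qed
 obtain G where G: "sheaf_morphism X ?AA I G"
  and G_germ: "\<And>x s. x \<in> topspace X \<Longrightarrow> s \<in> germs X ?AA x \<Longrightarrow>
   G (min_nbhd X x) s = g x (s x)"
  by (rule stalk_map_extends[OF fin sheaf_imp_presheaf[OF sA] I' sm]) blast
 \<comment> \<open>Sections over \<open>U\<close> lie in a product of stalks over the finitely many
   points of \<open>U\<close>.\<close>
 have "secs ?BB U \<lesssim> (UNIV :: 'a set)" if U: "openin X U" for U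
 proof -
  have "secs ?BB U \<subseteq> (\<Pi>\<^sub>E x\<in>U. germs X B x)"
   by (auto simp: carrier_sheafify compatible_germs_def PiE_iff extensional_def)
  moreover have "(\<Pi>\<^sub>E x\<in>U. germs X B x) \<lesssim> (UNIV :: 'a set)"
   using small openin_subset[OF U] fin finite_subset
   by (intro lepoll_infinite_type_PiE) (auto simp: finite_space_def)
  ultimately show ?thesis using lepoll_trans subset_imp_lepoll by blast
 qed
 then have "\<exists>e :: ('s \<Rightarrow> 'b) \<Rightarrow> 'a. inj_on e (secs ?BB U)" if "openin X U" for U
  using that by (auto simp: lepoll_def)
 then obtain e :: "'s set \<Rightarrow> ('s \<Rightarrow> 'b) \<Rightarrow> 'a"
  where e: "\<And>U. openin X U \<Longrightarrow> inj_on (e U) (secs ?BB U)"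
  by metis
 have eA: "inj_on (e U) (secs ?AA U)" if "openin X U" for U
  using inj_on_subset[OF e sub] that by auto
 let ?TB = "transport_presheaf e ?BB" and ?TA = "transport_presheaf e ?AA"
 note TB = transport_presheaf[OF sB e] and TA = transport_presheaf[OF sA eA]
 have carT: "secs (transport_presheaf e F) U = e U ` secs F U"
  for F :: "('s, 's \<Rightarrow> 'b) presheaf_data" and U
  by (simp add: transport_presheaf_def image_group_def)
 \<comment> \<open>The same renaming \<open>e\<close> serves both sheaves, so the inclusion of
   \<open>?TA\<close> in \<open>?TB\<close> is the identity on elements.\<close>
 have inc: "sheaf_morphism X ?TA ?TB (\<lambda>U s. s)"
  unfolding sheaf_morphism_def
 proof (intro conjI allI impI ballI)
  fix U assume U: "openin X U"
  show "(\<lambda>s. s) \<in> hom (sect ?TA U) (sect ?TB U)"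
  proof (rule homI)
   fix s assume "s \<in> secs ?TA U"
   then show "s \<in> secs ?TB U" using sub[OF U] by (auto simp: carT)
  next
   fix s t assume "s \<in> secs ?TA U" "t \<in> secs ?TA U"
   then obtain s' t' where s': "s' \<in> secs ?AA U" "s = e U s'"
    and t': "t' \<in> secs ?AA U" "t = e U t'" by (auto simp: carT)
   have "e U s' \<otimes>\<^bsub>sect ?TA U\<^esub> e U t' = e U (s' \<otimes>\<^bsub>sect ?AA U\<^esub> t')"
    using hom_mult[OF morphismD(1)[OF TA(2) U] s'(1) t'(1)] by simp
   also have "\<dots> = e U s' \<otimes>\<^bsub>sect ?TB U\<^esub> e U t'"
    using hom_mult[OF morphismD(1)[OF TB(2) U], of s' t'] s'(1) t'(1) sub[OF U] by (auto simp: multA)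
   finally show "s \<otimes>\<^bsub>sect ?TA U\<^esub> t = s \<otimes>\<^bsub>sect ?TB U\<^esub> t" using s' t' by simp
  qed
 next
  fix U W s assume UW: "openin X U \<and> openin X W \<and> W \<subseteq> U" and "s \<in> secs ?TA U"
  then obtain s' where s': "s' \<in> secs ?AA U" "s = e U s'" by (auto simp: carT)
  show "rest ?TA U W s = rest ?TB U W s"
   using morphismD(3)[OF TA(2), of U W s'] morphismD(3)[OF TB(2), of U W s'] UW s' sub[of U]
   by (auto simp: restA)
 qed
 define G' where "G' U = G U \<circ> inv_into (secs ?AA U) (e U)" for U
 have G': "sheaf_morphism X ?TA I G'"
  using G TA(3) unfolding sheaf_morphism_def G'_def
  by (auto intro: hom_compose simp: hom_in_carrier)
 have ii: "inj_on (\<lambda>s. s) (secs ?TA U)" for U by (simp add: inj_on_def)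
 obtain H where H: "sheaf_morphism X ?TB I H"
  and HG: "\<And>U s. openin X U \<Longrightarrow> s \<in> secs ?TA U \<Longrightarrow> H U s = G' U s"
 proof (rule injective_sheafD[OF I TA(1) TB(1) inc ii G'])
  fix H
  assume 1: "sheaf_morphism X ?TB I H"
   and 2: "\<And>U s. openin X U \<Longrightarrow> s \<in> secs ?TA U \<Longrightarrow> H U s = G' U s"
  show thesis
   by (rule that[of H], rule 1, erule 2, assumption)
 qed
 define h where "h x = H (min_nbhd X x) \<circ> (e (min_nbhd X x) \<circ> germ_section X B x)" for x
 show thesis
 proof (rule that[of h])
  show "stalk_map X B I h"
   unfolding stalk_map_def
  proof (intro conjI ballI)
   fix x assume x: "x \<in> topspace X"
   note o = openin_min_nbhd[OF fin x]
   show "h x \<in> hom (stalk X B x) (stalk X I x)"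
    unfolding h_def
    by (rule hom_compose[OF hom_compose[OF germ_section_hom[OF fin B x] morphismD(1)[OF TB(2) o]]
       morphismD(1)[OF H o]])
   fix y b assume y: "y \<in> min_nbhd X x" and b: "b \<in> germs X B x"
   note oy = openin_min_nbhd[OF fin nX[OF x y]] and yx = min_nbhd_mono[OF fin x y]
   note gb = germ_section_carrier[OF fin B x b]
   show "h y (germ X B x y b) = germ X I x y (h x b)"
    unfolding h_def comp_def germ_section_rest[OF fin B x y b]
    using morphismD(3)[OF TB(2) o oy yx gb] morphismD(2)[OF TB(2) o gb]
     morphismD(3)[OF H o oy yx] by simp
  qed
  fix x a assume x: "x \<in> topspace X" and a: "a \<in> A x"
  note o = openin_min_nbhd[OF fin x]
  have eq: "germ_section X A0 x a = germ_section X B x a" by (simp add: germ_section_def A0r)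
  have ga: "germ_section X A0 x a \<in> germs X ?AA x"
   using germ_section_carrier[OF fin FA x] a A0c[OF x] by simp
  have "h x a = G' (min_nbhd X x) (e (min_nbhd X x) (germ_section X A0 x a))"
   unfolding h_def comp_def eq[symmetric] using ga by (intro HG[OF o]) (auto simp: carT)
  also have "\<dots> = G (min_nbhd X x) (germ_section X A0 x a)"
   using eA[OF o] ga by (simp add: G'_def)
  also have "\<dots> = g x a"
   using G_germ[OF x ga] germ_section_self[OF FA x] a A0c[OF x] by simp
  finally show "h x a = g x a" .
 qed
qed

text \<open>The restriction of an injective sheaf to an open set is again injective, as
  \<open>j_!\<close> is an exact left adjoint of restriction. Concretely, the data on
  \<open>V\<close> are extended by zero and the global extension property is applied.\<close>

lemma injective_extension:
 fixes I :: "('s, 'a::infinite) presheaf_data" and B :: "('s, 'b) presheaf_data"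
 assumes fin: "finite_space X" and V: "openin X V" and I: "injective_sheaf X I"
  and B: "stalk_functor (subtopology X V) B"
  and small: "\<And>x. x \<in> V \<Longrightarrow> germs X B x \<lesssim> (UNIV :: 'a set)"
  and A: "\<And>x. x \<in> V \<Longrightarrow> subgroup (A x) (stalk X B x)"
  and A_rest: "\<And>x y a. x \<in> V \<Longrightarrow> y \<in> min_nbhd X x \<Longrightarrow> a \<in> A x \<Longrightarrow>
   germ X B x y a \<in> A y"
  and g: "\<And>x. x \<in> V \<Longrightarrow>
   g x \<in> hom ((stalk X B x)\<lparr>carrier := A x\<rparr>) (stalk X I x)"
  and g_rest: "\<And>x y a. x \<in> V \<Longrightarrow> y \<in> min_nbhd X x \<Longrightarrow> a \<in> A x \<Longrightarrow>
   g y (germ X B x y a) = germ X I x y (g x a)"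
 obtains h where "stalk_map (subtopology X V) B I h" and "\<And>x a. x \<in> V \<Longrightarrow> a \<in> A x \<Longrightarrow> h x a = g x a"
proof -
 let ?B = "extension_by_zero V B"
 have PI: "presheaf X I" using I by (simp add: injective_sheaf_def sheaf_def)
 have VX: "V \<subseteq> topspace X" using V openin_subset by auto
 have top: "topspace (subtopology X V) = V" using VX by auto
 have nV: "min_nbhd (subtopology X V) x = min_nbhd X x" if "x \<in> V" for x
  using min_nbhd_open_subtopology[OF fin V that] .
 have sub: "min_nbhd X x \<subseteq> V \<longleftrightarrow> x \<in> V" for x
  using min_nbhd_refl min_nbhd_subset[OF V] by fast
 have V1: "y \<in> V" if "x \<in> V" "y \<in> min_nbhd X x" for x y using sub that by blast
 have BV: "stalk X ?B x = stalk X B x"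
  "rest ?B (min_nbhd X x) N b = rest B (min_nbhd X x) N b" if "x \<in> V" for x N b
  using that sub by (simp_all add: extension_by_zero_def)
 have BnV: "stalk X ?B x = singleton_group undefined" if "x \<notin> V" for x
  using that sub by (simp add: extension_by_zero_def)
 have FB: "stalk_functor X ?B" by (rule stalk_functor_extension_by_zero[OF fin V B])
 have gI: "group (stalk X I x)" if "x \<in> topspace X" for x
  using presheafD(2)[OF PI openin_min_nbhd[OF fin that]] .
 \<comment> \<open>Outside \<open>V\<close> the extended functor is trivial, so its subgroup and the
   map on it are forced.\<close>
 let ?A = "\<lambda>x. if x \<in> V then A x else {(one_sect ?B (min_nbhd X x))}"
 let ?g = "\<lambda>x a. if x \<in> V then g x a else (one_sect I (min_nbhd X x))"
 have sgA: "subgroup (?A x) (stalk X ?B x)" if "x \<in> topspace X" for x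
  using that A BV(1)[of x] group.triv_subgroup[OF stalk_functorD(2)[OF FB that]] by simp
 obtain h where h: "stalk_map X ?B I h" and hg: "\<And>x a. x \<in> topspace X \<Longrightarrow> a \<in> ?A x \<Longrightarrow> h x a = ?g x a"
 proof (rule injective_extension_global[OF fin I FB, of ?A ?g])
  fix x assume x: "x \<in> topspace X"
  show "germs X ?B x \<lesssim> (UNIV :: 'a set)"
   using small[of x] BV[of x] BnV[of x]
   by (cases "x \<in> V") (auto simp: singleton_group_def finite_lepoll_infinite infinite_UNIV)
  show "subgroup (?A x) (stalk X ?B x)" using sgA[OF x] .
  show "?g x \<in> hom ((stalk X ?B x)\<lparr>carrier := ?A x\<rparr>) (stalk X I x)"
   using g[of x] BV[of x] gI[OF x]
   by (cases "x \<in> V") (auto intro!: homI simp: group.is_monoid)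
  fix y a assume y: "y \<in> min_nbhd X x" and a: "a \<in> ?A x"
  have yX: "y \<in> topspace X" using min_nbhd_in_topspace[OF x y] .
  have "germ X ?B x y (one_sect ?B (min_nbhd X x)) = one_sect ?B (min_nbhd X y)"
   by (rule hom_one[OF stalk_functorD(3)[OF FB x y]])
    (use stalk_functorD(2)[OF FB] x yX in auto)
  then show r: "germ X ?B x y a \<in> ?A y"
   using a V1[OF _ y] A_rest[OF _ y] BV[of x] subgroup.one_closed[OF sgA[OF yX]] by (auto split: if_splits)
  have r1: "germ X I x y (one_sect I (min_nbhd X x)) = one_sect I (min_nbhd X y)"
   using presheaf_rest_one[OF PI openin_min_nbhd[OF fin x] openin_min_nbhd[OF fin yX] min_nbhd_mono[OF fin x y]] .
  have g1: "g y (one_sect B (min_nbhd X y)) = one_sect I (min_nbhd X y)" if "y \<in> V"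
  proof -
   have "group (stalk X B y)" using stalk_functorD(2)[OF FB yX] BV that by simp
   from subgroup.subgroup_is_group[OF A[OF that] this] show ?thesis
    using hom_one[OF g[OF that] _ gI[OF yX]] by simp
  qed
  show "?g y (germ X ?B x y a) = germ X I x y (?g x a)"
  proof (cases "x \<in> V")
   case True
   then show ?thesis using a V1[OF True y] g_rest[OF True y] BV by simp
  next
   case False
   then have "germ X ?B x y a = one_sect ?B (min_nbhd X y)"
    using a \<open>germ X ?B x y (one_sect ?B (min_nbhd X x)) = one_sect ?B (min_nbhd X y)\<close>
    by simp
   then show ?thesis using False r1 g1 BV(1)[of y] by simp
  qed
 qed blast
 show thesis
 proof (rule that[of h])
  show "stalk_map (subtopology X V) B I h"
   unfolding stalk_map_def top
  proof (intro conjI ballI)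
   fix x assume x: "x \<in> V"
   then have xX: "x \<in> topspace X" using VX by auto
   show "h x \<in> hom (stalk (subtopology X V) B x) (stalk (subtopology X V) I x)"
    using stalk_mapD(1)[OF h xX] BV[OF x] nV[OF x] by simp
   fix y s assume y: "y \<in> min_nbhd (subtopology X V) x" and s: "s \<in> germs (subtopology X V) B x"
   have y': "y \<in> min_nbhd X x" using y nV[OF x] by simp
   show "h y (germ (subtopology X V) B x y s) =
    germ (subtopology X V) I x y (h x s)"
    using stalk_mapD(3)[OF h xX y', of s] s BV[OF x] nV[OF x] nV[OF V1[OF x y']] by simp
  qed
  show "h x a = g x a" if "x \<in> V" "a \<in> A x" for x a
   using hg[of x a] that VX by auto
 qed
qed

section \<open>Flasque sheaves\<close>

definition flasque :: "'s topology \<Rightarrow> ('s, 'a) presheaf_data \<Rightarrow> bool" where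
 "flasque X F \<longleftrightarrow> (\<forall>U V. openin X U \<and> openin X V \<and> V \<subseteq> U \<longrightarrow>
  (\<forall>s\<in>secs F V. \<exists>t\<in>secs F U. rest F U V t = s))"

lemma flasqueD:
 assumes "flasque X F" "openin X U" "openin X V" "V \<subseteq> U" "s \<in> secs F V"
 obtains t where "t \<in> secs F U" "rest F U V t = s"
 using assms unfolding flasque_def by blast

text \<open>A section over \<open>W\<close> is a morphism \<open>\<int>\<^sub>W \<rightarrow> I\<close>, and \<open>\<int>\<^sub>W \<subseteq> \<int>\<^sub>U\<close> for \<open>W \<subseteq> U\<close>.\<close>

lemma injective_imp_flasque:
 fixes I :: "('s, 'a::infinite) presheaf_data"
 assumes fin: "finite_space X" and I: "injective_sheaf X I"
 shows "flasque X I"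
 unfolding flasque_def
proof (intro allI impI ballI)
 fix U W s assume UW: "openin X U \<and> openin X W \<and> W \<subseteq> U" and s: "s \<in> secs I W"
 then have U: "openin X U" and W: "openin X W" and WU: "W \<subseteq> U" by auto
 have sI: "sheaf X I" using I by (simp add: injective_sheaf_def)
 note PI = sheaf_imp_presheaf[OF sI]
 define B :: "('s, int) presheaf_data" where
  "B = \<lparr>sect = (\<lambda>N. integer_group), rest = (\<lambda>N N' k. k)\<rparr>"
 have top: "topspace (subtopology X U) = U" using openin_subset[OF U] by auto
 have B: "stalk_functor (subtopology X U) B"
  by (auto simp: stalk_functor_def B_def abelian_integer_group hom_def)
 define r where "r x = rest I W (min_nbhd X x) s" for x
 have nU: "openin X (min_nbhd X x)" if "x \<in> U" for x
  using openin_min_nbhd[OF fin] openin_subset[OF U] that by auto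
 have sub: "min_nbhd X x \<subseteq> W" if "x \<in> W" for x using min_nbhd_subset[OF W that] .
 have r: "r x \<in> germs X I x" if "x \<in> W" for x
  using presheafD(5)[OF PI W nU sub s] that WU by (auto simp: r_def)
 have grp: "group (stalk X I x)" if "x \<in> U" for x
  using presheafD(2)[OF PI nU[OF that]] .
 have nUU: "y \<in> U" if "x \<in> U" "y \<in> min_nbhd X x" for x y using min_nbhd_subset[OF U that(1)] that by auto
 have hom: "group_hom (stalk X I x) (stalk X I y) (germ X I x y)"
  if "x \<in> U" "y \<in> min_nbhd X x" for x y
  using presheafD(4)[OF PI nU[OF that(1)] nU[OF nUU[OF that]]] grp that nUU[OF that]
   min_nbhd_subset[OF nU[OF that(1)] that(2)]
  by (simp add: group_hom_def group_hom_axioms_def)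
 \<comment> \<open>\<open>?A\<close> is the subsheaf of the constant sheaf on \<open>U\<close> that
   is the integers over \<open>W\<close> and zero elsewhere; \<open>?g\<close> is the morphism on it
   that sends 1 to the germ of \<open>s\<close>, hence \<open>k\<close> to a power of this
   germ.\<close>
 let ?A = "\<lambda>x. if x \<in> W then UNIV else {0 :: int}"
 let ?g = "\<lambda>x k. if x \<in> W then r x [^]\<^bsub>stalk X I x\<^esub> (k :: int) else (one_sect I (min_nbhd X x))"
 obtain h where h: "stalk_map (subtopology X U) B I h"
  and hg: "\<And>x a. x \<in> U \<Longrightarrow> a \<in> ?A x \<Longrightarrow> h x a = ?g x a"
 proof (rule injective_extension[OF fin U I B, of ?A ?g])
  fix x assume x: "x \<in> U"
  show "germs X B x \<lesssim> (UNIV :: 'a set)"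
   by (simp add: B_def countable_lepoll_infinite_type)
  have "subgroup {\<one>\<^bsub>integer_group\<^esub>} integer_group" by (rule group.triv_subgroup) simp
  moreover have "subgroup (carrier integer_group) integer_group" by (rule group.subgroup_self) simp
  ultimately show "subgroup (?A x) (stalk X B x)" by (simp add: B_def)
  interpret G: group "stalk X I x" using grp[OF x] .
  show "?g x \<in> hom ((stalk X B x)\<lparr>carrier := ?A x\<rparr>) (stalk X I x)"
   using r[of x] by (intro homI) (auto simp: B_def G.int_pow_mult)
  fix y a assume y: "y \<in> min_nbhd X x" and a: "a \<in> ?A x"
  interpret r: group_hom "stalk X I x" "stalk X I y" "germ X I x y"
   using hom[OF x y] .
  show "germ X B x y a \<in> ?A y"
   using a sub[of x] y by (auto simp: B_def split: if_splits)
  show "?g y (germ X B x y a) = germ X I x y (?g x a)"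
  proof (cases "x \<in> W")
   case True
   then have yW: "y \<in> W" using sub[of x] y by auto
   have "germ X I x y (r x) = r y"
    unfolding r_def
    using presheafD(7)[OF PI W nU[OF x] nU[OF nUU[OF x y]] _ sub[OF True] s] min_nbhd_subset[OF nU[OF x] y] by simp
   then show ?thesis using True yW r[OF True] by (simp add: B_def r.hom_int_pow)
  next
   case False
   then show ?thesis using a by (simp add: B_def)
  qed
 qed blast
 \<comment> \<open>The values at 1 of the extended morphism form a section over \<open>U\<close>.
   Over \<open>W\<close> they are the germs of \<open>s\<close>.\<close>
 have ch: "compatible_germs X I U (\<lambda>x. h x 1)"
  unfolding compatible_germs_def
 proof (intro conjI ballI)
  fix x assume x: "x \<in> U"
  note n = min_nbhd_open_subtopology[OF fin U x]
  have x': "x \<in> topspace (subtopology X U)" using x top by simp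
  show "h x 1 \<in> germs X I x"
   using stalk_mapD(2)[OF h x', of 1] n by (simp add: B_def)
  fix y assume y: "y \<in> min_nbhd X x"
  show "germ X I x y (h x 1) = h y 1"
   using stalk_mapD(3)[OF h x', of y 1] y n min_nbhd_open_subtopology[OF fin U nUU[OF x y]]
   by (simp add: B_def)
 qed
 from sheaf_glue[OF fin sI U ch] obtain t where t: "has_germs X I U (\<lambda>x. h x 1) t" .
 have "has_germs X I W r s" using s by (simp add: has_germs_def r_def)
 moreover have "h x 1 = r x" if "x \<in> W" for x
 proof -
  interpret G: group "stalk X I x" using grp WU that by auto
  show ?thesis using hg[of x 1] that WU G.int_pow_1[OF r[OF that]] by auto
 qed
 ultimately have "rest I U W t = s"
  using has_germs_unique[OF fin sI W has_germs_rest[OF fin PI U W WU t]] by metis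
 then show "\<exists>t\<in>secs I U. rest I U W t = s" using t by (auto simp: has_germs_def)
qed

subsection \<open>Complexes of sheaves\<close>

text \<open>Different indices may carry the same open set, and agreement on the overlap then forces
  equal sections. This form serves direct images, where different open sets can have the same
  inverse image.\<close>

lemma sheaf_glue_family:
 assumes F: "sheaf X F" and op: "\<And>i. i \<in> A \<Longrightarrow> openin X (U i)"
  and s: "\<And>i. i \<in> A \<Longrightarrow> s i \<in> secs F (U i)"
  and agree: "\<And>i j. i \<in> A \<Longrightarrow> j \<in> A \<Longrightarrow> rest F (U i) (U i \<inter> U j) (s i) = rest F (U j) (U i \<inter> U j) (s j)"
 shows "\<exists>!t. t \<in> secs F (\<Union>(U ` A)) \<and> (\<forall>i\<in>A. rest F (\<Union>(U ` A)) (U i) t = s i)"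
proof -
 note P = sheaf_imp_presheaf[OF F]
 define r where "r N = s (SOME i. i \<in> A \<and> U i = N)" for N
 have r: "r (U i) = s i" if i: "i \<in> A" for i
 proof -
  define j where "j = (SOME j. j \<in> A \<and> U j = U i)"
  have j: "j \<in> A" "U j = U i" using someI[of "\<lambda>j. j \<in> A \<and> U j = U i" i] i unfolding j_def by auto
  have "s j = s i"
   using agree[OF j(1) i] presheafD(6)[OF P op[OF i] s[OF i]] presheafD(6)[OF P op[OF j(1)] s[OF j(1)]] j(2)
   by simp
  then show ?thesis by (simp add: r_def j_def)
 qed
 have "\<exists>!t. t \<in> secs F (\<Union>(U ` A)) \<and> (\<forall>N\<in>U ` A. rest F (\<Union>(U ` A)) N t = r N)"
  using op s agree r by (intro mp[OF spec[OF spec[OF conjunct2[OF F[unfolded sheaf_def]]], of "U ` A" r]]) auto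
 then show ?thesis using r by simp
qed

lemma sheaf_glue_two:
 assumes F: "sheaf X F" and U: "openin X U" and V: "openin X V"
  and a: "a \<in> secs F U" and b: "b \<in> secs F V"
  and agree: "rest F U (U \<inter> V) a = rest F V (U \<inter> V) b"
 shows "\<exists>!t. t \<in> secs F (U \<union> V) \<and> rest F (U \<union> V) U t = a \<and> rest F (U \<union> V) V t = b"
proof -
 define W where "W i = (if i then U else V)" for i
 define s where "s i = (if i then a else b)" for i
 have "\<exists>!t. t \<in> secs F (\<Union>(W ` UNIV)) \<and> (\<forall>i\<in>UNIV. rest F (\<Union>(W ` UNIV)) (W i) t = s i)"
  by (rule sheaf_glue_family[OF F]) (use assms in \<open>auto simp: W_def s_def Int_commute\<close>)
 moreover have "\<Union>(W ` UNIV) = U \<union> V" by (auto simp: W_def UNIV_bool)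
 ultimately show ?thesis by (simp add: W_def s_def all_bool_eq)
qed

lemma is_sheaf_complexD:
 assumes "is_sheaf_complex X K"
 shows "sheaf X (Sh K n)" "presheaf X (Sh K n)"
  and "sheaf_morphism X (Sh K n) (Sh K (n + 1)) (Dsh K n)"
  and "openin X U \<Longrightarrow> s \<in> secs (Sh K n) U \<Longrightarrow>
   Dsh K (n + 1) U (Dsh K n U s) = one_sect (Sh K (n + 2)) U"
 using assms unfolding is_sheaf_complex_def by (auto simp: sheaf_imp_presheaf)

lemma complex_morphismD:
 assumes "complex_morphism X K L \<phi>"
 shows "is_sheaf_complex X K" "is_sheaf_complex X L"
  and "sheaf_morphism X (Sh K n) (Sh L n) (\<phi> n)"
  and "openin X U \<Longrightarrow> s \<in> secs (Sh K n) U \<Longrightarrow>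
   \<phi> (n + 1) U (Dsh K n U s) = Dsh L n U (\<phi> n U s)"
 using assms unfolding complex_morphism_def by auto

lemma sections_simps [simp]:
 "Ob (sections K U) n = sect (Sh K n) U" "Df (sections K U) n = Dsh K n U"
 by (simp_all add: sections_def)

lemma group_complex_sections:
 assumes "is_sheaf_complex X K" "openin X U"
 shows "group_complex (sections K U)"
 unfolding group_complex_def
 using presheafD(1)[OF is_sheaf_complexD(2)[OF assms(1)] assms(2)]
  morphismD(1)[OF is_sheaf_complexD(3)[OF assms(1)] assms(2)]
  is_sheaf_complexD(4)[OF assms] by auto

lemma chain_map_sections:
 assumes "complex_morphism X K L \<phi>" "openin X U"
 shows "chain_map (sections K U) (sections L U) (\<lambda>n. \<phi> n U)"
 unfolding chain_map_def
 using morphismD(1)[OF complex_morphismD(3)[OF assms(1)] assms(2)] complex_morphismD(4)[OF assms] by auto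

lemma exact_complex_iff:
 "exact_complex A \<longleftrightarrow> (\<forall>n. \<forall>a\<in>obs A n. Df A n a = one_ob A (n + 1) \<longrightarrow>
  (\<exists>b\<in>obs A (n - 1). Df A (n - 1) b = a))"
 by (auto simp: exact_complex_def cocycles_def coboundaries_def)

section \<open>From exactness on stalks to exactness on sections\<close>

definition bounded_below :: "'s topology \<Rightarrow> ('s, 'a) sheaf_complex \<Rightarrow> bool" where
 "bounded_below X K \<longleftrightarrow> (\<exists>m. \<forall>n<m. \<forall>U. openin X U \<longrightarrow> secs (Sh K n) U \<subseteq> {(one_sect (Sh K n) U)})"

text \<open>Primitives exist on smallest neighbourhoods and are glued by adding one neighbourhood at
  a time. On an overlap two primitives differ by a cocycle of the preceding degree, so the argument
  is an induction on the degree that starts at the lower bound of the complex.\<close>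

lemma flasque_complex_exact:
 assumes fin: "finite_space X" and K: "is_sheaf_complex X K" and fl: "\<And>n. flasque X (Sh K n)"
  and bdd: "bounded_below X K"
  and ex: "\<And>x. x \<in> topspace X \<Longrightarrow> exact_complex (stalks X K x)"
  and W: "openin X W"
 shows "exact_complex (sections K W)"
proof -
 note D = is_sheaf_complexD[OF K]
 note S = D(1) and P = D(2) and M = D(3)
 have grp: "group (sect (Sh K n) U)" if "openin X U" for n U using presheafD(2)[OF P that] .
 obtain m where m: "\<And>n U s. n < m \<Longrightarrow> openin X U \<Longrightarrow> s \<in> secs (Sh K n) U \<Longrightarrow> s = one_sect (Sh K n) U"
  using bdd unfolding bounded_below_def by blast
 have M': "sheaf_morphism X (Sh K (n - 1)) (Sh K n) (Dsh K (n - 1))" for n using M[of "n - 1"] by simp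
 have d1: "Dsh K n U (one_sect (Sh K n) U) = one_sect (Sh K (n + 1)) U" if "openin X U" for n U
  using hom_one[OF morphismD(1)[OF M that]] grp that by auto
 \<comment> \<open>The claim in one degree covers all open sets, since the overlaps that occur in
   the next degree are arbitrary.\<close>
 define claim where "claim n \<longleftrightarrow> (\<forall>U s. openin X U \<longrightarrow> s \<in> secs (Sh K n) U \<longrightarrow>
   Dsh K n U s = one_sect (Sh K (n + 1)) U \<longrightarrow> (\<exists>t\<in>secs (Sh K (n - 1)) U. Dsh K (n - 1) U t = s))" for n
 have base: "claim n" if "n < m" for n
  unfolding claim_def
 proof (intro allI impI)
  fix U s assume U: "openin X U" and s: "s \<in> secs (Sh K n) U"
  have "Dsh K (n - 1) U (one_sect (Sh K (n - 1)) U) = s"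
   using d1[OF U, of "n - 1"] m[OF that U s] by simp
  then show "\<exists>t\<in>secs (Sh K (n - 1)) U. Dsh K (n - 1) U t = s"
   using monoid.one_closed[OF group.is_monoid[OF grp[OF U, of "n - 1"]]] by blast
 qed
 have step: "claim n" if prev: "claim (n - 1)" for n
  unfolding claim_def
 proof (intro allI impI)
  fix U s assume U: "openin X U" and s: "s \<in> secs (Sh K n) U"
   and ds: "Dsh K n U s = one_sect (Sh K (n + 1)) U"
  define N where "N T = \<Union>(min_nbhd X ` T)" for T
  have UX: "U \<subseteq> topspace X" using openin_subset[OF U] .
  have No: "openin X (N T)" if "T \<subseteq> U" for T
   using that UX openin_min_nbhd[OF fin] unfolding N_def by blast
  have NU: "N T \<subseteq> U" if "T \<subseteq> U" for T
   using that min_nbhd_subset[OF U] unfolding N_def by blast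
  have "\<exists>t\<in>secs (Sh K (n - 1)) (N T). Dsh K (n - 1) (N T) t = rest (Sh K n) U (N T) s"
   if "finite T" "T \<subseteq> U" for T
   using that
  proof (induction T rule: finite_induct)
   case empty
   have N0: "N {} = {}" by (simp add: N_def)
   have "rest (Sh K n) U {} s = \<one>\<^bsub>sect (Sh K n) {}\<^esub>"
    using sheaf_empty_trivial[OF fin S] presheafD(5)[OF P U _ _ s] by auto
   then show ?case
    using d1[of "{}" "n - 1"] grp[of "{}" "n - 1"] unfolding N0
    by (metis diff_add_cancel group.is_monoid monoid.one_closed openin_empty)
  next
   case (insert x T)
   then have TU: "T \<subseteq> U" and xU: "x \<in> U" by auto
   obtain t where t: "t \<in> secs (Sh K (n - 1)) (N T)"
    and dt: "Dsh K (n - 1) (N T) t = rest (Sh K n) U (N T) s"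
    using insert TU by auto
   let ?Q = "min_nbhd X x"
   have Q: "openin X ?Q" "?Q \<subseteq> U" using xU UX openin_min_nbhd[OF fin] min_nbhd_subset[OF U] by auto
   note NT = No[OF TU] NU[OF TU]
   have sQ: "rest (Sh K n) U ?Q s \<in> secs (Sh K n) ?Q" using presheafD(5)[OF P U Q s] .
   have "Dsh K n ?Q (rest (Sh K n) U ?Q s) = one_sect (Sh K (n + 1)) ?Q"
    using morphismD(3)[OF M U Q s] ds presheaf_rest_one[OF P U Q] by simp
   then obtain u where u: "u \<in> secs (Sh K (n - 1)) ?Q"
    and du: "Dsh K (n - 1) ?Q u = rest (Sh K n) U ?Q s"
    using ex[of x] xU UX sQ unfolding exact_complex_iff by auto
   define Z where "Z = ?Q \<inter> N T"
   have Z: "openin X Z" "Z \<subseteq> ?Q" "Z \<subseteq> N T" "Z \<subseteq> U" using Q NT by (auto simp: Z_def)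
   let ?G = "\<lambda>i. sect (Sh K i)"
   interpret A: comm_group "?G (n - 1) Z" using presheafD(1)[OF P Z(1)] .
   interpret AQ: comm_group "?G (n - 1) ?Q" using presheafD(1)[OF P Q(1)] .
   interpret BQ: comm_group "?G n ?Q" using presheafD(1)[OF P Q(1)] .
   interpret B: comm_group "?G n Z" using presheafD(1)[OF P Z(1)] .
   interpret dZ: group_hom "?G (n - 1) Z" "?G n Z" "Dsh K (n - 1) Z"
    using morphismD(1)[OF M' Z(1)] by unfold_locales
   interpret dQ: group_hom "?G (n - 1) ?Q" "?G n ?Q" "Dsh K (n - 1) ?Q"
    using morphismD(1)[OF M' Q(1)] by unfold_locales
   interpret rQ: group_hom "?G (n - 1) ?Q" "?G (n - 1) Z" "rest (Sh K (n - 1)) ?Q Z"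
    using presheafD(4)[OF P Q(1) Z(1,2)] by unfold_locales
   define uz where "uz = rest (Sh K (n - 1)) ?Q Z u"
   define tz where "tz = rest (Sh K (n - 1)) (N T) Z t"
   have uz: "uz \<in> carrier (?G (n - 1) Z)" unfolding uz_def using presheafD(5)[OF P Q(1) Z(1,2) u] .
   have tz: "tz \<in> carrier (?G (n - 1) Z)" unfolding tz_def using presheafD(5)[OF P NT(1) Z(1,3) t] .
   have "Dsh K (n - 1) Z uz = rest (Sh K n) U Z s"
    using morphismD(3)[OF M' Q(1) Z(1,2) u] presheafD(7)[OF P U Q(1) Z(1,2) Q(2) s]
    by (simp add: uz_def du)
   moreover have "Dsh K (n - 1) Z tz = rest (Sh K n) U Z s"
    using morphismD(3)[OF M' NT(1) Z(1,3) t] presheafD(7)[OF P U NT(1) Z(1,3) NT(2) s]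
    by (simp add: tz_def dt)
   moreover have "rest (Sh K n) U Z s \<in> carrier (?G n Z)" using presheafD(5)[OF P U Z(1,4) s] .
   \<comment> \<open>The two primitives have the same differential on the overlap, so their quotient
     is a cocycle one degree lower, where the claim is already known.\<close>
   ultimately have "Dsh K (n - 1) Z (uz \<otimes>\<^bsub>?G (n - 1) Z\<^esub> inv\<^bsub>?G (n - 1) Z\<^esub> tz) = \<one>\<^bsub>?G (n - 1 + 1) Z\<^esub>"
    using uz tz by simp
   moreover have "uz \<otimes>\<^bsub>?G (n - 1) Z\<^esub> inv\<^bsub>?G (n - 1) Z\<^esub> tz \<in> carrier (?G (n - 1) Z)" using uz tz by simp
   ultimately obtain v where v: "v \<in> carrier (?G (n - 1 - 1) Z)"
    and dv: "Dsh K (n - 1 - 1) Z v = uz \<otimes>\<^bsub>?G (n - 1) Z\<^esub> inv\<^bsub>?G (n - 1) Z\<^esub> tz"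
    using prev[unfolded claim_def] Z(1) by blast
   \<comment> \<open>A primitive of the discrepancy extends from the overlap to the new
     neighbourhood because the sheaf is flasque. Dividing \<open>u\<close> by its differential makes
     the two primitives agree and leaves the differential of \<open>u\<close> unchanged.\<close>
   obtain v' where v': "v' \<in> carrier (?G (n - 1 - 1) ?Q)" "rest (Sh K (n - 1 - 1)) ?Q Z v' = v"
    using flasqueD[OF fl Q(1) Z(1,2) v] .
   define w where "w = Dsh K (n - 1 - 1) ?Q v'"
   have w: "w \<in> carrier (?G (n - 1) ?Q)" unfolding w_def using morphismD(2)[OF M' Q(1) v'(1)] .
   have dw: "Dsh K (n - 1) ?Q w = \<one>\<^bsub>?G n ?Q\<^esub>"
    using D(4)[OF Q(1) v'(1)] by (simp add: w_def)
   have wz: "rest (Sh K (n - 1)) ?Q Z w = uz \<otimes>\<^bsub>?G (n - 1) Z\<^esub> inv\<^bsub>?G (n - 1) Z\<^esub> tz"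
    using morphismD(3)[OF M' Q(1) Z(1,2) v'(1)] v'(2) dv by (simp add: w_def)
   define u' where "u' = u \<otimes>\<^bsub>?G (n - 1) ?Q\<^esub> inv\<^bsub>?G (n - 1) ?Q\<^esub> w"
   have u': "u' \<in> carrier (?G (n - 1) ?Q)" using u w by (simp add: u'_def)
   have "rest (Sh K (n - 1)) ?Q Z u' = uz \<otimes>\<^bsub>?G (n - 1) Z\<^esub> inv\<^bsub>?G (n - 1) Z\<^esub> (uz \<otimes>\<^bsub>?G (n - 1) Z\<^esub> inv\<^bsub>?G (n - 1) Z\<^esub> tz)"
    using u w by (simp add: u'_def wz uz_def[symmetric])
   also have "\<dots> = tz"
    using uz tz by (simp add: A.inv_mult_group A.m_comm[of tz "inv\<^bsub>?G (n - 1) Z\<^esub> uz"] A.m_assoc[symmetric])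
   finally have agree: "rest (Sh K (n - 1)) ?Q Z u' = rest (Sh K (n - 1)) (N T) Z t" by (simp add: tz_def)
   have du': "Dsh K (n - 1) ?Q u' = rest (Sh K n) U ?Q s"
    using u w sQ by (simp add: u'_def dw du)
   obtain r where r: "r \<in> carrier (?G (n - 1) (?Q \<union> N T))" "rest (Sh K (n - 1)) (?Q \<union> N T) ?Q r = u'"
    "rest (Sh K (n - 1)) (?Q \<union> N T) (N T) r = t"
    using sheaf_glue_two[OF S Q(1) NT(1) u' t] agree unfolding Z_def by blast
   have QT: "openin X (?Q \<union> N T)" "?Q \<union> N T \<subseteq> U" using Q NT by auto
   let ?a = "rest (Sh K n) U ?Q s" and ?b = "rest (Sh K n) U (N T) s"
   \<comment> \<open>The differential of the glued \<open>r\<close> and the restriction of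
     \<open>s\<close> agree on both pieces, so they coincide by uniqueness of gluing.\<close>
   have "\<exists>!e. e \<in> carrier (?G n (?Q \<union> N T)) \<and> rest (Sh K n) (?Q \<union> N T) ?Q e = ?a \<and> rest (Sh K n) (?Q \<union> N T) (N T) e = ?b"
    using presheafD(7)[OF P U Q(1) _ _ Q(2) s] presheafD(7)[OF P U NT(1) _ _ NT(2) s] Q NT
     presheafD(5)[OF P U NT s] sQ Z(1)[unfolded Z_def]
    by (intro sheaf_glue_two[OF S Q(1) NT(1)]) auto
   moreover have "Dsh K (n - 1) (?Q \<union> N T) r \<in> carrier (?G n (?Q \<union> N T))"
    using morphismD(2)[OF M' QT(1) r(1)] .
   moreover have "rest (Sh K n) (?Q \<union> N T) ?Q (Dsh K (n - 1) (?Q \<union> N T) r) = ?a"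
    using morphismD(3)[OF M' QT(1) Q(1) _ r(1)] r(2) du' by simp
   moreover have "rest (Sh K n) (?Q \<union> N T) (N T) (Dsh K (n - 1) (?Q \<union> N T) r) = ?b"
    using morphismD(3)[OF M' QT(1) NT(1) _ r(1)] r(3) dt by simp
   moreover have "rest (Sh K n) U (?Q \<union> N T) s \<in> carrier (?G n (?Q \<union> N T))"
    using presheafD(5)[OF P U QT s] .
   moreover have "rest (Sh K n) (?Q \<union> N T) ?Q (rest (Sh K n) U (?Q \<union> N T) s) = ?a"
    using presheafD(7)[OF P U QT(1) Q(1) _ QT(2) s] by simp
   moreover have "rest (Sh K n) (?Q \<union> N T) (N T) (rest (Sh K n) U (?Q \<union> N T) s) = ?b"
    using presheafD(7)[OF P U QT(1) NT(1) _ QT(2) s] by simp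
   ultimately have "Dsh K (n - 1) (?Q \<union> N T) r = rest (Sh K n) U (?Q \<union> N T) s" by metis
   moreover have "N (insert x T) = ?Q \<union> N T" by (simp add: N_def)
   ultimately show ?case using r(1) by auto
  qed
  moreover have "finite U" using UX fin finite_subset by (auto simp: finite_space_def)
  moreover have "N U = U" unfolding N_def by (rule Union_min_nbhd[OF U])
  ultimately show "\<exists>t\<in>secs (Sh K (n - 1)) U. Dsh K (n - 1) U t = s"
   using presheafD(6)[OF P U s] by (metis order_refl)
 qed
 \<comment> \<open>Below \<open>m\<close> all sections are trivial; from there the claim climbs one
   degree at a time.\<close>
 have low: "\<forall>n < m + int k. claim n" for k
 proof (induction k)
  case 0
  then show ?case using base by simp
 next
  case (Suc k)
  show ?case
  proof (intro allI impI)
   fix n assume "n < m + int (Suc k)"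
   then have "claim (n - 1)" using Suc by simp
   then show "claim n" by (rule step)
  qed
 qed
 have "claim n" for n using low[of "nat (n - m + 1)"] by simp
 then show ?thesis unfolding exact_complex_iff claim_def using W by simp
qed

lemma comm_group_DirProd: "comm_group G \<Longrightarrow> comm_group H \<Longrightarrow> comm_group (G \<times>\<times> H)"
 by (rule group.group_comm_groupI)
   (auto intro!: DirProd_group simp: comm_group.axioms(2) comm_groupE(4))

lemma mult_interchange:
 fixes G (structure)
 assumes "comm_group G" "a \<in> carrier G" "b \<in> carrier G" "c \<in> carrier G" "d \<in> carrier G"
 shows "(a \<otimes> b) \<otimes> (c \<otimes> d) = (a \<otimes> c) \<otimes> (b \<otimes> d)"
proof -
 interpret comm_group G by fact
 show ?thesis using assms by (simp add: m_ac)
qed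

subsection \<open>Mapping cones\<close>

lemma group_cone_simps [simp]:
 "Ob (group_cone \<phi> A B) n = Ob A (n + 1) \<times>\<times> Ob B n"
 "Df (group_cone \<phi> A B) n (a, b) =
  (inv\<^bsub>Ob A (n + 2)\<^esub> Df A (n + 1) a, \<phi> (n + 1) a \<otimes>\<^bsub>Ob B (n + 1)\<^esub> Df B n b)"
 by (simp_all add: group_cone_def)

lemma group_cone_hom:
 assumes A: "group_complex A" and B: "group_complex B" and \<phi>: "chain_map A B \<phi>"
 shows "Df (group_cone \<phi> A B) n \<in> hom (Ob (group_cone \<phi> A B) n) (Ob (group_cone \<phi> A B) (n + 1))"
proof -
 have e: "n + 1 + 1 = n + 2" by simp
 interpret A1: comm_group "Ob A (n + 1)" by (rule complexD(1)[OF A])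
 interpret A2: comm_group "Ob A (n + 2)" by (rule complexD(1)[OF A])
 interpret B0: comm_group "Ob B n" by (rule complexD(1)[OF B])
 interpret B1: comm_group "Ob B (n + 1)" by (rule complexD(1)[OF B])
 interpret dA: group_hom "Ob A (n + 1)" "Ob A (n + 2)" "Df A (n + 1)"
  using complexD(4)[OF A, of "n + 1"] unfolding e by unfold_locales
 interpret dB: group_hom "Ob B n" "Ob B (n + 1)" "Df B n"
  using complexD(4)[OF B, of n] by unfold_locales
 interpret f: group_hom "Ob A (n + 1)" "Ob B (n + 1)" "\<phi> (n + 1)"
  using chain_mapD(1)[OF \<phi>] by unfold_locales
 show ?thesis
 proof (rule homI)
  fix s assume s: "s \<in> obs (group_cone \<phi> A B) n"
  obtain a b where "s = (a, b)" by fastforce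
  then show "Df (group_cone \<phi> A B) n s \<in> obs (group_cone \<phi> A B) (n + 1)"
   using s by (simp add: e)
 next
  fix s t assume cst: "s \<in> obs (group_cone \<phi> A B) n" "t \<in> obs (group_cone \<phi> A B) n"
  obtain a b a' b' where st: "s = (a, b)" "t = (a', b')" by fastforce
  then have c: "a \<in> obs A (n + 1)" "b \<in> obs B n" "a' \<in> obs A (n + 1)" "b' \<in> obs B n"
   using cst by simp_all
  have "Df (group_cone \<phi> A B) n (s \<otimes>\<^bsub>Ob (group_cone \<phi> A B) n\<^esub> t) =
    (inv\<^bsub>Ob A (n + 2)\<^esub> Df A (n + 1) a \<otimes>\<^bsub>Ob A (n + 2)\<^esub> inv\<^bsub>Ob A (n + 2)\<^esub> Df A (n + 1) a',
    (\<phi> (n + 1) a \<otimes>\<^bsub>Ob B (n + 1)\<^esub> \<phi> (n + 1) a') \<otimes>\<^bsub>Ob B (n + 1)\<^esub> (Df B n b \<otimes>\<^bsub>Ob B (n + 1)\<^esub> Df B n b'))"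
   using c by (simp add: st A2.inv_mult)
  also have "\<dots> = Df (group_cone \<phi> A B) n s \<otimes>\<^bsub>Ob (group_cone \<phi> A B) (n + 1)\<^esub> Df (group_cone \<phi> A B) n t"
   using c by (simp add: st e mult_interchange[OF B1.comm_group_axioms])
  finally show "Df (group_cone \<phi> A B) n (s \<otimes>\<^bsub>Ob (group_cone \<phi> A B) n\<^esub> t) =
   Df (group_cone \<phi> A B) n s \<otimes>\<^bsub>Ob (group_cone \<phi> A B) (n + 1)\<^esub> Df (group_cone \<phi> A B) n t" .
 qed
qed

lemma group_complex_cone:
 assumes A: "group_complex A" and B: "group_complex B" and \<phi>: "chain_map A B \<phi>"
 shows "group_complex (group_cone \<phi> A B)"
 unfolding group_complex_def
proof (intro conjI allI ballI)
 fix n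
 show "comm_group (Ob (group_cone \<phi> A B) n)"
  using complexD(1)[OF A] complexD(1)[OF B] by (simp add: comm_group_DirProd)
 show "Df (group_cone \<phi> A B) n \<in> hom (Ob (group_cone \<phi> A B) n) (Ob (group_cone \<phi> A B) (n + 1))"
  using group_cone_hom[OF A B \<phi>, of n] .
 fix s assume "s \<in> obs (group_cone \<phi> A B) n"
 then obtain a b where s: "s = (a, b)" "a \<in> obs A (n + 1)" "b \<in> obs B n" by auto
 have e: "n + 1 + 1 = n + 2" "n + 1 + 2 = n + 3" "n + 2 + 1 = n + 3" by simp_all
 interpret A1: comm_group "Ob A (n + 1)" by (rule complexD(1)[OF A])
 interpret A2: comm_group "Ob A (n + 2)" by (rule complexD(1)[OF A])
 interpret A3: comm_group "Ob A (n + 3)" by (rule complexD(1)[OF A])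
 interpret B0: comm_group "Ob B n" by (rule complexD(1)[OF B])
 interpret B1: comm_group "Ob B (n + 1)" by (rule complexD(1)[OF B])
 interpret B2: comm_group "Ob B (n + 2)" by (rule complexD(1)[OF B])
 interpret dA: group_hom "Ob A (n + 1)" "Ob A (n + 2)" "Df A (n + 1)"
  using complexD(4)[OF A, of "n + 1"] unfolding e by unfold_locales
 interpret dA': group_hom "Ob A (n + 2)" "Ob A (n + 3)" "Df A (n + 2)"
  using complexD(4)[OF A, of "n + 2"] unfolding e by unfold_locales
 interpret dB: group_hom "Ob B n" "Ob B (n + 1)" "Df B n"
  using complexD(4)[OF B, of n] by unfold_locales
 interpret dB': group_hom "Ob B (n + 1)" "Ob B (n + 2)" "Df B (n + 1)"
  using complexD(4)[OF B, of "n + 1"] unfolding e by unfold_locales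
 interpret f: group_hom "Ob A (n + 1)" "Ob B (n + 1)" "\<phi> (n + 1)"
  using chain_mapD(1)[OF \<phi>] by unfold_locales
 interpret f': group_hom "Ob A (n + 2)" "Ob B (n + 2)" "\<phi> (n + 2)"
  using chain_mapD(1)[OF \<phi>] by unfold_locales
 have "Df A (n + 2) (Df A (n + 1) a) = one_ob A (n + 3)"
  using complexD(5)[OF A s(2)] unfolding e .
 moreover have "Df B (n + 1) (Df B n b) = one_ob B (n + 2)"
  using complexD(5)[OF B s(3)] .
 moreover have "\<phi> (n + 2) (Df A (n + 1) a) = Df B (n + 1) (\<phi> (n + 1) a)"
  using chain_mapD(2)[OF \<phi> s(2)] unfolding e .
 ultimately show "Df (group_cone \<phi> A B) (n + 1) (Df (group_cone \<phi> A B) n s) = one_ob (group_cone \<phi> A B) (n + 2)"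
  using s by (simp add: e)
qed

text \<open>The long exact sequence of the cone, carried out on elements: a cocycle of the cone is a
  pair in which \<open>a\<close> is a cocycle and the image of \<open>a\<close> is cancelled by the
  differential of \<open>b\<close>.\<close>

lemma quasi_iso_iff_exact_cone:
 assumes A: "group_complex A" and B: "group_complex B" and \<phi>: "chain_map A B \<phi>"
 shows "quasi_iso A B \<phi> \<longleftrightarrow> exact_complex (group_cone \<phi> A B)"
proof
 assume q: "quasi_iso A B \<phi>"
 show "exact_complex (group_cone \<phi> A B)"
  unfolding exact_complex_iff
 proof (intro allI ballI impI)
  fix n s assume s: "s \<in> obs (group_cone \<phi> A B) n"
   and ds: "Df (group_cone \<phi> A B) n s = one_ob (group_cone \<phi> A B) (n + 1)"
  then obtain a b where ab: "s = (a, b)" "a \<in> obs A (n + 1)" "b \<in> obs B n" by auto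
  have e: "n + 1 + 1 = n + 2" "n - 1 + 1 = n" "n - 1 + 2 = n + 1" by simp_all
  interpret A0: comm_group "Ob A n" by (rule complexD(1)[OF A])
  interpret A1: comm_group "Ob A (n + 1)" by (rule complexD(1)[OF A])
  interpret A2: comm_group "Ob A (n + 2)" by (rule complexD(1)[OF A])
  interpret B0: comm_group "Ob B n" by (rule complexD(1)[OF B])
  interpret B1: comm_group "Ob B (n + 1)" by (rule complexD(1)[OF B])
  interpret dA: group_hom "Ob A (n + 1)" "Ob A (n + 2)" "Df A (n + 1)"
   using complexD(4)[OF A, of "n + 1"] unfolding e by unfold_locales
  interpret dA0: group_hom "Ob A n" "Ob A (n + 1)" "Df A n"
   using complexD(4)[OF A, of n] by unfold_locales
  interpret dB: group_hom "Ob B n" "Ob B (n + 1)" "Df B n"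
   using complexD(4)[OF B, of n] by unfold_locales
  interpret f: group_hom "Ob A (n + 1)" "Ob B (n + 1)" "\<phi> (n + 1)"
   using chain_mapD(1)[OF \<phi>] by unfold_locales
  interpret f0: group_hom "Ob A n" "Ob B n" "\<phi> n"
   using chain_mapD(1)[OF \<phi>] by unfold_locales
  have da: "inv\<^bsub>Ob A (n + 2)\<^esub> Df A (n + 1) a = one_ob A (n + 2)"
   and fb: "\<phi> (n + 1) a \<otimes>\<^bsub>Ob B (n + 1)\<^esub> Df B n b = one_ob B (n + 1)"
   using ds by (auto simp: ab e)
  have "Df A (n + 1) a = one_ob A (n + 2)" using da ab(2) by (metis A2.inv_inv A2.inv_one dA.hom_closed)
  then have a: "a \<in> cocycles A (n + 1)" using ab by (simp add: cocycles_def e)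
  have "\<phi> (n + 1) a = Df B n (inv\<^bsub>Ob B n\<^esub> b)"
   using fb ab by (simp add: B1.inv_equality[symmetric])
  then have "\<phi> (n + 1) a \<in> coboundaries B (n + 1)" using ab(3) B0.inv_closed by (auto simp only: coboundaries_alt)
  then have "a \<in> coboundaries A (n + 1)" using q a unfolding quasi_iso_def by blast
  then obtain c where c: "c \<in> obs A n" "Df A n c = a" by (auto simp: coboundaries_alt)
  have fc: "Df B n (\<phi> n c) = \<phi> (n + 1) a" using chain_mapD(2)[OF \<phi> c(1)] c(2) by simp
  \<comment> \<open>Additively, \<open>\<phi> a + d b = 0\<close> and \<open>d c = a\<close>, so
    \<open>?z\<close> is a cocycle. Writing it as \<open>\<phi> a' + d b'\<close> with a cocycle
    \<open>a'\<close>, the pair \<open>(a' - c, b')\<close> is the primitive sought.\<close>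
  let ?z = "\<phi> n c \<otimes>\<^bsub>Ob B n\<^esub> b"
  have "?z \<in> cocycles B n" using c ab fc fb by (simp add: cocycles_def)
  then obtain a' r where a': "a' \<in> cocycles A n" and r: "r \<in> coboundaries B n"
   and z: "?z = \<phi> n a' \<otimes>\<^bsub>Ob B n\<^esub> r"
   using q unfolding quasi_iso_def by blast
  obtain b' where b': "b' \<in> obs B (n - 1)" "Df B (n - 1) b' = r"
   using r by (auto simp: coboundaries_def)
  have rc: "r \<in> obs B n" using subgroup.mem_carrier[OF subgroup_coboundaries[OF B] r] .
  have a'c: "a' \<in> obs A n" "Df A n a' = one_ob A (n + 1)" using a' by (auto simp: cocycles_def)
  define w where "w = a' \<otimes>\<^bsub>Ob A n\<^esub> inv\<^bsub>Ob A n\<^esub> c"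
  have w: "w \<in> obs A n" using a'c c by (simp add: w_def)
  have "inv\<^bsub>Ob A (n + 1)\<^esub> Df A n w = a" using a'c c ab by (simp add: w_def)
  moreover have "\<phi> n w \<otimes>\<^bsub>Ob B n\<^esub> r = b"
  proof -
   have "\<phi> n w \<otimes>\<^bsub>Ob B n\<^esub> r = inv\<^bsub>Ob B n\<^esub> \<phi> n c \<otimes>\<^bsub>Ob B n\<^esub> (\<phi> n a' \<otimes>\<^bsub>Ob B n\<^esub> r)"
    using a'c c rc by (simp add: w_def B0.m_ac)
   also have "\<dots> = b" using c ab by (simp add: z[symmetric] B0.m_assoc[symmetric])
   finally show ?thesis .
  qed
  ultimately have "Df (group_cone \<phi> A B) (n - 1) (w, b') = s"
   using b' ab by (simp add: e)
  then show "\<exists>t\<in>obs (group_cone \<phi> A B) (n - 1). Df (group_cone \<phi> A B) (n - 1) t = s"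
   using w b' by (intro bexI[of _ "(w, b')"]) auto
 qed
next
 assume ex: "exact_complex (group_cone \<phi> A B)"
 show "quasi_iso A B \<phi>"
  unfolding quasi_iso_def
 proof (intro allI conjI ballI impI)
  fix n a assume a: "a \<in> cocycles A n" and fa: "\<phi> n a \<in> coboundaries B n"
  have e: "n - 1 + 1 = n" "n - 1 + 2 = n + 1" "n - 1 - 1 + 1 = n - 1" "n - 1 - 1 + 2 = n" by simp_all
  interpret A0: comm_group "Ob A n" by (rule complexD(1)[OF A])
  interpret A1: comm_group "Ob A (n + 1)" by (rule complexD(1)[OF A])
  interpret Am: comm_group "Ob A (n - 1)" by (rule complexD(1)[OF A])
  interpret B0: comm_group "Ob B n" by (rule complexD(1)[OF B])
  interpret Bm: comm_group "Ob B (n - 1)" by (rule complexD(1)[OF B])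
  interpret dB: group_hom "Ob B (n - 1)" "Ob B n" "Df B (n - 1)"
   using complexD(4)[OF B, of "n - 1"] unfolding e by unfold_locales
  interpret dA: group_hom "Ob A (n - 1)" "Ob A n" "Df A (n - 1)"
   using complexD(4)[OF A, of "n - 1"] unfolding e by unfold_locales
  obtain b where b: "b \<in> obs B (n - 1)" "Df B (n - 1) b = \<phi> n a" using fa by (auto simp: coboundaries_def)
  have fac: "\<phi> n a \<in> obs B n" using b dB.hom_closed by metis
  have ac: "a \<in> obs A n" "Df A n a = one_ob A (n + 1)" using a by (auto simp: cocycles_def)
  \<comment> \<open>A primitive of the image of \<open>a\<close>, taken with the opposite sign,
    completes \<open>a\<close> to a cocycle of the cone; the first component of a primitive of this
    pair is, up to sign, a primitive of \<open>a\<close>.\<close>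
  let ?s = "(a, inv\<^bsub>Ob B (n - 1)\<^esub> b)"
  have "?s \<in> obs (group_cone \<phi> A B) (n - 1)" using ac b by (simp add: e)
  moreover have "Df (group_cone \<phi> A B) (n - 1) ?s = one_ob (group_cone \<phi> A B) (n - 1 + 1)"
   using ac b fac by (simp add: e dB.hom_inv)
  ultimately obtain t where t: "t \<in> obs (group_cone \<phi> A B) (n - 1 - 1)"
   "Df (group_cone \<phi> A B) (n - 1 - 1) t = ?s"
   using ex unfolding exact_complex_iff by blast
  obtain w v where wv: "t = (w, v)" "w \<in> obs A (n - 1)" using t by (auto simp: e)
  have "a = Df A (n - 1) (inv\<^bsub>Ob A (n - 1)\<^esub> w)" using t wv by (simp add: e)
  then show "a \<in> coboundaries A n" unfolding coboundaries_def by (rule image_eqI) (use wv in simp)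
 next
  fix n b assume b: "b \<in> cocycles B n"
  have e: "n - 1 + 1 = n" "n - 1 + 2 = n + 1" "n + 1 + 1 = n + 2" by simp_all
  interpret A0: comm_group "Ob A n" by (rule complexD(1)[OF A])
  interpret A1: comm_group "Ob A (n + 1)" by (rule complexD(1)[OF A])
  interpret A2: comm_group "Ob A (n + 2)" by (rule complexD(1)[OF A])
  interpret B0: comm_group "Ob B n" by (rule complexD(1)[OF B])
  interpret B1: comm_group "Ob B (n + 1)" by (rule complexD(1)[OF B])
  interpret dA: group_hom "Ob A (n + 1)" "Ob A (n + 2)" "Df A (n + 1)"
   using complexD(4)[OF A, of "n + 1"] unfolding e by unfold_locales
  interpret dA0: group_hom "Ob A n" "Ob A (n + 1)" "Df A n"
   using complexD(4)[OF A, of n] by unfold_locales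
  interpret f: group_hom "Ob A (n + 1)" "Ob B (n + 1)" "\<phi> (n + 1)"
   using chain_mapD(1)[OF \<phi>] by unfold_locales
  have bc: "b \<in> obs B n" "Df B n b = one_ob B (n + 1)" using b by (auto simp: cocycles_def)
  \<comment> \<open>Paired with the unit, a cocycle of \<open>B\<close> is a cocycle of the cone;
    the components of a primitive supply the required cocycle of \<open>A\<close> and the coboundary
    correction.\<close>
  let ?s = "((one_ob A (n + 1)), b)"
  have "?s \<in> obs (group_cone \<phi> A B) n" using bc by simp
  moreover have "Df (group_cone \<phi> A B) n ?s = one_ob (group_cone \<phi> A B) (n + 1)"
   using bc by (simp add: e)
  ultimately obtain t where t: "t \<in> obs (group_cone \<phi> A B) (n - 1)"
   "Df (group_cone \<phi> A B) (n - 1) t = ?s"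
   using ex unfolding exact_complex_iff by blast
  obtain w v where wv: "t = (w, v)" "w \<in> obs A n" "v \<in> obs B (n - 1)" using t by (auto simp: e)
  have "inv\<^bsub>Ob A (n + 1)\<^esub> Df A n w = one_ob A (n + 1)" "\<phi> n w \<otimes>\<^bsub>Ob B n\<^esub> Df B (n - 1) v = b"
   using t wv by (auto simp: e)
  then have "w \<in> cocycles A n" "b = \<phi> n w \<otimes>\<^bsub>Ob B n\<^esub> Df B (n - 1) v"
   using wv by (auto simp: cocycles_def)
  then show "\<exists>a\<in>cocycles A n. \<exists>c\<in>coboundaries B n. b = \<phi> n a \<otimes>\<^bsub>Ob B n\<^esub> c"
   using wv by (auto simp: coboundaries_def)
 qed
qed

lemma sheaf_cone_simps:
 "sect (Sh (sheaf_cone \<phi> K L) n) U = sect (Sh K (n + 1)) U \<times>\<times> sect (Sh L n) U"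
 "rest (Sh (sheaf_cone \<phi> K L) n) U V (s, t) = (rest (Sh K (n + 1)) U V s, rest (Sh L n) U V t)"
 "Dsh (sheaf_cone \<phi> K L) n U = Df (group_cone (\<lambda>m. \<phi> m U) (sections K U) (sections L U)) n"
 by (simp_all add: sheaf_cone_def)

lemma sections_sheaf_cone:
 "sections (sheaf_cone \<phi> K L) U = group_cone (\<lambda>m. \<phi> m U) (sections K U) (sections L U)"
 by (simp add: sections_def sheaf_cone_def group_cone_def)

lemma presheaf_pair:
 assumes F: "presheaf X F" and G: "presheaf X G"
  and H: "\<And>U. sect H U = sect F U \<times>\<times> sect G U"
  and Hr: "\<And>U V s t. rest H U V (s, t) = (rest F U V s, rest G U V t)"
 shows "presheaf X H"
 unfolding presheaf_def
proof (intro conjI allI impI ballI)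
 fix U assume "openin X U"
 then show "comm_group (sect H U)" using presheafD(1)[OF F] presheafD(1)[OF G] by (simp add: H comm_group_DirProd)
next
 fix U V assume UV: "openin X U \<and> openin X V \<and> V \<subseteq> U"
 then have "rest F U V \<in> hom (sect F U) (sect F V)" "rest G U V \<in> hom (sect G U) (sect G V)"
  using presheafD(4)[OF F] presheafD(4)[OF G] by auto
 then show "rest H U V \<in> hom (sect H U) (sect H V)"
  unfolding H by (intro homI) (auto simp: Hr hom_mult hom_in_carrier)
next
 fix U s assume "openin X U" "s \<in> secs H U"
 then show "rest H U U s = s" using presheafD(6)[OF F] presheafD(6)[OF G] by (cases s) (auto simp: H Hr)
next
 fix U V W s assume "openin X U \<and> openin X V \<and> openin X W \<and> W \<subseteq> V \<and> V \<subseteq> U" "s \<in> secs H U"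
 then show "rest H V W (rest H U V s) = rest H U W s"
  using presheafD(7)[OF F] presheafD(7)[OF G] by (cases s) (auto simp: H Hr)
qed

text \<open>The product is described through its equations on pairs, which is the form in which
  \<open>sheaf_cone\<close> presents its sections and restrictions; gluing is componentwise.\<close>

lemma sheaf_pair:
 assumes fin: "finite_space X" and F: "sheaf X F" and G: "sheaf X G"
  and H: "\<And>U. sect H U = sect F U \<times>\<times> sect G U"
  and Hr: "\<And>U V s t. rest H U V (s, t) = (rest F U V s, rest G U V t)"
 shows "sheaf X H"
proof (rule sheafI[OF fin])
 show "presheaf X H" using presheaf_pair[OF F[THEN sheaf_imp_presheaf] G[THEN sheaf_imp_presheaf] H Hr] .
 fix U assume U: "openin X U"
 {
  fix s t assume s: "s \<in> secs H U" and t: "t \<in> secs H U"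
   and eq: "\<And>x. x \<in> U \<Longrightarrow> rest H U (min_nbhd X x) s = rest H U (min_nbhd X x) t"
  obtain s1 s2 t1 t2 where st: "s = (s1, s2)" "t = (t1, t2)" by fastforce
  have r: "rest F U (min_nbhd X x) s1 = rest F U (min_nbhd X x) t1"
   "rest G U (min_nbhd X x) s2 = rest G U (min_nbhd X x) t2" if "x \<in> U" for x
   using eq[OF that] by (simp_all add: Hr st)
  have "s1 = t1" by (rule sheaf_eqI[OF fin F U _ _ r(1)]) (use s t in \<open>simp_all add: H st\<close>)
  moreover have "s2 = t2" by (rule sheaf_eqI[OF fin G U _ _ r(2)]) (use s t in \<open>simp_all add: H st\<close>)
  ultimately show "s = t" by (simp add: st)
 next
  fix t assume t: "compatible_germs X H U t"
  have Hr': "rest H N N' s = (rest F N N' (fst s), rest G N N' (snd s))" for N N' s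
   using Hr[of N N' "fst s" "snd s"] by simp
  have t1: "compatible_germs X F U (fst \<circ> t)" and t2: "compatible_germs X G U (snd \<circ> t)"
   using t by (auto simp: compatible_germs_def H Hr' mem_Times_iff prod_eq_iff)
  obtain s1 where s1: "has_germs X F U (fst \<circ> t) s1" by (rule sheaf_glue[OF fin F U t1])
  obtain s2 where s2: "has_germs X G U (snd \<circ> t) s2" by (rule sheaf_glue[OF fin G U t2])
  have "has_germs X H U t (s1, s2)" using s1 s2 by (auto simp: has_germs_def H Hr)
  then show "\<exists>s. has_germs X H U t s" by blast
 }
qed

lemma is_sheaf_complex_cone:
 assumes fin: "finite_space X" and \<phi>: "complex_morphism X K L \<phi>"
 shows "is_sheaf_complex X (sheaf_cone \<phi> K L)"
proof -
 note K = complex_morphismD(1)[OF \<phi>] and L = complex_morphismD(2)[OF \<phi>]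
 let ?C = "sheaf_cone \<phi> K L"
 have gc: "group_complex (sections ?C U)" if "openin X U" for U
  unfolding sections_sheaf_cone
  using group_complex_cone[OF group_complex_sections[OF K that] group_complex_sections[OF L that] chain_map_sections[OF \<phi> that]] .
 show ?thesis
  unfolding is_sheaf_complex_def
 proof (intro conjI allI impI ballI)
  fix n
  show "sheaf X (Sh ?C n)"
   by (rule sheaf_pair[OF fin is_sheaf_complexD(1)[OF K] is_sheaf_complexD(1)[OF L]]) (rule sheaf_cone_simps)+
  show "sheaf_morphism X (Sh ?C n) (Sh ?C (n + 1)) (Dsh ?C n)"
   unfolding sheaf_morphism_def
  proof (intro conjI allI impI ballI)
   fix U assume U: "openin X U"
   show "Dsh ?C n U \<in> hom (sect (Sh ?C n) U) (sect (Sh ?C (n + 1)) U)"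
    using complexD(4)[OF gc[OF U], of n] by simp
  next
   fix U V s assume UV: "openin X U \<and> openin X V \<and> V \<subseteq> U" and "s \<in> secs (Sh ?C n) U"
   then obtain a b where s: "s = (a, b)" "a \<in> secs (Sh K (n + 1)) U" "b \<in> secs (Sh L n) U"
    by (auto simp: sheaf_cone_simps)
   have U: "openin X U" and V: "openin X V" "V \<subseteq> U" using UV by auto
   have e: "n + 1 + 1 = n + 2" by simp
   have rK: "group_hom (sect (Sh K m) U) (sect (Sh K m) V) (rest (Sh K m) U V)" for m
    using presheafD(2,4)[OF is_sheaf_complexD(2)[OF K]] U V by (simp add: group_hom_def group_hom_axioms_def)
   have rL: "group_hom (sect (Sh L m) U) (sect (Sh L m) V) (rest (Sh L m) U V)" for m
    using presheafD(2,4)[OF is_sheaf_complexD(2)[OF L]] U V by (simp add: group_hom_def group_hom_axioms_def)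
   have da: "Dsh K (n + 1) U a \<in> secs (Sh K (n + 2)) U"
    using morphismD(2)[OF is_sheaf_complexD(3)[OF K] U s(2)] unfolding e .
   have db: "Dsh L n U b \<in> secs (Sh L (n + 1)) U"
    using morphismD(2)[OF is_sheaf_complexD(3)[OF L] U s(3)] .
   have fa: "\<phi> (n + 1) U a \<in> secs (Sh L (n + 1)) U"
    using morphismD(2)[OF complex_morphismD(3)[OF \<phi>] U s(2)] .
   show "Dsh ?C n V (rest (Sh ?C n) U V s) = rest (Sh ?C (n + 1)) U V (Dsh ?C n U s)"
    using morphismD(3)[OF is_sheaf_complexD(3)[OF K] U V s(2)]
     morphismD(3)[OF is_sheaf_complexD(3)[OF L] U V s(3)]
     morphismD(3)[OF complex_morphismD(3)[OF \<phi>] U V s(2)]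
     group_hom.hom_inv[OF rK da] group_hom.hom_mult[OF rL fa db]
    by (simp add: sheaf_cone_simps s e)
  qed
  fix U s assume U: "openin X U" and s: "s \<in> secs (Sh ?C n) U"
  show "Dsh ?C (n + 1) U (Dsh ?C n U s) = one_sect (Sh ?C (n + 2)) U"
   using complexD(5)[OF gc[OF U], of s n] s by simp
 qed
qed

lemma flasque_pair:
 assumes F: "flasque X F" and G: "flasque X G"
  and H: "\<And>U. sect H U = sect F U \<times>\<times> sect G U"
  and Hr: "\<And>U V s t. rest H U V (s, t) = (rest F U V s, rest G U V t)"
 shows "flasque X H"
 unfolding flasque_def
proof (intro allI impI ballI)
 fix U V s assume UV: "openin X U \<and> openin X V \<and> V \<subseteq> U" and "s \<in> secs H V"
 then obtain a b where s: "s = (a, b)" "a \<in> secs F V" "b \<in> secs G V" by (auto simp: H)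
 obtain a' where "a' \<in> secs F U" "rest F U V a' = a" using flasqueD[OF F _ _ _ s(2)] UV by blast
 moreover obtain b' where "b' \<in> secs G U" "rest G U V b' = b" using flasqueD[OF G _ _ _ s(3)] UV by blast
 ultimately show "\<exists>t\<in>secs H U. rest H U V t = s"
  by (intro bexI[of _ "(a', b')"]) (auto simp: H Hr s)
qed

lemma flasque_cone:
 assumes "\<And>n. flasque X (Sh K n)" "\<And>n. flasque X (Sh L n)"
 shows "flasque X (Sh (sheaf_cone \<phi> K L) n)"
 by (rule flasque_pair[OF assms]) (rule sheaf_cone_simps)+

lemma bounded_below_cone:
 assumes "bounded_below X K" "bounded_below X L"
 shows "bounded_below X (sheaf_cone \<phi> K L)"
proof -
 obtain k l where k: "\<And>n U. n < k \<Longrightarrow> openin X U \<Longrightarrow> secs (Sh K n) U \<subseteq> {(one_sect (Sh K n) U)}"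
  and l: "\<And>n U. n < l \<Longrightarrow> openin X U \<Longrightarrow> secs (Sh L n) U \<subseteq> {(one_sect (Sh L n) U)}"
  using assms unfolding bounded_below_def by metis
 have "secs (Sh (sheaf_cone \<phi> K L) n) U \<subseteq> {(one_sect (Sh (sheaf_cone \<phi> K L) n) U)}"
  if n: "n < min (k - 1) l" and U: "openin X U" for n U
  using k[OF _ U, of "n + 1"] l[OF _ U, of n] n by (auto simp: sheaf_cone_simps)
 then show ?thesis unfolding bounded_below_def by blast
qed

text \<open>The cone of \<open>\<phi>\<close> is again flasque and bounded below, and it is exact on
  stalks because \<open>\<phi>\<close> is a quasi-isomorphism there;
  \<open>flasque_complex_exact\<close> then makes its sections exact.\<close>

lemma flasque_quasi_iso:
 assumes fin: "finite_space X" and \<phi>: "complex_morphism X K L \<phi>"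
  and "\<And>n. flasque X (Sh K n)" "\<And>n. flasque X (Sh L n)" "bounded_below X K" "bounded_below X L"
  and stalk: "\<And>x. x \<in> topspace X \<Longrightarrow>
   quasi_iso (stalks X K x) (stalks X L x) (\<lambda>n. \<phi> n (min_nbhd X x))"
  and W: "openin X W"
 shows "quasi_iso (sections K W) (sections L W) (\<lambda>n. \<phi> n W)"
proof -
 note K = complex_morphismD(1)[OF \<phi>] and L = complex_morphismD(2)[OF \<phi>]
 have iff: "quasi_iso (sections K U) (sections L U) (\<lambda>n. \<phi> n U) \<longleftrightarrow> exact_complex (sections (sheaf_cone \<phi> K L) U)"
  if "openin X U" for U
  unfolding sections_sheaf_cone
  by (rule quasi_iso_iff_exact_cone)
    (use group_complex_sections[OF K that] group_complex_sections[OF L that] chain_map_sections[OF \<phi> that] in auto)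
 have "exact_complex (sections (sheaf_cone \<phi> K L) W)"
  using iff stalk openin_min_nbhd[OF fin] assms
  by (intro flasque_complex_exact[OF fin is_sheaf_complex_cone[OF fin \<phi>] flasque_cone bounded_below_cone _ W]) auto
 then show ?thesis using iff[OF W] by simp
qed

subsection \<open>Shifts, direct images and restriction to open subsets\<close>

lemma sheaf_shift_simps:
 "Sh (sheaf_shift k K) n = Sh K (n + k)"
 "Dsh (sheaf_shift k K) n U s =
  (if even k then Dsh K (n + k) U s else inv\<^bsub>sect (Sh K (n + k + 1)) U\<^esub> Dsh K (n + k) U s)"
 by (simp_all add: sheaf_shift_def group_shift_def)

lemma group_shift_simps:
 "Ob (group_shift k A) n = Ob A (n + k)"
 "Df (group_shift k A) n a = (if even k then Df A (n + k) a else inv\<^bsub>Ob A (n + k + 1)\<^esub> Df A (n + k) a)"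
 by (simp_all add: group_shift_def)

lemma is_sheaf_complex_shift:
 assumes K: "is_sheaf_complex X K"
 shows "is_sheaf_complex X (sheaf_shift k K)"
 unfolding is_sheaf_complex_def
proof (intro conjI allI impI ballI)
 fix n
 have e: "n + 1 + k = n + k + 1" "n + 2 + k = n + k + 2" by simp_all
 let ?d = "Dsh K (n + k)"
 show "sheaf X (Sh (sheaf_shift k K) n)" using is_sheaf_complexD(1)[OF K] by (simp add: sheaf_shift_simps)
 have M: "sheaf_morphism X (Sh K m) (Sh K (m + 1)) (Dsh K m)" for m by (rule is_sheaf_complexD(3)[OF K])
 note P = is_sheaf_complexD(2)[OF K]
 show "sheaf_morphism X (Sh (sheaf_shift k K) n) (Sh (sheaf_shift k K) (n + 1)) (Dsh (sheaf_shift k K) n)"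
  unfolding sheaf_morphism_def sheaf_shift_simps(1) e
 proof (intro conjI allI impI ballI)
  fix U assume U: "openin X U"
  interpret G: comm_group "sect (Sh K (n + k)) U" by (rule presheafD(1)[OF P U])
  interpret H: comm_group "sect (Sh K (n + k + 1)) U" by (rule presheafD(1)[OF P U])
  interpret d: group_hom "sect (Sh K (n + k)) U" "sect (Sh K (n + k + 1)) U" "?d U"
   using morphismD(1)[OF M U] by unfold_locales
  show "Dsh (sheaf_shift k K) n U \<in> hom (sect (Sh K (n + k)) U) (sect (Sh K (n + k + 1)) U)"
   by (rule homI) (simp_all add: sheaf_shift_simps H.inv_mult)
 next
  fix U V s assume UV: "openin X U \<and> openin X V \<and> V \<subseteq> U" and s: "s \<in> secs (Sh K (n + k)) U"
  then have U: "openin X U" and V: "openin X V" "V \<subseteq> U" by auto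
  have "group_hom (sect (Sh K (n + k + 1)) U) (sect (Sh K (n + k + 1)) V) (rest (Sh K (n + k + 1)) U V)"
   using presheafD(4)[OF P U V] presheafD(2)[OF P U] presheafD(2)[OF P V(1)]
   by (simp add: group_hom_def group_hom_axioms_def)
  from group_hom.hom_inv[OF this morphismD(2)[OF M U s]]
  show "Dsh (sheaf_shift k K) n V (rest (Sh K (n + k)) U V s) = rest (Sh K (n + k + 1)) U V (Dsh (sheaf_shift k K) n U s)"
   using morphismD(3)[OF M U V s] by (simp add: sheaf_shift_simps)
 qed
 fix U s assume U: "openin X U" and "s \<in> secs (Sh (sheaf_shift k K) n) U"
 then have s: "s \<in> secs (Sh K (n + k)) U" by (simp add: sheaf_shift_simps)
 have ee: "n + k + 1 + 1 = n + k + 2" by simp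
 interpret H: comm_group "sect (Sh K (n + k + 1)) U" by (rule presheafD(1)[OF P U])
 interpret H2: comm_group "sect (Sh K (n + k + 2)) U" by (rule presheafD(1)[OF P U])
 interpret d: group_hom "sect (Sh K (n + k + 1)) U" "sect (Sh K (n + k + 2)) U" "Dsh K (n + k + 1) U"
  using morphismD(1)[OF M U, of "n + k + 1"] unfolding ee by unfold_locales
 show "Dsh (sheaf_shift k K) (n + 1) U (Dsh (sheaf_shift k K) n U s) = one_sect (Sh (sheaf_shift k K) (n + 2)) U"
  using is_sheaf_complexD(4)[OF K U s] morphismD(2)[OF M U s]
  unfolding sheaf_shift_simps e ee by simp
qed

section \<open>Sheaves as complexes in degree zero\<close>

lemma group_deg0_simps:
 "Ob (group_deg0 G) n = (if n = 0 then G else singleton_group \<one>\<^bsub>G\<^esub>)"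
 "Df (group_deg0 G) n a = \<one>\<^bsub>G\<^esub>"
 by (simp_all add: group_deg0_def)

lemma one_Ob_group_deg0 [simp]: "(one_ob (group_deg0 G) n) = \<one>\<^bsub>G\<^esub>"
 by (simp add: group_deg0_simps singleton_group_def)

lemma group_complex_deg0: "comm_group G \<Longrightarrow> group_complex (group_deg0 G)"
 unfolding group_complex_def one_Ob_group_deg0
 by (auto simp: group_deg0_simps singleton_group_def comm_group.axioms(2) group.is_monoid hom_def
   intro: singleton_abelian_group[unfolded singleton_group_def])

lemma sheaf_deg0_simps:
 "sect (Sh (sheaf_deg0 F) n) U = (if n = 0 then sect F U else singleton_group (one_sect F U))"
 "rest (Sh (sheaf_deg0 F) n) U V s = rest F U V s"
 "Dsh (sheaf_deg0 F) n U s = one_sect F U"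
 "Sh (sheaf_deg0 F) 0 = F"
 by (simp_all add: sheaf_deg0_def group_deg0_simps)

text \<open>A zero sheaf still needs an element: over \<open>U\<close> it is the unit of
  \<open>F\<close>, restricted by the maps of \<open>F\<close>. This is how
  \<open>sheaf_deg0\<close> fills the degrees other than 0.\<close>

lemma sheaf_trivial:
 assumes fin: "finite_space X" and F: "presheaf X F"
  and G: "\<And>U. sect G U = singleton_group (one_sect F U)" "\<And>U V s. rest G U V s = rest F U V s"
 shows "sheaf X G"
proof (rule sheafI[OF fin])
 have r: "rest F U V (one_sect F U) = one_sect F V" if "openin X U" "openin X V" "V \<subseteq> U" for U V
  using presheaf_rest_one[OF F that] .
 have c: "secs G U = {(one_sect F U)}" for U by (simp add: G singleton_group_def)
 show "presheaf X G"
  unfolding presheaf_def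
 proof (intro conjI allI impI ballI)
  fix U V assume "openin X U \<and> openin X V \<and> V \<subseteq> U"
  then show "rest G U V \<in> hom (sect G U) (sect G V)"
   using r[of U V] by (intro homI) (auto simp: G singleton_group_def)
 qed (use r in \<open>auto simp: G singleton_group_def intro: singleton_abelian_group[unfolded singleton_group_def]\<close>)
 show "s = t" if "s \<in> secs G U" "t \<in> secs G U" for U s t
  using that by (simp add: c)
 fix U t assume U: "openin X U" and t: "compatible_germs X G U t"
 have "has_germs X G U t (one_sect F U)"
  using t r[OF U openin_min_nbhd[OF fin] min_nbhd_subset[OF U]] openin_subset[OF U]
  by (auto simp: has_germs_def compatible_germs_def c G(2))
 then show "\<exists>s. has_germs X G U t s" by blast
qed

lemma sheaf_morphism_one:
 assumes "presheaf X F" "presheaf X G"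
 shows "sheaf_morphism X F G (\<lambda>U s. (one_sect G U))"
 unfolding sheaf_morphism_def
 using presheaf_rest_one[OF assms(2)] monoid.one_closed[OF presheafD(3)[OF assms(2)]]
  monoid.l_one[OF presheafD(3)[OF assms(2)]]
 by (auto simp: hom_def)

lemma is_sheaf_complex_deg0:
 assumes fin: "finite_space X" and F: "sheaf X F"
 shows "is_sheaf_complex X (sheaf_deg0 F)"
proof -
 have S: "sheaf X (Sh (sheaf_deg0 F) n)" for n
 proof (cases "n = 0")
  case True
  then show ?thesis using F by (simp add: sheaf_deg0_simps)
 next
  case False
  then show ?thesis
   by (intro sheaf_trivial[OF fin sheaf_imp_presheaf[OF F]]) (simp_all add: sheaf_deg0_simps)
 qed
 have one: "(one_sect (Sh (sheaf_deg0 F) n) U) = one_sect F U" for n U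
  by (simp add: sheaf_deg0_simps singleton_group_def)
 have "sheaf_morphism X (Sh (sheaf_deg0 F) n) (Sh (sheaf_deg0 F) (n + 1)) (Dsh (sheaf_deg0 F) n)" for n
  using sheaf_morphism_one[OF sheaf_imp_presheaf[OF S] sheaf_imp_presheaf[OF S], of n "n + 1"]
  unfolding one sheaf_morphism_def sheaf_deg0_simps(3) by (simp add: sheaf_deg0_simps(3) fun_eq_iff cong: ball_cong)
 with S show ?thesis unfolding is_sheaf_complex_def one by (simp add: sheaf_deg0_simps(3))
qed

lemma flasque_deg0:
 assumes F: "presheaf X F" "flasque X F"
 shows "flasque X (Sh (sheaf_deg0 F) n)"
proof (cases "n = 0")
 case True
 then show ?thesis using F by (simp add: sheaf_deg0_simps)
next
 case False
 then show ?thesis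
  unfolding flasque_def
  using presheaf_rest_one[OF F(1)] by (simp add: sheaf_deg0_simps singleton_group_def)
qed

section \<open>Direct images\<close>

lemma pushforward_simps:
 "sect (Sh (pushforward X f K) n) V = sect (Sh K n) {x \<in> topspace X. f x \<in> V}"
 "rest (Sh (pushforward X f K) n) V W s = rest (Sh K n) {x \<in> topspace X. f x \<in> V} {x \<in> topspace X. f x \<in> W} s"
 "Dsh (pushforward X f K) n V = Dsh K n {x \<in> topspace X. f x \<in> V}"
 by (simp_all add: pushforward_def Let_def)

lemma sections_pushforward: "sections (pushforward X f K) V = sections K {x \<in> topspace X. f x \<in> V}"
 by (simp add: sections_def pushforward_simps pushforward_def Let_def)

text \<open>Inverse images commute with unions and intersections, so the gluing axiom is inherited.
  A cover pulls back to a family in which members may repeat, whence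
  \<open>sheaf_glue_family\<close>.\<close>

lemma is_sheaf_complex_pushforward:
 assumes f: "continuous_map X Y f" and K: "is_sheaf_complex X K"
 shows "is_sheaf_complex Y (pushforward X f K)"
proof -
 define pre where "pre V = {x \<in> topspace X. f x \<in> V}" for V
 have o: "openin X (pre V)" if "openin Y V" for V
  using openin_continuous_map_preimage[OF f that] by (simp add: pre_def)
 have m: "pre W \<subseteq> pre V" if "W \<subseteq> V" for V W using that by (auto simp: pre_def)
 have i: "pre (V \<inter> W) = pre V \<inter> pre W" for V W by (auto simp: pre_def)
 have u: "pre (\<Union>\<V>) = \<Union>(pre ` \<V>)" for \<V> by (auto simp: pre_def)
 let ?L = "pushforward X f K"
 note simps = pushforward_simps[of X f K, folded pre_def]
 note P = is_sheaf_complexD(2)[OF K] and M = is_sheaf_complexD(3)[OF K]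
 have pre: "presheaf Y (Sh ?L n)" for n
  unfolding presheaf_def
 proof (intro conjI allI impI ballI)
  fix U V assume UV: "openin Y U \<and> openin Y V \<and> V \<subseteq> U"
  then have "rest (Sh K n) (pre U) (pre V) \<in> hom (sect (Sh K n) (pre U)) (sect (Sh K n) (pre V))"
   using presheafD(4)[OF P o o m] by simp
  then show "rest (Sh ?L n) U V \<in> hom (sect (Sh ?L n) U) (sect (Sh ?L n) V)"
   by (simp add: hom_def simps Pi_iff)
 next
  fix U assume "openin Y U"
  then show "comm_group (sect (Sh ?L n) U)" using presheafD(1)[OF P o] by (simp add: simps)
 next
  fix U s assume "openin Y U" "s \<in> secs (Sh ?L n) U"
  then show "rest (Sh ?L n) U U s = s" using presheafD(6)[OF P o] by (simp add: simps)
 next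
  fix U V W s assume "openin Y U \<and> openin Y V \<and> openin Y W \<and> W \<subseteq> V \<and> V \<subseteq> U" "s \<in> secs (Sh ?L n) U"
  then show "rest (Sh ?L n) V W (rest (Sh ?L n) U V s) = rest (Sh ?L n) U W s"
   using presheafD(7)[OF P o o o m m] by (simp add: simps)
 qed
 show ?thesis
  unfolding is_sheaf_complex_def
 proof (intro conjI allI impI ballI)
  fix n
  show "sheaf Y (Sh ?L n)"
   unfolding sheaf_def
  proof (intro conjI pre allI impI)
   fix \<U> s
   assume "(\<forall>U\<in>\<U>. openin Y U \<and> s U \<in> secs (Sh ?L n) U) \<and>
    (\<forall>U\<in>\<U>. \<forall>V\<in>\<U>. rest (Sh ?L n) U (U \<inter> V) (s U) = rest (Sh ?L n) V (U \<inter> V) (s V))"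
   then show "\<exists>!t. t \<in> secs (Sh ?L n) (\<Union>\<U>) \<and> (\<forall>U\<in>\<U>. rest (Sh ?L n) (\<Union>\<U>) U t = s U)"
    unfolding simps i u by (intro sheaf_glue_family[OF is_sheaf_complexD(1)[OF K]]) (auto intro: o)
  qed
  show "sheaf_morphism Y (Sh ?L n) (Sh ?L (n + 1)) (Dsh ?L n)"
   unfolding sheaf_morphism_def simps
   using morphismD(1)[OF M o] morphismD(3)[OF M o o m] by simp
  show "Dsh ?L (n + 1) U (Dsh ?L n U s) = one_sect (Sh ?L (n + 2)) U"
   if "openin Y U" "s \<in> secs (Sh ?L n) U" for U s
   using is_sheaf_complexD(4)[OF K o[OF that(1)]] that(2) by (simp add: simps)
 qed
qed

lemma flasque_pushforward:
 assumes f: "continuous_map X Y f" and K: "flasque X (Sh K n)"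
 shows "flasque Y (Sh (pushforward X f K) n)"
 unfolding flasque_def pushforward_simps
proof (intro allI impI ballI)
 fix U V s assume UV: "openin Y U \<and> openin Y V \<and> V \<subseteq> U"
  and s: "s \<in> carrier (sect (Sh K n) {x \<in> topspace X. f x \<in> V})"
 have o: "openin X {x \<in> topspace X. f x \<in> W}" if "openin Y W" for W
  using openin_continuous_map_preimage[OF f that] .
 show "\<exists>t\<in>carrier (sect (Sh K n) {x \<in> topspace X. f x \<in> U}).
   rest (Sh K n) {x \<in> topspace X. f x \<in> U} {x \<in> topspace X. f x \<in> V} t = s"
  by (rule flasqueD[OF K o[of U] o[of V] _ s]) (use UV in blast)+
qed

section \<open>Restriction to open subsets\<close>

lemma presheaf_open_subtopology:
 assumes V: "openin X V" and F: "presheaf X F"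
 shows "presheaf (subtopology X V) F"
 unfolding presheaf_def openin_open_subtopology[OF V]
 using presheafD(1,4,6)[OF F] presheafD(7)[OF F] by simp

lemma sheaf_open_subtopology:
 assumes V: "openin X V" and F: "sheaf X F"
 shows "sheaf (subtopology X V) F"
 unfolding sheaf_def
proof (intro conjI presheaf_open_subtopology[OF V sheaf_imp_presheaf[OF F]] allI impI)
 fix \<U> s
 assume "(\<forall>U\<in>\<U>. openin (subtopology X V) U \<and> s U \<in> secs F U) \<and>
  (\<forall>U\<in>\<U>. \<forall>V\<in>\<U>. rest F U (U \<inter> V) (s U) = rest F V (U \<inter> V) (s V))"
 then have "(\<forall>U\<in>\<U>. openin X U \<and> s U \<in> secs F U) \<and>
  (\<forall>U\<in>\<U>. \<forall>V\<in>\<U>. rest F U (U \<inter> V) (s U) = rest F V (U \<inter> V) (s V))"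
  unfolding openin_open_subtopology[OF V] by blast
 then show "\<exists>!t. t \<in> secs F (\<Union>\<U>) \<and> (\<forall>U\<in>\<U>. rest F (\<Union>\<U>) U t = s U)"
  by (rule mp[OF spec[OF spec[OF conjunct2[OF F[unfolded sheaf_def]]], of \<U> s]])
qed

lemma sheaf_morphism_open_subtopology:
 assumes V: "openin X V" and "sheaf_morphism X F G \<phi>"
 shows "sheaf_morphism (subtopology X V) F G \<phi>"
 unfolding sheaf_morphism_def openin_open_subtopology[OF V]
 using morphismD(1,3)[OF assms(2)] by simp

lemma is_sheaf_complex_open_subtopology:
 assumes V: "openin X V" and K: "is_sheaf_complex X K"
 shows "is_sheaf_complex (subtopology X V) K"
 unfolding is_sheaf_complex_def
 using sheaf_open_subtopology[OF V is_sheaf_complexD(1)[OF K]]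
  sheaf_morphism_open_subtopology[OF V is_sheaf_complexD(3)[OF K]] is_sheaf_complexD(4)[OF K]
 by (simp add: openin_open_subtopology[OF V])

lemma flasque_open_subtopology:
 assumes V: "openin X V" and "flasque X F"
 shows "flasque (subtopology X V) F"
 unfolding flasque_def openin_open_subtopology[OF V]
 using assms(2)[unfolded flasque_def] by simp

subsection \<open>Resolutions\<close>

text \<open>Exactness of \<open>0 \<rightarrow> F \<rightarrow> K 0 \<rightarrow> K 1 \<rightarrow>
  ...\<close> on stalks, with nothing in negative degrees. The notion leaves the type of values free
  and does not ask for injectivity, so it covers the flasque resolutions by cochains, the relative
  complex and injective resolutions alike.\<close>

definition resolution ::
 "'s topology \<Rightarrow> ('s, 'b) presheaf_data \<Rightarrow> ('s, 'a) sheaf_complex \<Rightarrow> ('s set \<Rightarrow> 'b \<Rightarrow> 'a) \<Rightarrow> bool" where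
 "resolution X F K \<epsilon> \<longleftrightarrow> is_sheaf_complex X K \<and> presheaf X F \<and>
  (\<forall>n<0. \<forall>U. openin X U \<longrightarrow> secs (Sh K n) U \<subseteq> {(one_sect (Sh K n) U)}) \<and>
  sheaf_morphism X F (Sh K 0) \<epsilon> \<and>
  (\<forall>U. openin X U \<longrightarrow> (\<forall>s\<in>secs F U. Dsh K 0 U (\<epsilon> U s) = one_sect (Sh K 1) U)) \<and>
  (\<forall>x\<in>topspace X. let U = min_nbhd X x in
   (\<forall>s\<in>secs F U. \<epsilon> U s = one_sect (Sh K 0) U \<longrightarrow> s = one_sect F U) \<and>
   (\<forall>a\<in>secs (Sh K 0) U. Dsh K 0 U a = one_sect (Sh K 1) U \<longrightarrow> a \<in> \<epsilon> U ` secs F U) \<and>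
   (\<forall>n\<ge>0. \<forall>a\<in>secs (Sh K (n + 1)) U. Dsh K (n + 1) U a = one_sect (Sh K (n + 2)) U \<longrightarrow>
    a \<in> Dsh K n U ` secs (Sh K n) U))"

lemma resolutionD:
 assumes "resolution X F K \<epsilon>"
 shows "is_sheaf_complex X K" "presheaf X F"
  and "n < 0 \<Longrightarrow> openin X U \<Longrightarrow> a \<in> secs (Sh K n) U \<Longrightarrow> a = one_sect (Sh K n) U"
  and "sheaf_morphism X F (Sh K 0) \<epsilon>"
  and "openin X U \<Longrightarrow> s \<in> secs F U \<Longrightarrow> Dsh K 0 U (\<epsilon> U s) = one_sect (Sh K 1) U"
  and "x \<in> topspace X \<Longrightarrow> s \<in> germs X F x \<Longrightarrow>
   \<epsilon> (min_nbhd X x) s = one_sect (Sh K 0) (min_nbhd X x) \<Longrightarrow> s = one_sect F (min_nbhd X x)"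
  and "x \<in> topspace X \<Longrightarrow> a \<in> germs X (Sh K 0) x \<Longrightarrow>
   Dsh K 0 (min_nbhd X x) a = one_sect (Sh K 1) (min_nbhd X x) \<Longrightarrow>
   a \<in> \<epsilon> (min_nbhd X x) ` germs X F x"
  and "x \<in> topspace X \<Longrightarrow> 0 \<le> n \<Longrightarrow> a \<in> germs X (Sh K (n + 1)) x \<Longrightarrow>
   Dsh K (n + 1) (min_nbhd X x) a = one_sect (Sh K (n + 2)) (min_nbhd X x) \<Longrightarrow>
   a \<in> Dsh K n (min_nbhd X x) ` germs X (Sh K n) x"
proof -
 note c = assms[unfolded resolution_def Let_def]
 note t = c[THEN conjunct2, THEN conjunct2]
 note st = t[THEN conjunct2, THEN conjunct2, THEN conjunct2]
 show "is_sheaf_complex X K" using c by (rule conjunct1)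
 show "presheaf X F" using c[THEN conjunct2] by (rule conjunct1)
 show "n < 0 \<Longrightarrow> openin X U \<Longrightarrow> a \<in> secs (Sh K n) U \<Longrightarrow> a = one_sect (Sh K n) U"
  using t[THEN conjunct1] by blast
 show "sheaf_morphism X F (Sh K 0) \<epsilon>" using t[THEN conjunct2] by (rule conjunct1)
 show "openin X U \<Longrightarrow> s \<in> secs F U \<Longrightarrow> Dsh K 0 U (\<epsilon> U s) = one_sect (Sh K 1) U"
  using t[THEN conjunct2, THEN conjunct2, THEN conjunct1] by blast
 assume x: "x \<in> topspace X"
 note stx = bspec[OF st x]
 show "s \<in> germs X F x \<Longrightarrow>
   \<epsilon> (min_nbhd X x) s = one_sect (Sh K 0) (min_nbhd X x) \<Longrightarrow> s = one_sect F (min_nbhd X x)"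
  using stx[THEN conjunct1] by blast
 show "a \<in> germs X (Sh K 0) x \<Longrightarrow>
   Dsh K 0 (min_nbhd X x) a = one_sect (Sh K 1) (min_nbhd X x) \<Longrightarrow>
   a \<in> \<epsilon> (min_nbhd X x) ` germs X F x"
  using stx[THEN conjunct2, THEN conjunct1] by blast
 show "0 \<le> n \<Longrightarrow> a \<in> germs X (Sh K (n + 1)) x \<Longrightarrow>
   Dsh K (n + 1) (min_nbhd X x) a = one_sect (Sh K (n + 2)) (min_nbhd X x) \<Longrightarrow>
   a \<in> Dsh K n (min_nbhd X x) ` germs X (Sh K n) x"
  using stx[THEN conjunct2, THEN conjunct2] by blast
qed

lemma resolution_bounded_below:
 assumes "resolution X F K \<epsilon>" shows "bounded_below X K"
 unfolding bounded_below_def using resolutionD(3)[OF assms] by blast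

lemma resolution_open_subtopology:
 assumes fin: "finite_space X" and V: "openin X V" and R: "resolution X F K \<epsilon>"
 shows "resolution (subtopology X V) F K \<epsilon>"
proof -
 have top: "topspace (subtopology X V) = V" using openin_subset[OF V] by auto
 have "x \<in> topspace X" if "x \<in> V" for x using that openin_subset[OF V] by auto
 note xX = this
 note D = resolutionD[OF R]
 show ?thesis
  unfolding resolution_def top Let_def openin_open_subtopology[OF V]
 proof (intro conjI ballI allI impI)
  show "is_sheaf_complex (subtopology X V) K" using is_sheaf_complex_open_subtopology[OF V D(1)] .
  show "presheaf (subtopology X V) F" using presheaf_open_subtopology[OF V D(2)] .
  show "sheaf_morphism (subtopology X V) F (Sh K 0) \<epsilon>" using sheaf_morphism_open_subtopology[OF V D(4)] .
  show "secs (Sh K n) U \<subseteq> {(one_sect (Sh K n) U)}" if "n < 0" "openin X U \<and> U \<subseteq> V" for n U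
   using D(3)[OF that(1)] that(2) by blast
  show "Dsh K 0 U (\<epsilon> U s) = one_sect (Sh K 1) U" if "openin X U \<and> U \<subseteq> V" "s \<in> secs F U" for U s
   using D(5)[OF _ that(2)] that(1) by blast
 next
  fix x assume x: "x \<in> V"
  note n = min_nbhd_open_subtopology[OF fin V x]
  fix s assume "s \<in> germs (subtopology X V) F x"
   "\<epsilon> (min_nbhd (subtopology X V) x) s = one_sect (Sh K 0) (min_nbhd (subtopology X V) x)"
  then show "s = one_sect F (min_nbhd (subtopology X V) x)"
   unfolding n by (rule D(6)[OF xX[OF x]])
 next
  fix x assume x: "x \<in> V"
  note n = min_nbhd_open_subtopology[OF fin V x]
  fix a assume "a \<in> germs (subtopology X V) (Sh K 0) x"
   "Dsh K 0 (min_nbhd (subtopology X V) x) a = one_sect (Sh K 1) (min_nbhd (subtopology X V) x)"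
  then show "a \<in> \<epsilon> (min_nbhd (subtopology X V) x) ` germs (subtopology X V) F x"
   unfolding n by (rule D(7)[OF xX[OF x]])
 next
  fix x assume x: "x \<in> V"
  note n = min_nbhd_open_subtopology[OF fin V x]
  fix m :: int and a assume "0 \<le> m" "a \<in> germs (subtopology X V) (Sh K (m + 1)) x"
   "Dsh K (m + 1) (min_nbhd (subtopology X V) x) a = one_sect (Sh K (m + 2)) (min_nbhd (subtopology X V) x)"
  then show "a \<in> Dsh K m (min_nbhd (subtopology X V) x) ` germs (subtopology X V) (Sh K m) x"
   unfolding n by (rule D(8)[OF xX[OF x]])
 qed
qed

text \<open>Lets the resolved sheaf be replaced by one that agrees with it on open sets only. A
  sheaf formed on an open subspace and the restriction of one formed on the whole space can be such
  a pair.\<close>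

lemma resolution_cong:
 assumes R: "resolution X F K \<epsilon>" and F': "presheaf X F'"
  and eq: "\<And>U. openin X U \<Longrightarrow> sect F' U = sect F U" "rest F' = rest F" and fin: "finite_space X"
 shows "resolution X F' K \<epsilon>"
proof -
 have "sheaf_morphism X F' (Sh K 0) \<epsilon>"
  using R F' eq unfolding resolution_def sheaf_morphism_def by simp
 then show ?thesis
  using R F' unfolding resolution_def by (simp add: eq openin_min_nbhd[OF fin] Let_def)
qed

text \<open>Since degree -1 is trivial, the only coboundary in degree 0 is the unit. The isomorphism
  in cohomology then reads as exactness at \<open>F\<close> and at \<open>Sh I 0\<close>, and in
  positive degrees, where the source has no cohomology, as exactness of \<open>I\<close>.\<close>

lemma injective_resolution_imp_resolution:
 assumes fin: "finite_space X" and I: "injective_resolution X F I \<epsilon>"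
 shows "resolution X F I \<epsilon>"
proof -
 let ?e = "augmentation I \<epsilon>"
 have cm: "complex_morphism X (sheaf_deg0 F) I ?e"
  and coh: "\<And>x n. x \<in> topspace X \<Longrightarrow>
   cohomology_map (stalks X I x) (\<lambda>m. ?e m (min_nbhd X x)) n
     \<in> iso (cohomology (stalks X (sheaf_deg0 F) x) n) (cohomology (stalks X I x) n)"
  using I unfolding injective_resolution_def quasi_isomorphism_def Let_def by auto
 note D = complex_morphismD(1)[OF cm] and K = complex_morphismD(2)[OF cm]
 have F: "presheaf X F" using is_sheaf_complexD(2)[OF D, of 0] by (simp add: sheaf_deg0_simps)
 have e0: "?e 0 = \<epsilon>" by (simp add: augmentation_def fun_eq_iff)
 have mor: "sheaf_morphism X F (Sh I 0) \<epsilon>"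
  using complex_morphismD(3)[OF cm, of 0] by (simp add: sheaf_deg0_simps e0)
 have triv: "a = one_sect (Sh I n) U" if "n < 0" "openin X U" "a \<in> secs (Sh I n) U" for n U a
  using I that unfolding injective_resolution_def trivial_group_def by auto
 have d\<epsilon>: "Dsh I 0 U (\<epsilon> U s) = one_sect (Sh I 1) U" if "openin X U" "s \<in> secs F U" for U s
  using complex_morphismD(4)[OF cm that(1), of s 0] that(2) by (simp add: sheaf_deg0_simps e0 augmentation_def)
 have stalk: "(\<forall>s\<in>secs F U. \<epsilon> U s = one_sect (Sh I 0) U \<longrightarrow> s = one_sect F U) \<and>
   (\<forall>a\<in>secs (Sh I 0) U. Dsh I 0 U a = one_sect (Sh I 1) U \<longrightarrow> a \<in> \<epsilon> U ` secs F U) \<and>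
   (\<forall>n\<ge>0. \<forall>a\<in>secs (Sh I (n + 1)) U. Dsh I (n + 1) U a = one_sect (Sh I (n + 2)) U \<longrightarrow>
    a \<in> Dsh I n U ` secs (Sh I n) U)" if x: "x \<in> topspace X" and U: "U = min_nbhd X x" for x U
 proof -
  have o: "openin X U" using openin_min_nbhd[OF fin x] U by simp
  note gc = group_complex_sections[OF K o]
  have "quasi_iso (sections (sheaf_deg0 F) U) (sections I U) (\<lambda>m. ?e m U)"
   using quasi_iso_iff_cohomology[OF group_complex_sections[OF D o] gc chain_map_sections[OF cm o]]
    coh[OF x] U by simp
  then have inj: "\<And>n a. a \<in> cocycles (sections (sheaf_deg0 F) U) n \<Longrightarrow> ?e n U a \<in> coboundaries (sections I U) n \<Longrightarrow>
    a \<in> coboundaries (sections (sheaf_deg0 F) U) n"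
   and surj: "\<And>n b. b \<in> cocycles (sections I U) n \<Longrightarrow> \<exists>a\<in>cocycles (sections (sheaf_deg0 F) U) n.
    \<exists>c\<in>coboundaries (sections I U) n. b = ?e n U a \<otimes>\<^bsub>sect (Sh I n) U\<^esub> c"
   unfolding quasi_iso_def by auto
  have z0: "cocycles (sections (sheaf_deg0 F) U) 0 = secs F U"
   by (auto simp: cocycles_def sheaf_deg0_simps singleton_group_def)
  have b0: "coboundaries (sections (sheaf_deg0 F) U) 0 \<subseteq> {(one_sect F U)}"
   by (auto simp: coboundaries_def sheaf_deg0_simps)
  have c0: "coboundaries (sections I U) 0 = {(one_sect (Sh I 0) U)}"
  proof -
   have "Dsh I (- 1) U a = one_sect (Sh I 0) U" if "a \<in> secs (Sh I (- 1)) U" for a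
   proof -
    have "a = one_sect (Sh I (- 1)) U" using triv[OF _ o that] by simp
    then show ?thesis
     using hom_one[OF complexD(4)[OF gc, of "- 1"]] complexD(2)[OF gc] by simp
   qed
   moreover have "(one_sect (Sh I (- 1)) U) \<in> secs (Sh I (- 1)) U"
    using monoid.one_closed[OF complexD(3)[OF gc, of "- 1"]] by simp
   ultimately show ?thesis unfolding coboundaries_def by auto
  qed
  show ?thesis
  proof (intro conjI ballI impI allI)
   fix s assume "s \<in> secs F U" "\<epsilon> U s = one_sect (Sh I 0) U"
   then show "s = one_sect F U" using inj[of s 0] z0 b0 c0 e0 by auto
  next
   fix a assume "a \<in> secs (Sh I 0) U" "Dsh I 0 U a = one_sect (Sh I 1) U"
   then have "a \<in> cocycles (sections I U) 0" by (simp add: cocycles_def)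
   from surj[OF this] obtain s where s: "s \<in> secs F U"
    "a = \<epsilon> U s \<otimes>\<^bsub>sect (Sh I 0) U\<^esub> (one_sect (Sh I 0) U)"
    unfolding z0 c0 e0 by auto
   have "a = \<epsilon> U s"
    using s morphismD(2)[OF mor o s(1)] monoid.r_one[OF complexD(3)[OF gc, of 0]] by simp
   then show "a \<in> \<epsilon> U ` secs F U" using s by blast
  next
   fix n :: int and a assume n: "0 \<le> n" and "a \<in> secs (Sh I (n + 1)) U"
    "Dsh I (n + 1) U a = one_sect (Sh I (n + 2)) U"
   then have "a \<in> cocycles (sections I U) (n + 1)" by (simp add: cocycles_def add.commute[of n])
   from surj[OF this] obtain c where c: "c \<in> coboundaries (sections I U) (n + 1)"
    and a: "a = one_sect (Sh I (n + 1)) U \<otimes>\<^bsub>sect (Sh I (n + 1)) U\<^esub> c"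
    using n by (auto simp: augmentation_def)
   have "c \<in> secs (Sh I (n + 1)) U"
    using subgroup.mem_carrier[OF subgroup_coboundaries[OF gc] c] by simp
   then have "a = c" using a monoid.l_one[OF complexD(3)[OF gc, of "n + 1"]] by simp
   then show "a \<in> Dsh I n U ` secs (Sh I n) U" using c by (simp add: coboundaries_alt)
  qed
 qed
 have "\<forall>n<0. \<forall>U. openin X U \<longrightarrow> secs (Sh I n) U \<subseteq> {(one_sect (Sh I n) U)}"
  using triv by blast
 moreover have "\<forall>U. openin X U \<longrightarrow> (\<forall>s\<in>secs F U. Dsh I 0 U (\<epsilon> U s) = one_sect (Sh I 1) U)"
  using d\<epsilon> by blast
 ultimately show ?thesis
  unfolding resolution_def Let_def using K F mor stalk[OF _ refl] by (intro conjI ballI) simp_all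
qed

text \<open>\<open>u\<close> kills the kernel of \<open>d\<close> on stalks, so it descends to the
  image of \<open>d\<close>, a subfunctor of \<open>B\<close>; injectivity of \<open>I\<close>
  extends it from there to \<open>B\<close>. The bound on the stalks of \<open>B\<close> lets
  \<open>B\<close> be tested against \<open>I\<close>.\<close>

lemma extend_along:
 fixes I :: "('s, 'a::infinite) presheaf_data" and P :: "('s, 'c) presheaf_data" and B :: "('s, 'b) presheaf_data"
 assumes fin: "finite_space X" and V: "openin X V" and I: "injective_sheaf X I"
  and P: "presheaf (subtopology X V) P" and B: "presheaf (subtopology X V) B"
  and d: "sheaf_morphism (subtopology X V) P B d" and u: "sheaf_morphism (subtopology X V) P I u"
  and ker: "\<And>x r. x \<in> V \<Longrightarrow> r \<in> germs X P x \<Longrightarrow>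
   d (min_nbhd X x) r = one_sect B (min_nbhd X x) \<Longrightarrow> u (min_nbhd X x) r = one_sect I (min_nbhd X x)"
  and small: "\<And>x. x \<in> V \<Longrightarrow> germs X B x \<lesssim> (UNIV :: 'a set)"
 obtains h where "sheaf_morphism (subtopology X V) B I h"
  and "\<And>U r. openin (subtopology X V) U \<Longrightarrow> r \<in> secs P U \<Longrightarrow> h U (d U r) = u U r"
proof -
 let ?V = "subtopology X V"
 have finV: "finite_space ?V" by (rule finite_space_subtopology[OF fin])
 have top: "topspace ?V = V" using openin_subset[OF V] by auto
 have nV: "min_nbhd ?V x = min_nbhd X x" if "x \<in> V" for x
  using min_nbhd_open_subtopology[OF fin V that] .
 have sI: "sheaf ?V I" using sheaf_open_subtopology[OF V conjunct1[OF I[unfolded injective_sheaf_def]]] .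
 note PI = sheaf_imp_presheaf[OF sI]
 let ?n = "min_nbhd X"
 have o: "openin ?V (?n x)" if "x \<in> V" for x
  using openin_min_nbhd[OF finV, of x, unfolded top] that nV by simp
 have yV: "y \<in> V" "?n y \<subseteq> ?n x" if "x \<in> V" "y \<in> ?n x" for x y
 proof -
  have x: "x \<in> topspace X" using that openin_subset[OF V] by auto
  show "?n y \<subseteq> ?n x" using min_nbhd_mono[OF fin x that(2)] .
  show "y \<in> V" using min_nbhd_subset[OF V that(1)] that(2) by auto
 qed
 have gd: "group_hom (sect P U) (sect B U) (d U)" if "openin ?V U" for U
  using presheafD(2)[OF P that] presheafD(2)[OF B that] morphismD(1)[OF d that]
  by (simp add: group_hom_def group_hom_axioms_def)
 have gu: "group_hom (sect P U) (sect I U) (u U)" if "openin ?V U" for U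
  using presheafD(2)[OF P that] presheafD(2)[OF PI that] morphismD(1)[OF u that]
  by (simp add: group_hom_def group_hom_axioms_def)
 \<comment> \<open>An arbitrary preimage under \<open>d\<close> is chosen; two preimages differ by
   an element of the kernel, on which \<open>u\<close> is trivial.\<close>
 define g where "g x b = u (?n x) (SOME r. r \<in> secs P (?n x) \<and> d (?n x) r = b)" for x b
 have g: "g x (d (?n x) r) = u (?n x) r" if x: "x \<in> V" and r: "r \<in> secs P (?n x)" for x r
 proof -
  define r' where "r' = (SOME r'. r' \<in> secs P (?n x) \<and> d (?n x) r' = d (?n x) r)"
  have r': "r' \<in> secs P (?n x)" "d (?n x) r' = d (?n x) r"
   using someI[of "\<lambda>r'. r' \<in> secs P (?n x) \<and> d (?n x) r' = d (?n x) r" r] r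
   unfolding r'_def by auto
  interpret d: group_hom "sect P (?n x)" "sect B (?n x)" "d (?n x)" using gd[OF o[OF x]] .
  interpret u: group_hom "sect P (?n x)" "sect I (?n x)" "u (?n x)" using gu[OF o[OF x]] .
  let ?q = "r \<otimes>\<^bsub>sect P (?n x)\<^esub> inv\<^bsub>sect P (?n x)\<^esub> r'"
  have "d (?n x) ?q = one_sect B (?n x)" using r r' by simp
  then have "u (?n x) ?q = one_sect I (?n x)" using ker[OF x, of ?q] r r' by simp
  then have "u (?n x) r \<otimes>\<^bsub>sect I (?n x)\<^esub> inv\<^bsub>sect I (?n x)\<^esub> u (?n x) r' = one_sect I (?n x)"
   using r r' by simp
  then have "u (?n x) r = u (?n x) r'"
   using r r' u.H.inv_equality[of "u (?n x) r" "inv\<^bsub>sect I (?n x)\<^esub> u (?n x) r'"] by simp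
  then show ?thesis by (simp add: g_def r'_def)
 qed
 let ?A = "\<lambda>x. d (?n x) ` secs P (?n x)"
 obtain h where h: "stalk_map ?V B I h" and hg: "\<And>x a. x \<in> V \<Longrightarrow> a \<in> ?A x \<Longrightarrow> h x a = g x a"
 proof (rule injective_extension[OF fin V I presheaf_imp_stalk_functor[OF finV B] small, of ?A g])
  fix x assume x: "x \<in> V"
  interpret d: group_hom "sect P (?n x)" "sect B (?n x)" "d (?n x)" using gd[OF o[OF x]] .
  interpret u: group_hom "sect P (?n x)" "sect I (?n x)" "u (?n x)" using gu[OF o[OF x]] .
  show "subgroup (?A x) (sect B (?n x))" by (rule d.img_is_subgroup)
  show "g x \<in> hom (sect B (?n x)\<lparr>carrier := ?A x\<rparr>) (sect I (?n x))"
  proof (rule homI)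
   fix a assume "a \<in> carrier (sect B (?n x)\<lparr>carrier := ?A x\<rparr>)"
   then obtain r where "r \<in> secs P (?n x)" "a = d (?n x) r" by auto
   then show "g x a \<in> secs I (?n x)" using g[OF x] by simp
  next
   fix a b assume "a \<in> carrier (sect B (?n x)\<lparr>carrier := ?A x\<rparr>)" "b \<in> carrier (sect B (?n x)\<lparr>carrier := ?A x\<rparr>)"
   then obtain r s where r: "r \<in> secs P (?n x)" "a = d (?n x) r"
    and s: "s \<in> secs P (?n x)" "b = d (?n x) s" by auto
   have "g x (d (?n x) (r \<otimes>\<^bsub>sect P (?n x)\<^esub> s)) = u (?n x) (r \<otimes>\<^bsub>sect P (?n x)\<^esub> s)"
    using g[OF x] r s by (meson d.G.m_closed)
   then show "g x (a \<otimes>\<^bsub>sect B (?n x)\<lparr>carrier := ?A x\<rparr>\<^esub> b) = g x a \<otimes>\<^bsub>sect I (?n x)\<^esub> g x b"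
    using g[OF x] r s by simp
  qed
  fix y a assume y: "y \<in> ?n x" and "a \<in> ?A x"
  then obtain r where r: "r \<in> secs P (?n x)" "a = d (?n x) r" by auto
  note y' = yV[OF x y]
  have rr: "rest P (?n x) (?n y) r \<in> secs P (?n y)"
   using presheafD(5)[OF P o[OF x] o[OF y'(1)] y'(2) r(1)] .
  have a: "rest B (?n x) (?n y) a = d (?n y) (rest P (?n x) (?n y) r)"
   using morphismD(3)[OF d o[OF x] o[OF y'(1)] y'(2) r(1)] r(2) by simp
  then show "rest B (?n x) (?n y) a \<in> ?A y" using rr by blast
  show "g y (rest B (?n x) (?n y) a) = rest I (?n x) (?n y) (g x a)"
   using morphismD(3)[OF u o[OF x] o[OF y'(1)] y'(2) r(1)] g[OF y'(1) rr] g[OF x r(1)]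
   unfolding a by (simp add: r(2))
 next
  fix h
  assume 1: "stalk_map ?V B I h" and 2: "\<And>x a. x \<in> V \<Longrightarrow> a \<in> ?A x \<Longrightarrow> h x a = g x a"
  show thesis by (rule that[OF 1 2])
 qed
 obtain \<phi> where \<phi>: "sheaf_morphism ?V B I \<phi>"
  and \<phi>h: "\<And>x s. x \<in> topspace ?V \<Longrightarrow> s \<in> germs ?V B x \<Longrightarrow> \<phi> (min_nbhd ?V x) s = h x s"
  by (rule stalk_map_extends[OF finV B sI h]) blast
 show thesis
 proof (rule that[of \<phi>])
  show "sheaf_morphism ?V B I \<phi>" by (rule \<phi>)
  fix U r assume U: "openin ?V U" and r: "r \<in> secs P U"
  have dr: "d U r \<in> secs B U" using morphismD(2)[OF d U r] .
  show "\<phi> U (d U r) = u U r"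
  proof (rule sheaf_eqI[OF finV sI U morphismD(2)[OF \<phi> U dr] morphismD(2)[OF u U r]])
   fix x assume x: "x \<in> U"
   then have xV: "x \<in> V" using openin_subset[OF U] top by auto
   have s: "?n x \<subseteq> U" using min_nbhd_subset[OF U x] nV[OF xV] by simp
   have rn: "rest P U (?n x) r \<in> secs P (?n x)" using presheafD(5)[OF P U o[OF xV] s r] .
   have "rest I U (?n x) (\<phi> U (d U r)) = \<phi> (?n x) (d (?n x) (rest P U (?n x) r))"
    using morphismD(3)[OF \<phi> U o[OF xV] s dr] morphismD(3)[OF d U o[OF xV] s r] by simp
   also have "\<dots> = h x (d (?n x) (rest P U (?n x) r))"
    using \<phi>h[unfolded top, of x] xV nV morphismD(2)[OF d o[OF xV] rn] by simp
   also have "\<dots> = u (?n x) (rest P U (?n x) r)" using hg[OF xV imageI[OF rn]] g[OF xV rn] by simp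
   also have "\<dots> = rest I U (?n x) (u U r)" using morphismD(3)[OF u U o[OF xV] s r] .
   finally show "rest I U (min_nbhd ?V x) (\<phi> U (d U r)) = rest I U (min_nbhd ?V x) (u U r)"
    using nV[OF xV] by simp
  qed
 qed
qed

text \<open>The usual lifting into an injective complex, degree by degree from 0. Exactness of
  \<open>R\<close> on stalks lets each step pass: a cocycle of \<open>R\<close> comes from the
  preceding degree, so the next differential of \<open>I\<close> vanishes on its image.\<close>

lemma resolution_extends:
 fixes I :: "('s, 'a::infinite) sheaf_complex" and R :: "('s, 'b) sheaf_complex"
 assumes fin: "finite_space X" and V: "openin X V"
  and I: "is_sheaf_complex X I" and inj: "\<And>n. injective_sheaf X (Sh I n)"
  and R: "resolution (subtopology X V) F R \<iota>"
  and g: "sheaf_morphism (subtopology X V) F (Sh I 0) g"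
  and dg: "\<And>U s. openin (subtopology X V) U \<Longrightarrow> s \<in> secs F U \<Longrightarrow> Dsh I 0 U (g U s) = one_sect (Sh I 1) U"
  and small: "\<And>n x. x \<in> V \<Longrightarrow> germs X (Sh R n) x \<lesssim> (UNIV :: 'a set)"
 obtains \<theta> where "complex_morphism (subtopology X V) R I \<theta>"
  and "\<And>U s. openin (subtopology X V) U \<Longrightarrow> s \<in> secs F U \<Longrightarrow> \<theta> 0 U (\<iota> U s) = g U s"
proof -
 let ?V = "subtopology X V"
 let ?n = "min_nbhd X"
 have finV: "finite_space ?V" by (rule finite_space_subtopology[OF fin])
 have top: "topspace ?V = V" using openin_subset[OF V] by auto
 have nV: "min_nbhd ?V x = ?n x" if "x \<in> V" for x
  using min_nbhd_open_subtopology[OF fin V that] .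
 have o: "openin ?V (?n x)" if "x \<in> V" for x
  using openin_min_nbhd[OF finV, of x, unfolded top] that nV by simp
 have IV: "is_sheaf_complex ?V I" by (rule is_sheaf_complex_open_subtopology[OF V I])
 note RC = resolutionD(1)[OF R] and PF = resolutionD(2)[OF R]
 note PR = is_sheaf_complexD(2)[OF RC] and PI = is_sheaf_complexD(2)[OF IV]
 note MR = is_sheaf_complexD(3)[OF RC] and MI = is_sheaf_complexD(3)[OF IV]
 define N where "N n x = ?n x" for n :: nat and x
 \<comment> \<open>The invariant records what the next extension requires: \<open>Dsh I\<close>
   after \<open>\<phi>\<close> kills the kernel of \<open>Dsh R\<close> on stalks. Degree 0 also
   remembers the compatibility with the augmentations.\<close>
 define Pr where "Pr n \<phi> \<longleftrightarrow> sheaf_morphism ?V (Sh R (int n)) (Sh I (int n)) \<phi> \<and>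
   (\<forall>x\<in>V. \<forall>r\<in>secs (Sh R (int n)) (?n x). Dsh R (int n) (?n x) r = one_sect (Sh R (int n + 1)) (?n x) \<longrightarrow>
    Dsh I (int n) (?n x) (\<phi> (?n x) r) = one_sect (Sh I (int n + 1)) (?n x)) \<and>
   (n = 0 \<longrightarrow> (\<forall>U. openin ?V U \<longrightarrow> (\<forall>s\<in>secs F U. \<phi> U (\<iota> U s) = g U s)))"
  for n :: nat and \<phi> :: "'s set \<Rightarrow> 'b \<Rightarrow> 'a"
 define Q where "Q n \<phi> \<psi> \<longleftrightarrow> (\<forall>U. openin ?V U \<longrightarrow> (\<forall>r\<in>secs (Sh R (int n)) U.
   \<psi> U (Dsh R (int n) U r) = Dsh I (int n) U (\<phi> U r)))"
  for n :: nat and \<phi> \<psi> :: "'s set \<Rightarrow> 'b \<Rightarrow> 'a"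
 have base: "\<exists>\<phi>. Pr 0 \<phi>"
 proof -
  have ker: "g (?n x) r = one_sect (Sh I 0) (?n x)"
   if x: "x \<in> V" and r: "r \<in> secs F (?n x)" and e: "\<iota> (?n x) r = one_sect (Sh R 0) (?n x)" for x r
  proof -
   have "r = one_sect F (?n x)"
    using resolutionD(6)[OF R, unfolded top, of x r] x r e top nV[OF x] by simp
   then show ?thesis
    using hom_one[OF morphismD(1)[OF g o[OF x]]] presheafD(2)[OF PF o[OF x]] presheafD(2)[OF PI o[OF x]]
    by simp
  qed
  obtain h where h: "sheaf_morphism ?V (Sh R 0) (Sh I 0) h"
   and hg: "\<And>U r. openin ?V U \<Longrightarrow> r \<in> secs F U \<Longrightarrow> h U (\<iota> U r) = g U r"
  proof (rule extend_along[OF fin V inj PF PR resolutionD(4)[OF R] g ker small])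
   fix h
   assume 1: "sheaf_morphism ?V (Sh R 0) (Sh I 0) h"
    and 2: "\<And>U r. openin ?V U \<Longrightarrow> r \<in> secs F U \<Longrightarrow> h U (\<iota> U r) = g U r"
   show thesis by (rule that[OF 1 2])
  qed
  have "Dsh I 0 (?n x) (h (?n x) r) = one_sect (Sh I 1) (?n x)"
   if x: "x \<in> V" and r: "r \<in> secs (Sh R 0) (?n x)" and dr: "Dsh R 0 (?n x) r = one_sect (Sh R 1) (?n x)" for x r
  proof -
   have "r \<in> \<iota> (?n x) ` secs F (?n x)"
    using resolutionD(7)[OF R, unfolded top, of x r] x r dr top nV[OF x] by simp
   then show ?thesis using hg[OF o[OF x]] dg[OF o[OF x]] by auto
  qed
  then have "Pr 0 h" using h hg by (simp add: Pr_def)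
  then show ?thesis by blast
 qed
 have step: "\<exists>\<psi>. Pr (Suc n) \<psi> \<and> Q n \<phi> \<psi>" if \<phi>: "Pr n \<phi>" for n \<phi>
 proof -
  have m\<phi>: "sheaf_morphism ?V (Sh R (int n)) (Sh I (int n)) \<phi>"
   and ker: "\<And>x r. x \<in> V \<Longrightarrow> r \<in> secs (Sh R (int n)) (?n x) \<Longrightarrow>
    Dsh R (int n) (?n x) r = one_sect (Sh R (int n + 1)) (?n x) \<Longrightarrow>
    Dsh I (int n) (?n x) (\<phi> (?n x) r) = one_sect (Sh I (int n + 1)) (?n x)"
   using \<phi> unfolding Pr_def by blast+
  have u: "sheaf_morphism ?V (Sh R (int n)) (Sh I (int n + 1)) (\<lambda>U r. Dsh I (int n) U (\<phi> U r))"
   unfolding sheaf_morphism_def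
  proof (intro conjI allI impI ballI)
   fix U assume U: "openin ?V U"
   show "(\<lambda>r. Dsh I (int n) U (\<phi> U r)) \<in> hom (sect (Sh R (int n)) U) (sect (Sh I (int n + 1)) U)"
    using hom_compose[OF morphismD(1)[OF m\<phi> U] morphismD(1)[OF MI U]] by (simp add: comp_def)
  next
   fix U W s assume UW: "openin ?V U \<and> openin ?V W \<and> W \<subseteq> U" and s: "s \<in> secs (Sh R (int n)) U"
   then have U: "openin ?V U" and W: "openin ?V W" "W \<subseteq> U" by auto
   show "Dsh I (int n) W (\<phi> W (rest (Sh R (int n)) U W s)) = rest (Sh I (int n + 1)) U W (Dsh I (int n) U (\<phi> U s))"
    using morphismD(3)[OF m\<phi> U W s] morphismD(3)[OF MI U W morphismD(2)[OF m\<phi> U s]] by simp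
  qed
  obtain h where h: "sheaf_morphism ?V (Sh R (int n + 1)) (Sh I (int n + 1)) h"
   and hd: "\<And>U r. openin ?V U \<Longrightarrow> r \<in> secs (Sh R (int n)) U \<Longrightarrow>
    h U (Dsh R (int n) U r) = Dsh I (int n) U (\<phi> U r)"
  proof (rule extend_along[OF fin V inj PR PR MR u ker small])
   fix h
   assume 1: "sheaf_morphism ?V (Sh R (int n + 1)) (Sh I (int n + 1)) h"
    and 2: "\<And>U r. openin ?V U \<Longrightarrow> r \<in> secs (Sh R (int n)) U \<Longrightarrow>
     h U (Dsh R (int n) U r) = Dsh I (int n) U (\<phi> U r)"
   show thesis by (rule that[OF 1 2])
  qed
  have K: "Dsh I (int n + 1) (?n x) (h (?n x) r) = one_sect (Sh I (int n + 2)) (?n x)"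
   if x: "x \<in> V" and r: "r \<in> secs (Sh R (int n + 1)) (?n x)"
    and dr: "Dsh R (int n + 1) (?n x) r = one_sect (Sh R (int n + 2)) (?n x)" for x r
  proof -
   have "r \<in> Dsh R (int n) (?n x) ` secs (Sh R (int n)) (?n x)"
    using resolutionD(8)[OF R, unfolded top, of x "int n" r] x r dr top nV[OF x] by simp
   then obtain q where q: "q \<in> secs (Sh R (int n)) (?n x)" "r = Dsh R (int n) (?n x) q" by auto
   show ?thesis
    unfolding q(2) hd[OF o[OF x] q(1)]
    using is_sheaf_complexD(4)[OF IV o[OF x] morphismD(2)[OF m\<phi> o[OF x] q(1)]] .
  qed
  have e: "int (Suc n) = int n + 1" "int n + 1 + 1 = int n + 2" by simp_all
  have "Pr (Suc n) h"
   unfolding Pr_def e by (intro conjI ballI impI, rule h, erule (2) K, simp)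
  moreover have "Q n \<phi> h" using hd by (simp add: Q_def)
  ultimately show ?thesis by blast
 qed
 obtain \<phi> where \<phi>: "\<And>n. Pr n (\<phi> n)" and Q: "\<And>n. Q n (\<phi> n) (\<phi> (Suc n))"
  using dependent_nat_choice[of Pr Q, OF base step] by auto
 \<comment> \<open>In negative degrees \<open>R\<close> is trivial, and \<open>\<theta>\<close> is
   the trivial map.\<close>
 define \<theta> where "\<theta> n = (if 0 \<le> n then \<phi> (nat n) else (\<lambda>U s. (one_sect (Sh I n) U)))" for n :: int
 have mor: "sheaf_morphism ?V (Sh R n) (Sh I n) (\<theta> n)" for n
 proof (cases "0 \<le> n")
  case True
  then show ?thesis using \<phi>[of "nat n"] by (simp add: \<theta>_def Pr_def)
 next
  case False
  then show ?thesis using sheaf_morphism_one[OF PR PI, of n n] by (simp add: \<theta>_def)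
 qed
 have chain: "\<theta> (n + 1) U (Dsh R n U s) = Dsh I n U (\<theta> n U s)"
  if U: "openin ?V U" and s: "s \<in> secs (Sh R n) U" for n U s
 proof (cases "0 \<le> n")
  case True
  then have "nat (n + 1) = Suc (nat n)" by simp
  then show ?thesis using Q[of "nat n"] True U s by (simp add: \<theta>_def Q_def)
 next
  case False
  have s1: "s = one_sect (Sh R n) U" using resolutionD(3)[OF R _ U s] False by simp
  have g: "group (sect (Sh R m) U)" "group (sect (Sh I m) U)" for m
   using presheafD(2)[OF PR U] presheafD(2)[OF PI U] .
  have "Dsh R n U s = one_sect (Sh R (n + 1)) U"
   unfolding s1 using hom_one[OF morphismD(1)[OF MR U]] g by simp
  then have "\<theta> (n + 1) U (Dsh R n U s) = one_sect (Sh I (n + 1)) U"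
   using hom_one[OF morphismD(1)[OF mor U]] g by simp
  moreover have "\<theta> n U s = one_sect (Sh I n) U" using False by (simp add: \<theta>_def)
  ultimately show ?thesis using hom_one[OF morphismD(1)[OF MI U]] g by simp
 qed
 show thesis
 proof (rule that[of \<theta>])
  show "complex_morphism ?V R I \<theta>"
   unfolding complex_morphism_def using RC IV mor chain by simp
  show "\<theta> 0 U (\<iota> U s) = g U s" if "openin ?V U" "s \<in> secs F U" for U s
   using \<phi>[of 0] that by (simp add: Pr_def \<theta>_def)
 qed
qed

text \<open>Both complexes have the stalk of \<open>F\<close> in degree 0 as their only cohomology,
  and \<open>\<theta>\<close> is compatible with the two identifications; in other degrees every
  cocycle is a coboundary on both sides.\<close>

lemma resolution_stalk_quasi_iso:
 assumes fin: "finite_space X" and R: "resolution X F R \<iota>" and I: "resolution X F I \<epsilon>"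
  and \<theta>: "complex_morphism X R I \<theta>"
  and \<theta>\<iota>: "\<And>U s. openin X U \<Longrightarrow> s \<in> secs F U \<Longrightarrow> \<theta> 0 U (\<iota> U s) = \<epsilon> U s"
  and x: "x \<in> topspace X"
 shows "quasi_iso (stalks X R x) (stalks X I x) (\<lambda>n. \<theta> n (min_nbhd X x))"
proof -
 define U where "U = min_nbhd X x"
 have o: "openin X U" using openin_min_nbhd[OF fin x] by (simp add: U_def)
 note gR = group_complex_sections[OF resolutionD(1)[OF R] o] and gI = group_complex_sections[OF resolutionD(1)[OF I] o]
 have exact: "a \<in> coboundaries (sections K U) n"
  if K: "resolution X F' K e" and a: "a \<in> cocycles (sections K U) n" and n: "n \<noteq> 0"
  for F' :: "('a, 'e) presheaf_data" and K :: "('a, 'f) sheaf_complex" and e a n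
 proof -
  note gK = group_complex_sections[OF resolutionD(1)[OF K] o]
  have ac: "a \<in> secs (Sh K n) U" "Dsh K n U a = one_sect (Sh K (n + 1)) U"
   using a by (auto simp: cocycles_def)
  show ?thesis
  proof (cases "n < 0")
   case True
   then have "a = one_ob (sections K U) n" using resolutionD(3)[OF K True o ac(1)] by simp
   then show ?thesis using subgroup.one_closed[OF subgroup_coboundaries[OF gK]] by metis
  next
   case False
   have "a \<in> Dsh K (n - 1) U ` secs (Sh K (n - 1)) U"
    using resolutionD(8)[OF K x, of "n - 1" a] False n ac unfolding U_def by (simp add: add.commute)
   then show ?thesis by (simp add: coboundaries_def)
  qed
 qed
 show ?thesis
  unfolding quasi_iso_def U_def[symmetric] sections_simps
 proof (intro allI conjI ballI impI)
  fix n a assume a: "a \<in> cocycles (sections R U) n" and fa: "\<theta> n U a \<in> coboundaries (sections I U) n"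
  show "a \<in> coboundaries (sections R U) n"
  proof (cases "n = 0")
   case True
   have ac: "a \<in> secs (Sh R 0) U" "Dsh R 0 U a = one_sect (Sh R 1) U"
    using a True by (auto simp: cocycles_def)
   then obtain s where s: "s \<in> secs F U" "a = \<iota> U s"
    using resolutionD(7)[OF R x, of a] unfolding U_def by auto
   obtain b where b: "b \<in> secs (Sh I (- 1)) U" "\<theta> 0 U a = Dsh I (- 1) U b"
    using fa True by (auto simp: coboundaries_def)
   have "b = one_sect (Sh I (- 1)) U" using resolutionD(3)[OF I _ o b(1)] by simp
   then have "\<theta> 0 U a = one_sect (Sh I 0) U"
    using b(2) hom_one[OF complexD(4)[OF gI, of "- 1"]] complexD(2)[OF gI] by simp
   then have "\<epsilon> U s = one_sect (Sh I 0) U" using \<theta>\<iota>[OF o s(1)] s(2) by simp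
   then have "s = one_sect F U" using resolutionD(6)[OF I x, of s] s(1) unfolding U_def by simp
   then have "a = one_ob (sections R U) 0"
    using s(2) hom_one[OF morphismD(1)[OF resolutionD(4)[OF R] o]]
     presheafD(2)[OF resolutionD(2)[OF R] o] complexD(2)[OF gR, of 0] by simp
   then show ?thesis using subgroup.one_closed[OF subgroup_coboundaries[OF gR]] True by metis
  qed (rule exact[OF R a])
 next
  fix n b assume b: "b \<in> cocycles (sections I U) n"
  show "\<exists>a\<in>cocycles (sections R U) n. \<exists>c\<in>coboundaries (sections I U) n. b = \<theta> n U a \<otimes>\<^bsub>sect (Sh I n) U\<^esub> c"
  proof (cases "n = 0")
   case True
   have "b \<in> \<epsilon> U ` secs F U"
    using b True resolutionD(7)[OF I x, of b] unfolding U_def by (simp add: cocycles_def)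
   then obtain s where s: "s \<in> secs F U" "b = \<epsilon> U s" by auto
   have "\<iota> U s \<in> cocycles (sections R U) n"
    using True resolutionD(5)[OF R o s(1)] morphismD(2)[OF resolutionD(4)[OF R] o s(1)]
    by (simp add: cocycles_def)
   moreover have "(one_ob (sections I U) n) \<in> coboundaries (sections I U) n"
    using subgroup.one_closed[OF subgroup_coboundaries[OF gI]] .
   moreover have "b = \<theta> n U (\<iota> U s) \<otimes>\<^bsub>sect (Sh I n) U\<^esub> (one_ob (sections I U) n)"
    using True s \<theta>\<iota>[OF o s(1)] morphismD(2)[OF resolutionD(4)[OF I] o s(1)]
     monoid.r_one[OF complexD(3)[OF gI, of 0]] by simp
   ultimately show ?thesis by blast
  next
   case False
   have "b \<in> coboundaries (sections I U) n" by (rule exact[OF I b False])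
   moreover have "(one_ob (sections R U) n) \<in> cocycles (sections R U) n"
    using subgroup.one_closed[OF subgroup_cocycles[OF gR]] .
   moreover have "b = \<theta> n U (one_ob (sections R U) n) \<otimes>\<^bsub>sect (Sh I n) U\<^esub> b"
    using b hom_one[OF chain_mapD(1)[OF chain_map_sections[OF \<theta> o], of n]] complexD(2)[OF gR, of n]
     complexD(2)[OF gI, of n] monoid.l_one[OF complexD(3)[OF gI, of n]]
    by (simp add: cocycles_def)
   ultimately show ?thesis by blast
  qed
 qed
qed

text \<open>Injectivity of \<open>I\<close> provides \<open>\<theta>\<close>; flasqueness of both
  sides upgrades the quasi-isomorphism on stalks to one on sections over every open set. Hence
  \<open>R\<close> can stand in for \<open>I\<close> when sections are computed.\<close>

lemma resolution_comparison:
 fixes I :: "('s, 'a::infinite) sheaf_complex" and R :: "('s, 'b) sheaf_complex"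
 assumes fin: "finite_space X" and V: "openin X V"
  and inj: "\<And>n. injective_sheaf X (Sh I n)" and IC: "is_sheaf_complex X I"
  and I: "resolution (subtopology X V) F I \<epsilon>"
  and R: "resolution (subtopology X V) F R \<iota>" and fl: "\<And>n. flasque (subtopology X V) (Sh R n)"
  and small: "\<And>n x. x \<in> V \<Longrightarrow> germs X (Sh R n) x \<lesssim> (UNIV :: 'a set)"
 obtains \<theta> where "complex_morphism (subtopology X V) R I \<theta>"
  and "\<And>U s. openin (subtopology X V) U \<Longrightarrow> s \<in> secs F U \<Longrightarrow> \<theta> 0 U (\<iota> U s) = \<epsilon> U s"
  and "\<And>W. openin (subtopology X V) W \<Longrightarrow> quasi_iso (sections R W) (sections I W) (\<lambda>n. \<theta> n W)"
proof -
 have finV: "finite_space (subtopology X V)" by (rule finite_space_subtopology[OF fin])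
 obtain \<theta> where \<theta>: "complex_morphism (subtopology X V) R I \<theta>"
  and \<theta>\<iota>: "\<And>U s. openin (subtopology X V) U \<Longrightarrow> s \<in> secs F U \<Longrightarrow> \<theta> 0 U (\<iota> U s) = \<epsilon> U s"
 proof (rule resolution_extends[OF fin V IC inj R resolutionD(4)[OF I] resolutionD(5)[OF I] small])
  fix \<theta>
  assume 1: "complex_morphism (subtopology X V) R I \<theta>"
   and 2: "\<And>U s. openin (subtopology X V) U \<Longrightarrow> s \<in> secs F U \<Longrightarrow> \<theta> 0 U (\<iota> U s) = \<epsilon> U s"
  show thesis by (rule that[OF 1 2])
 qed
 have "quasi_iso (sections R W) (sections I W) (\<lambda>n. \<theta> n W)" if W: "openin (subtopology X V) W" for W
  by (rule flasque_quasi_iso[OF finV \<theta> fl flasque_open_subtopology[OF V injective_imp_flasque[OF fin inj]]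
     resolution_bounded_below[OF R] resolution_bounded_below[OF I]
     resolution_stalk_quasi_iso[OF finV R I \<theta> \<theta>\<iota>] W])
 with \<theta> \<theta>\<iota> show thesis by (rule that)
qed

subsection \<open>Sheaves of integer-valued functions\<close>

lemma const_sheaf_simps:
 "s \<otimes>\<^bsub>sect (const_sheaf X S) U\<^esub> t = (\<lambda>x. s x + t x)"
 "(one_sect (const_sheaf X S) U) = (\<lambda>x. 0)"
 "rest (const_sheaf X S) U V s = (\<lambda>x. if x \<in> V then s x else 0)"
 by (simp_all add: const_sheaf_def)

text \<open>One condition merges two. For \<open>x\<close> in \<open>S\<close> it is local constancy
  on \<open>S\<close>; for \<open>x\<close> outside \<open>S\<close>, where \<open>s x = 0\<close>,
  it is closedness of the support, since \<open>s\<close> then has to vanish on the smallest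
  neighbourhood of \<open>x\<close>.\<close>

lemma mem_const_sheaf:
 assumes fin: "finite_space X" and U: "openin X U"
 shows "s \<in> secs (const_sheaf X S) U \<longleftrightarrow>
  (\<forall>x. x \<notin> U \<inter> S \<longrightarrow> s x = 0) \<and> (\<forall>x\<in>U. \<forall>y\<in>min_nbhd X x \<inter> S. s y = s x)" (is "_ \<longleftrightarrow> ?z \<and> ?c")
proof -
 have UX: "U \<subseteq> topspace X" using openin_subset[OF U] .
 have nU: "y \<in> U" if "x \<in> U" "y \<in> min_nbhd X x" for x y using min_nbhd_subset[OF U that(1)] that(2) by auto
 have top: "topspace (subtopology X (U \<inter> S)) = U \<inter> S" using UX by auto
 have cont: "continuous_map (subtopology X (U \<inter> S)) (discrete_topology UNIV) s \<longleftrightarrow>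
   (\<forall>x\<in>U \<inter> S. \<forall>y\<in>min_nbhd X x \<inter> S. s y = s x)" (is "?l \<longleftrightarrow> ?r")
 proof
  assume l: ?l
  show ?r
  proof (intro ballI)
   fix x y assume x: "x \<in> U \<inter> S" and y: "y \<in> min_nbhd X x \<inter> S"
   have "openin (subtopology X (U \<inter> S)) {z \<in> U \<inter> S. s z \<in> {s x}}"
    using openin_continuous_map_preimage[OF l, of "{s x}"] unfolding top by simp
   then obtain T where T: "openin X T" "{z \<in> U \<inter> S. s z \<in> {s x}} = T \<inter> (U \<inter> S)"
    unfolding openin_subtopology by blast
   have "x \<in> T" using x T(2) by blast
   then have "y \<in> T" using min_nbhd_subset[OF T(1)] y by blast
   moreover have "y \<in> U \<inter> S" using nU x y by blast
   ultimately show "s y = s x" using T(2) by blast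
  qed
 next
  assume r: ?r
  have "openin (subtopology X (U \<inter> S)) {x \<in> U \<inter> S. s x \<in> W}" for W
  proof -
   let ?T = "\<Union>(min_nbhd X ` {x \<in> U \<inter> S. s x \<in> W})"
   have "openin X ?T" using openin_min_nbhd[OF fin] UX by blast
   moreover have "{x \<in> U \<inter> S. s x \<in> W} = ?T \<inter> (U \<inter> S)"
   proof (intro equalityI subsetI)
    fix y assume "y \<in> {x \<in> U \<inter> S. s x \<in> W}"
    then show "y \<in> ?T \<inter> (U \<inter> S)" using min_nbhd_refl[of y X] by auto
   next
    fix y assume "y \<in> ?T \<inter> (U \<inter> S)"
    then obtain x where "x \<in> U \<inter> S" "s x \<in> W" "y \<in> min_nbhd X x" "y \<in> U \<inter> S" by blast
    moreover from this have "s y = s x" using r by simp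
    ultimately show "y \<in> {x \<in> U \<inter> S. s x \<in> W}" by simp
   qed
   ultimately show ?thesis unfolding openin_subtopology by blast
  qed
  then show ?l unfolding continuous_map_def top by auto
 qed
 have closed: "closedin (subtopology X U) {x \<in> U. s x \<noteq> 0} \<longleftrightarrow>
   (\<forall>x\<in>U. s x = 0 \<longrightarrow> (\<forall>y\<in>min_nbhd X x. s y = 0))"
 proof -
  have t: "topspace (subtopology X U) = U" using UX by auto
  have "U - {x \<in> U. s x \<noteq> 0} = {x \<in> U. s x = 0}" by auto
  then have "closedin (subtopology X U) {x \<in> U. s x \<noteq> 0} \<longleftrightarrow> openin X {x \<in> U. s x = 0}"
   unfolding closedin_def t openin_open_subtopology[OF U] by auto
  also have "\<dots> \<longleftrightarrow> (\<forall>x\<in>U. s x = 0 \<longrightarrow> (\<forall>y\<in>min_nbhd X x. s y = 0))"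
   unfolding openin_iff_min_nbhd[OF fin] using UX nU by blast
  finally show ?thesis .
 qed
 have "s \<in> secs (const_sheaf X S) U \<longleftrightarrow>
   ?z \<and> (\<forall>x\<in>U \<inter> S. \<forall>y\<in>min_nbhd X x \<inter> S. s y = s x) \<and> (\<forall>x\<in>U. s x = 0 \<longrightarrow> (\<forall>y\<in>min_nbhd X x. s y = 0))"
  using cont closed by (simp add: const_sheaf_def)
 also have "\<dots> \<longleftrightarrow> ?z \<and> ?c"
 proof (rule iffI; elim conjE; intro conjI)
  assume z: ?z and a: "\<forall>x\<in>U \<inter> S. \<forall>y\<in>min_nbhd X x \<inter> S. s y = s x"
   and b: "\<forall>x\<in>U. s x = 0 \<longrightarrow> (\<forall>y\<in>min_nbhd X x. s y = 0)"
  show ?c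
  proof (intro ballI)
   fix x y assume x: "x \<in> U" and y: "y \<in> min_nbhd X x \<inter> S"
   show "s y = s x"
   proof (cases "x \<in> S")
    case True
    then show ?thesis using a x y by blast
   next
    case False
    then have "s x = 0" using z by blast
    then show ?thesis using b x y by simp
   qed
  qed
 next
  assume z: ?z and c: ?c
  show "\<forall>x\<in>U \<inter> S. \<forall>y\<in>min_nbhd X x \<inter> S. s y = s x" using c by blast
  show "\<forall>x\<in>U. s x = 0 \<longrightarrow> (\<forall>y\<in>min_nbhd X x. s y = 0)"
  proof (intro ballI impI)
   fix x y assume "x \<in> U" "s x = 0" "y \<in> min_nbhd X x"
   then show "s y = 0" using c z by (cases "y \<in> S") auto
  qed
 qed
 finally show ?thesis .
qed

lemma comm_group_pointwise_int:
 assumes G: "mult G = (\<lambda>s t x. s x + t x)" "one G = (\<lambda>x. 0 :: int)"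
  and c: "\<And>s t. s \<in> carrier G \<Longrightarrow> t \<in> carrier G \<Longrightarrow> (\<lambda>x. s x + t x) \<in> carrier G"
  and u: "\<And>s. s \<in> carrier G \<Longrightarrow> (\<lambda>x. - s x) \<in> carrier G" and z: "(\<lambda>x. 0) \<in> carrier G"
 shows "comm_group G"
proof (rule comm_groupI)
 fix s assume "s \<in> carrier G"
 then show "\<exists>t\<in>carrier G. t \<otimes>\<^bsub>G\<^esub> s = \<one>\<^bsub>G\<^esub>" using u[of s] by (intro bexI[of _ "\<lambda>x. - s x"]) (auto simp: G)
qed (use c z in \<open>auto simp: G add_ac\<close>)

lemma sheaf_const_sheaf:
 assumes fin: "finite_space X"
 shows "sheaf X (const_sheaf X S)"
proof (rule sheafI[OF fin])
 let ?F = "const_sheaf X S"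
 note car = mem_const_sheaf[OF fin]
 have grp: "comm_group (sect ?F U)" if "openin X U" for U
 proof (rule comm_group_pointwise_int)
  show "mult (sect ?F U) = (\<lambda>s t x. s x + t x)" "one (sect ?F U) = (\<lambda>x. 0)"
   by (simp_all add: const_sheaf_def)
  show "(\<lambda>x. s x + t x) \<in> secs ?F U" if "s \<in> secs ?F U" "t \<in> secs ?F U" for s t
   using that unfolding car[OF \<open>openin X U\<close>] by simp
  show "(\<lambda>x. - s x) \<in> secs ?F U" if "s \<in> secs ?F U" for s
   using that unfolding car[OF \<open>openin X U\<close>] by simp
  show "(\<lambda>x. 0) \<in> secs ?F U" unfolding car[OF \<open>openin X U\<close>] by simp
 qed
 have nU: "y \<in> U" if "openin X U" "x \<in> U" "y \<in> min_nbhd X x" for x y U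
  using min_nbhd_subset[OF that(1,2)] that(3) by auto
 have rc: "rest ?F U V s \<in> secs ?F V"
  if "openin X U" "openin X V" "V \<subseteq> U" "s \<in> secs ?F U" for U V s
  using that(3,4) nU[OF that(2)] unfolding car[OF that(1)] car[OF that(2)] const_sheaf_simps
  by auto
 show "presheaf X ?F"
  unfolding presheaf_def
 proof (intro conjI allI impI ballI)
  fix U V assume UV: "openin X U \<and> openin X V \<and> V \<subseteq> U"
  show "rest ?F U V \<in> hom (sect ?F U) (sect ?F V)"
   using rc UV by (intro homI) (auto simp: const_sheaf_simps fun_eq_iff)
 next
  fix U s assume U: "openin X U" and "s \<in> secs ?F U"
  then show "rest ?F U U s = s" unfolding car[OF U] by (auto simp: const_sheaf_simps fun_eq_iff)
 next
  fix U V W s assume "openin X U \<and> openin X V \<and> openin X W \<and> W \<subseteq> V \<and> V \<subseteq> U"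
  then show "rest ?F V W (rest ?F U V s) = rest ?F U W s" by (auto simp: const_sheaf_simps fun_eq_iff)
 qed (rule grp)
 fix U assume U: "openin X U"
 {
  fix s t assume s: "s \<in> secs ?F U" and t: "t \<in> secs ?F U"
   and eq: "\<And>x. x \<in> U \<Longrightarrow> rest ?F U (min_nbhd X x) s = rest ?F U (min_nbhd X x) t"
  have "s x = t x" for x
  proof (cases "x \<in> U")
   case True
   show ?thesis using fun_cong[OF eq[OF True], of x] min_nbhd_refl[of x X] by (simp add: const_sheaf_simps)
  next
   case False
   then show ?thesis using s t unfolding car[OF U] by simp
  qed
  then show "s = t" by blast
 next
  fix t assume t: "compatible_germs X ?F U t"
  have oU: "openin X (min_nbhd X x)" if "x \<in> U" for x
   using openin_min_nbhd[OF fin] openin_subset[OF U] that by auto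
  have tx: "t x \<in> germs X ?F x" if "x \<in> U" for x
   using t that by (simp add: compatible_germs_def)
  have tt: "t x y = t y y" if "x \<in> U" "y \<in> min_nbhd X x" for x y
  proof -
   have "germ X ?F x y (t x) = t y" using t that by (simp add: compatible_germs_def)
   from fun_cong[OF this, of y] show ?thesis by (simp add: const_sheaf_simps min_nbhd_refl)
  qed
  define s where "s x = (if x \<in> U then t x x else 0)" for x
  have st: "s y = t x y" if "x \<in> U" "y \<in> min_nbhd X x" for x y
   using tt[OF that] nU[OF U that] by (simp add: s_def)
  have "s \<in> secs ?F U"
   unfolding car[OF U]
  proof (intro conjI allI impI ballI)
   fix x assume "x \<notin> U \<inter> S"
   then show "s x = 0" using tx[of x] unfolding s_def by (auto simp: car[OF oU] min_nbhd_refl)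
  next
   fix x y assume x: "x \<in> U" and y: "y \<in> min_nbhd X x \<inter> S"
   have "t x y = t x x" using tx[OF x] y min_nbhd_refl[of x X] unfolding car[OF oU[OF x]] by blast
   then show "s y = s x" using st[OF x] y min_nbhd_refl[of x X] by simp
  qed
  moreover have "rest ?F U (min_nbhd X x) s = t x" if x: "x \<in> U" for x
  proof
   fix y
   show "rest ?F U (min_nbhd X x) s y = t x y"
    using st[OF x, of y] tx[OF x] unfolding car[OF oU[OF x]] by (auto simp: const_sheaf_simps)
  qed
  ultimately have "has_germs X ?F U t s" by (simp add: has_germs_def)
  then show "\<exists>s. has_germs X ?F U t s" by blast
 }
qed

text \<open>A product of skyscraper sheaves: \<open>l\<close> contributes a copy of the integers at
  the point \<open>a l\<close>, visible on exactly the open sets that contain this point. Extending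
  functions by zero makes it flasque.\<close>

definition function_sheaf :: "'t set \<Rightarrow> ('t \<Rightarrow> 's) \<Rightarrow> ('s, 't \<Rightarrow> int) presheaf_data" where
 "function_sheaf T a =
  \<lparr>sect = (\<lambda>U. \<lparr>carrier = {g. \<forall>l. g l \<noteq> 0 \<longrightarrow> l \<in> T \<and> a l \<in> U},
         monoid.mult = (\<lambda>s t x. s x + t x), one = (\<lambda>x. 0)\<rparr>),
   rest = (\<lambda>U V g l. if a l \<in> V then g l else 0)\<rparr>"

lemma function_sheaf_simps:
 "s \<otimes>\<^bsub>sect (function_sheaf T a) U\<^esub> t = (\<lambda>x. s x + t x)"
 "(one_sect (function_sheaf T a) U) = (\<lambda>x. 0)"
 "rest (function_sheaf T a) U V s = (\<lambda>l. if a l \<in> V then s l else 0)"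
 "g \<in> secs (function_sheaf T a) U \<longleftrightarrow> (\<forall>l. g l \<noteq> 0 \<longrightarrow> l \<in> T \<and> a l \<in> U)"
 by (simp_all add: function_sheaf_def)

lemma sheaf_function_sheaf:
 assumes fin: "finite_space X"
 shows "sheaf X (function_sheaf T a)"
proof (rule sheafI[OF fin])
 let ?F = "function_sheaf T a"
 have grp: "comm_group (sect ?F U)" for U
 proof (rule comm_group_pointwise_int)
  show "mult (sect ?F U) = (\<lambda>s t x. s x + t x)" "one (sect ?F U) = (\<lambda>x. 0)"
   by (simp_all add: function_sheaf_def)
 qed (auto simp: function_sheaf_simps, (metis add.right_neutral)+)
 show "presheaf X ?F"
  unfolding presheaf_def
 proof (intro conjI allI impI ballI)
  fix U V assume UV: "openin X U \<and> openin X V \<and> V \<subseteq> U"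
  then show "rest ?F U V \<in> hom (sect ?F U) (sect ?F V)"
   by (intro homI) (auto simp: function_sheaf_simps fun_eq_iff)
 next
  fix U s assume U: "openin X U" and "s \<in> secs ?F U"
  then show "rest ?F U U s = s" by (auto simp: function_sheaf_simps fun_eq_iff)
 next
  fix U V W s assume "openin X U \<and> openin X V \<and> openin X W \<and> W \<subseteq> V \<and> V \<subseteq> U"
  then show "rest ?F V W (rest ?F U V s) = rest ?F U W s" by (auto simp: function_sheaf_simps fun_eq_iff)
 qed (rule grp)
 fix U assume U: "openin X U"
 {
  fix s t assume s: "s \<in> secs ?F U" and t: "t \<in> secs ?F U"
   and eq: "\<And>x. x \<in> U \<Longrightarrow> rest ?F U (min_nbhd X x) s = rest ?F U (min_nbhd X x) t"
  have "s l = t l" for l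
  proof (cases "a l \<in> U")
   case True
   show ?thesis using fun_cong[OF eq[OF True], of l] min_nbhd_refl[of "a l" X] by (simp add: function_sheaf_simps)
  next
   case False
   then show ?thesis using s t unfolding function_sheaf_simps by metis
  qed
  then show "s = t" by blast
 next
  fix t assume t: "compatible_germs X ?F U t"
  define s where "s l = (if a l \<in> U then t (a l) l else 0)" for l
  have tx: "l \<in> T \<and> a l \<in> min_nbhd X x" if "x \<in> U" "t x l \<noteq> 0" for x l
   using t that by (auto simp: compatible_germs_def function_sheaf_simps)
  have tt: "t x l = t (a l) l" if "x \<in> U" "a l \<in> min_nbhd X x" for x l
  proof -
   have "germ X ?F x (a l) (t x) = t (a l)" using t that by (simp add: compatible_germs_def)
   from fun_cong[OF this, of l] show ?thesis by (simp add: function_sheaf_simps min_nbhd_refl)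
  qed
  have "s \<in> secs ?F U" using tx by (auto simp: function_sheaf_simps s_def)
  moreover have "rest ?F U (min_nbhd X x) s = t x" if x: "x \<in> U" for x
  proof
   fix l
   show "rest ?F U (min_nbhd X x) s l = t x l"
    using tt[OF x, of l] tx[OF x, of l] min_nbhd_subset[OF U x] by (auto simp: function_sheaf_simps s_def)
  qed
  ultimately have "has_germs X ?F U t s" by (simp add: has_germs_def)
  then show "\<exists>s. has_germs X ?F U t s" by blast
 }
qed

lemma flasque_function_sheaf: "flasque X (function_sheaf T a)"
 unfolding flasque_def
proof (intro allI impI ballI)
 fix U V g assume "openin X U \<and> openin X V \<and> V \<subseteq> U" "g \<in> secs (function_sheaf T a) V"
 then show "\<exists>t\<in>secs (function_sheaf T a) U. rest (function_sheaf T a) U V t = g"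
  by (intro bexI[of _ g]) (auto simp: function_sheaf_simps fun_eq_iff)
qed

text \<open>Bounds the groups of cochains, which live on the finitely many chains of a finite space,
  so that they embed into any infinite type.\<close>

lemma countable_finite_support:
 assumes "finite A" shows "countable {g :: 't \<Rightarrow> int. \<forall>l. g l \<noteq> 0 \<longrightarrow> l \<in> A}"
proof -
 have "inj_on (\<lambda>g. restrict g A) {g :: 't \<Rightarrow> int. \<forall>l. g l \<noteq> 0 \<longrightarrow> l \<in> A}"
 proof (rule inj_onI)
  fix g h :: "'t \<Rightarrow> int"
  assume g: "g \<in> {g. \<forall>l. g l \<noteq> 0 \<longrightarrow> l \<in> A}" and h: "h \<in> {g. \<forall>l. g l \<noteq> 0 \<longrightarrow> l \<in> A}"
   and eq: "restrict g A = restrict h A"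
  show "g = h"
  proof
   fix l
   have "l \<notin> A \<Longrightarrow> g l = 0" "l \<notin> A \<Longrightarrow> h l = 0" using g h by auto
   then show "g l = h l" using fun_cong[OF eq, of l] by (cases "l \<in> A") auto
  qed
 qed
 moreover have "(\<lambda>g. restrict g A) ` {g :: 't \<Rightarrow> int. \<forall>l. g l \<noteq> 0 \<longrightarrow> l \<in> A} \<subseteq> (\<Pi>\<^sub>E l\<in>A. UNIV)"
  by auto
 moreover have "countable (\<Pi>\<^sub>E l\<in>A. (UNIV :: int set))"
  by (rule countable_PiE[OF assms]) simp
 ultimately show ?thesis by (meson countable_image_inj_on countable_subset)
qed

subsection \<open>Cochains on chains of points\<close>

text \<open>The alternating sum of the values of \<open>g\<close> on the faces of a list, the face
  without entry \<open>i\<close> having the sign \<open>(-1)^i\<close>. The empty list counts as the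
  face of a list with one entry, so this is the differential of augmented cochains.\<close>

fun coface :: "('x list \<Rightarrow> int) \<Rightarrow> 'x list \<Rightarrow> int" where
 "coface g [] = 0"
| "coface g (x # l) = g l - coface (\<lambda>m. g (x # m)) l"

lemma coface_add: "coface (\<lambda>m. g m + h m) l = coface g l + coface h l"
 by (induction l arbitrary: g h) simp_all

lemma coface_diff: "coface (\<lambda>m. g m - h m) l = coface g l - coface h l"
 by (induction l arbitrary: g h) simp_all

lemma coface_zero [simp]: "coface (\<lambda>m. 0) l = 0"
 by (induction l) simp_all

lemma coface_coface: "coface (coface g) l = 0"
proof (induction l arbitrary: g)
 case (Cons x l)
 have "coface (coface g) (x # l) = coface g l - coface (\<lambda>m. g m - coface (\<lambda>m. g (x # m)) m) l"
  by simp
 also have "\<dots> = 0" unfolding coface_diff Cons.IH by simp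
 finally show ?case .
qed simp

text \<open>Only the face that drops the last entry leaves the lists ending in \<open>q\<close>;
  this separates the chains through a maximal point from the others.\<close>

lemma coface_snoc: "coface g (l @ [q]) = coface (\<lambda>m. g (m @ [q])) l + (- 1) ^ length l * g l"
 by (induction l arbitrary: g) simp_all

section \<open>Faces, and chains in the specialisation order\<close>

definition delete_nth :: "nat \<Rightarrow> 'x list \<Rightarrow> 'x list" where
 "delete_nth i l = take i l @ drop (Suc i) l"

lemma coface_cong:
 assumes "\<And>i. i < length l \<Longrightarrow> g (delete_nth i l) = h (delete_nth i l)"
 shows "coface g l = coface h l"
 using assms
proof (induction l arbitrary: g h)
 case (Cons x l)
 have "g l = h l" using Cons.prems[of 0] by (simp add: delete_nth_def)
 moreover have "coface (\<lambda>m. g (x # m)) l = coface (\<lambda>m. h (x # m)) l"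
 proof (rule Cons.IH)
  fix i assume "i < length l"
  then show "g (x # delete_nth i l) = h (x # delete_nth i l)"
   using Cons.prems[of "Suc i"] by (simp add: delete_nth_def)
 qed
 ultimately show ?case by simp
qed simp

lemma length_delete_nth: "i < length l \<Longrightarrow> length (delete_nth i l) = length l - 1"
 by (simp add: delete_nth_def)

lemma set_delete_nth: "set (delete_nth i l) \<subseteq> set l"
 by (auto simp: delete_nth_def dest: in_set_takeD in_set_dropD)

text \<open>Strictly increasing chains in the specialisation order, written upwards.
  \<open>sorted_wrt\<close> relates all pairs of entries, so a face of a chain is a chain without
  appeal to transitivity.\<close>

definition strict_chain :: "'s topology \<Rightarrow> 's set \<Rightarrow> 's list \<Rightarrow> bool" where
 "strict_chain X D l \<longleftrightarrow> set l \<subseteq> D \<and> sorted_wrt (\<lambda>x y. y \<in> min_nbhd X x \<and> y \<noteq> x) l"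

lemma strict_chain_Nil [simp]: "strict_chain X D []"
 by (simp add: strict_chain_def)

lemma strict_chain_Cons:
 "strict_chain X D (x # l) \<longleftrightarrow> x \<in> D \<and> (\<forall>y\<in>set l. y \<in> min_nbhd X x \<and> y \<noteq> x) \<and> strict_chain X D l"
 by (auto simp: strict_chain_def)

lemma strict_chain_snoc:
 "strict_chain X D (l @ [q]) \<longleftrightarrow> q \<in> D \<and> (\<forall>y\<in>set l. q \<in> min_nbhd X y \<and> q \<noteq> y) \<and> strict_chain X D l"
 by (auto simp: strict_chain_def sorted_wrt_append)

lemma strict_chain_mono: "strict_chain X D l \<Longrightarrow> D \<subseteq> E \<Longrightarrow> strict_chain X E l"
 by (auto simp: strict_chain_def)

lemma strict_chain_delete_nth:
 assumes "strict_chain X D l" "i < length l"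
 shows "strict_chain X D (delete_nth i l)"
proof -
 have "l = take i l @ l ! i # drop (Suc i) l" using assms(2) by (rule id_take_nth_drop)
 then have "sorted_wrt (\<lambda>x y. y \<in> min_nbhd X x \<and> y \<noteq> x) (take i l @ l ! i # drop (Suc i) l)"
  using assms(1) by (simp add: strict_chain_def)
 then have "sorted_wrt (\<lambda>x y. y \<in> min_nbhd X x \<and> y \<noteq> x) (delete_nth i l)"
  unfolding delete_nth_def sorted_wrt_append by simp
 then show ?thesis using assms(1) set_delete_nth[of i l] by (auto simp: strict_chain_def)
qed

lemma finite_strict_chains:
 assumes "finite D" shows "finite {l. strict_chain X D l}"
proof -
 have "distinct l" if "strict_chain X D l" for l
  using that by (induction l) (auto simp: strict_chain_Cons)
 then have "{l. strict_chain X D l} \<subseteq> {l. set l \<subseteq> D \<and> distinct l}"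
  by (auto simp: strict_chain_def)
 then show ?thesis using finite_subset_distinct[OF assms] finite_subset by blast
qed

text \<open>The reduced cochain complex of \<open>D\<close> (with the empty chain included) is exact; all degrees are
 treated at once.\<close>

definition reduced_acyclic :: "'s topology \<Rightarrow> 's set \<Rightarrow> bool" where
 "reduced_acyclic X D \<longleftrightarrow>
  (\<forall>g. (\<forall>l. g l \<noteq> 0 \<longrightarrow> strict_chain X D l) \<and> (\<forall>l. strict_chain X D l \<longrightarrow> coface g l = 0) \<longrightarrow>
   (\<exists>u. (\<forall>l. u l \<noteq> 0 \<longrightarrow> strict_chain X D l) \<and> (\<forall>l. strict_chain X D l \<longrightarrow> coface u l = g l)))"

lemma reduced_acyclicD:
 assumes "reduced_acyclic X D" and "\<And>l. g l \<noteq> 0 \<Longrightarrow> strict_chain X D l"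
  and "\<And>l. strict_chain X D l \<Longrightarrow> coface g l = 0"
 shows "\<exists>u. (\<forall>l. u l \<noteq> 0 \<longrightarrow> strict_chain X D l) \<and> (\<forall>l. strict_chain X D l \<longrightarrow> coface u l = g l)"
 by (rule assms(1)[unfolded reduced_acyclic_def, THEN spec, THEN mp]) (use assms(2,3) in \<open>intro conjI allI impI; simp\<close>)

lemma coface_cong_chain:
 assumes l: "strict_chain X D l" and eq: "\<And>m. strict_chain X D m \<Longrightarrow> g m = h m"
 shows "coface g l = coface h l"
 by (rule coface_cong) (rule eq[OF strict_chain_delete_nth[OF l]])

text \<open>The chains of \<open>E\<close> that contain \<open>q\<close> are the chains of elements below \<open>q\<close>, followed by \<open>q\<close>.\<close>

lemma reduced_acyclic_insert_maximal:
 assumes q: "q \<in> E" and max: "\<And>z. z \<in> E \<Longrightarrow> z \<in> min_nbhd X q \<Longrightarrow> z = q"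
  and E': "reduced_acyclic X (E - {q})" and D: "reduced_acyclic X {z \<in> E. q \<in> min_nbhd X z \<and> z \<noteq> q}"
 shows "reduced_acyclic X E"
 unfolding reduced_acyclic_def
proof (intro allI impI)
 let ?D = "{z \<in> E. q \<in> min_nbhd X z \<and> z \<noteq> q}"
 fix g assume "(\<forall>l. g l \<noteq> 0 \<longrightarrow> strict_chain X E l) \<and> (\<forall>l. strict_chain X E l \<longrightarrow> coface g l = 0)"
 then have g: "\<And>l. g l \<noteq> 0 \<Longrightarrow> strict_chain X E l" and dg: "\<And>l. strict_chain X E l \<Longrightarrow> coface g l = 0" by auto
 have E'E: "strict_chain X E l" if "strict_chain X (E - {q}) l" for l using that by (rule strict_chain_mono) auto
 have DE': "strict_chain X (E - {q}) l" if "strict_chain X ?D l" for l using that by (rule strict_chain_mono) auto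
 have Dq: "strict_chain X E (l @ [q])" if "strict_chain X ?D l" for l
  using that E'E[OF DE'[OF that]] q by (auto simp: strict_chain_snoc) (auto simp: strict_chain_def)
 have notin: "q \<notin> set l" if "strict_chain X (E - {q}) l" for l using that by (auto simp: strict_chain_def)
 have split: "strict_chain X (E - {q}) l \<or> (\<exists>m. l = m @ [q] \<and> strict_chain X ?D m)" if l: "strict_chain X E l" for l
 proof (cases "q \<in> set l")
  case True
  then obtain a b where ab: "l = a @ q # b" by (meson split_list)
  \<comment> \<open>\<open>q\<close> is maximal in \<open>E\<close>, so it can only stand at the end
    of a chain.\<close>
  have "b = []"
  proof (rule ccontr)
   assume "b \<noteq> []"
   then have "hd b \<in> set b" by simp
   then have "hd b \<in> E" "hd b \<in> min_nbhd X q" "hd b \<noteq> q"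
    using l ab by (auto simp: strict_chain_def sorted_wrt_append)
   then show False using max by blast
  qed
  then have la: "l = a @ [q]" using ab by simp
  then have "strict_chain X ?D a" using l unfolding la strict_chain_snoc by (auto simp: strict_chain_def)
  then show ?thesis using la by blast
 next
  case False
  then show ?thesis using l by (auto simp: strict_chain_def)
 qed
 define g' where "g' l = (if strict_chain X (E - {q}) l then g l else 0)" for l
 have dg': "coface g' l = 0" if "strict_chain X (E - {q}) l" for l
  using coface_cong_chain[OF that, of g' g] dg[OF E'E[OF that]] by (simp add: g'_def)
 have g'E: "strict_chain X (E - {q}) l" if "g' l \<noteq> 0" for l using that by (simp add: g'_def split: if_splits)
 obtain u where u: "\<And>l. u l \<noteq> 0 \<Longrightarrow> strict_chain X (E - {q}) l"
  and du: "\<And>l. strict_chain X (E - {q}) l \<Longrightarrow> coface u l = g' l"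
  using reduced_acyclicD[OF E' g'E dg'] by blast
 \<comment> \<open>Subtracting the coboundary of a primitive found on \<open>E - {q}\<close> leaves
   a cocycle that lives on the chains through \<open>q\<close> only.\<close>
 define g1 where "g1 l = (if strict_chain X E l then g l - coface u l else 0)" for l
 have g1E': "g1 l = 0" if "strict_chain X (E - {q}) l" for l
  using du[OF that] that E'E[OF that] by (simp add: g1_def g'_def)
 have dg1: "coface g1 l = 0" if "strict_chain X E l" for l
 proof -
  have "coface g1 l = coface (\<lambda>m. g m - coface u m) l"
   using that by (rule coface_cong_chain) (simp add: g1_def)
  then show ?thesis using dg[OF that] by (simp add: coface_diff coface_coface)
 qed
 \<comment> \<open>\<open>g1\<close> read as a cochain of \<open>?D\<close>. The face that drops
   \<open>q\<close> lies in \<open>E - {q}\<close>, where \<open>g1\<close> vanishes, so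
   \<open>k\<close> is again a cocycle.\<close>
 define k where "k m = (if strict_chain X ?D m then g1 (m @ [q]) else 0)" for m
 have kD: "strict_chain X ?D l" if "k l \<noteq> 0" for l using that by (simp add: k_def split: if_splits)
 have dk: "coface k l = 0" if l: "strict_chain X ?D l" for l
 proof -
  have "coface k l = coface (\<lambda>m. g1 (m @ [q])) l"
   using l by (rule coface_cong_chain) (simp add: k_def)
  also have "\<dots> = coface g1 (l @ [q])" using g1E'[OF DE'[OF l]] by (simp add: coface_snoc)
  also have "\<dots> = 0" by (rule dg1[OF Dq[OF l]])
  finally show ?thesis .
 qed
 obtain v where v: "\<And>l. v l \<noteq> 0 \<Longrightarrow> strict_chain X ?D l"
  and dv: "\<And>l. strict_chain X ?D l \<Longrightarrow> coface v l = k l"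
  using reduced_acyclicD[OF D kD dk] by blast
 \<comment> \<open>The primitive found below \<open>q\<close> is placed on the chains ending in
   \<open>q\<close> and vanishes on the others, so it does not disturb the part already
   solved.\<close>
 define w where "w l = (if l \<noteq> [] \<and> last l = q then v (butlast l) else 0)" for l
 have wq: "w (m @ [q]) = v m" for m by (simp add: w_def)
 have wE': "w l = 0" if "strict_chain X (E - {q}) l" for l
  using notin[OF that] by (auto simp: w_def)
 have dw: "coface w l = g1 l" if l: "strict_chain X E l" for l
  using split[OF l]
 proof (elim disjE exE conjE)
  assume l': "strict_chain X (E - {q}) l"
  have "coface w l = coface (\<lambda>m. 0) l" using l' by (rule coface_cong_chain) (rule wE')
  then show ?thesis using g1E'[OF l'] by simp
 next
  fix m assume m: "l = m @ [q]" "strict_chain X ?D m"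
  show ?thesis
   using wE'[OF DE'[OF m(2)]] dv[OF m(2)] m(2) by (simp add: m(1) coface_snoc wq k_def)
 qed
 have "strict_chain X E l" if "u l + w l \<noteq> 0" for l
 proof (cases "u l = 0")
  case True
  then have "l \<noteq> [] \<and> last l = q \<and> v (butlast l) \<noteq> 0" using that by (auto simp: w_def split: if_splits)
  then show ?thesis using Dq[OF v, of "butlast l"] by (metis append_butlast_last_id)
 next
  case False
  then show ?thesis using E'E[OF u] by blast
 qed
 moreover have "coface (\<lambda>l. u l + w l) l = g l" if "strict_chain X E l" for l
  using dw[OF that] that by (simp add: coface_add g1_def)
 ultimately show "\<exists>u. (\<forall>l. u l \<noteq> 0 \<longrightarrow> strict_chain X E l) \<and> (\<forall>l. strict_chain X E l \<longrightarrow> coface u l = g l)"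
  by (intro exI[of _ "\<lambda>l. u l + w l"]) simp
qed

text \<open>A cohomological form of Quillen's fibre lemma for the inclusion of \<open>K\<close> in \<open>W\<close>.\<close>

lemma reduced_acyclic_fibre:
 assumes fin: "finite_space X" and W: "openin X W"
  and up: "\<And>x z. x \<in> W \<Longrightarrow> x \<notin> K \<Longrightarrow> z \<in> min_nbhd X x \<Longrightarrow> z \<notin> K"
  and K: "\<And>q. q \<in> W \<Longrightarrow> q \<notin> K \<Longrightarrow> reduced_acyclic X {x \<in> W. q \<in> min_nbhd X x \<and> x \<in> K}"
  and "E \<subseteq> W" and "\<And>x z. x \<in> E \<Longrightarrow> z \<in> W \<Longrightarrow> x \<in> min_nbhd X z \<Longrightarrow> z \<in> E"
  and "reduced_acyclic X (E \<inter> K)"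
 shows "reduced_acyclic X E"
 using assms(5-7)
proof (induction "card E" arbitrary: E rule: less_induct)
 case less
 have WX: "W \<subseteq> topspace X" using openin_subset[OF W] .
 have finW: "finite W" using fin WX finite_subset by (auto simp: finite_space_def)
 have finE: "finite E" using finW less.prems(1) finite_subset by auto
 show ?case
 proof (cases "E \<subseteq> K")
  case True
  then show ?thesis using less.prems(3) by (simp add: Int_absorb2)
 next
  case False
  have "\<exists>q\<in>E - K. \<forall>z\<in>E - K. z \<in> min_nbhd X q \<longrightarrow> z = q"
  proof -
   \<comment> \<open>A point of \<open>E - K\<close> with the fewest points of \<open>E\<close>
     above it is maximal in \<open>E - K\<close>, because passing to a larger point strictly shrinks
     the set above.\<close>
   have neg: "\<exists>q\<in>E - K. card (min_nbhd X q \<inter> E) = Min ((\<lambda>q. card (min_nbhd X q \<inter> E)) ` (E - K))"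
    using False finE Min_in[of "(\<lambda>q. card (min_nbhd X q \<inter> E)) ` (E - K)"] by fastforce
   then obtain q where q: "q \<in> E - K" "card (min_nbhd X q \<inter> E) = Min ((\<lambda>q. card (min_nbhd X q \<inter> E)) ` (E - K))"
    by blast
   have "z = q" if z: "z \<in> E - K" "z \<in> min_nbhd X q" for z
   proof (rule ccontr)
    assume "z \<noteq> q"
    have qX: "q \<in> topspace X" using q less.prems(1) WX by auto
    have "q \<notin> min_nbhd X z" using min_nbhd_antisym[OF fin qX z(2)] \<open>z \<noteq> q\<close> by auto
    then have "min_nbhd X z \<inter> E \<subset> min_nbhd X q \<inter> E"
     using min_nbhd_mono[OF fin qX z(2)] min_nbhd_refl[of q X] q by blast
    then have "card (min_nbhd X z \<inter> E) < card (min_nbhd X q \<inter> E)" using finE by (intro psubset_card_mono) auto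
    moreover have "Min ((\<lambda>q. card (min_nbhd X q \<inter> E)) ` (E - K)) \<le> card (min_nbhd X z \<inter> E)"
     using finE z by (intro Min_le) auto
    ultimately show False using q by simp
   qed
   then show ?thesis using q by blast
  qed
  then obtain q where q: "q \<in> E" "q \<notin> K" and qmax: "\<And>z. z \<in> E - K \<Longrightarrow> z \<in> min_nbhd X q \<Longrightarrow> z = q" by blast
  have qW: "q \<in> W" and qX: "q \<in> topspace X" using q less.prems(1) WX by auto
  \<comment> \<open>Points above \<open>q\<close> are again outside \<open>K\<close>, so
    \<open>q\<close> is maximal even in \<open>E\<close>.\<close>
  have max: "z = q" if "z \<in> E" "z \<in> min_nbhd X q" for z using qmax up[OF qW q(2) that(2)] that by blast
  let ?D = "{z \<in> E. q \<in> min_nbhd X z \<and> z \<noteq> q}"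
  show ?thesis
  proof (rule reduced_acyclic_insert_maximal[OF q(1) max])
   show "reduced_acyclic X (E - {q})"
   proof (rule less.hyps)
    show "card (E - {q}) < card E" using finE q by (intro psubset_card_mono) auto
    show "E - {q} \<subseteq> W" using less.prems(1) by auto
    show "z \<in> E - {q}" if "x \<in> E - {q}" "z \<in> W" "x \<in> min_nbhd X z" for x z
     using that less.prems(2)[of x z] max[of x] by blast
    have "(E - {q}) \<inter> K = E \<inter> K" using q by auto
    then show "reduced_acyclic X ((E - {q}) \<inter> K)" using less.prems(3) by simp
   qed
   show "reduced_acyclic X ?D"
   proof (rule less.hyps)
    have "?D \<subset> E" using q by auto
    then show "card ?D < card E" using finE by (rule psubset_card_mono[rotated])
    show "?D \<subseteq> W" using less.prems(1) by auto
    show "z \<in> ?D" if x: "x \<in> ?D" and z: "z \<in> W" "x \<in> min_nbhd X z" for x z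
    proof -
     have zX: "z \<in> topspace X" using z WX by auto
     have "z \<in> E" using less.prems(2)[of x z] x z by auto
     moreover have "q \<in> min_nbhd X z" using min_nbhd_mono[OF fin zX z(2)] x by auto
     moreover have "z \<noteq> q" using max[of x] x z by auto
     ultimately show ?thesis by auto
    qed
    \<comment> \<open>Below \<open>q\<close> the points of \<open>K\<close> in \<open>E\<close> are
      all those in \<open>W\<close>, since \<open>E\<close> is downward closed; their acyclicity is
      the fibre hypothesis at \<open>q\<close>.\<close>
    have "?D \<inter> K = {x \<in> W. q \<in> min_nbhd X x \<and> x \<in> K}"
     using less.prems(1) less.prems(2)[of q] q by auto
    then show "reduced_acyclic X (?D \<inter> K)" using K[OF qW q(2)] by simp
   qed
  qed
 qed
qed

text \<open>Cochains on a family of lists, organised as a sheaf by an anchor: a list counts over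
  \<open>U\<close> when its anchor \<open>a l\<close> lies in \<open>U\<close>. Degree and anchor
  are parameters, since the constant sheaf and the point sheaf call for different ones.\<close>

definition cochain_complex :: "(int \<Rightarrow> 's list set) \<Rightarrow> ('s list \<Rightarrow> 's) \<Rightarrow> ('s, 's list \<Rightarrow> int) sheaf_complex" where
 "cochain_complex T a =
  \<lparr>Sh = (\<lambda>n. function_sheaf (T n) a),
   Dsh = (\<lambda>n U g l. if l \<in> T (n + 1) \<and> a l \<in> U then coface g l else 0)\<rparr>"

lemma cochain_complex_simps:
 "Sh (cochain_complex T a) n = function_sheaf (T n) a"
 "Dsh (cochain_complex T a) n U g = (\<lambda>l. if l \<in> T (n + 1) \<and> a l \<in> U then coface g l else 0)"
 by (simp_all add: cochain_complex_def fun_eq_iff)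

text \<open>Nonempty faces stay in the family, and anchors of faces move upwards, hence stay in any
  open set that contains the anchor of the chain. An empty face may be missing from the
  family.\<close>

lemma is_sheaf_complex_cochain:
 assumes fin: "finite_space X"
  and faces: "\<And>n l i. l \<in> T (n + 1) \<Longrightarrow> i < length l \<Longrightarrow> delete_nth i l \<noteq> [] \<Longrightarrow> delete_nth i l \<in> T n"
  and anchor: "\<And>n l i. l \<in> T (n + 1) \<Longrightarrow> i < length l \<Longrightarrow> delete_nth i l \<in> T n \<Longrightarrow>
   a (delete_nth i l) \<in> min_nbhd X (a l)"
 shows "is_sheaf_complex X (cochain_complex T a)"
proof -
 let ?K = "cochain_complex T a"
 have aU: "a (delete_nth i l) \<in> U"
  if "openin X U" "l \<in> T (n + 1)" "i < length l" "delete_nth i l \<in> T n" "a l \<in> U" for U n l i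
  using anchor[OF that(2,3,4)] min_nbhd_subset[OF that(1,5)] by auto
 show ?thesis
  unfolding is_sheaf_complex_def
 proof (intro conjI allI impI ballI)
  fix n
  show "sheaf X (Sh ?K n)" by (simp add: cochain_complex_simps sheaf_function_sheaf[OF fin])
  show "sheaf_morphism X (Sh ?K n) (Sh ?K (n + 1)) (Dsh ?K n)"
   unfolding sheaf_morphism_def cochain_complex_simps
  proof (intro conjI allI impI ballI)
   fix U assume "openin X U"
   show "(\<lambda>g l. if l \<in> T (n + 1) \<and> a l \<in> U then coface g l else 0)
     \<in> hom (sect (function_sheaf (T n) a) U) (sect (function_sheaf (T (n + 1)) a) U)"
    by (rule homI) (auto simp: function_sheaf_simps coface_add fun_eq_iff)
  next
   fix U V g assume UV: "openin X U \<and> openin X V \<and> V \<subseteq> U"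
    and "g \<in> secs (function_sheaf (T n) a) U"
   then have g: "\<And>l. g l \<noteq> 0 \<Longrightarrow> l \<in> T n" by (auto simp: function_sheaf_simps)
   have "coface (\<lambda>l. if a l \<in> V then g l else 0) l = coface g l" if l: "l \<in> T (n + 1)" "a l \<in> V" for l
   proof (rule coface_cong)
    fix i assume i: "i < length l"
    show "(if a (delete_nth i l) \<in> V then g (delete_nth i l) else 0) = g (delete_nth i l)"
    proof (cases "delete_nth i l \<in> T n")
     case True
     then show ?thesis using aU[of V l n i] UV l i by simp
    next
     case False
     then have "g (delete_nth i l) = 0" using g by blast
     then show ?thesis by simp
    qed
   qed
   then show "(\<lambda>l. if l \<in> T (n + 1) \<and> a l \<in> V then coface (rest (function_sheaf (T n) a) U V g) l else 0) =
     rest (function_sheaf (T (n + 1)) a) U V (\<lambda>l. if l \<in> T (n + 1) \<and> a l \<in> U then coface g l else 0)"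
    using UV by (auto simp: function_sheaf_simps fun_eq_iff)
  qed
  fix U g assume U: "openin X U"
  have e: "n + 1 + 1 = n + 2" by simp
  have "coface (\<lambda>l. if l \<in> T (n + 1) \<and> a l \<in> U then coface g l else 0) l = 0"
   if l: "l \<in> T (n + 1 + 1)" "a l \<in> U" for l
  proof -
   have "coface (\<lambda>l. if l \<in> T (n + 1) \<and> a l \<in> U then coface g l else 0) l = coface (coface g) l"
   proof (rule coface_cong)
    fix i assume i: "i < length l"
    show "(if delete_nth i l \<in> T (n + 1) \<and> a (delete_nth i l) \<in> U then coface g (delete_nth i l) else 0)
      = coface g (delete_nth i l)"
    proof (cases "delete_nth i l \<in> T (n + 1)")
     case True
     then show ?thesis using aU[OF U l(1) i True l(2)] by simp
    next
     case False
     \<comment> \<open>A missing empty face is harmless in the second differential because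
       \<open>coface g [] = 0\<close>.\<close>
     then have "delete_nth i l = []" using faces[OF l(1) i] by blast
     then show ?thesis by simp
    qed
   qed
   then show ?thesis by (simp add: coface_coface)
  qed
  then show "Dsh ?K (n + 1) U (Dsh ?K n U g) = one_sect (Sh ?K (n + 2)) U"
   unfolding cochain_complex_simps function_sheaf_simps by (auto simp: fun_eq_iff)
 qed
qed

lemma cochain_small:
 assumes "finite (T n)"
 shows "secs (Sh (cochain_complex T a) n) U \<lesssim> (UNIV :: 'a::infinite set)"
proof -
 have "secs (Sh (cochain_complex T a) n) U \<subseteq> {g. \<forall>l. g l \<noteq> 0 \<longrightarrow> l \<in> T n}"
  by (auto simp: cochain_complex_simps function_sheaf_simps)
 then show ?thesis
  using countable_finite_support[OF assms] countable_subset countable_lepoll_infinite_type by blast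
qed

text \<open>Prepending a minimal element is a contracting homotopy.\<close>

lemma coface_contraction:
 assumes fin: "finite_space X" and D: "D \<subseteq> topspace X" and x: "x \<in> D"
  and g: "\<And>l. g l \<noteq> 0 \<Longrightarrow> strict_chain X D l"
  and dg: "\<And>l. strict_chain X D l \<Longrightarrow> set l \<subseteq> min_nbhd X x \<Longrightarrow> length l = n + 1 \<Longrightarrow> coface g l = 0"
  and l: "strict_chain X D l" "set l \<subseteq> min_nbhd X x" "length l = n"
 shows "coface (\<lambda>m. g (x # m)) l = g l"
proof -
 have "coface g (x # l) = 0"
 proof (cases "x \<in> set l")
  case False
  then have "strict_chain X D (x # l)" using l x by (auto simp: strict_chain_Cons)
  then show ?thesis using dg[of "x # l"] l min_nbhd_refl[of x X] by simp
 next
  case True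
  then obtain y m where ym: "l = y # m" by (cases l) auto
  have "y = x"
  proof (rule ccontr)
   assume "y \<noteq> x"
   then have "x \<in> min_nbhd X y" using True l(1) ym by (auto simp: strict_chain_Cons)
   moreover have "y \<in> min_nbhd X x" using l(2) ym by auto
   ultimately show False using min_nbhd_antisym[OF fin, of x y] x D \<open>y \<noteq> x\<close> by auto
  qed
  then have lm: "l = x # m" using ym by simp
  \<comment> \<open>For \<open>l = x # m\<close> the list \<open>x # l\<close> repeats
    \<open>x\<close>. Its first two faces coincide and cancel, and every other face still repeats
    \<open>x\<close>, where \<open>g\<close> vanishes.\<close>
  have "\<not> strict_chain X D (x # x # k)" for k by (auto simp: strict_chain_Cons)
  then have "(\<lambda>k. g (x # x # k)) = (\<lambda>k. 0)" using g by blast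
  then show ?thesis by (simp add: lm)
 qed
 then show ?thesis by simp
qed

text \<open>The same homotopy, cut off to chains of \<open>D\<close> of the right length in the
  smallest neighbourhood of \<open>x\<close>, so that it is a section of the cochain sheaf. All
  faces of \<open>l\<close> satisfy the restriction, so the value at \<open>l\<close> is
  unaffected.\<close>

lemma contraction_exact:
 assumes fin: "finite_space X" and D: "D \<subseteq> topspace X" and x: "x \<in> D"
  and g: "\<And>l. g l \<noteq> 0 \<Longrightarrow> strict_chain X D l"
  and dg: "\<And>l. strict_chain X D l \<Longrightarrow> set l \<subseteq> min_nbhd X x \<Longrightarrow> length l = Suc n + 1 \<Longrightarrow> coface g l = 0"
  and l: "strict_chain X D l" "set l \<subseteq> min_nbhd X x" "length l = Suc n"
 shows "coface (\<lambda>m. if strict_chain X D m \<and> set m \<subseteq> min_nbhd X x \<and> length m = n then g (x # m) else 0) l = g l"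
proof -
 have "coface (\<lambda>m. if strict_chain X D m \<and> set m \<subseteq> min_nbhd X x \<and> length m = n then g (x # m) else 0) l =
   coface (\<lambda>m. g (x # m)) l"
 proof (rule coface_cong)
  fix i assume i: "i < length l"
  have "strict_chain X D (delete_nth i l)" using strict_chain_delete_nth[OF l(1) i] .
  moreover have "set (delete_nth i l) \<subseteq> min_nbhd X x" using set_delete_nth[of i l] l(2) by blast
  moreover have "length (delete_nth i l) = n" using length_delete_nth[OF i] l(3) by simp
  ultimately show "(if strict_chain X D (delete_nth i l) \<and> set (delete_nth i l) \<subseteq> min_nbhd X x \<and>
    length (delete_nth i l) = n then g (x # delete_nth i l) else 0) = g (x # delete_nth i l)" by simp
 qed
 also have "\<dots> = g l" by (rule coface_contraction[OF fin D x g dg l])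
 finally show ?thesis .
qed

lemma strict_chain_above_hd:
 assumes "strict_chain X D l" "l \<noteq> []"
 shows "set l \<subseteq> min_nbhd X (hd l)"
 using assms by (cases l) (auto simp: strict_chain_Cons min_nbhd_refl)

lemma hd_delete_nth:
 assumes "strict_chain X D l" "i < length l" "delete_nth i l \<noteq> []"
 shows "hd (delete_nth i l) \<in> min_nbhd X (hd l)"
proof -
 have "hd (delete_nth i l) \<in> set l" using hd_in_set[OF assms(3)] set_delete_nth[of i l] by blast
 moreover have "l \<noteq> []" using assms(2) by auto
 ultimately show ?thesis using strict_chain_above_hd[OF assms(1)] by auto
qed

text \<open>The anchor is the least point of the chain, so a chain lies in an open \<open>U\<close>
  as soon as its head does, and the sections over \<open>U\<close> are the cochains of the order
  complex of \<open>U\<close>. A chain of degree \<open>n\<close> has \<open>n + 1\<close>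
  points.\<close>

definition const_cochains :: "'s topology \<Rightarrow> ('s, 's list \<Rightarrow> int) sheaf_complex" where
 "const_cochains X = cochain_complex
  (\<lambda>n. {l. strict_chain X (topspace X) l \<and> l \<noteq> [] \<and> int (length l) = n + 1}) hd"

definition const_cochains_unit :: "'s set \<Rightarrow> ('s \<Rightarrow> int) \<Rightarrow> 's list \<Rightarrow> int" where
 "const_cochains_unit U s = (\<lambda>l. if length l = 1 then s (hd l) else 0)"

text \<open>The chains over the smallest neighbourhood of \<open>x\<close> form the order complex of
  a set with least element \<open>x\<close>, which is contractible: prepending \<open>x\<close> is
  the homotopy. A cocycle of degree 0 is constant, because the chain from \<open>x\<close> to any
  other point compares the two values.\<close>

lemma resolution_const_cochains:
 assumes fin: "finite_space X"
 shows "resolution X (const_sheaf X (topspace X)) (const_cochains X) const_cochains_unit"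
proof -
 define T where "T n = {l. strict_chain X (topspace X) l \<and> l \<noteq> [] \<and> int (length l) = n + 1}" for n
 have K: "const_cochains X = cochain_complex T hd" by (simp add: const_cochains_def T_def[abs_def])
 have Tset: "l \<in> T n \<longleftrightarrow> strict_chain X (topspace X) l \<and> l \<noteq> [] \<and> int (length l) = n + 1" for l n
  by (simp add: T_def)
 note simps = cochain_complex_simps function_sheaf_simps
 note cs = const_sheaf_simps mem_const_sheaf[OF fin]
 have sc: "is_sheaf_complex X (cochain_complex T hd)"
 proof (rule is_sheaf_complex_cochain[OF fin])
  fix n l i assume "l \<in> T (n + 1)" "i < length l" "delete_nth i l \<noteq> []"
  then show "delete_nth i l \<in> T n"
   using strict_chain_delete_nth[of X "topspace X" l i] by (auto simp: Tset length_delete_nth)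
 next
  fix n l i assume "l \<in> T (n + 1)" "i < length l" "delete_nth i l \<in> T n"
  then show "hd (delete_nth i l) \<in> min_nbhd X (hd l)"
   using hd_delete_nth[of X "topspace X" l i] by (auto simp: Tset)
 qed
 have ps: "presheaf X (const_sheaf X (topspace X))" using sheaf_imp_presheaf[OF sheaf_const_sheaf[OF fin]] .
 have chainU: "set l \<subseteq> U" if "openin X U" "strict_chain X (topspace X) l" "l \<noteq> []" "hd l \<in> U" for l U
  using strict_chain_above_hd[OF that(2,3)] min_nbhd_subset[OF that(1,4)] by auto
 have unit_mor: "sheaf_morphism X (const_sheaf X (topspace X)) (function_sheaf (T 0) hd) const_cochains_unit"
  unfolding sheaf_morphism_def
 proof (intro conjI allI impI ballI)
  fix U assume U: "openin X U"
  show "const_cochains_unit U \<in> hom (sect (const_sheaf X (topspace X)) U) (sect (function_sheaf (T 0) hd) U)"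
  proof (rule homI)
   fix s assume s: "s \<in> secs (const_sheaf X (topspace X)) U"
   show "const_cochains_unit U s \<in> secs (function_sheaf (T 0) hd) U"
    unfolding function_sheaf_simps
   proof (intro allI impI)
    fix l assume "const_cochains_unit U s l \<noteq> 0"
    then have "length l = 1" and nz: "s (hd l) \<noteq> 0" by (auto simp: const_cochains_unit_def split: if_splits)
    then obtain y where y: "l = [y]" by (cases l) auto
    then have "y \<in> U \<inter> topspace X" using s nz unfolding cs(4)[OF U] by auto
    then show "l \<in> T 0 \<and> hd l \<in> U" by (auto simp: y Tset strict_chain_Cons)
   qed
  qed (auto simp: const_cochains_unit_def const_sheaf_simps function_sheaf_simps fun_eq_iff)
 qed (auto simp: const_cochains_unit_def const_sheaf_simps function_sheaf_simps fun_eq_iff)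
 show ?thesis
  unfolding resolution_def K Let_def
 proof (intro conjI allI impI ballI)
  show "is_sheaf_complex X (cochain_complex T hd)" by (rule sc)
  show "presheaf X (const_sheaf X (topspace X))" by (rule ps)
  show "sheaf_morphism X (const_sheaf X (topspace X)) (Sh (cochain_complex T hd) 0) const_cochains_unit"
   using unit_mor by (simp add: simps)
  show "secs (Sh (cochain_complex T hd) n) U \<subseteq> {(one_sect (Sh (cochain_complex T hd) n) U)}" if "n < 0" for n U
  proof -
   have "l \<notin> T n" for l using that by (cases l) (auto simp: Tset)
   then show ?thesis by (auto simp: simps fun_eq_iff)
  qed
 next
  fix U s assume U: "openin X U" and s: "s \<in> secs (const_sheaf X (topspace X)) U"
  have "coface (const_cochains_unit U s) l = 0" if l: "l \<in> T (0 + 1)" "hd l \<in> U" for l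
  proof -
   have "length l = 2" using l by (simp add: Tset)
   then obtain y z where yz: "l = [y, z]" by (auto simp: length_Suc_conv numeral_2_eq_2)
   have "z \<in> min_nbhd X y \<inter> topspace X" "y \<in> U" using l unfolding Tset yz by (auto simp: strict_chain_Cons)
   then have "s z = s y" using s unfolding cs(4)[OF U] by blast
   then show ?thesis by (simp add: yz const_cochains_unit_def)
  qed
  then show "Dsh (cochain_complex T hd) 0 U (const_cochains_unit U s) = one_sect (Sh (cochain_complex T hd) 1) U"
   unfolding simps by (auto simp: fun_eq_iff)
 next
  fix x s assume x: "x \<in> topspace X" and s: "s \<in> germs X (const_sheaf X (topspace X)) x"
   and z: "const_cochains_unit (min_nbhd X x) s = one_sect (Sh (cochain_complex T hd) 0) (min_nbhd X x)"
  have "s y = 0" for y using fun_cong[OF z, of "[y]"] by (simp add: simps const_cochains_unit_def)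
  then show "s = one_sect (const_sheaf X (topspace X)) (min_nbhd X x)" by (simp add: cs fun_eq_iff)
 next
  fix x g assume x: "x \<in> topspace X" and g: "g \<in> germs X (Sh (cochain_complex T hd) 0) x"
   and dg: "Dsh (cochain_complex T hd) 0 (min_nbhd X x) g = one_sect (Sh (cochain_complex T hd) 1) (min_nbhd X x)"
  let ?U = "min_nbhd X x"
  have U: "openin X ?U" by (rule openin_min_nbhd[OF fin x])
  have gT: "\<And>l. g l \<noteq> 0 \<Longrightarrow> l \<in> T 0 \<and> hd l \<in> ?U" using g by (auto simp: simps)
  have same: "g [y] = g [x]" if y: "y \<in> ?U" for y
  proof (cases "y = x")
   case False
   have "strict_chain X (topspace X) [x, y]"
    using x y min_nbhd_in_topspace[OF x y] False by (auto simp: strict_chain_Cons)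
   then have "[x, y] \<in> T (0 + 1)" by (simp add: Tset)
   then show ?thesis using fun_cong[OF dg, of "[x, y]"] min_nbhd_refl[of x X] by (simp add: simps)
  qed simp
  define s where "s y = (if y \<in> ?U then g [x] else 0)" for y
  have "s \<in> secs (const_sheaf X (topspace X)) ?U"
   unfolding cs(4)[OF U] using min_nbhd_topspace[OF x] min_nbhd_subset[OF U] by (auto simp: s_def)
  moreover have "g l = const_cochains_unit ?U s l" for l
  proof (cases "length l = 1")
   case True
   then obtain y where y: "l = [y]" by (cases l) auto
   show ?thesis
    using same[of y] gT[of "[y]"] by (auto simp: y const_cochains_unit_def s_def)
  next
   case False
   then have "l \<notin> T 0" by (simp add: Tset)
   then have "g l = 0" using gT by blast
   then show ?thesis using False by (simp add: const_cochains_unit_def)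
  qed
  ultimately show "g \<in> const_cochains_unit ?U ` secs (const_sheaf X (topspace X)) ?U"
   by (intro image_eqI[of _ _ s]) (auto simp: fun_eq_iff)
 next
  fix x n g assume x: "x \<in> topspace X" and n: "0 \<le> (n :: int)"
   and g: "g \<in> germs X (Sh (cochain_complex T hd) (n + 1)) x"
   and dg: "Dsh (cochain_complex T hd) (n + 1) (min_nbhd X x) g = one_sect (Sh (cochain_complex T hd) (n + 2)) (min_nbhd X x)"
  let ?U = "min_nbhd X x"
  have U: "openin X ?U" by (rule openin_min_nbhd[OF fin x])
  have gT: "\<And>l. g l \<noteq> 0 \<Longrightarrow> l \<in> T (n + 1) \<and> hd l \<in> ?U" using g by (auto simp: simps)
  define N where "N = nat (n + 1)"
  have N: "int N = n + 1" "N \<noteq> 0" using n by (auto simp: N_def)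
  \<comment> \<open>The homotopy prepends \<open>x\<close>; a chain of degree \<open>n\<close> has
    \<open>n + 1\<close> points, hence the length \<open>N\<close>.\<close>
  define u where "u m = (if strict_chain X (topspace X) m \<and> set m \<subseteq> ?U \<and> length m = N then g (x # m) else 0)" for m
  have Tl: "l \<in> T m \<and> hd l \<in> ?U \<longleftrightarrow> strict_chain X (topspace X) l \<and> set l \<subseteq> ?U \<and> int (length l) = m + 1"
   if "m \<ge> 0" for l m
  proof
   assume "l \<in> T m \<and> hd l \<in> ?U"
   then show "strict_chain X (topspace X) l \<and> set l \<subseteq> ?U \<and> int (length l) = m + 1"
    using chainU[OF U, of l] by (auto simp: Tset)
  next
   assume *: "strict_chain X (topspace X) l \<and> set l \<subseteq> ?U \<and> int (length l) = m + 1"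
   then have "l \<noteq> []" using that by auto
   then show "l \<in> T m \<and> hd l \<in> ?U" using * by (auto simp: Tset)
  qed
  have "u \<in> secs (Sh (cochain_complex T hd) n) ?U"
   unfolding simps using Tl[OF n] N by (auto simp: u_def split: if_splits)
  moreover have "Dsh (cochain_complex T hd) n ?U u = g"
  proof
   fix l
   show "Dsh (cochain_complex T hd) n ?U u l = g l"
   proof (cases "l \<in> T (n + 1) \<and> hd l \<in> ?U")
    case True
    then have l: "strict_chain X (topspace X) l" "set l \<subseteq> ?U" "length l = Suc N" using Tl[of "n + 1" l] n N by auto
    have dz: "coface g l' = 0" if "strict_chain X (topspace X) l'" "set l' \<subseteq> ?U" "length l' = Suc N + 1" for l'
    proof -
     have e: "n + 1 + 1 = n + 2" by simp
     have "l' \<in> T (n + 1 + 1) \<and> hd l' \<in> ?U" using that Tl[of "n + 1 + 1" l'] n N by auto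
     then show ?thesis using fun_cong[OF dg, of l'] by (simp add: simps e)
    qed
    have "coface u l = g l"
     unfolding u_def
     by (rule contraction_exact[OF fin order_refl x _ dz l]) (use gT in \<open>auto simp: Tset\<close>)
    then show ?thesis using True by (simp add: simps)
   next
    case False
    then have "g l = 0" using gT by blast
    then show ?thesis using False by (auto simp: simps)
   qed
  qed
  ultimately show "g \<in> Dsh (cochain_complex T hd) n ?U ` secs (Sh (cochain_complex T hd) n) ?U"
   by (metis image_eqI)
 qed
qed

lemma flasque_const_cochains: "flasque X (Sh (const_cochains X) n)"
 by (simp add: const_cochains_def cochain_complex_simps flasque_function_sheaf)

lemma const_cochains_small:
 assumes "finite_space X"
 shows "secs (Sh (const_cochains X) n) U \<lesssim> (UNIV :: 'a::infinite set)"
 unfolding const_cochains_def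
 by (rule cochain_small, rule finite_subset[OF _ finite_strict_chains[of "topspace X" X]])
   (use assms in \<open>auto simp: finite_space_def\<close>)

text \<open>A list \<open>l\<close> stands for the chain \<open>l @ [p]\<close>: these are the
  cochains of the closure of \<open>p\<close> relative to the closure without \<open>p\<close>. The
  anchor is the first entry of \<open>l @ [p]\<close>, and the degree is the number of points other
  than \<open>p\<close>.\<close>

definition point_cochains :: "'s topology \<Rightarrow> 's \<Rightarrow> ('s, 's list \<Rightarrow> int) sheaf_complex" where
 "point_cochains X p = cochain_complex
  (\<lambda>n. {l. strict_chain X {x \<in> topspace X. p \<in> min_nbhd X x \<and> x \<noteq> p} l \<and> int (length l) = n})
  (\<lambda>l. if l = [] then p else hd l)"

definition point_cochains_unit :: "'s \<Rightarrow> 's set \<Rightarrow> ('s \<Rightarrow> int) \<Rightarrow> 's list \<Rightarrow> int" where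
 "point_cochains_unit p U s = (\<lambda>l. if l = [] then s p else 0)"

text \<open>At a point \<open>x\<close> strictly below \<open>p\<close>, prepending \<open>x\<close>
  contracts the stalk; at \<open>p\<close> only the empty chain remains; at any other point there
  are no chains. Thus the only cohomology is a copy of the integers at \<open>p\<close> in degree
  0.\<close>

lemma resolution_point_cochains:
 assumes fin: "finite_space X" and p: "p \<in> topspace X"
 shows "resolution X (const_sheaf X {p}) (point_cochains X p) (point_cochains_unit p)"
proof -
 define D where "D = {x \<in> topspace X. p \<in> min_nbhd X x \<and> x \<noteq> p}"
 define T where "T n = {l. strict_chain X D l \<and> int (length l) = n}" for n
 define a where "a l = (if l = [] then p else hd l)" for l
 have K: "point_cochains X p = cochain_complex T a" by (simp add: point_cochains_def T_def[abs_def] a_def[abs_def] D_def)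
 have Tset: "l \<in> T n \<longleftrightarrow> strict_chain X D l \<and> int (length l) = n" for l n
  by (simp add: T_def)
 have DX: "D \<subseteq> topspace X" by (auto simp: D_def)
 note simps = cochain_complex_simps function_sheaf_simps
 note cs = const_sheaf_simps mem_const_sheaf[OF fin]
 have hdD: "hd l \<in> D" if "strict_chain X D l" "l \<noteq> []" for l
  using that hd_in_set[OF that(2)] by (auto simp: strict_chain_def)
 have sc: "is_sheaf_complex X (cochain_complex T a)"
 proof (rule is_sheaf_complex_cochain[OF fin])
  fix n l i assume "l \<in> T (n + 1)" "i < length l" "delete_nth i l \<noteq> []"
  then show "delete_nth i l \<in> T n"
   using strict_chain_delete_nth[of X D l i] by (auto simp: Tset length_delete_nth)
 next
  fix n l i assume l: "l \<in> T (n + 1)" and i: "i < length l" and "delete_nth i l \<in> T n"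
  have "l \<noteq> []" using i by auto
  then show "a (delete_nth i l) \<in> min_nbhd X (a l)"
   using hd_delete_nth[of X D l i] l i hdD[of l] by (auto simp: Tset a_def) (auto simp: D_def)
 qed
 have ps: "presheaf X (const_sheaf X {p})" using sheaf_imp_presheaf[OF sheaf_const_sheaf[OF fin]] .
 have chainU: "set l \<subseteq> U" if "openin X U" "strict_chain X D l" "a l \<in> U" for l U
  using strict_chain_above_hd[OF that(2)] min_nbhd_subset[OF that(1)] that(3)
  by (cases "l = []") (auto simp: a_def)
 have supp: "s y = 0" if "openin X U" "s \<in> secs (const_sheaf X {p}) U" "y \<noteq> p \<or> y \<notin> U" for s U y
  using that unfolding cs(4)[OF that(1)] by auto
 have unit_mor: "sheaf_morphism X (const_sheaf X {p}) (function_sheaf (T 0) a) (point_cochains_unit p)"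
  unfolding sheaf_morphism_def
 proof (intro conjI allI impI ballI)
  fix U assume U: "openin X U"
  show "point_cochains_unit p U \<in> hom (sect (const_sheaf X {p}) U) (sect (function_sheaf (T 0) a) U)"
  proof (rule homI)
   fix s assume s: "s \<in> secs (const_sheaf X {p}) U"
   have "p \<in> U" if "s p \<noteq> 0" using supp[OF U s, of p] that by blast
   then show "point_cochains_unit p U s \<in> secs (function_sheaf (T 0) a) U"
    by (auto simp: function_sheaf_simps point_cochains_unit_def Tset a_def split: if_splits)
  qed (auto simp: point_cochains_unit_def const_sheaf_simps function_sheaf_simps fun_eq_iff)
 next
  fix U V s assume "openin X U \<and> openin X V \<and> V \<subseteq> U" "s \<in> secs (const_sheaf X {p}) U"
  then show "point_cochains_unit p V (rest (const_sheaf X {p}) U V s) =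
    rest (function_sheaf (T 0) a) U V (point_cochains_unit p U s)"
   by (auto simp: point_cochains_unit_def const_sheaf_simps function_sheaf_simps fun_eq_iff a_def)
 qed
 show ?thesis
  unfolding resolution_def K Let_def
 proof (intro conjI allI impI ballI)
  show "is_sheaf_complex X (cochain_complex T a)" by (rule sc)
  show "presheaf X (const_sheaf X {p})" by (rule ps)
  show "sheaf_morphism X (const_sheaf X {p}) (Sh (cochain_complex T a) 0) (point_cochains_unit p)"
   using unit_mor by (simp add: simps)
  show "secs (Sh (cochain_complex T a) n) U \<subseteq> {(one_sect (Sh (cochain_complex T a) n) U)}" if "n < 0" for n U
   using that by (auto simp: simps Tset fun_eq_iff)
 next
  fix U s assume U: "openin X U" and s: "s \<in> secs (const_sheaf X {p}) U"
  have "coface (point_cochains_unit p U s) l = 0" if l: "l \<in> T (0 + 1)" "a l \<in> U" for l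
  proof -
   have "length l = 1" using l by (simp add: Tset)
   then obtain y where y: "l = [y]" by (cases l) auto
   have yD: "y \<in> D" "y \<in> U" using l unfolding Tset y by (auto simp: strict_chain_Cons a_def)
   then have "s p = s y" using s unfolding cs(4)[OF U] D_def by blast
   then have "s p = 0" using supp[OF U s, of y] yD by (auto simp: D_def)
   then show ?thesis by (simp add: y point_cochains_unit_def)
  qed
  then show "Dsh (cochain_complex T a) 0 U (point_cochains_unit p U s) = one_sect (Sh (cochain_complex T a) 1) U"
   unfolding simps by (auto simp: fun_eq_iff)
 next
  fix x s assume x: "x \<in> topspace X" and s: "s \<in> germs X (const_sheaf X {p}) x"
   and z: "point_cochains_unit p (min_nbhd X x) s = one_sect (Sh (cochain_complex T a) 0) (min_nbhd X x)"
  have "s p = 0" using fun_cong[OF z, of "[]"] by (simp add: simps point_cochains_unit_def)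
  then have "s y = 0" for y using supp[OF openin_min_nbhd[OF fin x] s, of y] by blast
  then show "s = one_sect (const_sheaf X {p}) (min_nbhd X x)" by (simp add: cs fun_eq_iff)
 next
  fix x g assume x: "x \<in> topspace X" and g: "g \<in> germs X (Sh (cochain_complex T a) 0) x"
   and dg: "Dsh (cochain_complex T a) 0 (min_nbhd X x) g = one_sect (Sh (cochain_complex T a) 1) (min_nbhd X x)"
  let ?U = "min_nbhd X x"
  have U: "openin X ?U" by (rule openin_min_nbhd[OF fin x])
  have gT: "\<And>l. g l \<noteq> 0 \<Longrightarrow> l = [] \<and> p \<in> ?U" using g by (auto simp: simps Tset a_def split: if_splits)
  define s where "s y = (if y = p then g [] else 0)" for y
  \<comment> \<open>For \<open>x\<close> strictly below \<open>p\<close> the list \<open>[x]\<close>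
    has the empty list as its only face, so a cocycle of degree 0 vanishes.\<close>
  have g0: "g [] = 0" if "x \<noteq> p"
  proof (rule ccontr)
   assume "g [] \<noteq> 0"
   then have "p \<in> ?U" using gT by blast
   then have "[x] \<in> T (0 + 1)" "a [x] \<in> ?U"
    using that x min_nbhd_refl[of x X] by (auto simp: Tset strict_chain_Cons D_def a_def)
   then show False using fun_cong[OF dg, of "[x]"] \<open>g [] \<noteq> 0\<close> by (simp add: simps)
  qed
  have "s \<in> secs (const_sheaf X {p}) ?U"
   unfolding cs(4)[OF U]
  proof (intro conjI allI impI ballI)
   show "s y = 0" if "y \<notin> ?U \<inter> {p}" for y using that gT[of "[]"] by (auto simp: s_def)
   fix y z assume y: "y \<in> ?U" and z: "z \<in> min_nbhd X y \<inter> {p}"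
   show "s z = s y"
   proof (cases "x = p")
    case True
    then have "y = p" using min_nbhd_antisym[OF fin x, of y] y z by auto
    then show ?thesis using z by simp
   qed (use g0 in \<open>simp add: s_def\<close>)
  qed
  moreover have "g l = point_cochains_unit p ?U s l" for l
   using gT[of l] by (auto simp: point_cochains_unit_def s_def)
  ultimately show "g \<in> point_cochains_unit p ?U ` secs (const_sheaf X {p}) ?U"
   by (intro image_eqI[of _ _ s]) (auto simp: fun_eq_iff)
 next
  fix x n g assume x: "x \<in> topspace X" and n: "0 \<le> (n :: int)"
   and g: "g \<in> germs X (Sh (cochain_complex T a) (n + 1)) x"
   and dg: "Dsh (cochain_complex T a) (n + 1) (min_nbhd X x) g = one_sect (Sh (cochain_complex T a) (n + 2)) (min_nbhd X x)"
  let ?U = "min_nbhd X x"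
  have U: "openin X ?U" by (rule openin_min_nbhd[OF fin x])
  have gT: "\<And>l. g l \<noteq> 0 \<Longrightarrow> l \<in> T (n + 1) \<and> a l \<in> ?U" using g by (auto simp: simps)
  define N where "N = nat n"
  have N: "int N = n" using n by (auto simp: N_def)
  define u where "u m = (if strict_chain X D m \<and> set m \<subseteq> ?U \<and> length m = N then g (x # m) else 0)" for m
  \<comment> \<open>A nonempty chain over the stalk at \<open>x\<close> has its first entry between
    \<open>x\<close> and \<open>p\<close>, and different from \<open>p\<close>; this puts
    \<open>x\<close> strictly below \<open>p\<close>.\<close>
  have empty: "x \<in> D" if "l \<noteq> []" "strict_chain X D l" "a l \<in> ?U" for l
  proof -
   have h: "hd l \<in> D" "hd l \<in> ?U" using that hdD[OF that(2,1)] by (auto simp: a_def)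
   have "p \<in> min_nbhd X x" using h min_nbhd_mono[OF fin x, of "hd l"] by (auto simp: D_def)
   moreover have "x \<noteq> p"
   proof
    assume "x = p"
    then have "hd l = p" using h min_nbhd_antisym[OF fin x, of "hd l"] by (auto simp: D_def)
    then show False using h by (simp add: D_def)
   qed
   ultimately show ?thesis using x by (simp add: D_def)
  qed
  show "g \<in> Dsh (cochain_complex T a) n ?U ` secs (Sh (cochain_complex T a) n) ?U"
  proof (cases "x \<in> D")
   case False
   have "g l = 0" for l
   proof (rule ccontr)
    assume "g l \<noteq> 0"
    then have "l \<in> T (n + 1)" "a l \<in> ?U" using gT by auto
    moreover from this have "l \<noteq> []" using n by (auto simp: Tset)
    ultimately show False using empty[of l] False by (auto simp: Tset)
   qed
   then have "g = (\<lambda>l. 0)" by blast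
   then show ?thesis by (intro image_eqI[of _ _ "\<lambda>l. 0"]) (auto simp: simps fun_eq_iff)
  next
   case xD: True
   then have pU: "p \<in> ?U" by (simp add: D_def)
   have Tl: "l \<in> T m \<and> a l \<in> ?U \<longleftrightarrow> strict_chain X D l \<and> set l \<subseteq> ?U \<and> int (length l) = m" for l m
   proof
    assume "l \<in> T m \<and> a l \<in> ?U"
    then show "strict_chain X D l \<and> set l \<subseteq> ?U \<and> int (length l) = m"
     using chainU[OF U, of l] by (auto simp: Tset)
   next
    assume *: "strict_chain X D l \<and> set l \<subseteq> ?U \<and> int (length l) = m"
    then show "l \<in> T m \<and> a l \<in> ?U" using pU by (auto simp: Tset a_def)
   qed
   have "u \<in> secs (Sh (cochain_complex T a) n) ?U"
    unfolding simps using Tl N by (auto simp: u_def split: if_splits)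
   moreover have "Dsh (cochain_complex T a) n ?U u = g"
   proof
    fix l
    show "Dsh (cochain_complex T a) n ?U u l = g l"
    proof (cases "l \<in> T (n + 1) \<and> a l \<in> ?U")
     case True
     then have l: "strict_chain X D l" "set l \<subseteq> ?U" "length l = Suc N" using Tl[of l "n + 1"] N by auto
     have dz: "coface g l' = 0" if "strict_chain X D l'" "set l' \<subseteq> ?U" "length l' = Suc N + 1" for l'
     proof -
      have e: "n + 1 + 1 = n + 2" by simp
      have "l' \<in> T (n + 1 + 1) \<and> a l' \<in> ?U" using that Tl[of l' "n + 1 + 1"] N by auto
      then show ?thesis using fun_cong[OF dg, of l'] by (simp add: simps e)
     qed
     have "coface u l = g l"
      unfolding u_def
      by (rule contraction_exact[OF fin DX xD _ dz l]) (use gT in \<open>auto simp: Tset\<close>)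
     then show ?thesis using True by (simp add: simps)
    next
     case False
     then have "g l = 0" using gT by blast
     then show ?thesis using False by (auto simp: simps)
    qed
   qed
   ultimately show ?thesis by (metis image_eqI)
  qed
 qed
qed

lemma flasque_point_cochains: "flasque X (Sh (point_cochains X p) n)"
 by (simp add: point_cochains_def cochain_complex_simps flasque_function_sheaf)

lemma point_cochains_small:
 assumes "finite_space X"
 shows "secs (Sh (point_cochains X p) n) U \<lesssim> (UNIV :: 'a::infinite set)"
 unfolding point_cochains_def
 by (rule cochain_small, rule finite_subset[OF _ finite_strict_chains[of "{x \<in> topspace X. p \<in> min_nbhd X x \<and> x \<noteq> p}" X]])
   (use assms in \<open>auto simp: finite_space_def\<close>)

text \<open>Over \<open>W\<close> the point cochains are the reduced cochains of the part of
  \<open>W\<close> strictly below \<open>p\<close>, with the empty chain in degree 0. They are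
  trivial when \<open>p\<close> is not in \<open>W\<close>, because a chain over \<open>W\<close>
  forces its upper bound \<open>p\<close> into \<open>W\<close>.\<close>

lemma point_cochains_exact:
 assumes fin: "finite_space X" and p: "p \<in> topspace X" and W: "openin X W"
  and ac: "p \<in> W \<Longrightarrow> reduced_acyclic X {x \<in> W. p \<in> min_nbhd X x \<and> x \<noteq> p}"
 shows "exact_complex (sections (point_cochains X p) W)"
proof -
 define D where "D = {x \<in> topspace X. p \<in> min_nbhd X x \<and> x \<noteq> p}"
 define T where "T n = {l. strict_chain X D l \<and> int (length l) = n}" for n
 define a where "a l = (if l = [] then p else hd l)" for l
 define DW where "DW = {x \<in> W. p \<in> min_nbhd X x \<and> x \<noteq> p}"
 have K: "point_cochains X p = cochain_complex T a" by (simp add: point_cochains_def T_def[abs_def] a_def[abs_def] D_def)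
 note simps = cochain_complex_simps function_sheaf_simps
 have WX: "W \<subseteq> topspace X" using openin_subset[OF W] .
 have TW: "l \<in> T n \<and> a l \<in> W \<longleftrightarrow> p \<in> W \<and> strict_chain X DW l \<and> int (length l) = n" for l n
 proof
  assume l: "l \<in> T n \<and> a l \<in> W"
  have lc: "strict_chain X D l" using l by (simp add: T_def)
  have sl: "set l \<subseteq> W"
   using strict_chain_above_hd[OF lc] min_nbhd_subset[OF W] l by (cases "l = []") (auto simp: a_def)
  have "p \<in> W"
  proof (cases "l = []")
   case False
   then have h: "hd l \<in> D" using hd_in_set lc by (auto simp: strict_chain_def)
   have "hd l \<in> W" using sl hd_in_set[OF False] by auto
   then show ?thesis using h min_nbhd_subset[OF W] by (auto simp: D_def)
  qed (use l in \<open>simp add: a_def\<close>)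
  moreover have "strict_chain X DW l" using lc sl by (auto simp: strict_chain_def D_def DW_def)
  ultimately show "p \<in> W \<and> strict_chain X DW l \<and> int (length l) = n" using l by (simp add: T_def)
 next
  assume l: "p \<in> W \<and> strict_chain X DW l \<and> int (length l) = n"
  have "strict_chain X D l" using l WX by (auto simp: strict_chain_def D_def DW_def)
  have "hd l \<in> W" if "l \<noteq> []" using l hd_in_set[OF that] unfolding strict_chain_def DW_def by blast
  then have "a l \<in> W" using l by (simp add: a_def)
  moreover note \<open>strict_chain X D l\<close>
  ultimately show "l \<in> T n \<and> a l \<in> W" using l by (simp add: T_def)
 qed
 show ?thesis
  unfolding exact_complex_iff K sections_simps
 proof (intro allI ballI impI)
  fix n g assume g: "g \<in> secs (Sh (cochain_complex T a) n) W"
   and dg: "Dsh (cochain_complex T a) n W g = one_sect (Sh (cochain_complex T a) (n + 1)) W"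
  have gT: "p \<in> W \<and> strict_chain X DW l \<and> int (length l) = n" if "g l \<noteq> 0" for l
   using g that TW[of l n] by (simp add: simps)
  show "\<exists>t\<in>secs (Sh (cochain_complex T a) (n - 1)) W. Dsh (cochain_complex T a) (n - 1) W t = g"
  proof (cases "p \<in> W")
   case False
   then have "g = (\<lambda>l. 0)" using gT by blast
   then show ?thesis by (intro bexI[of _ "\<lambda>l. 0"]) (auto simp: simps fun_eq_iff)
  next
   case pW: True
   \<comment> \<open>Acyclicity treats all lengths at once, so \<open>g\<close> has to be closed on
     chains of every length. On lengths other than \<open>n + 1\<close> the faces have the wrong
     length and \<open>g\<close> vanishes on them.\<close>
   have cg: "coface g l = 0" if l: "strict_chain X DW l" for l
   proof (cases "int (length l) = n + 1")
    case True
    then have "l \<in> T (n + 1) \<and> a l \<in> W" using TW[of l "n + 1"] l pW by simp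
    then show ?thesis using fun_cong[OF dg, of l] by (simp add: simps)
   next
    case False
    have "coface g l = coface (\<lambda>m. 0) l"
    proof (rule coface_cong)
     fix i assume "i < length l"
     then have "int (length (delete_nth i l)) \<noteq> n" using False by (simp add: length_delete_nth)
     then show "g (delete_nth i l) = 0" using gT by blast
    qed
    then show ?thesis by simp
   qed
   obtain u where u: "\<And>l. u l \<noteq> 0 \<Longrightarrow> strict_chain X DW l" and du: "\<And>l. strict_chain X DW l \<Longrightarrow> coface u l = g l"
    using reduced_acyclicD[OF ac[OF pW, folded DW_def], of g] gT cg by blast
   \<comment> \<open>Only the part of the primitive on chains of length \<open>n - 1\<close> lies in
     the right degree; the faces of a chain of length \<open>n\<close> see nothing else.\<close>
   define t where "t l = (if int (length l) = n - 1 then u l else 0)" for l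
   have "t l \<noteq> 0 \<Longrightarrow> l \<in> T (n - 1) \<and> a l \<in> W" for l
    using TW[of l "n - 1"] u[of l] pW by (auto simp: t_def split: if_splits)
   then have "t \<in> secs (Sh (cochain_complex T a) (n - 1)) W" by (simp add: simps)
   moreover have "Dsh (cochain_complex T a) (n - 1) W t = g"
   proof
    fix l
    show "Dsh (cochain_complex T a) (n - 1) W t l = g l"
    proof (cases "l \<in> T n \<and> a l \<in> W")
     case True
     then have l: "strict_chain X DW l" "int (length l) = n" using TW[of l n] by auto
     have "coface t l = coface u l"
     proof (rule coface_cong)
      fix i assume "i < length l"
      then show "t (delete_nth i l) = u (delete_nth i l)" using l(2) by (auto simp: t_def length_delete_nth)
     qed
     then show ?thesis using True du[OF l(1)] by (simp add: simps)
    next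
     case False
     then have "g l = 0" using gT[of l] TW[of l n] by blast
     then show ?thesis using False by (auto simp: simps)
    qed
   qed
   ultimately show ?thesis by blast
  qed
 qed
qed

subsection \<open>Cohomologically trivial fibres\<close>

lemma quasi_iso_exact:
 assumes A: "group_complex A" and B: "group_complex B" and \<phi>: "chain_map A B \<phi>"
  and q: "quasi_iso A B \<phi>" and ex: "exact_complex A"
 shows "exact_complex B"
 unfolding exact_complex_def
proof (intro allI subsetI)
 fix n b assume "b \<in> cocycles B n"
 then obtain a c where a: "a \<in> cocycles A n" and c: "c \<in> coboundaries B n" and b: "b = \<phi> n a \<otimes>\<^bsub>Ob B n\<^esub> c"
  using q unfolding quasi_iso_def by blast
 have "a \<in> coboundaries A n" using ex a unfolding exact_complex_def by blast
 then have "\<phi> n a \<in> coboundaries B n" using chain_map_coboundaries[OF \<phi>] by blast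
 then show "b \<in> coboundaries B n"
  unfolding b using subgroup.m_closed[OF subgroup_coboundaries[OF B]] c by blast
qed

lemma strict_chain_subtopology:
 assumes fin: "finite_space X" and D: "D \<subseteq> topspace X" "D \<subseteq> S"
 shows "strict_chain (subtopology X S) D l \<longleftrightarrow> strict_chain X D l"
proof (induction l)
 case (Cons x l)
 have "(\<forall>y\<in>set l. y \<in> min_nbhd (subtopology X S) x \<and> y \<noteq> x) \<longleftrightarrow> (\<forall>y\<in>set l. y \<in> min_nbhd X x \<and> y \<noteq> x)"
  if "x \<in> D" "strict_chain X D l"
 proof -
  have "min_nbhd (subtopology X S) x = min_nbhd X x \<inter> S"
   using that(1) D by (intro min_nbhd_subtopology[OF fin]) auto
  moreover have "set l \<subseteq> S" using that(2) D(2) by (auto simp: strict_chain_def)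
  ultimately show ?thesis by auto
 qed
 then show ?case unfolding strict_chain_Cons Cons.IH by blast
qed simp

lemma reduced_acyclic_subtopology:
 assumes "finite_space X" "D \<subseteq> topspace X" "D \<subseteq> S"
 shows "reduced_acyclic (subtopology X S) D \<longleftrightarrow> reduced_acyclic X D"
 by (simp add: reduced_acyclic_def strict_chain_subtopology[OF assms])

lemma RGamma_red_chain_map:
 assumes fin: "finite_space S" and J: "resolution S (const_sheaf S (topspace S)) J \<eta>"
 shows "chain_map (group_deg0 integer_group) (sections J (topspace S))
  (\<lambda>n k. augmentation J \<eta> n (topspace S) (\<lambda>x. if x \<in> topspace S then k else 0))"
proof -
 let ?W = "topspace S"
 let ?c = "\<lambda>k x. if x \<in> topspace S then k else (0 :: int)"
 have o: "openin S ?W" by simp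
 note gJ = group_complex_sections[OF resolutionD(1)[OF J] o]
 have c: "?c k \<in> secs (const_sheaf S ?W) ?W" for k
  unfolding mem_const_sheaf[OF fin o] by auto
 have hom: "(\<lambda>k. \<eta> ?W (?c k)) \<in> hom integer_group (sect (Sh J 0) ?W)"
 proof (rule homI)
  show "\<eta> ?W (?c k) \<in> secs (Sh J 0) ?W" for k
   using morphismD(2)[OF resolutionD(4)[OF J] o c] .
  show "\<eta> ?W (?c (k \<otimes>\<^bsub>integer_group\<^esub> l)) = \<eta> ?W (?c k) \<otimes>\<^bsub>sect (Sh J 0) ?W\<^esub> \<eta> ?W (?c l)" for k l
  proof -
   have "?c (k \<otimes>\<^bsub>integer_group\<^esub> l) = ?c k \<otimes>\<^bsub>sect (const_sheaf S ?W) ?W\<^esub> ?c l"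
    by (auto simp: const_sheaf_simps)
   then show ?thesis using hom_mult[OF morphismD(1)[OF resolutionD(4)[OF J] o] c c] by simp
  qed
 qed
 have one: "(one_sect (Sh J n) ?W) \<in> secs (Sh J n) ?W" for n
  using monoid.one_closed[OF complexD(3)[OF gJ, of n]] by simp
 have d1: "Dsh J n ?W (one_sect (Sh J n) ?W) = one_sect (Sh J (n + 1)) ?W" for n
  using hom_one[OF complexD(4)[OF gJ, of n]] complexD(2)[OF gJ] by simp
 \<comment> \<open>This settles the passage from degree -1 to degree 0, where the augmentation is
   \<open>\<eta>\<close> of the zero function and not the unit by definition.\<close>
 have \<eta>0: "\<eta> ?W (?c 0) = one_sect (Sh J 0) ?W"
  using hom_one[OF hom] complexD(2)[OF gJ, of 0] by (simp cong: if_cong)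
 show ?thesis
  unfolding chain_map_def
 proof (intro conjI allI ballI)
  fix n
  show "(\<lambda>k. augmentation J \<eta> n ?W (?c k)) \<in> hom (Ob (group_deg0 integer_group) n) (Ob (sections J ?W) n)"
  proof (cases "n = 0")
   case True
   then show ?thesis using hom by (simp add: augmentation_def group_deg0_simps)
  next
   case False
   then show ?thesis
    using one[of n] monoid.l_one[OF complexD(3)[OF gJ, of n]]
    by (intro homI) (auto simp: augmentation_def)
  qed
  fix k assume k: "k \<in> obs (group_deg0 integer_group) n"
  show "augmentation J \<eta> (n + 1) ?W (?c (Df (group_deg0 integer_group) n k)) =
    Df (sections J ?W) n (augmentation J \<eta> n ?W (?c k))"
  proof -
   have df: "Df (group_deg0 integer_group) n k = 0" by (simp add: group_deg0_simps)
   show ?thesis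
    unfolding df using \<eta>0 d1[of n] resolutionD(5)[OF J o c] by (auto simp: augmentation_def)
  qed
 qed
qed

lemma group_complex_RGamma_red:
 assumes fin: "finite_space S" and J: "resolution S (const_sheaf S (topspace S)) J \<eta>"
 shows "group_complex (RGamma_red S J \<eta>)"
 unfolding RGamma_red_def
 by (rule group_complex_cone[OF group_complex_deg0[OF abelian_integer_group]
    group_complex_sections[OF resolutionD(1)[OF J] openin_topspace] RGamma_red_chain_map[OF assms]])

text \<open>The cochains on nonempty chains are a flasque resolution of the constant sheaf, so their
  global sections compute the same cohomology as those of \<open>J\<close>. Acyclicity of the cone
  says that a cocycle is, up to a coboundary, a constant in degree 0; the empty chain accounts for
  the constants.\<close>

lemma reduced_acyclic_if_acyclic:
 fixes J :: "('s, 'a::infinite) sheaf_complex"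
 assumes fin: "finite_space S" and J: "injective_resolution S (const_sheaf S (topspace S)) J \<eta>"
  and ac: "acyclic_complex (RGamma_red S J \<eta>)"
 shows "reduced_acyclic S (topspace S)"
proof -
 let ?W = "topspace S"
 let ?c = "\<lambda>k x. if x \<in> topspace S then k else (0 :: int)"
 let ?R = "const_cochains S"
 let ?Z = "group_deg0 integer_group"
 let ?\<phi> = "\<lambda>n k. augmentation J \<eta> n ?W (?c k)"
 have o: "openin S ?W" by simp
 have sub: "subtopology S ?W = S" by simp
 note rJ = injective_resolution_imp_resolution[OF fin J]
 have inj: "injective_sheaf S (Sh J n)" for n using J by (simp add: injective_resolution_def)
 note gJ = group_complex_sections[OF resolutionD(1)[OF rJ] o]
 note rR = resolution_const_cochains[OF fin]
 note gR = group_complex_sections[OF resolutionD(1)[OF rR] o]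
 note gZ = group_complex_deg0[OF abelian_integer_group]
 note \<phi> = RGamma_red_chain_map[OF fin rJ]
 have "exact_complex (RGamma_red S J \<eta>)"
  using acyclic_complex_imp_exact[OF group_complex_RGamma_red[OF fin rJ] ac] .
 then have q\<phi>: "quasi_iso ?Z (sections J ?W) ?\<phi>"
  using quasi_iso_iff_exact_cone[OF gZ gJ \<phi>] by (simp add: RGamma_red_def)
 obtain \<theta> where \<theta>: "complex_morphism S ?R J \<theta>"
  and \<theta>\<iota>: "\<And>U s. openin S U \<Longrightarrow> s \<in> secs (const_sheaf S ?W) U \<Longrightarrow>
   \<theta> 0 U (const_cochains_unit U s) = \<eta> U s"
  and q\<theta>: "\<And>U. openin S U \<Longrightarrow> quasi_iso (sections ?R U) (sections J U) (\<lambda>n. \<theta> n U)"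
 proof (rule resolution_comparison[OF fin o inj resolutionD(1)[OF rJ], unfolded sub, OF rJ rR
    flasque_const_cochains const_cochains_small[OF fin]])
  fix \<theta>
  assume 1: "complex_morphism S ?R J \<theta>"
   and 2: "\<And>U s. openin S U \<Longrightarrow> s \<in> secs (const_sheaf S ?W) U \<Longrightarrow>
    \<theta> 0 U (const_cochains_unit U s) = \<eta> U s"
   and 3: "\<And>W. openin S W \<Longrightarrow> quasi_iso (sections ?R W) (sections J W) (\<lambda>n. \<theta> n W)"
  show thesis by (rule that[OF 1 2 3])
 qed
 note c\<theta> = chain_map_sections[OF \<theta> o]
 have cW: "?c k \<in> secs (const_sheaf S ?W) ?W" for k
  unfolding mem_const_sheaf[OF fin o] by auto
 have zero_only: "k = 0" if "k \<in> coboundaries ?Z 0" for k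
  using that by (auto simp: coboundaries_def group_deg0_simps)
 \<comment> \<open>For the empty space the cone has cohomology in degree -1: the integer 1 maps to
   the only section over the empty set.\<close>
 have ne: "?W \<noteq> {}"
 proof
  assume e: "?W = {}"
  have "1 \<in> cocycles ?Z 0" by (simp add: cocycles_def group_deg0_simps singleton_group_def)
  moreover have "?\<phi> 0 1 \<in> secs (Sh J 0) ?W"
   using chain_mapD(1)[OF \<phi>, of 0] by (auto simp: hom_def group_deg0_simps)
  then have "?\<phi> 0 1 = one_ob (sections J ?W) 0"
   using sheaf_empty_trivial[OF fin is_sheaf_complexD(1)[OF resolutionD(1)[OF rJ]]] unfolding e by simp
  then have "?\<phi> 0 1 \<in> coboundaries (sections J ?W) 0"
   using subgroup.one_closed[OF subgroup_coboundaries[OF gJ, of 0]] by metis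
  ultimately have "(1 :: int) \<in> coboundaries ?Z 0" using q\<phi> unfolding quasi_iso_def by blast
  then show False using zero_only[of 1] by simp
 qed
 note simps = const_cochains_def cochain_complex_simps function_sheaf_simps
 have hdW: "hd l \<in> ?W" if "strict_chain S ?W l" "l \<noteq> []" for l
  using that hd_in_set[OF that(2)] unfolding strict_chain_def by blast
 \<comment> \<open>One length at a time. Chains of length \<open>n\<close> have degree
   \<open>n - 1\<close>, and the primitive lives on chains with one point less.\<close>
 have graded: "\<exists>u. (\<forall>l. u l \<noteq> 0 \<longrightarrow> strict_chain S ?W l \<and> Suc (length l) = n) \<and>
   (\<forall>l. strict_chain S ?W l \<and> length l = n \<longrightarrow> coface u l = g l)"
  if g: "\<And>l. g l \<noteq> 0 \<Longrightarrow> strict_chain S ?W l \<and> length l = n"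
   and dg: "\<And>l. strict_chain S ?W l \<Longrightarrow> coface g l = 0" for n g
 proof (cases n)
  case 0
  obtain x where x: "x \<in> ?W" using ne by blast
  \<comment> \<open>Length 0 is the reduced part: a nonempty space has a chain \<open>[x]\<close>,
    whose only face is empty, so the cocycle vanishes.\<close>
  have "g [] = 0" using dg[of "[x]"] x by (simp add: strict_chain_Cons)
  then have "coface (\<lambda>l. 0) l = g l" if "length l = n" for l using that 0 by simp
  then show ?thesis by (intro exI[of _ "\<lambda>l. 0"]) auto
 next
  case (Suc m)
  have gc: "g \<in> secs (Sh ?R (int m)) ?W"
   unfolding simps using g hdW Suc by fastforce
  have dgm: "Dsh ?R (int m) ?W g = one_sect (Sh ?R (int m + 1)) ?W"
   unfolding simps using dg by (auto simp: fun_eq_iff)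
  have gz: "g \<in> cocycles (sections ?R ?W) (int m)" using gc dgm by (simp add: cocycles_def)
  have "\<theta> (int m) ?W g \<in> cocycles (sections J ?W) (int m)"
   using chain_map_cocycles[OF gR gJ c\<theta> gz] .
  then obtain k c where k: "k \<in> cocycles ?Z (int m)" and c: "c \<in> coboundaries (sections J ?W) (int m)"
   and eq: "\<theta> (int m) ?W g = ?\<phi> (int m) k \<otimes>\<^bsub>sect (Sh J (int m)) ?W\<^esub> c"
   using q\<phi> unfolding quasi_iso_def by fastforce
  \<comment> \<open>In degree 0 the constant \<open>k\<close> found by the quasi-isomorphism is
    subtracted; in higher degrees the augmentation contributes nothing.\<close>
  define h where "h l = (if m = 0 then g l - const_cochains_unit ?W (?c k) l else g l)" for l
  have cc: "c \<in> secs (Sh J (int m)) ?W"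
   using subgroup.mem_carrier[OF subgroup_coboundaries[OF gJ] c] by simp
  have "h \<in> cocycles (sections ?R ?W) (int m) \<and> \<theta> (int m) ?W h \<in> coboundaries (sections J ?W) (int m)"
  proof (cases "m = 0")
   case False
   then have "?\<phi> (int m) k = one_sect (Sh J (int m)) ?W" by (simp add: augmentation_def)
   then have "\<theta> (int m) ?W g = c"
    using eq cc monoid.l_one[OF complexD(3)[OF gJ, of "int m"]] by simp
   moreover have "h = g" using False by (simp add: h_def fun_eq_iff)
   ultimately show ?thesis using gz c by simp
  next
   case True
   let ?e = "const_cochains_unit ?W (?c k)"
   have e: "?e \<in> secs (Sh ?R 0) ?W" using morphismD(2)[OF resolutionD(4)[OF rR] o cW] .
   have de: "Dsh ?R 0 ?W ?e = one_sect (Sh ?R 1) ?W" using resolutionD(5)[OF rR o cW] .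
   have ez: "?e \<in> cocycles (sections ?R ?W) 0" using e de by (simp add: cocycles_def)
   interpret R: comm_group "sect (Sh ?R 0) ?W" using complexD(1)[OF gR, of 0] by simp
   interpret J: comm_group "sect (Sh J 0) ?W" using complexD(1)[OF gJ, of 0] by simp
   interpret t: group_hom "sect (Sh ?R 0) ?W" "sect (Sh J 0) ?W" "\<theta> 0 ?W"
    using chain_mapD(1)[OF c\<theta>, of 0] by unfold_locales simp
   have gc0: "g \<in> secs (Sh ?R 0) ?W" using gc True by simp
   have "h \<otimes>\<^bsub>sect (Sh ?R 0) ?W\<^esub> ?e = g" using True by (simp add: simps h_def fun_eq_iff)
   moreover have hc: "h \<in> secs (Sh ?R 0) ?W"
    unfolding simps
   proof (intro allI impI)
    fix l assume "h l \<noteq> 0"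
    then have "g l \<noteq> 0 \<or> ?e l \<noteq> 0" using True by (auto simp: h_def)
    then show "l \<in> {l. strict_chain S ?W l \<and> l \<noteq> [] \<and> int (length l) = 0 + 1} \<and> hd l \<in> ?W"
     using gc0 e unfolding simps by blast
   qed
   ultimately have hg: "h = g \<otimes>\<^bsub>sect (Sh ?R 0) ?W\<^esub> inv\<^bsub>sect (Sh ?R 0) ?W\<^esub> ?e"
    using R.inv_solve_right[OF hc gc0 e] by simp
   have "h \<in> cocycles (sections ?R ?W) 0"
    unfolding hg using subgroup.m_closed[OF subgroup_cocycles[OF gR, of 0], simplified]
     subgroup.m_inv_closed[OF subgroup_cocycles[OF gR, of 0], simplified] gz ez True by simp
   moreover have "\<theta> 0 ?W h = c"
   proof -
    have "\<theta> 0 ?W ?e = ?\<phi> 0 k" using \<theta>\<iota>[OF o cW] by (simp add: augmentation_def)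
    moreover have "?\<phi> 0 k \<in> secs (Sh J 0) ?W" using calculation t.hom_closed[OF e] by simp
    ultimately show ?thesis
     using hg eq True gc0 e cc by (simp add: J.m_comm[of _ c] J.m_assoc)
   qed
   ultimately show ?thesis using True c by simp
  qed
  then have "h \<in> coboundaries (sections ?R ?W) (int m)"
   using q\<theta>[OF o] unfolding quasi_iso_def by blast
  then obtain v where v: "v \<in> secs (Sh ?R (int m - 1)) ?W" "Dsh ?R (int m - 1) ?W v = h"
   by (auto simp: coboundaries_def)
  have vs: "strict_chain S ?W l \<and> l \<noteq> [] \<and> int (length l) = int m" if "v l \<noteq> 0" for l
   using v(1) that by (auto simp: simps)
  \<comment> \<open>In degree 0 what remains after subtracting \<open>k\<close> vanishes, and the
    constant \<open>k\<close> is the coboundary of the value \<open>k\<close> on the empty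
    chain.\<close>
  define u where "u l = (if m = 0 then (if l = [] then k else 0) else v l)" for l
  have "u l \<noteq> 0 \<Longrightarrow> strict_chain S ?W l \<and> Suc (length l) = n" for l
   using vs[of l] Suc by (auto simp: u_def split: if_splits)
  moreover have "coface u l = g l" if l: "strict_chain S ?W l" "length l = n" for l
  proof (cases "m = 0")
   case True
   then obtain y where y: "l = [y]" using l Suc by (cases l) auto
   have "v = (\<lambda>l. 0)" using vs True by fastforce
   then have "h l = 0" using fun_cong[OF v(2), of l] by (simp add: simps y split: if_splits)
   then show ?thesis using True l by (simp add: h_def y u_def const_cochains_unit_def strict_chain_Cons)
  next
   case False
   have "l \<noteq> []" using l Suc by auto
   then have "coface v l = h l"
    using fun_cong[OF v(2), of l] l Suc hdW[of l] by (simp add: simps)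
   moreover have "coface u l = coface v l" by (rule coface_cong) (simp add: u_def False)
   ultimately show ?thesis using False by (simp add: h_def)
  qed
  ultimately show ?thesis by blast
 qed
 show ?thesis
  unfolding reduced_acyclic_def
 proof (intro allI impI)
  fix g assume "(\<forall>l. g l \<noteq> 0 \<longrightarrow> strict_chain S ?W l) \<and> (\<forall>l. strict_chain S ?W l \<longrightarrow> coface g l = 0)"
  then have g: "\<And>l. g l \<noteq> 0 \<Longrightarrow> strict_chain S ?W l" and dg: "\<And>l. strict_chain S ?W l \<Longrightarrow> coface g l = 0" by auto
  \<comment> \<open>The cocycle is cut into its homogeneous parts, and the primitives are
    reassembled by length; the value at a chain comes from the part that is one longer.\<close>
  define gn where "gn n l = (if length l = n then g l else 0)" for n l
  have "\<exists>u. (\<forall>l. u l \<noteq> 0 \<longrightarrow> strict_chain S ?W l \<and> Suc (length l) = n) \<and>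
   (\<forall>l. strict_chain S ?W l \<and> length l = n \<longrightarrow> coface u l = gn n l)" for n
  proof (rule graded)
   show "gn n l \<noteq> 0 \<Longrightarrow> strict_chain S ?W l \<and> length l = n" for l
    using g[of l] by (auto simp: gn_def split: if_splits)
   fix l assume l: "strict_chain S ?W l"
   show "coface (gn n) l = 0"
   proof (cases "length l = Suc n")
    case True
    have "coface (gn n) l = coface g l"
     by (rule coface_cong) (use True in \<open>simp add: gn_def length_delete_nth\<close>)
    then show ?thesis using dg[OF l] by simp
   next
    case False
    have "coface (gn n) l = coface (\<lambda>m. 0) l"
     by (rule coface_cong) (use False in \<open>auto simp: gn_def length_delete_nth\<close>)
    then show ?thesis by simp
   qed
  qed
  then obtain u where u: "\<And>n l. u n l \<noteq> 0 \<Longrightarrow> strict_chain S ?W l \<and> Suc (length l) = n"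
   and du: "\<And>n l. strict_chain S ?W l \<and> length l = n \<Longrightarrow> coface (u n) l = gn n l"
   by metis
  have "coface (\<lambda>m. u (Suc (length m)) m) l = g l" if l: "strict_chain S ?W l" for l
  proof -
   have "coface (\<lambda>m. u (Suc (length m)) m) l = coface (u (length l)) l"
   proof (rule coface_cong)
    fix i assume i: "i < length l"
    then have "Suc (length (delete_nth i l)) = length l" by (simp add: length_delete_nth)
    then show "u (Suc (length (delete_nth i l))) (delete_nth i l) = u (length l) (delete_nth i l)" by simp
   qed
   then show ?thesis using du[of l "length l"] l by (simp add: gn_def)
  qed
  then show "\<exists>u. (\<forall>l. u l \<noteq> 0 \<longrightarrow> strict_chain S ?W l) \<and> (\<forall>l. strict_chain S ?W l \<longrightarrow> coface u l = g l)"
   using u by (intro exI[of _ "\<lambda>m. u (Suc (length m)) m"]) blast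
 qed
qed

lemma continuous_map_min_nbhd:
 assumes "continuous_map X Y f" "finite_space Y" "x \<in> topspace X" "z \<in> min_nbhd X x"
 shows "f z \<in> min_nbhd Y (f x)"
proof -
 have fx: "f x \<in> topspace Y" using assms(1,3) by (auto simp: continuous_map_def)
 have "openin X {w \<in> topspace X. f w \<in> min_nbhd Y (f x)}"
  using openin_continuous_map_preimage[OF assms(1) openin_min_nbhd[OF assms(2) fx]] .
 from min_nbhd_subset[OF this, of x] assms(3,4) min_nbhd_refl[of "f x" Y] show ?thesis by auto
qed

text \<open>On the inverse image \<open>W\<close> of the smallest neighbourhood of \<open>y\<close>,
  \<open>reduced_acyclic_fibre\<close> is applied with \<open>K\<close> the fibre over
  \<open>y\<close>: for each \<open>q\<close> in \<open>W\<close> the points of the fibre below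
  \<open>q\<close> form an acyclic set by c-properness. So the points of \<open>W\<close> strictly
  below \<open>p\<close> are acyclic when \<open>p\<close> is in \<open>W\<close>, the point
  cochains are exact on \<open>W\<close>, and \<open>I\<close> is exact there by comparison.\<close>

lemma c_proper_point_exact:
 fixes I :: "('x, 'a::infinite) sheaf_complex"
 assumes finX: "finite_space X" and finY: "finite_space Y" and f: "c_proper TYPE('a) X Y f"
  and p: "p \<in> topspace X" and I: "injective_resolution X (const_sheaf X {p}) I \<epsilon>"
  and y: "y \<in> topspace Y" "y \<noteq> f p"
 shows "exact_complex (sections I {x \<in> topspace X. f x \<in> min_nbhd Y y})"
proof -
 have cont: "continuous_map X Y f" using f by (simp add: c_proper_def)
 define W where "W = {x \<in> topspace X. f x \<in> min_nbhd Y y}"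
 have W: "openin X W"
  using openin_continuous_map_preimage[OF cont openin_min_nbhd[OF finY y(1)]] by (simp add: W_def)
 have WX: "x \<in> topspace X" if "x \<in> W" for x using that by (simp add: W_def)
 \<comment> \<open>\<open>y\<close> is the least point of its smallest neighbourhood, so the fibre
   over it is downward closed in \<open>W\<close>.\<close>
 define K where "K = {x. f x = y}"
 have red: "reduced_acyclic X {x \<in> W. q \<in> min_nbhd X x \<and> x \<in> K}" if q: "q \<in> W" for q
 proof -
  have fq: "f q \<in> topspace Y" using WX[OF q] cont by (auto simp: continuous_map_def)
  have "y \<in> Y closure_of {f q}"
   using q y by (simp add: in_closure_of_iff_min_nbhd[OF finY fq] W_def)
  then have "cohomologically_trivial TYPE('a) (subtopology X {x \<in> X closure_of {q}. f x = y})"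
   using f WX[OF q] by (simp add: c_proper_def)
  \<comment> \<open>Over \<open>y\<close> membership in \<open>W\<close> is automatic, so this set
    is the fibre of the closure of \<open>q\<close> to which c-properness applies.\<close>
  moreover have D: "{x \<in> X closure_of {q}. f x = y} = {x \<in> W. q \<in> min_nbhd X x \<and> x \<in> K}"
   using min_nbhd_refl[of y Y] by (auto simp: in_closure_of_iff_min_nbhd[OF finX WX[OF q]] W_def K_def)
  ultimately have "cohomologically_trivial TYPE('a) (subtopology X {x \<in> W. q \<in> min_nbhd X x \<and> x \<in> K})" by simp
  then obtain J :: "('x, 'a) sheaf_complex" and \<eta> where
   "injective_resolution (subtopology X {x \<in> W. q \<in> min_nbhd X x \<and> x \<in> K})
    (const_sheaf (subtopology X {x \<in> W. q \<in> min_nbhd X x \<and> x \<in> K})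
     (topspace (subtopology X {x \<in> W. q \<in> min_nbhd X x \<and> x \<in> K}))) J \<eta>"
   "acyclic_complex (RGamma_red (subtopology X {x \<in> W. q \<in> min_nbhd X x \<and> x \<in> K}) J \<eta>)"
   unfolding cohomologically_trivial_def by blast
  from reduced_acyclic_if_acyclic[OF finite_space_subtopology[OF finX] this]
  have "reduced_acyclic (subtopology X {x \<in> W. q \<in> min_nbhd X x \<and> x \<in> K})
    (topspace (subtopology X {x \<in> W. q \<in> min_nbhd X x \<and> x \<in> K}))" .
  moreover have "topspace (subtopology X {x \<in> W. q \<in> min_nbhd X x \<and> x \<in> K}) = {x \<in> W. q \<in> min_nbhd X x \<and> x \<in> K}"
   using WX by auto
  ultimately show ?thesis
   using reduced_acyclic_subtopology[OF finX, of "{x \<in> W. q \<in> min_nbhd X x \<and> x \<in> K}"] WX by auto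
 qed
 have "exact_complex (sections (point_cochains X p) W)"
 proof (rule point_cochains_exact[OF finX p W])
  assume pW: "p \<in> W"
  let ?E = "{x \<in> W. p \<in> min_nbhd X x \<and> x \<noteq> p}"
  show "reduced_acyclic X ?E"
  proof (rule reduced_acyclic_fibre[OF finX W, of K])
   fix x z assume x: "x \<in> W" "x \<notin> K" and z: "z \<in> min_nbhd X x"
   have "f z \<in> min_nbhd Y (f x)" using continuous_map_min_nbhd[OF cont finY WX[OF x(1)] z] .
   moreover have "f x \<in> min_nbhd Y y" "f x \<noteq> y" using x by (auto simp: W_def K_def)
   ultimately show "z \<notin> K" using min_nbhd_antisym[OF finY y(1), of "f x"] by (auto simp: K_def)
  next
   show "reduced_acyclic X {x \<in> W. q \<in> min_nbhd X x \<and> x \<in> K}" if "q \<in> W" for q using red[OF that] .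
   show "?E \<subseteq> W" by auto
   \<comment> \<open>\<open>p\<close> itself does not lie over \<open>y\<close>, so removing it does
     not affect the fibre.\<close>
   have "?E \<inter> K = {x \<in> W. p \<in> min_nbhd X x \<and> x \<in> K}" using y(2) by (auto simp: K_def)
   then show "reduced_acyclic X (?E \<inter> K)" using red[OF pW] by simp
   fix x z assume x: "x \<in> ?E" and z: "z \<in> W" "x \<in> min_nbhd X z"
   have "p \<in> min_nbhd X z" using min_nbhd_mono[OF finX WX[OF z(1)] z(2)] x by auto
   moreover have "z \<noteq> p" using min_nbhd_antisym[OF finX p, of x] x z by auto
   ultimately show "z \<in> ?E" using z by simp
  qed
 qed
 moreover
 note rI = injective_resolution_imp_resolution[OF finX I]
 have inj: "injective_sheaf X (Sh I n)" for n using I by (simp add: injective_resolution_def)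
 have sub: "subtopology X (topspace X) = X" by simp
 note rR = resolution_point_cochains[OF finX p]
 obtain \<theta> where \<theta>: "complex_morphism X (point_cochains X p) I \<theta>"
  and q\<theta>: "quasi_iso (sections (point_cochains X p) W) (sections I W) (\<lambda>n. \<theta> n W)"
 proof (rule resolution_comparison[OF finX openin_topspace inj resolutionD(1)[OF rI], unfolded sub, OF rI rR
    flasque_point_cochains point_cochains_small[OF finX]])
  fix \<theta>
  assume 1: "complex_morphism X (point_cochains X p) I \<theta>"
   and 3: "\<And>W. openin X W \<Longrightarrow> quasi_iso (sections (point_cochains X p) W) (sections I W) (\<lambda>n. \<theta> n W)"
  show thesis by (rule that[OF 1 3[OF W]])
 qed
 ultimately show ?thesis
  using quasi_iso_exact[OF group_complex_sections[OF resolutionD(1)[OF rR] W]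
    group_complex_sections[OF resolutionD(1)[OF rI] W] chain_map_sections[OF \<theta> W] q\<theta>]
  by (simp add: W_def)
qed

lemma quasi_iso_bij:
 assumes A: "group_complex A" and B: "group_complex B" and \<phi>: "chain_map A B \<phi>"
  and bij: "\<And>n. bij_betw (\<phi> n) (obs A n) (obs B n)"
 shows "quasi_iso A B \<phi>"
 unfolding quasi_iso_def
proof (intro allI conjI ballI impI)
 fix n a assume a: "a \<in> cocycles A n" and fa: "\<phi> n a \<in> coboundaries B n"
 obtain b where b: "b \<in> obs B (n - 1)" "\<phi> n a = Df B (n - 1) b" using fa by (auto simp: coboundaries_def)
 obtain c where c: "c \<in> obs A (n - 1)" "b = \<phi> (n - 1) c"
  using b(1) bij_betw_imp_surj_on[OF bij, of "n - 1"] by auto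
 have "\<phi> n a = \<phi> n (Df A (n - 1) c)" using chain_mapD(2)[OF \<phi> c(1)] b(2) c(2) by simp
 moreover have "Df A (n - 1) c \<in> obs A n"
  using hom_in_carrier[OF complexD(4)[OF A, of "n - 1"] c(1)] by simp
 moreover have "a \<in> obs A n" using a by (simp add: cocycles_def)
 ultimately have "a = Df A (n - 1) c" using bij_betw_imp_inj_on[OF bij, of n] by (auto dest: inj_onD)
 then show "a \<in> coboundaries A n" using c(1) by (simp add: coboundaries_def)
next
 fix n b assume b: "b \<in> cocycles B n"
 have bc: "b \<in> obs B n" "Df B n b = one_ob B (n + 1)" using b by (auto simp: cocycles_def)
 then obtain a where a: "a \<in> obs A n" "b = \<phi> n a"
  using bij_betw_imp_surj_on[OF bij, of n] by auto
 have "\<phi> (n + 1) (Df A n a) = \<phi> (n + 1) (one_ob A (n + 1))"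
  using chain_mapD(2)[OF \<phi> a(1)] a(2) bc(2) hom_one[OF chain_mapD(1)[OF \<phi>, of "n + 1"]]
   complexD(2)[OF A] complexD(2)[OF B] by simp
 moreover have "Df A n a \<in> obs A (n + 1)" using hom_in_carrier[OF complexD(4)[OF A] a(1)] .
 moreover have "(one_ob A (n + 1)) \<in> obs A (n + 1)" using monoid.one_closed[OF complexD(3)[OF A]] .
 ultimately have "Df A n a = one_ob A (n + 1)" using bij_betw_imp_inj_on[OF bij, of "n + 1"] by (auto dest: inj_onD)
 then have "a \<in> cocycles A n" using a(1) by (simp add: cocycles_def)
 moreover have "b = \<phi> n a \<otimes>\<^bsub>Ob B n\<^esub> (one_ob B n)"
  using a(2) bc(1) monoid.r_one[OF complexD(3)[OF B]] by simp
 moreover have "(one_ob B n) \<in> coboundaries B n" using subgroup.one_closed[OF subgroup_coboundaries[OF B]] .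
 ultimately show "\<exists>a\<in>cocycles A n. \<exists>c\<in>coboundaries B n. b = \<phi> n a \<otimes>\<^bsub>Ob B n\<^esub> c" by blast
qed

lemma chain_map_compose:
 assumes "chain_map A B \<phi>" "chain_map B C \<psi>"
 shows "chain_map A C (\<lambda>n a. \<psi> n (\<phi> n a))"
 unfolding chain_map_def
proof (intro conjI allI ballI)
 fix n
 show "(\<lambda>a. \<psi> n (\<phi> n a)) \<in> hom (Ob A n) (Ob C n)"
  using hom_compose[OF chain_mapD(1)[OF assms(1), of n] chain_mapD(1)[OF assms(2), of n]] by (simp add: comp_def)
 fix a assume a: "a \<in> obs A n"
 show "\<psi> (n + 1) (\<phi> (n + 1) (Df A n a)) = Df C n (\<psi> n (\<phi> n a))"
  using chain_mapD(2)[OF assms(1) a] chain_mapD(2)[OF assms(2) hom_in_carrier[OF chain_mapD(1)[OF assms(1)] a]]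
  by simp
qed

lemma quasi_iso_compose:
 assumes A: "group_complex A" and B: "group_complex B" and C: "group_complex C"
  and \<phi>: "chain_map A B \<phi>" and \<psi>: "chain_map B C \<psi>"
  and q\<phi>: "quasi_iso A B \<phi>" and q\<psi>: "quasi_iso B C \<psi>"
 shows "quasi_iso A C (\<lambda>n a. \<psi> n (\<phi> n a))"
 unfolding quasi_iso_def
proof (intro allI conjI ballI impI)
 fix n a assume a: "a \<in> cocycles A n" and fa: "\<psi> n (\<phi> n a) \<in> coboundaries C n"
 have "\<phi> n a \<in> coboundaries B n"
  using q\<psi> chain_map_cocycles[OF A B \<phi> a] fa unfolding quasi_iso_def by blast
 then show "a \<in> coboundaries A n" using q\<phi> a unfolding quasi_iso_def by blast
next
 fix n c assume c: "c \<in> cocycles C n"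
 obtain b r where b: "b \<in> cocycles B n" and r: "r \<in> coboundaries C n" and cb: "c = \<psi> n b \<otimes>\<^bsub>Ob C n\<^esub> r"
  using q\<psi> c unfolding quasi_iso_def by blast
 obtain a s where a: "a \<in> cocycles A n" and s: "s \<in> coboundaries B n" and ba: "b = \<phi> n a \<otimes>\<^bsub>Ob B n\<^esub> s"
  using q\<phi> b unfolding quasi_iso_def by blast
 interpret C: comm_group "Ob C n" using complexD(1)[OF C] .
 have ps: "\<psi> n s \<in> coboundaries C n" using chain_map_coboundaries[OF \<psi> s] .
 have car: "\<phi> n a \<in> obs B n" "s \<in> obs B n" "r \<in> obs C n"
  using chain_map_cocycles[OF A B \<phi> a] subgroup.mem_carrier[OF subgroup_coboundaries[OF B] s]
   subgroup.mem_carrier[OF subgroup_coboundaries[OF C] r] by (auto simp: cocycles_def)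
 have "c = \<psi> n (\<phi> n a) \<otimes>\<^bsub>Ob C n\<^esub> (\<psi> n s \<otimes>\<^bsub>Ob C n\<^esub> r)"
  unfolding cb ba hom_mult[OF chain_mapD(1)[OF \<psi>] car(1,2)]
  using car hom_in_carrier[OF chain_mapD(1)[OF \<psi>, of n]] by (simp add: C.m_assoc)
 moreover have "\<psi> n s \<otimes>\<^bsub>Ob C n\<^esub> r \<in> coboundaries C n"
  using subgroup.m_closed[OF subgroup_coboundaries[OF C] ps r] .
 ultimately show "\<exists>a\<in>cocycles A n. \<exists>r\<in>coboundaries C n. c = \<psi> n (\<phi> n a) \<otimes>\<^bsub>Ob C n\<^esub> r"
  using a by blast
qed

subsection \<open>The relative complex\<close>

text \<open>The sheaf of integers on the closure of \<open>p\<close> is the skyscraper sheaf at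
  \<open>p\<close>: an open set that meets the closure contains \<open>p\<close>, and a section is
  constant on the closure with its value there.\<close>

lemma flasque_const_sheaf_closure:
 assumes fin: "finite_space E" and p: "p \<in> topspace E"
 shows "flasque E (const_sheaf E {x \<in> topspace E. p \<in> min_nbhd E x})"
 unfolding flasque_def
proof (intro allI impI ballI)
 let ?G = "{x \<in> topspace E. p \<in> min_nbhd E x}"
 fix U W s assume UW: "openin E U \<and> openin E W \<and> W \<subseteq> U" and s: "s \<in> secs (const_sheaf E ?G) W"
 then have U: "openin E U" and W: "openin E W" and WU: "W \<subseteq> U" by auto
 note sW = s[unfolded mem_const_sheaf[OF fin W]]
 have pW: "p \<in> W" if "x \<in> W \<inter> ?G" for x using that min_nbhd_subset[OF W] by auto
 have sx: "s x = s p" if x: "x \<in> W \<inter> ?G" for x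
 proof -
  have "p \<in> min_nbhd E x \<inter> ?G" using x p min_nbhd_refl[of p E] by auto
  then show ?thesis using bspec[OF bspec[OF conjunct2[OF sW]], of x p] x by simp
 qed
 define k where "k = (if p \<in> W then s p else 0)"
 define t where "t x = (if x \<in> U \<inter> ?G then k else 0)" for x
 have down: "x \<in> ?G" if "x \<in> U" "y \<in> min_nbhd E x" "y \<in> ?G" for x y
  using that min_nbhd_mono[OF fin, of x y] openin_subset[OF U] by auto
 have "t \<in> secs (const_sheaf E ?G) U"
  unfolding mem_const_sheaf[OF fin U]
 proof (intro conjI allI impI ballI)
  show "x \<notin> U \<inter> ?G \<Longrightarrow> t x = 0" for x by (auto simp: t_def)
  fix x y assume x: "x \<in> U" and y: "y \<in> min_nbhd E x \<inter> ?G"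
  then have "x \<in> ?G" "y \<in> U" using down min_nbhd_subset[OF U x] by blast+
  then show "t y = t x" using x y by (simp add: t_def)
 qed
 moreover have "rest (const_sheaf E ?G) U W t x = s x" for x
 proof (cases "x \<in> W \<inter> ?G")
  case True
  then show ?thesis using sx[OF True] pW[OF True] WU by (auto simp: const_sheaf_simps t_def k_def)
 next
  case False
  then have "s x = 0" using sW by blast
  then show ?thesis using False by (auto simp: const_sheaf_simps t_def)
 qed
 ultimately show "\<exists>t\<in>secs (const_sheaf E ?G) U. rest (const_sheaf E ?G) U W t = s" by blast
qed

lemma const_sheaf_small:
 assumes fin: "finite_space E" and U: "openin E U"
 shows "secs (const_sheaf E S) U \<lesssim> (UNIV :: 'a::infinite set)"
proof -
 have "secs (const_sheaf E S) U \<subseteq> {g. \<forall>l. g l \<noteq> 0 \<longrightarrow> l \<in> topspace E}"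
 proof
  fix g assume g: "g \<in> secs (const_sheaf E S) U"
  have "l \<in> topspace E" if "g l \<noteq> 0" for l
  proof (rule ccontr)
   assume "l \<notin> topspace E"
   then have "l \<notin> U \<inter> S" using openin_subset[OF U] by auto
   then show False using g that unfolding mem_const_sheaf[OF fin U] by blast
  qed
  then show "g \<in> {g. \<forall>l. g l \<noteq> 0 \<longrightarrow> l \<in> topspace E}" by blast
 qed
 moreover have "finite (topspace E)" using fin by (simp add: finite_space_def)
 ultimately show ?thesis
  by (rule countable_lepoll_infinite_type[OF countable_subset[OF _ countable_finite_support]])
qed

text \<open>To be applied with \<open>E\<close> the inverse image of the smallest neighbourhood of
  \<open>f p\<close>, where the closure of \<open>p\<close> in its fibre becomes the closure of
  \<open>p\<close> in \<open>E\<close>. \<open>J\<close> enters as a flasque resolution.\<close>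

locale point_boundary =
 fixes E :: "'s topology" and p :: 's and G :: "'s set" and dG :: "'s topology"
  and J :: "('s, 'a) sheaf_complex" and \<eta> :: "'s set \<Rightarrow> ('s \<Rightarrow> int) \<Rightarrow> 'a"
 assumes fin: "finite_space E" and p: "p \<in> topspace E"
  and G: "G = {x \<in> topspace E. p \<in> min_nbhd E x}"
  and dG: "dG = subtopology E (G - {p})"
  and J: "resolution dG (const_sheaf dG (topspace dG)) J \<eta>"
  and flJ: "\<And>n. flasque dG (Sh J n)"
begin

abbreviation B :: "'s set" where "B \<equiv> topspace dG"

abbreviation K :: "('s, 's \<Rightarrow> int) sheaf_complex" where "K \<equiv> sheaf_deg0 (const_sheaf E G)"

abbreviation L :: "('s, 'a) sheaf_complex" where "L \<equiv> pushforward dG id J"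

abbreviation \<rho> :: "('s \<Rightarrow> int) \<Rightarrow> 's \<Rightarrow> int" where "\<rho> s \<equiv> (\<lambda>x. if x \<in> B then s x else 0)"

abbreviation \<phi> :: "int \<Rightarrow> 's set \<Rightarrow> ('s \<Rightarrow> int) \<Rightarrow> 'a" where
 "\<phi> n U s \<equiv> augmentation J \<eta> n (U \<inter> B) (\<rho> s)"

abbreviation R :: "('s, ('s \<Rightarrow> int) \<times> 'a) sheaf_complex" where "R \<equiv> relative_complex E G dG J \<eta>"

lemma relative_complex_eq: "R = sheaf_shift (-1) (sheaf_cone \<phi> K L)"
 by (simp add: relative_complex_def)

lemma B_eq: "B = G - {p}"
 by (auto simp: dG G)

lemma fin_dG: "finite_space dG"
 unfolding dG by (rule finite_space_subtopology[OF fin])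

lemma openin_B: "openin E U \<Longrightarrow> openin dG (U \<inter> B)"
 unfolding B_eq by (auto simp: dG openin_subtopology)

lemma min_nbhd_dG:
 assumes "x \<in> B" shows "min_nbhd dG x = min_nbhd E x \<inter> B"
proof -
 have "x \<in> topspace E" "x \<in> G - {p}" using assms unfolding B_eq G by auto
 from min_nbhd_subtopology[OF fin this] show ?thesis unfolding dG[symmetric] B_eq .
qed

lemma pre_eq: "{x \<in> B. id x \<in> U} = U \<inter> B"
 by auto

lemma L_simps:
 "sect (Sh L n) U = sect (Sh J n) (U \<inter> B)"
 "rest (Sh L n) U W s = rest (Sh J n) (U \<inter> B) (W \<inter> B) s"
 "Dsh L n U = Dsh J n (U \<inter> B)"
 unfolding pushforward_simps pre_eq by simp_all

lemma cont: "continuous_map dG E id"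
 unfolding dG by (simp add: continuous_map_from_subtopology)

lemma K_complex: "is_sheaf_complex E K"
 by (rule is_sheaf_complex_deg0[OF fin sheaf_const_sheaf[OF fin]])

lemma L_complex: "is_sheaf_complex E L"
 by (rule is_sheaf_complex_pushforward[OF cont resolutionD(1)[OF J]])

lemma \<rho>_carrier:
 assumes U: "openin E U" and s: "s \<in> secs (const_sheaf E G) U"
 shows "\<rho> s \<in> secs (const_sheaf dG B) (U \<inter> B)"
 unfolding mem_const_sheaf[OF fin_dG openin_B[OF U]]
proof (intro conjI allI impI ballI)
 show "\<rho> s x = 0" if "x \<notin> U \<inter> B \<inter> B" for x
  using that s unfolding mem_const_sheaf[OF fin U] by auto
 fix x y assume x: "x \<in> U \<inter> B" and y: "y \<in> min_nbhd dG x \<inter> B"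
 then have "y \<in> min_nbhd E x \<inter> G" "y \<in> B" using min_nbhd_dG[of x] by (auto simp: B_eq)
 then show "\<rho> s y = \<rho> s x" using s x unfolding mem_const_sheaf[OF fin U] by simp
qed

lemma J_group: "openin E U \<Longrightarrow> group (sect (Sh J n) (U \<inter> B))"
 using presheafD(2)[OF is_sheaf_complexD(2)[OF resolutionD(1)[OF J]] openin_B] .

lemma J_comm_group: "openin E U \<Longrightarrow> comm_group (sect (Sh J n) (U \<inter> B))"
 using presheafD(1)[OF is_sheaf_complexD(2)[OF resolutionD(1)[OF J]] openin_B] .

lemma J_d_hom: "openin E U \<Longrightarrow> Dsh J n (U \<inter> B) \<in> hom (sect (Sh J n) (U \<inter> B)) (sect (Sh J (n + 1)) (U \<inter> B))"
 using morphismD(1)[OF is_sheaf_complexD(3)[OF resolutionD(1)[OF J]] openin_B] .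

lemma J_d_one: "openin E U \<Longrightarrow> Dsh J n (U \<inter> B) (one_sect (Sh J n) (U \<inter> B)) = one_sect (Sh J (n + 1)) (U \<inter> B)"
 using hom_one[OF J_d_hom J_group J_group] .

lemma \<eta>_hom: "openin E U \<Longrightarrow> \<eta> (U \<inter> B) \<in> hom (sect (const_sheaf dG B) (U \<inter> B)) (sect (Sh J 0) (U \<inter> B))"
 using morphismD(1)[OF resolutionD(4)[OF J] openin_B] .

lemma \<eta>_zero: assumes "openin E U" shows "\<eta> (U \<inter> B) (\<lambda>x. 0) = one_sect (Sh J 0) (U \<inter> B)"
 using hom_one[OF \<eta>_hom[OF assms] presheafD(2)[OF resolutionD(2)[OF J] openin_B[OF assms]] J_group[OF assms]]
 by (simp add: const_sheaf_simps)

lemma \<phi>_morphism: "complex_morphism E K L \<phi>"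
 unfolding complex_morphism_def
proof (intro conjI allI impI ballI)
 show "is_sheaf_complex E K" by (rule K_complex)
 show "is_sheaf_complex E L" by (rule L_complex)
 fix n
 show "sheaf_morphism E (Sh K n) (Sh L n) (\<phi> n)"
 proof (cases "n = 0")
  case False
  have "sheaf_morphism E (Sh K n) (Sh L n) (\<lambda>U s. (one_sect (Sh L n) U))"
   by (rule sheaf_morphism_one[OF is_sheaf_complexD(2)[OF K_complex] is_sheaf_complexD(2)[OF L_complex]])
  then show ?thesis using False by (simp add: augmentation_def L_simps)
 next
  case True
  show ?thesis
   unfolding sheaf_morphism_def True
  proof (intro conjI allI impI ballI)
   fix U assume U: "openin E U"
   show "\<phi> 0 U \<in> hom (sect (Sh K 0) U) (sect (Sh L 0) U)"
   proof (rule homI)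
    fix s assume "s \<in> secs (Sh K 0) U"
    then have s: "s \<in> secs (const_sheaf E G) U" by (simp add: sheaf_deg0_simps)
    show "\<phi> 0 U s \<in> secs (Sh L 0) U"
     using hom_in_carrier[OF \<eta>_hom[OF U] \<rho>_carrier[OF U s]] by (simp add: augmentation_def L_simps)
    fix t assume "t \<in> secs (Sh K 0) U"
    then have t: "t \<in> secs (const_sheaf E G) U" by (simp add: sheaf_deg0_simps)
    have m: "s \<otimes>\<^bsub>sect (Sh K 0) U\<^esub> t = (\<lambda>x. s x + t x)" by (simp add: sheaf_deg0_simps const_sheaf_simps)
    have "\<rho> (\<lambda>x. s x + t x) = (\<lambda>x. \<rho> s x + \<rho> t x)" by auto
    then show "\<phi> 0 U (s \<otimes>\<^bsub>sect (Sh K 0) U\<^esub> t) = \<phi> 0 U s \<otimes>\<^bsub>sect (Sh L 0) U\<^esub> \<phi> 0 U t"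
     unfolding m using hom_mult[OF \<eta>_hom[OF U] \<rho>_carrier[OF U s] \<rho>_carrier[OF U t]]
     by (simp add: augmentation_def L_simps const_sheaf_simps)
   qed
  next
   fix U W s assume UW: "openin E U \<and> openin E W \<and> W \<subseteq> U" and "s \<in> secs (Sh K 0) U"
   then have U: "openin E U" and W: "openin E W" "W \<inter> B \<subseteq> U \<inter> B" and s: "s \<in> secs (const_sheaf E G) U"
    by (auto simp: sheaf_deg0_simps)
   have r: "rest (Sh K 0) U W s = (\<lambda>x. if x \<in> W then s x else 0)" by (simp add: sheaf_deg0_simps const_sheaf_simps)
   have "\<rho> (\<lambda>x. if x \<in> W then s x else 0) = (\<lambda>x. if x \<in> W \<inter> B then \<rho> s x else 0)" by auto
   then show "\<phi> 0 W (rest (Sh K 0) U W s) = rest (Sh L 0) U W (\<phi> 0 U s)"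
    unfolding r using morphismD(3)[OF resolutionD(4)[OF J] openin_B[OF U] openin_B[OF W(1)] W(2) \<rho>_carrier[OF U s]]
    by (simp add: augmentation_def L_simps const_sheaf_simps)
  qed
 qed
 fix U s assume U: "openin E U" and s: "s \<in> secs (Sh K n) U"
 have d: "Dsh K n U s = (\<lambda>x. 0)" by (simp add: sheaf_deg0_simps const_sheaf_simps)
 have r0: "\<rho> (\<lambda>x. 0) = (\<lambda>x. 0)" by auto
 show "\<phi> (n + 1) U (Dsh K n U s) = Dsh L n U (\<phi> n U s)"
 proof (cases "n = 0")
  case True
  then have s': "s \<in> secs (const_sheaf E G) U" using s by (simp add: sheaf_deg0_simps)
  show ?thesis
   unfolding d r0 using True resolutionD(5)[OF J openin_B[OF U] \<rho>_carrier[OF U s']]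
   by (simp add: augmentation_def L_simps)
 next
  case False
  show ?thesis
  \<comment> \<open>From degree -1 the differential leads to degree 0, where the augmentation is
    \<open>\<eta>\<close> of the zero function and not the unit by definition.\<close>
  proof (cases "n + 1 = 0")
   case True
   then have n: "n = -1" by simp
   show ?thesis unfolding d r0 unfolding n using \<eta>_zero[OF U] J_d_one[OF U, of "-1"] by (simp add: augmentation_def L_simps)
  next
   case F: False
   show ?thesis unfolding d r0 using False F J_d_one[OF U, of n] by (simp add: augmentation_def L_simps)
  qed
 qed
qed

lemma R_complex: "is_sheaf_complex E R"
 unfolding relative_complex_eq
 by (rule is_sheaf_complex_shift[OF is_sheaf_complex_cone[OF fin \<phi>_morphism]])

lemma R_sect: "sect (Sh R n) U = sect (Sh K n) U \<times>\<times> sect (Sh J (n - 1)) (U \<inter> B)"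
 unfolding relative_complex_eq sheaf_shift_simps sheaf_cone_simps L_simps by simp

lemma R_rest: "rest (Sh R n) U W (s, t) = (rest (Sh K n) U W s, rest (Sh J (n - 1)) (U \<inter> B) (W \<inter> B) t)"
 unfolding relative_complex_eq sheaf_shift_simps sheaf_cone_simps L_simps by simp

text \<open>In degree \<open>n\<close> the first component of \<open>R\<close> is \<open>K\<close>
  and the second is \<open>J\<close> in degree \<open>n - 1\<close>. The shift by -1 reverses the
  sign of the cone differential, hence the inverse; \<open>K\<close> itself has zero
  differential.\<close>

lemma R_d:
 assumes U: "openin E U" and s: "s \<in> secs (Sh K n) U" and b: "b \<in> secs (Sh J (n - 1)) (U \<inter> B)"
 shows "Dsh R n U (s, b) = ((\<lambda>x. 0), inv\<^bsub>sect (Sh J n) (U \<inter> B)\<^esub> (\<phi> n U s \<otimes>\<^bsub>sect (Sh J n) (U \<inter> B)\<^esub> Dsh J (n - 1) (U \<inter> B) b))"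
proof -
 have e: "n + - 1 + 1 = n" "n + - 1 + 2 = n + 1" "n + - 1 = n - 1" by simp_all
 have g1: "group (sect (Sh K (n + 1)) U)" using presheafD(2)[OF is_sheaf_complexD(2)[OF K_complex] U] .
 have one: "(one_sect (Sh K (n + 1)) U) = (\<lambda>x. 0)"
  by (simp add: sheaf_deg0_simps singleton_group_def const_sheaf_simps)
 have gJ: "group (sect (Sh J n) (U \<inter> B))" using J_group[OF U] .
 have f: "\<phi> n U s \<in> secs (Sh J n) (U \<inter> B)"
  using morphismD(2)[OF complex_morphismD(3)[OF \<phi>_morphism] U s] unfolding L_simps .
 have db: "Dsh J (n - 1) (U \<inter> B) b \<in> secs (Sh J n) (U \<inter> B)"
  using hom_in_carrier[OF J_d_hom[OF U, of "n - 1"] b] by simp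
 have i: "inv\<^bsub>sect (Sh K (n + 1)) U\<^esub> (\<lambda>x. 0) = (\<lambda>x. 0)"
  using monoid.inv_one[OF group.is_monoid[OF g1]] unfolding one .
 have c: "\<phi> n U s \<otimes>\<^bsub>sect (Sh J n) (U \<inter> B)\<^esub> Dsh J (n - 1) (U \<inter> B) b \<in> secs (Sh J n) (U \<inter> B)"
  using monoid.m_closed[OF group.is_monoid[OF gJ] f db] .
 have z: "(\<lambda>x. 0) \<in> secs (Sh K (n + 1)) U"
  using monoid.one_closed[OF group.is_monoid[OF g1]] unfolding one .
 have "Dsh R n U (s, b) = inv\<^bsub>sect (Sh K (n + 1)) U \<times>\<times> sect (Sh J n) (U \<inter> B)\<^esub>
   (inv\<^bsub>sect (Sh K (n + 1)) U\<^esub> (\<lambda>x. 0), \<phi> n U s \<otimes>\<^bsub>sect (Sh J n) (U \<inter> B)\<^esub> Dsh J (n - 1) (U \<inter> B) b)"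
  unfolding relative_complex_eq sheaf_shift_simps(2) sheaf_cone_simps(1,3) e group_cone_simps sections_simps L_simps
  by (simp add: sheaf_deg0_simps(3) const_sheaf_simps e add.commute[of 1 n])
 then show ?thesis unfolding i inv_DirProd[OF g1 gJ z c] .
qed

text \<open>\<open>p\<close> is open in its closure \<open>G\<close>, so the functions supported at
  \<open>p\<close> form a subsheaf of the sheaf on \<open>G\<close>, and they die on
  \<open>G - {p}\<close>.\<close>

lemma point_sect_subset:
 assumes U: "openin E U" and s: "s \<in> secs (const_sheaf E {p}) U"
 shows "s \<in> secs (const_sheaf E G) U" "\<rho> s = (\<lambda>x. 0)"
proof -
 have z: "s x = 0" if "x \<noteq> p \<or> x \<notin> U" for x using s that unfolding mem_const_sheaf[OF fin U] by auto
 show "\<rho> s = (\<lambda>x. 0)" using z by (auto simp: B_eq)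
 have pG: "p \<in> G" using p min_nbhd_refl[of p E] by (simp add: G)
 show "s \<in> secs (const_sheaf E G) U"
  unfolding mem_const_sheaf[OF fin U]
 proof (intro conjI allI impI ballI)
  show "s x = 0" if "x \<notin> U \<inter> G" for x using z[of x] that pG by blast
  fix x y assume x: "x \<in> U" and y: "y \<in> min_nbhd E x \<inter> G"
  show "s y = s x"
  proof (cases "y = p")
   case True
   then show ?thesis using s x y unfolding mem_const_sheaf[OF fin U] by blast
  next
   case False
   have "x \<noteq> p"
   proof
    assume "x = p"
    then have "y = p" using min_nbhd_antisym[OF fin p, of y] y G by auto
    then show False using False by simp
   qed
   then show ?thesis using z False by simp
  qed
 qed
qed

text \<open>Stalk by stalk, the sections of the sheaf on \<open>G\<close> map onto the degree 0
  cocycles of \<open>J\<close>, with kernel the functions supported at \<open>p\<close>, and in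
  positive degrees \<open>J\<close> is exact. At points outside \<open>B\<close> the sections of
  \<open>J\<close> are taken over the empty set.\<close>

lemma R_resolution:
 "resolution E (const_sheaf E {p}) R (\<lambda>U s. (s, (one_sect (Sh J (- 1)) (U \<inter> B))))" (is "resolution _ _ _ ?\<iota>")
 unfolding resolution_def Let_def
proof (intro conjI allI impI ballI)
 have K0: "sect (Sh K 0) U = sect (const_sheaf E G) U" for U by (simp add: sheaf_deg0_simps)
 have Kn: "secs (Sh K n) U = {\<lambda>x. 0}" if "n \<noteq> 0" for n U
  using that by (simp add: sheaf_deg0_simps singleton_group_def const_sheaf_simps)
 have K1: "(one_sect (Sh K n) U) = (\<lambda>x. 0)" for n U
  by (simp add: sheaf_deg0_simps singleton_group_def const_sheaf_simps)
 have Kz: "(\<lambda>x. 0) \<in> secs (Sh K n) U" if "openin E U" for n U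
  using monoid.one_closed[OF presheafD(3)[OF is_sheaf_complexD(2)[OF K_complex] that]] unfolding K1 .
 have J1: "(one_sect (Sh J n) (U \<inter> B)) \<in> secs (Sh J n) (U \<inter> B)" if "openin E U" for n U
  using monoid.one_closed[OF group.is_monoid[OF J_group[OF that]]] .
 have Jneg: "b = one_sect (Sh J n) (U \<inter> B)" if "n < 0" "openin E U" "b \<in> secs (Sh J n) (U \<inter> B)" for n U b
  using resolutionD(3)[OF J that(1) openin_B[OF that(2)] that(3)] .
 have oneR: "(one_sect (Sh R n) U) = (\<lambda>x. 0, (one_sect (Sh J (n - 1)) (U \<inter> B)))" for n U
  unfolding R_sect by (simp add: K1)
 have \<phi>0: "augmentation J \<eta> 0 U s = \<eta> U s" for U s by (simp add: augmentation_def)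
 have \<phi>n: "augmentation J \<eta> n U s = one_sect (Sh J n) U" if "n \<noteq> 0" for n U s using that by (simp add: augmentation_def)
 show "is_sheaf_complex E R" by (rule R_complex)
 show "presheaf E (const_sheaf E {p})" by (rule sheaf_imp_presheaf[OF sheaf_const_sheaf[OF fin]])
 show "secs (Sh R n) U \<subseteq> {(one_sect (Sh R n) U)}" if "n < 0" "openin E U" for n U
  using Kn[of n U] Jneg[of "n - 1" U] that unfolding oneR R_sect by (auto simp: K1)
 show "sheaf_morphism E (const_sheaf E {p}) (Sh R 0) ?\<iota>"
  unfolding sheaf_morphism_def
 proof (intro conjI allI impI ballI)
  fix U assume U: "openin E U"
  show "?\<iota> U \<in> hom (sect (const_sheaf E {p}) U) (sect (Sh R 0) U)"
   unfolding R_sect K0 using point_sect_subset(1)[OF U] J1[OF U, of "-1"] monoid.l_one[OF group.is_monoid[OF J_group[OF U, of "-1"]]]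
   by (intro homI) (auto simp: const_sheaf_simps)
 next
  fix U W s assume UW: "openin E U \<and> openin E W \<and> W \<subseteq> U"
  have "rest (Sh J (- 1)) (U \<inter> B) (W \<inter> B) (one_sect (Sh J (- 1)) (U \<inter> B)) = one_sect (Sh J (- 1)) (W \<inter> B)"
   using UW openin_B by (intro presheaf_rest_one[OF is_sheaf_complexD(2)[OF resolutionD(1)[OF J]]]) auto
  then show "?\<iota> W (rest (const_sheaf E {p}) U W s) = rest (Sh R 0) U W (?\<iota> U s)"
   unfolding R_rest by (simp add: sheaf_deg0_simps const_sheaf_simps)
 qed
 show "Dsh R 0 U (?\<iota> U s) = one_sect (Sh R 1) U" if U: "openin E U" and s: "s \<in> secs (const_sheaf E {p}) U" for U s
 proof -
  interpret J0: group "sect (Sh J 0) (U \<inter> B)" using J_group[OF U] .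
  have "Dsh R 0 U (s, (one_sect (Sh J (0 - 1)) (U \<inter> B))) = ((\<lambda>x. 0), (one_sect (Sh J 0) (U \<inter> B)))"
   using R_d[OF U, of s 0 "(one_sect (Sh J (0 - 1)) (U \<inter> B))"] point_sect_subset[OF U s] K0 J1[OF U]
    \<eta>_zero[OF U] J_d_one[OF U, of "-1"] by (simp add: augmentation_def)
  then show ?thesis unfolding oneR by simp
 qed
 fix x assume x: "x \<in> topspace E"
 let ?U = "min_nbhd E x"
 have U: "openin E ?U" by (rule openin_min_nbhd[OF fin x])
 show "s = one_sect (const_sheaf E {p}) ?U" if "?\<iota> ?U s = one_sect (Sh R 0) ?U" for s
  using that unfolding oneR by (simp add: const_sheaf_simps)
 \<comment> \<open>A point outside \<open>B\<close> with a point of \<open>B\<close> in its smallest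
   neighbourhood would lie below \<open>p\<close>, hence be \<open>p\<close>; but no other point of
   \<open>G\<close> lies above \<open>p\<close>.\<close>
 have empty: "?U \<inter> B = {}" if "x \<notin> B"
 proof (rule ccontr)
  assume "?U \<inter> B \<noteq> {}"
  then obtain y where y: "y \<in> ?U" "y \<in> G" "y \<noteq> p" by (auto simp: B_eq)
  then have "p \<in> min_nbhd E y" by (simp add: G)
  then have "p \<in> ?U" using min_nbhd_mono[OF fin x y(1)] by auto
  then have "x \<in> G" using x by (simp add: G)
  then have "x = p" using that by (simp add: B_eq)
  then have "y = p" using min_nbhd_antisym[OF fin p, of y] y G by auto
  then show False using y by simp
 qed
 show "a \<in> ?\<iota> ?U ` secs (const_sheaf E {p}) ?U"
  if "a \<in> secs (Sh R 0) ?U" and da: "Dsh R 0 ?U a = one_sect (Sh R 1) ?U" for a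
 proof -
  obtain s b where a: "a = (s, b)" "s \<in> secs (const_sheaf E G) ?U" "b \<in> secs (Sh J (0 - 1)) (?U \<inter> B)"
   using \<open>a \<in> _\<close> unfolding R_sect K0 by auto
  have b: "b = one_sect (Sh J (- 1)) (?U \<inter> B)" using Jneg[OF _ U a(3)] by simp
  interpret J0: group "sect (Sh J 0) (?U \<inter> B)" using J_group[OF U] .
  have fs: "\<eta> (?U \<inter> B) (\<rho> s) \<in> secs (Sh J 0) (?U \<inter> B)"
   using hom_in_carrier[OF \<eta>_hom[OF U] \<rho>_carrier[OF U a(2)]] .
  have "inv\<^bsub>sect (Sh J 0) (?U \<inter> B)\<^esub> \<eta> (?U \<inter> B) (\<rho> s) = one_sect (Sh J 0) (?U \<inter> B)"
   using da R_d[OF U, of s 0 b] a K0 fs J_d_one[OF U, of "-1"] unfolding oneR by (simp add: \<phi>0 b)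
  then have \<eta>s: "\<eta> (?U \<inter> B) (\<rho> s) = one_sect (Sh J 0) (?U \<inter> B)" using fs by (metis J0.inv_inv J0.inv_one)
  \<comment> \<open>\<open>\<eta>\<close> is known to be injective on the stalks of
    \<open>dG\<close>, so \<open>\<rho> s\<close> is restricted to the smallest neighbourhood of
    each point of \<open>B\<close>.\<close>
  have sB: "s z = 0" if z: "z \<in> ?U" "z \<in> B" for z
  proof -
   let ?N = "min_nbhd dG z"
   have o: "openin dG ?N" using openin_min_nbhd[OF fin_dG z(2)] .
   have sub: "?N \<subseteq> ?U \<inter> B" using min_nbhd_subset[OF openin_B[OF U]] z by auto
   let ?r = "rest (const_sheaf dG B) (?U \<inter> B) ?N (\<rho> s)"
   have "\<eta> ?N ?r = one_sect (Sh J 0) ?N"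
    using morphismD(3)[OF resolutionD(4)[OF J] openin_B[OF U] o sub \<rho>_carrier[OF U a(2)]]
     presheaf_rest_one[OF is_sheaf_complexD(2)[OF resolutionD(1)[OF J]] openin_B[OF U] o sub] \<eta>s by simp
   moreover have "?r \<in> secs (const_sheaf dG B) ?N"
    using presheafD(5)[OF resolutionD(2)[OF J] openin_B[OF U] o sub \<rho>_carrier[OF U a(2)]] .
   ultimately have "?r = one_sect (const_sheaf dG B) ?N" using resolutionD(6)[OF J z(2)] by blast
   from fun_cong[OF this, of z] show ?thesis using z(2) min_nbhd_refl[of z dG] by (simp add: const_sheaf_simps)
  qed
  have "s \<in> secs (const_sheaf E {p}) ?U"
   unfolding mem_const_sheaf[OF fin U]
  proof (intro conjI allI impI ballI)
   show "s z = 0" if "z \<notin> ?U \<inter> {p}" for z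
   proof (cases "z \<in> ?U \<inter> G")
    case True
    then show ?thesis using sB[of z] that by (auto simp: B_eq)
   next
    case False
    then show ?thesis using a(2) unfolding mem_const_sheaf[OF fin U] by blast
   qed
   fix y z assume y: "y \<in> ?U" and z: "z \<in> min_nbhd E y \<inter> {p}"
   have "z \<in> min_nbhd E y \<inter> G" using z p min_nbhd_refl[of p E] by (auto simp: G)
   then show "s z = s y" using a(2) y unfolding mem_const_sheaf[OF fin U] by blast
  qed
  then show ?thesis using a(1) b by auto
 qed
 show "a \<in> Dsh R n ?U ` secs (Sh R n) ?U"
  if n: "0 \<le> n" and "a \<in> secs (Sh R (n + 1)) ?U" and da: "Dsh R (n + 1) ?U a = one_sect (Sh R (n + 2)) ?U" for n a
 proof -
  have e: "n + 1 - 1 = n" "n + 2 - 1 = n + 1" by simp_all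
  obtain b where a: "a = (\<lambda>x. 0, b)" "b \<in> secs (Sh J n) (?U \<inter> B)"
   using \<open>a \<in> _\<close> Kn[of "n + 1"] n unfolding R_sect e by auto
  interpret J0: comm_group "sect (Sh J n) (?U \<inter> B)" using J_comm_group[OF U] .
  interpret J1: group "sect (Sh J (n + 1)) (?U \<inter> B)" using J_group[OF U] .
  have dbc: "Dsh J n (?U \<inter> B) b \<in> secs (Sh J (n + 1)) (?U \<inter> B)" using hom_in_carrier[OF J_d_hom[OF U] a(2)] .
  have "inv\<^bsub>sect (Sh J (n + 1)) (?U \<inter> B)\<^esub> Dsh J n (?U \<inter> B) b = one_sect (Sh J (n + 1)) (?U \<inter> B)"
   using da R_d[OF U Kz[OF U], of b "n + 1"] a \<phi>n[of "n + 1"] n dbc unfolding oneR e by simp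
  then have db: "Dsh J n (?U \<inter> B) b = one_sect (Sh J (n + 1)) (?U \<inter> B)" using dbc by (metis J1.inv_inv J1.inv_one)
  have "\<exists>s b'. s \<in> secs (Sh K n) ?U \<and> b' \<in> secs (Sh J (n - 1)) (?U \<inter> B) \<and>
    inv\<^bsub>sect (Sh J n) (?U \<inter> B)\<^esub> (\<phi> n ?U s \<otimes>\<^bsub>sect (Sh J n) (?U \<inter> B)\<^esub> Dsh J (n - 1) (?U \<inter> B) b') = b"
  proof (cases "x \<in> B")
   case False
   have "b = one_sect (Sh J n) (?U \<inter> B)"
    using sheaf_empty_trivial[OF fin_dG is_sheaf_complexD(1)[OF resolutionD(1)[OF J]]] a(2) unfolding empty[OF False] by simp
   moreover have "\<phi> n ?U (\<lambda>x. 0) = one_sect (Sh J n) (?U \<inter> B)"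
    using \<eta>_zero[OF U] by (cases "n = 0") (simp_all add: augmentation_def)
   moreover have "Dsh J (n - 1) (?U \<inter> B) (one_sect (Sh J (n - 1)) (?U \<inter> B)) = one_sect (Sh J n) (?U \<inter> B)"
    using J_d_one[OF U, of "n - 1"] by simp
   ultimately show ?thesis using Kz[OF U] J1[OF U] by (intro exI[of _ "\<lambda>x. 0"] exI[of _ "(one_sect (Sh J (n - 1)) (?U \<inter> B))"]) simp
  next
   case xB: True
   \<comment> \<open>For \<open>x\<close> in \<open>B\<close> the overlap is the smallest
     neighbourhood of \<open>x\<close> in \<open>dG\<close>, so exactness of \<open>J\<close> on
     stalks applies.\<close>
   have nb: "min_nbhd dG x = ?U \<inter> B" by (rule min_nbhd_dG[OF xB])
   show ?thesis
   proof (cases "n = 0")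
    case True
    have b0: "b \<in> germs dG (Sh J 0) x" "Dsh J 0 (min_nbhd dG x) b = one_sect (Sh J 1) (min_nbhd dG x)"
     using a(2) db True unfolding nb by simp_all
    obtain t where t: "t \<in> secs (const_sheaf dG B) (?U \<inter> B)" "b = \<eta> (?U \<inter> B) t"
     using resolutionD(7)[OF J xB b0] unfolding nb by auto
    \<comment> \<open>\<open>t\<close> is constant on the overlap, so it extends to a constant on
      the points of \<open>G\<close> in the neighbourhood. The sign compensates for the inverse in
      \<open>R_d\<close>.\<close>
    define s where "s z = (if z \<in> ?U \<inter> G then - t x else 0)" for z
    have s: "s \<in> secs (const_sheaf E G) ?U"
     unfolding mem_const_sheaf[OF fin U]
    proof (intro conjI allI impI ballI)
     show "z \<notin> ?U \<inter> G \<Longrightarrow> s z = 0" for z by (auto simp: s_def)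
     fix y z assume y: "y \<in> ?U" and z: "z \<in> min_nbhd E y \<inter> G"
     have yE: "y \<in> topspace E" using min_nbhd_in_topspace[OF x y] .
     have "y \<in> G" using z yE min_nbhd_mono[OF fin yE, of z] by (auto simp: G)
     moreover have "z \<in> ?U" using z min_nbhd_mono[OF fin x y] by auto
     ultimately show "s z = s y" using y z by (simp add: s_def)
    qed
    have t2: "\<forall>y\<in>?U \<inter> B. \<forall>z\<in>min_nbhd dG y \<inter> B. t z = t y"
     using t(1) unfolding mem_const_sheaf[OF fin_dG openin_B[OF U]] by (rule conjunct2)
    have xUB: "x \<in> ?U \<inter> B" using xB min_nbhd_refl[of x E] by simp
    have tz: "t z = t x" if "z \<in> ?U \<inter> B" for z
     by (rule bspec[OF bspec[OF t2 xUB]]) (use that nb in simp)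
    have "\<rho> s = inv\<^bsub>sect (const_sheaf dG B) (?U \<inter> B)\<^esub> t"
    proof (rule group.inv_equality[symmetric])
     show g: "group (sect (const_sheaf dG B) (?U \<inter> B))" using presheafD(2)[OF resolutionD(2)[OF J] openin_B[OF U]] .
     show "t \<in> secs (const_sheaf dG B) (?U \<inter> B)" by (rule t(1))
     show "\<rho> s \<in> secs (const_sheaf dG B) (?U \<inter> B)" by (rule \<rho>_carrier[OF U s])
     have "\<rho> s z + t z = 0" for z
     proof (cases "z \<in> ?U \<inter> B")
      case True
      then show ?thesis using tz[OF True] by (auto simp: s_def B_eq)
     next
      case False
      have "t z = 0" using t(1) False unfolding mem_const_sheaf[OF fin_dG openin_B[OF U]] by blast
      then show ?thesis using False by (auto simp: s_def)
     qed
     then show "\<rho> s \<otimes>\<^bsub>sect (const_sheaf dG B) (?U \<inter> B)\<^esub> t = one_sect (const_sheaf dG B) (?U \<inter> B)"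
      by (simp add: const_sheaf_simps)
    qed
    then have "\<phi> 0 ?U s = inv\<^bsub>sect (Sh J 0) (?U \<inter> B)\<^esub> b"
     using group_hom.hom_inv[of "sect (const_sheaf dG B) (?U \<inter> B)" "sect (Sh J 0) (?U \<inter> B)" "\<eta> (?U \<inter> B)" t]
      presheafD(2)[OF resolutionD(2)[OF J] openin_B[OF U]] J_group[OF U, of 0] \<eta>_hom[OF U] t
     by (simp add: \<phi>0 group_hom_def group_hom_axioms_def)
    moreover have "inv\<^bsub>sect (Sh J n) (?U \<inter> B)\<^esub> (inv\<^bsub>sect (Sh J n) (?U \<inter> B)\<^esub> b
      \<otimes>\<^bsub>sect (Sh J n) (?U \<inter> B)\<^esub> (one_sect (Sh J n) (?U \<inter> B))) = b"
     using a(2) by simp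
    ultimately show ?thesis
     using s K0 J1[OF U, of "-1"] J_d_one[OF U, of "-1"] a(2) True
     by (intro exI[of _ s] exI[of _ "(one_sect (Sh J (- 1)) (?U \<inter> B))"]) simp
   next
    case False
    have "b \<in> Dsh J (n - 1) (?U \<inter> B) ` secs (Sh J (n - 1)) (?U \<inter> B)"
     using resolutionD(8)[OF J xB, of "n - 1" b] a(2) db n False unfolding nb by (simp add: add.commute)
    then obtain b' where b': "b' \<in> secs (Sh J (n - 1)) (?U \<inter> B)" "b = Dsh J (n - 1) (?U \<inter> B) b'" by auto
    interpret Jm: group "sect (Sh J (n - 1)) (?U \<inter> B)" using J_group[OF U] .
    interpret d: group_hom "sect (Sh J (n - 1)) (?U \<inter> B)" "sect (Sh J n) (?U \<inter> B)" "Dsh J (n - 1) (?U \<inter> B)"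
     using J_d_hom[OF U, of "n - 1"] by unfold_locales simp
    show ?thesis
     using b' \<phi>n[OF False] Kz[OF U] a(2)
     by (intro exI[of _ "\<lambda>x. 0"] exI[of _ "inv\<^bsub>sect (Sh J (n - 1)) (?U \<inter> B)\<^esub> b'"]) simp
   qed
  qed
  then obtain s b' where sb: "s \<in> secs (Sh K n) ?U" "b' \<in> secs (Sh J (n - 1)) (?U \<inter> B)"
   "inv\<^bsub>sect (Sh J n) (?U \<inter> B)\<^esub> (\<phi> n ?U s \<otimes>\<^bsub>sect (Sh J n) (?U \<inter> B)\<^esub> Dsh J (n - 1) (?U \<inter> B) b') = b"
   by blast
  show ?thesis
  proof (rule image_eqI[of _ _ "(s, b')"])
   show "a = Dsh R n ?U (s, b')" using R_d[OF U sb(1,2)] sb(3) a(1) by simp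
   show "(s, b') \<in> secs (Sh R n) ?U" using sb by (simp add: R_sect)
  qed
 qed
qed

lemma R_flasque: "flasque E (Sh R n)"
 unfolding relative_complex_eq sheaf_shift_simps
proof (rule flasque_cone)
 show "flasque E (Sh K m)" for m
  using flasque_deg0[OF sheaf_imp_presheaf[OF sheaf_const_sheaf[OF fin]] flasque_const_sheaf_closure[OF fin p]]
  unfolding G .
 show "flasque E (Sh L m)" for m by (rule flasque_pushforward[OF cont flJ])
qed

end

subsection \<open>Tensor products\<close>

abbreviation tensor_free :: "'a monoid \<Rightarrow> 'b monoid \<Rightarrow> ('a \<times> 'b \<Rightarrow>\<^sub>0 int) monoid" where
 "tensor_free A B \<equiv> free_Abelian_group (carrier A \<times> carrier B)"

definition tensor_class :: "'a monoid \<Rightarrow> 'b monoid \<Rightarrow> ('a \<times> 'b \<Rightarrow>\<^sub>0 int) \<Rightarrow> ('a \<times> 'b \<Rightarrow>\<^sub>0 int) set" where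
 "tensor_class A B z = tensor_relations A B #>\<^bsub>tensor_free A B\<^esub> z"

definition tensor_generators :: "'a monoid \<Rightarrow> 'b monoid \<Rightarrow> ('a \<times> 'b \<Rightarrow>\<^sub>0 int) set" where
 "tensor_generators A B =
  {frag_of (a \<otimes>\<^bsub>A\<^esub> a', b) - frag_of (a, b) - frag_of (a', b) | a a' b.
    a \<in> carrier A \<and> a' \<in> carrier A \<and> b \<in> carrier B} \<union>
  {frag_of (a, b \<otimes>\<^bsub>B\<^esub> b') - frag_of (a, b) - frag_of (a, b') | a b b'.
    a \<in> carrier A \<and> b \<in> carrier B \<and> b' \<in> carrier B}"

lemma tensor_relations_eq: "tensor_relations A B = generate (tensor_free A B) (tensor_generators A B)"
 by (simp add: tensor_relations_def tensor_generators_def)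

lemma tensor_generators_carrier:
 assumes "monoid A" "monoid B"
 shows "tensor_generators A B \<subseteq> carrier (tensor_free A B)"
proof -
 have A: "a \<otimes>\<^bsub>A\<^esub> a' \<in> carrier A" if "a \<in> carrier A" "a' \<in> carrier A" for a a'
  using monoid.m_closed[OF assms(1) that] .
 have B: "b \<otimes>\<^bsub>B\<^esub> b' \<in> carrier B" if "b \<in> carrier B" "b' \<in> carrier B" for b b'
  using monoid.m_closed[OF assms(2) that] .
 show ?thesis
  unfolding tensor_generators_def
  by (auto dest!: subsetD[OF keys_diff] simp: A B split: if_splits)
qed

lemma subgroup_tensor_relations:
 assumes "monoid A" "monoid B"
 shows "subgroup (tensor_relations A B) (tensor_free A B)"
 unfolding tensor_relations_eq
 by (rule group.generate_is_subgroup[OF group_free_Abelian_group tensor_generators_carrier[OF assms]])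

lemma tensor_relations_subset:
 assumes "monoid A" "monoid B" "subgroup N (tensor_free A B)" "tensor_generators A B \<subseteq> N"
 shows "tensor_relations A B \<subseteq> N"
 unfolding tensor_relations_eq
 by (rule group.generate_subgroup_incl[OF group_free_Abelian_group assms(4,3)])

lemma tensor_generator_relation: "z \<in> tensor_generators A B \<Longrightarrow> z \<in> tensor_relations A B"
 unfolding tensor_relations_eq by (rule generate.incl)

lemma comm_group_tensor_group:
 assumes "monoid A" "monoid B"
 shows "comm_group (tensor_group A B)"
 unfolding tensor_group_def
 by (rule comm_group.abelian_FactGroup[OF abelian_free_Abelian_group subgroup_tensor_relations[OF assms]])

lemma carrier_tensor_group: "carrier (tensor_group A B) = tensor_class A B ` carrier (tensor_free A B)"
 by (auto simp: tensor_group_def FactGroup_def RCOSETS_def tensor_class_def)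

lemma tensor_class_eq_iff:
 assumes "monoid A" "monoid B" "z \<in> carrier (tensor_free A B)" "w \<in> carrier (tensor_free A B)"
 shows "tensor_class A B z = tensor_class A B w \<longleftrightarrow> z - w \<in> tensor_relations A B"
 unfolding tensor_class_def
 using coset_eq_iff[OF abelian_free_Abelian_group subgroup_tensor_relations[OF assms(1,2)] assms(3,4)] assms(4)
 by simp

lemma tensor_class_hom:
 assumes "monoid A" "monoid B"
 shows "tensor_class A B \<in> hom (tensor_free A B) (tensor_group A B)"
proof (rule homI)
 show "tensor_class A B z \<in> carrier (tensor_group A B)" if "z \<in> carrier (tensor_free A B)" for z
  using that by (auto simp: carrier_tensor_group)
 fix z w assume "z \<in> carrier (tensor_free A B)" "w \<in> carrier (tensor_free A B)"
 then show "tensor_class A B (z \<otimes>\<^bsub>tensor_free A B\<^esub> w) = tensor_class A B z \<otimes>\<^bsub>tensor_group A B\<^esub> tensor_class A B w"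
  using normal.rcos_sum[OF comm_group.subgroup_imp_normal[OF abelian_free_Abelian_group subgroup_tensor_relations[OF assms]], of z w]
  by (simp add: tensor_group_def FactGroup_def tensor_class_def)
qed

lemma pure_tensor_eq: "pure_tensor A B a b = tensor_class A B (frag_of (a, b))"
 by (simp add: pure_tensor_def tensor_class_def)

lemma pure_tensor_carrier:
 "a \<in> carrier A \<Longrightarrow> b \<in> carrier B \<Longrightarrow> pure_tensor A B a b \<in> carrier (tensor_group A B)"
 by (simp add: pure_tensor_eq carrier_tensor_group)

lemma pure_tensor_mult_left:
 assumes "monoid A" "monoid B" "a \<in> carrier A" "a' \<in> carrier A" "b \<in> carrier B"
 shows "pure_tensor A B (a \<otimes>\<^bsub>A\<^esub> a') b = pure_tensor A B a b \<otimes>\<^bsub>tensor_group A B\<^esub> pure_tensor A B a' b"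
proof -
 have m: "a \<otimes>\<^bsub>A\<^esub> a' \<in> carrier A" using monoid.m_closed[OF assms(1,3,4)] .
 have "tensor_class A B (frag_of (a \<otimes>\<^bsub>A\<^esub> a', b)) = tensor_class A B (frag_of (a, b) + frag_of (a', b))"
 proof (subst tensor_class_eq_iff[OF assms(1,2)])
  have "frag_of (a \<otimes>\<^bsub>A\<^esub> a', b) - frag_of (a, b) - frag_of (a', b) \<in> tensor_generators A B"
   unfolding tensor_generators_def using assms by blast
  then show "frag_of (a \<otimes>\<^bsub>A\<^esub> a', b) - (frag_of (a, b) + frag_of (a', b)) \<in> tensor_relations A B"
   using tensor_generator_relation by (simp add: diff_diff_eq)
 qed (use assms m in \<open>auto dest!: subsetD[OF keys_add]\<close>)
 then show ?thesis
  using hom_mult[OF tensor_class_hom[OF assms(1,2)], of "frag_of (a, b)" "frag_of (a', b)"] assms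
  by (simp add: pure_tensor_eq)
qed

lemma pure_tensor_mult_right:
 assumes "monoid A" "monoid B" "a \<in> carrier A" "b \<in> carrier B" "b' \<in> carrier B"
 shows "pure_tensor A B a (b \<otimes>\<^bsub>B\<^esub> b') = pure_tensor A B a b \<otimes>\<^bsub>tensor_group A B\<^esub> pure_tensor A B a b'"
proof -
 have m: "b \<otimes>\<^bsub>B\<^esub> b' \<in> carrier B" using monoid.m_closed[OF assms(2,4,5)] .
 have "tensor_class A B (frag_of (a, b \<otimes>\<^bsub>B\<^esub> b')) = tensor_class A B (frag_of (a, b) + frag_of (a, b'))"
 proof (subst tensor_class_eq_iff[OF assms(1,2)])
  have "frag_of (a, b \<otimes>\<^bsub>B\<^esub> b') - frag_of (a, b) - frag_of (a, b') \<in> tensor_generators A B"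
   unfolding tensor_generators_def using assms by blast
  then show "frag_of (a, b \<otimes>\<^bsub>B\<^esub> b') - (frag_of (a, b) + frag_of (a, b')) \<in> tensor_relations A B"
   using tensor_generator_relation by (simp add: diff_diff_eq)
 qed (use assms m in \<open>auto dest!: subsetD[OF keys_add]\<close>)
 then show ?thesis
  using hom_mult[OF tensor_class_hom[OF assms(1,2)], of "frag_of (a, b)" "frag_of (a, b')"] assms
  by (simp add: pure_tensor_eq)
qed

text \<open>The induction principle for tensor products: classes of free generators are pure
  tensors, and they generate the quotient of the free group.\<close>

lemma tensor_group_subgroup_eq:
 assumes A: "monoid A" "monoid B" and H: "subgroup H (tensor_group A B)"
  and pure: "\<And>a b. a \<in> carrier A \<Longrightarrow> b \<in> carrier B \<Longrightarrow> pure_tensor A B a b \<in> H"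
 shows "carrier (tensor_group A B) \<subseteq> H"
proof
 fix S assume "S \<in> carrier (tensor_group A B)"
 then obtain z where z: "Poly_Mapping.keys z \<subseteq> carrier A \<times> carrier B" "S = tensor_class A B z"
  by (auto simp: carrier_tensor_group)
 have g: "group (tensor_group A B)" using comm_group.axioms(2)[OF comm_group_tensor_group[OF A]] .
 interpret c: group_hom "tensor_free A B" "tensor_group A B" "tensor_class A B"
  using tensor_class_hom[OF A] g by (simp add: group_hom_def group_hom_axioms_def)
 have "tensor_class A B z \<in> H"
 proof (rule free_Abelian_group_induct[OF z(1)])
  show "tensor_class A B 0 \<in> H" using c.hom_one subgroup.one_closed[OF H] by simp
  fix x y assume xy: "Poly_Mapping.keys x \<subseteq> carrier A \<times> carrier B" "Poly_Mapping.keys y \<subseteq> carrier A \<times> carrier B"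
   and xH: "tensor_class A B x \<in> H" "tensor_class A B y \<in> H"
  have "x - y = x \<otimes>\<^bsub>tensor_free A B\<^esub> inv\<^bsub>tensor_free A B\<^esub> y" using xy by simp
  then have "tensor_class A B (x - y) = tensor_class A B x \<otimes>\<^bsub>tensor_group A B\<^esub> inv\<^bsub>tensor_group A B\<^esub> tensor_class A B y"
   using xy c.hom_mult[of x "inv\<^bsub>tensor_free A B\<^esub> y"] c.hom_inv[of y] by simp
  then show "tensor_class A B (x - y) \<in> H"
   using subgroup.m_closed[OF H xH(1) subgroup.m_inv_closed[OF H xH(2)]] by simp
 next
  show "tensor_class A B (frag_of a) \<in> H" if "a \<in> carrier A \<times> carrier B" for a
   using that pure[of "fst a" "snd a"] by (auto simp: pure_tensor_eq)
 qed
 then show "S \<in> H" using z by simp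
qed

lemma tensor_group_hom_eqI:
 assumes A: "monoid A" "monoid B" and G: "group G" and f: "f \<in> hom (tensor_group A B) G" and h: "h \<in> hom (tensor_group A B) G"
  and eq: "\<And>a b. a \<in> carrier A \<Longrightarrow> b \<in> carrier B \<Longrightarrow> f (pure_tensor A B a b) = h (pure_tensor A B a b)"
  and S: "S \<in> carrier (tensor_group A B)"
 shows "f S = h S"
proof -
 have g: "group (tensor_group A B)" using comm_group.axioms(2)[OF comm_group_tensor_group[OF A]] .
 interpret f: group_hom "tensor_group A B" G f using f g G by (simp add: group_hom_def group_hom_axioms_def)
 interpret h: group_hom "tensor_group A B" G h using h g G by (simp add: group_hom_def group_hom_axioms_def)
 have "subgroup {S \<in> carrier (tensor_group A B). f S = h S} (tensor_group A B)"
  by (rule f.G.subgroupI) auto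
 then have "carrier (tensor_group A B) \<subseteq> {S \<in> carrier (tensor_group A B). f S = h S}"
  by (rule tensor_group_subgroup_eq[OF A]) (simp add: eq pure_tensor_carrier)
 then show ?thesis using S by auto
qed

text \<open>\<open>tensor_map\<close> is defined on cosets as sets. That it can be computed on
  representatives rests on the induced map of free groups sending relations to relations.\<close>

lemma tensor_map_class:
 assumes C: "monoid C" "monoid D" and A: "monoid A" "monoid B"
  and g: "g \<in> hom C A" and h: "h \<in> hom D B" and z: "z \<in> carrier (tensor_free C D)"
 shows "tensor_map A B g h (tensor_class C D z) = tensor_class A B (frag_extend (\<lambda>(c, d). frag_of (g c, h d)) z)"
  and "frag_extend (\<lambda>(c, d). frag_of (g c, h d)) z \<in> carrier (tensor_free A B)"
proof -
 let ?F = "frag_extend (\<lambda>(c, d). frag_of (g c, h d))"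
 have gc: "g c \<in> carrier A" if "c \<in> carrier C" for c using hom_in_carrier[OF g that] .
 have hd: "h d \<in> carrier B" if "d \<in> carrier D" for d using hom_in_carrier[OF h that] .
 have F: "?F w \<in> carrier (tensor_free A B)" if "w \<in> carrier (tensor_free C D)" for w
 proof -
  have "Poly_Mapping.keys (?F w) \<subseteq> (\<Union>x \<in> Poly_Mapping.keys w. Poly_Mapping.keys (case x of (c, d) \<Rightarrow> frag_of (g c, h d)))"
   by (rule keys_frag_extend)
  also have "\<dots> \<subseteq> carrier A \<times> carrier B" using that gc hd by auto
  finally show ?thesis by simp
 qed
 show "?F z \<in> carrier (tensor_free A B)" using F[OF z] .
 \<comment> \<open>The preimage of the relations is a subgroup, so it contains all relations once it
   contains the generating ones.\<close>
 let ?N = "{w \<in> carrier (tensor_free C D). ?F w \<in> tensor_relations A B}"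
 note rAB = subgroup_tensor_relations[OF A]
 have N: "subgroup ?N (tensor_free C D)"
 proof (rule group.subgroupI[OF group_free_Abelian_group])
  show "?N \<noteq> {}" using subgroup.one_closed[OF rAB] by (simp add: Set.set_eq_iff) (rule exI[of _ 0], simp)
 next
  fix w assume w: "w \<in> ?N"
  then show "inv\<^bsub>tensor_free C D\<^esub> w \<in> ?N"
   using subgroup.m_inv_closed[OF rAB, of "?F w"] F[of w] by (simp add: frag_extend_minus)
 next
  fix w w' assume w: "w \<in> ?N" and w': "w' \<in> ?N"
  then show "w \<otimes>\<^bsub>tensor_free C D\<^esub> w' \<in> ?N"
   using subgroup.m_closed[OF rAB, of "?F w" "?F w'"] by (auto simp: frag_extend_add dest!: subsetD[OF keys_add])
 qed auto
 have "tensor_generators C D \<subseteq> ?N"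
 proof
  fix w assume w: "w \<in> tensor_generators C D"
  have wc: "w \<in> carrier (tensor_free C D)" using tensor_generators_carrier[OF C] w by blast
  have "?F w \<in> tensor_generators A B"
   using w unfolding tensor_generators_def
  proof (elim UnE CollectE exE conjE)
   fix a a' b assume w: "w = frag_of (a \<otimes>\<^bsub>C\<^esub> a', b) - frag_of (a, b) - frag_of (a', b)"
    and c: "a \<in> carrier C" "a' \<in> carrier C" "b \<in> carrier D"
   have "?F w = frag_of (g a \<otimes>\<^bsub>A\<^esub> g a', h b) - frag_of (g a, h b) - frag_of (g a', h b)"
    using hom_mult[OF g c(1,2)] by (simp add: w frag_extend_diff)
   then show "?F w \<in> {frag_of (a \<otimes>\<^bsub>A\<^esub> a', b) - frag_of (a, b) - frag_of (a', b) | a a' b.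
      a \<in> carrier A \<and> a' \<in> carrier A \<and> b \<in> carrier B} \<union>
     {frag_of (a, b \<otimes>\<^bsub>B\<^esub> b') - frag_of (a, b) - frag_of (a, b') | a b b'.
      a \<in> carrier A \<and> b \<in> carrier B \<and> b' \<in> carrier B}"
    by (intro UnI1 CollectI exI[of _ "g a"] exI[of _ "g a'"] exI[of _ "h b"] conjI) (use c gc hd in simp_all)
  next
   fix a b b' assume w: "w = frag_of (a, b \<otimes>\<^bsub>D\<^esub> b') - frag_of (a, b) - frag_of (a, b')"
    and c: "a \<in> carrier C" "b \<in> carrier D" "b' \<in> carrier D"
   have "?F w = frag_of (g a, h b \<otimes>\<^bsub>B\<^esub> h b') - frag_of (g a, h b) - frag_of (g a, h b')"
    using hom_mult[OF h c(2,3)] by (simp add: w frag_extend_diff)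
   then show "?F w \<in> {frag_of (a \<otimes>\<^bsub>A\<^esub> a', b) - frag_of (a, b) - frag_of (a', b) | a a' b.
      a \<in> carrier A \<and> a' \<in> carrier A \<and> b \<in> carrier B} \<union>
     {frag_of (a, b \<otimes>\<^bsub>B\<^esub> b') - frag_of (a, b) - frag_of (a, b') | a b b'.
      a \<in> carrier A \<and> b \<in> carrier B \<and> b' \<in> carrier B}"
    by (intro UnI2 CollectI exI[of _ "g a"] exI[of _ "h b"] exI[of _ "h b'"] conjI) (use c gc hd in simp_all)
  qed
  then show "w \<in> ?N" using wc tensor_generator_relation[of "?F w" A B] by simp
 qed
 then have rel: "?F w \<in> tensor_relations A B" if "w \<in> tensor_relations C D" for w
  using subsetD[OF tensor_relations_subset[OF C N] that] by simp
 have zero: "0 \<in> tensor_relations C D" using subgroup.one_closed[OF subgroup_tensor_relations[OF C]] by simp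
 show "tensor_map A B g h (tensor_class C D z) = tensor_class A B (?F z)"
 proof (rule Set.set_eqI, rule iffI)
  fix x assume "x \<in> tensor_map A B g h (tensor_class C D z)"
  then obtain r s where r: "r \<in> tensor_relations A B" and s: "s \<in> tensor_relations C D" and x: "x = r + ?F (s + z)"
   unfolding tensor_map_def tensor_class_def set_mult_def r_coset_def by (simp del: case_prod_unfold) blast
  have "x = (r + ?F s) + ?F z" by (simp add: x frag_extend_add add.assoc)
  moreover have "r + ?F s \<in> tensor_relations A B" using subgroup.m_closed[OF rAB r rel[OF s]] by simp
  ultimately show "x \<in> tensor_class A B (?F z)" unfolding tensor_class_def r_coset_def by auto
 next
  fix x assume "x \<in> tensor_class A B (?F z)"
  then obtain r where r: "r \<in> tensor_relations A B" "x = r + ?F z" unfolding tensor_class_def r_coset_def by auto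
  have "z \<in> tensor_class C D z"
   unfolding tensor_class_def r_coset_def by (rule UN_I[OF zero]) simp
  then show "x \<in> tensor_map A B g h (tensor_class C D z)"
   unfolding tensor_map_def set_mult_def by (intro UN_I[OF r(1)] UN_I[OF imageI]) (simp_all add: r(2))
 qed
qed

lemma tensor_map_pure:
 assumes "monoid C" "monoid D" "monoid A" "monoid B" "g \<in> hom C A" "h \<in> hom D B" "c \<in> carrier C" "d \<in> carrier D"
 shows "tensor_map A B g h (pure_tensor C D c d) = pure_tensor A B (g c) (h d)"
 using tensor_map_class(1)[OF assms(1-6), of "frag_of (c, d)"] assms(7,8) by (simp add: pure_tensor_eq)

lemma tensor_map_hom:
 assumes C: "monoid C" "monoid D" and A: "monoid A" "monoid B" and g: "g \<in> hom C A" and h: "h \<in> hom D B"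
 shows "tensor_map A B g h \<in> hom (tensor_group C D) (tensor_group A B)"
proof (rule homI)
 note cl = tensor_map_class[OF C A g h]
 fix S assume "S \<in> carrier (tensor_group C D)"
 then obtain z where z: "z \<in> carrier (tensor_free C D)" "S = tensor_class C D z" by (auto simp: carrier_tensor_group)
 show "tensor_map A B g h S \<in> carrier (tensor_group A B)"
  unfolding z(2) cl(1)[OF z(1)] carrier_tensor_group using cl(2)[OF z(1)] by blast
 fix T assume "T \<in> carrier (tensor_group C D)"
 then obtain w where w: "w \<in> carrier (tensor_free C D)" "T = tensor_class C D w" by (auto simp: carrier_tensor_group)
 have zw: "z + w \<in> carrier (tensor_free C D)" using z w by (auto dest!: subsetD[OF keys_add])
 have ST: "S \<otimes>\<^bsub>tensor_group C D\<^esub> T = tensor_class C D (z + w)"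
  using hom_mult[OF tensor_class_hom[OF C] z(1) w(1)] z w by simp
 show "tensor_map A B g h (S \<otimes>\<^bsub>tensor_group C D\<^esub> T) = tensor_map A B g h S \<otimes>\<^bsub>tensor_group A B\<^esub> tensor_map A B g h T"
  unfolding ST cl(1)[OF zw] unfolding z(2) w(2) cl(1)[OF z(1)] cl(1)[OF w(1)]
  using hom_mult[OF tensor_class_hom[OF A] cl(2)[OF z(1)] cl(2)[OF w(1)]] by (simp add: frag_extend_add)
qed

lemma tensor_map_tensor_map:
 assumes C: "monoid C" "monoid D" and A: "monoid A" "monoid B" and E: "monoid A'" "monoid B'"
  and g: "g \<in> hom C A" and h: "h \<in> hom D B" and g': "g' \<in> hom A A'" and h': "h' \<in> hom B B'"
  and S: "S \<in> carrier (tensor_group C D)"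
 shows "tensor_map A' B' g' h' (tensor_map A B g h S) = tensor_map A' B' (g' \<circ> g) (h' \<circ> h) S"
proof (rule tensor_group_hom_eqI[where f = "\<lambda>S. tensor_map A' B' g' h' (tensor_map A B g h S)" and h = "tensor_map A' B' (g' \<circ> g) (h' \<circ> h)", OF C _ _ _ _ S])
 note gg = hom_compose[OF g g'] and hh = hom_compose[OF h h']
 show "group (tensor_group A' B')" using comm_group.axioms(2)[OF comm_group_tensor_group[OF E]] .
 show "(\<lambda>S. tensor_map A' B' g' h' (tensor_map A B g h S)) \<in> hom (tensor_group C D) (tensor_group A' B')"
  using hom_compose[OF tensor_map_hom[OF C A g h] tensor_map_hom[OF A E g' h']] by (simp add: comp_def)
 show "tensor_map A' B' (g' \<circ> g) (h' \<circ> h) \<in> hom (tensor_group C D) (tensor_group A' B')"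
  by (rule tensor_map_hom[OF C E gg hh])
 fix a b assume ab: "a \<in> carrier C" "b \<in> carrier D"
 show "tensor_map A' B' g' h' (tensor_map A B g h (pure_tensor C D a b)) = tensor_map A' B' (g' \<circ> g) (h' \<circ> h) (pure_tensor C D a b)"
  using tensor_map_pure[OF C A g h ab] tensor_map_pure[OF C E gg hh ab]
   tensor_map_pure[OF A E g' h' hom_in_carrier[OF g ab(1)] hom_in_carrier[OF h ab(2)]] by (simp only: comp_apply)
qed

lemma tensor_map_cong:
 assumes C: "monoid C" "monoid D" and A: "monoid A" "monoid B"
  and g: "g \<in> hom C A" and h: "h \<in> hom D B" and g': "g' \<in> hom C A" and h': "h' \<in> hom D B"
  and eq: "\<And>c. c \<in> carrier C \<Longrightarrow> g c = g' c" "\<And>d. d \<in> carrier D \<Longrightarrow> h d = h' d"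
  and S: "S \<in> carrier (tensor_group C D)"
 shows "tensor_map A B g h S = tensor_map A B g' h' S"
proof (rule tensor_group_hom_eqI[where f = "tensor_map A B g h" and h = "tensor_map A B g' h'", OF C _ _ _ _ S])
 show "group (tensor_group A B)" using comm_group.axioms(2)[OF comm_group_tensor_group[OF A]] .
 show "tensor_map A B g h \<in> hom (tensor_group C D) (tensor_group A B)" by (rule tensor_map_hom[OF C A g h])
 show "tensor_map A B g' h' \<in> hom (tensor_group C D) (tensor_group A B)" by (rule tensor_map_hom[OF C A g' h'])
 fix a b assume ab: "a \<in> carrier C" "b \<in> carrier D"
 show "tensor_map A B g h (pure_tensor C D a b) = tensor_map A B g' h' (pure_tensor C D a b)"
  unfolding tensor_map_pure[OF C A g h ab] tensor_map_pure[OF C A g' h' ab] using eq ab by simp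
qed

lemma tensor_map_id:
 assumes C: "monoid C" "monoid D" and S: "S \<in> carrier (tensor_group C D)"
  and g: "g \<in> hom C C" "\<And>c. c \<in> carrier C \<Longrightarrow> g c = c"
 shows "tensor_map C D g id S = S"
proof (rule tensor_group_hom_eqI[where f = "tensor_map C D g id" and h = "\<lambda>S. S", OF C _ _ _ _ S])
 have i: "id \<in> hom D D" by (simp add: hom_def)
 show "group (tensor_group C D)" using comm_group.axioms(2)[OF comm_group_tensor_group[OF C]] .
 show "tensor_map C D g id \<in> hom (tensor_group C D) (tensor_group C D)" by (rule tensor_map_hom[OF C C g(1) i])
 show "(\<lambda>S. S) \<in> hom (tensor_group C D) (tensor_group C D)" by (simp add: hom_def)
 fix a b assume ab: "a \<in> carrier C" "b \<in> carrier D"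
 show "tensor_map C D g id (pure_tensor C D a b) = pure_tensor C D a b"
  unfolding tensor_map_pure[OF C C g(1) i ab] using g(2) ab by simp
qed

text \<open>A pure tensor whose left factor is the unit equals its own double, hence is trivial;
  pure tensors generate.\<close>

lemma tensor_group_trivial_left:
 assumes A: "group A" "monoid B" and triv: "carrier A \<subseteq> {\<one>\<^bsub>A\<^esub>}"
 shows "carrier (tensor_group A B) = {\<one>\<^bsub>tensor_group A B\<^esub>}"
proof -
 have m: "monoid A" using A(1) by (rule group.is_monoid)
 interpret T: group "tensor_group A B" using comm_group.axioms(2)[OF comm_group_tensor_group[OF m A(2)]] .
 have "carrier (tensor_group A B) \<subseteq> {\<one>\<^bsub>tensor_group A B\<^esub>}"
 proof (rule tensor_group_subgroup_eq[OF m A(2) T.triv_subgroup])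
  fix a b assume a: "a \<in> carrier A" and b: "b \<in> carrier B"
  have "a \<otimes>\<^bsub>A\<^esub> a = a" using a triv monoid.l_one[OF m] by auto
  then have "pure_tensor A B a b \<otimes>\<^bsub>tensor_group A B\<^esub> pure_tensor A B a b = pure_tensor A B a b"
   using pure_tensor_mult_left[OF m A(2) a a b] by simp
  then show "pure_tensor A B a b \<in> {\<one>\<^bsub>tensor_group A B\<^esub>}"
   using pure_tensor_carrier[OF a b] T.l_cancel_one by blast
 qed
 then show ?thesis by auto
qed

lemma stalk_functor_tensor_presheaf:
 assumes fin: "finite_space Y" and F: "presheaf Y F" and M: "monoid M"
 shows "stalk_functor Y (tensor_presheaf F M)"
proof -
 have i: "id \<in> hom M M" by (simp add: hom_def)
 note SF = stalk_functorD[OF presheaf_imp_stalk_functor[OF fin F]]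
 have m: "monoid (stalk Y F x)" if "x \<in> topspace Y" for x using SF(2)[OF that] by (rule group.is_monoid)
 have nY: "y \<in> topspace Y" if "x \<in> topspace Y" "y \<in> min_nbhd Y x" for x y using min_nbhd_in_topspace[OF that] .
 show ?thesis
  unfolding stalk_functor_def tensor_presheaf_def presheaf_data.simps
 proof (intro conjI ballI)
  fix x assume x: "x \<in> topspace Y"
  show "comm_group (tensor_group (stalk Y F x) M)" by (rule comm_group_tensor_group[OF m[OF x] M])
  have r: "germ Y F x x \<in> hom (stalk Y F x) (stalk Y F x)"
   using SF(3)[OF x min_nbhd_refl] .
  show "tensor_map (stalk Y F x) M (germ Y F x x) id S = S"
   if "S \<in> carrier (tensor_group (stalk Y F x) M)" for S
   by (rule tensor_map_id[OF m[OF x] M that r SF(5)[OF x]])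
  fix y assume y: "y \<in> min_nbhd Y x"
  show "tensor_map (stalk Y F y) M (germ Y F x y) id
    \<in> hom (tensor_group (stalk Y F x) M) (tensor_group (stalk Y F y) M)"
   by (rule tensor_map_hom[OF m[OF x] M m[OF nY[OF x y]] M SF(3)[OF x y] i])
  fix z S assume z: "z \<in> min_nbhd Y y" and S: "S \<in> carrier (tensor_group (stalk Y F x) M)"
  have zx: "z \<in> min_nbhd Y x" using min_nbhd_mono[OF fin x y] z by auto
  note c = hom_compose[OF SF(3)[OF x y] SF(3)[OF nY[OF x y] z]]
  have "tensor_map (stalk Y F z) M (germ Y F y z) id
     (tensor_map (stalk Y F y) M (germ Y F x y) id S) =
    tensor_map (stalk Y F z) M (germ Y F y z \<circ> germ Y F x y) (id \<circ> id) S"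
   by (rule tensor_map_tensor_map[OF m[OF x] M m[OF nY[OF x y]] M m[OF nY[OF x zx]] M SF(3)[OF x y] i SF(3)[OF nY[OF x y] z] i S])
  also have "\<dots> = tensor_map (stalk Y F z) M (germ Y F x z) id S"
   using SF(6)[OF x y z] i
   by (intro tensor_map_cong[OF m[OF x] M m[OF nY[OF x zx]] M c _ SF(3)[OF x zx] i _ _ S]) auto
  finally show "tensor_map (stalk Y F z) M (germ Y F y z) id
     (tensor_map (stalk Y F y) M (germ Y F x y) id S) =
    tensor_map (stalk Y F z) M (germ Y F x z) id S" .
 qed
qed

section \<open>The tensor product as a complex of sheaves\<close>

lemma sheaf_tensor_simps:
 "Sh (sheaf_tensor Y F M) n = sheafify Y (tensor_presheaf F (Ob M n))"
 "Dsh (sheaf_tensor Y F M) n U s =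
  (\<lambda>x\<in>U. tensor_map (stalk Y F x) (Ob M (n + 1)) id (Df M n) (s x))"
 by (simp_all add: sheaf_tensor_def)

lemma tensor_presheaf_simps:
 "sect (tensor_presheaf F A) U = tensor_group (sect F U) A"
 "rest (tensor_presheaf F A) U V = tensor_map (sect F V) A (rest F U V) id"
 by (simp_all add: tensor_presheaf_def)

text \<open>The maps induced by the differential commute with those induced by restriction, as they
  act on different factors. That two differentials compose to the trivial map is checked on pure
  tensors.\<close>

lemma is_sheaf_complex_tensor:
 assumes fin: "finite_space Y" and F: "presheaf Y F" and M: "group_complex M"
 shows "is_sheaf_complex Y (sheaf_tensor Y F M)"
proof -
 have i: "id \<in> hom G G" for G :: "'z monoid" by (simp add: hom_def)
 have iM: "id \<in> hom (Ob M n) (Ob M n)" for n by (simp add: hom_def)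
 have iF: "id \<in> hom (sect F U) (sect F U)" for U by (simp add: hom_def)
 note SF = stalk_functorD[OF presheaf_imp_stalk_functor[OF fin F]]
 have m: "monoid (stalk Y F x)" if "x \<in> topspace Y" for x using SF(2)[OF that] by (rule group.is_monoid)
 note mM = complexD(3)[OF M] and d = complexD(4)[OF M]
 have nY: "y \<in> topspace Y" if "x \<in> topspace Y" "y \<in> min_nbhd Y x" for x y using min_nbhd_in_topspace[OF that] .
 let ?t = "\<lambda>n x. tensor_map (stalk Y F x) (Ob M (n + 1)) id (Df M n)"
 have hom: "?t n x \<in> hom (tensor_group (stalk Y F x) (Ob M n)) (tensor_group (stalk Y F x) (Ob M (n + 1)))"
  if "x \<in> topspace Y" for n x
  by (rule tensor_map_hom[OF m[OF that] mM m[OF that] mM iF d])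
 have nat: "?t n y (tensor_map (stalk Y F y) (Ob M n) (germ Y F x y) id S) =
   tensor_map (stalk Y F y) (Ob M (n + 1)) (germ Y F x y) id (?t n x S)"
  if x: "x \<in> topspace Y" and y: "y \<in> min_nbhd Y x" and S: "S \<in> carrier (tensor_group (stalk Y F x) (Ob M n))" for n x y S
  using tensor_map_tensor_map[OF m[OF x] mM m[OF nY[OF x y]] mM m[OF nY[OF x y]] mM SF(3)[OF x y] iM iF d S]
   tensor_map_tensor_map[OF m[OF x] mM m[OF x] mM m[OF nY[OF x y]] mM iF d SF(3)[OF x y] iM S] by simp
 have dd: "?t (n + 1) x (?t n x S) = \<one>\<^bsub>tensor_group (stalk Y F x) (Ob M (n + 1 + 1))\<^esub>"
  if x: "x \<in> topspace Y" and S: "S \<in> carrier (tensor_group (stalk Y F x) (Ob M n))" for n x S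
 proof (rule tensor_group_hom_eqI[where f = "\<lambda>S. ?t (n + 1) x (?t n x S)" and h = "\<lambda>S. \<one>\<^bsub>tensor_group (stalk Y F x) (Ob M (n + 1 + 1))\<^esub>", OF m[OF x] mM _ _ _ _ S])
  let ?T = "tensor_group (stalk Y F x) (Ob M (n + 1 + 1))"
  interpret T: group ?T using comm_group.axioms(2)[OF comm_group_tensor_group[OF m[OF x] mM]] .
  show "group ?T" by (rule T.is_group)
  show "(\<lambda>S. ?t (n + 1) x (?t n x S)) \<in> hom (tensor_group (stalk Y F x) (Ob M n)) ?T"
   using hom_compose[OF hom[OF x, of n] hom[OF x, of "n + 1"]] by (simp add: comp_def)
  show "(\<lambda>S. \<one>\<^bsub>?T\<^esub>) \<in> hom (tensor_group (stalk Y F x) (Ob M n)) ?T"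
   by (rule homI) (rule T.one_closed, rule T.l_one[OF T.one_closed, symmetric])
  fix a b assume a: "a \<in> germs Y F x" and b: "b \<in> obs M n"
  have ab: "?t (n + 1) x (?t n x (pure_tensor (stalk Y F x) (Ob M n) a b)) =
    pure_tensor (stalk Y F x) (Ob M (n + 1 + 1)) a (Df M (n + 1) (Df M n b))"
   unfolding tensor_map_pure[OF m[OF x] mM m[OF x] mM iF d a b] id_apply
    tensor_map_pure[OF m[OF x] mM m[OF x] mM iF d a hom_in_carrier[OF d b]] ..
  let ?o = "(one_ob M (n + 1 + 1))"
  have o: "?o \<in> obs M (n + 1 + 1)" "?o \<otimes>\<^bsub>Ob M (n + 1 + 1)\<^esub> ?o = ?o"
   using monoid.one_closed[OF mM] monoid.l_one[OF mM] by blast+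
  have "pure_tensor (stalk Y F x) (Ob M (n + 1 + 1)) a ?o = \<one>\<^bsub>?T\<^esub>"
   using pure_tensor_mult_right[OF m[OF x] mM a o(1) o(1)] o(2) pure_tensor_carrier[OF a o(1)] T.l_cancel_one by metis
  moreover have "Df M (n + 1) (Df M n b) = ?o" using complexD(5)[OF M b] by (simp add: add.assoc)
  ultimately show "?t (n + 1) x (?t n x (pure_tensor (stalk Y F x) (Ob M n) a b)) = \<one>\<^bsub>?T\<^esub>"
   using ab by simp
 qed
 note sf = stalk_functor_tensor_presheaf[OF fin F mM]
 have comp: "s x \<in> carrier (tensor_group (stalk Y F x) (Ob M n))"
  "y \<in> min_nbhd Y x \<Longrightarrow> s y = tensor_map (stalk Y F y) (Ob M n) (germ Y F x y) id (s x)"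
  if "s \<in> secs (sheafify Y (tensor_presheaf F (Ob M n))) U" "x \<in> U" for s x U n y
  using that by (simp_all add: carrier_sheafify compatible_germs_def tensor_presheaf_simps)
 have dhom: "Dsh (sheaf_tensor Y F M) n U \<in> hom (sect (sheafify Y (tensor_presheaf F (Ob M n))) U)
   (sect (sheafify Y (tensor_presheaf F (Ob M (n + 1)))) U)" if U: "openin Y U" for n U
 proof -
  have xY: "x \<in> topspace Y" if "x \<in> U" for x using that openin_subset[OF U] by auto
  have yU: "y \<in> U" if "x \<in> U" "y \<in> min_nbhd Y x" for x y using min_nbhd_subset[OF U that(1)] that(2) by auto
  show ?thesis
  proof (rule homI)
   fix s assume s: "s \<in> secs (sheafify Y (tensor_presheaf F (Ob M n))) U"
   show "Dsh (sheaf_tensor Y F M) n U s \<in> carrier (sect (sheafify Y (tensor_presheaf F (Ob M (n + 1)))) U)"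
    unfolding carrier_sheafify compatible_germs_def tensor_presheaf_simps sheaf_tensor_simps
   proof (intro conjI ballI)
    fix x assume x: "x \<in> U"
    show "(\<lambda>x\<in>U. ?t n x (s x)) x \<in> carrier (tensor_group (stalk Y F x) (Ob M (n + 1)))"
     using hom_in_carrier[OF hom[OF xY[OF x]] comp(1)[OF s x]] x by simp
    fix y assume y: "y \<in> min_nbhd Y x"
    show "tensor_map (stalk Y F y) (Ob M (n + 1)) (germ Y F x y) id
      ((\<lambda>x\<in>U. ?t n x (s x)) x) = (\<lambda>x\<in>U. ?t n x (s x)) y"
     using nat[OF xY[OF x] y comp(1)[OF s x]] comp(2)[OF s x y] x yU[OF x y] by simp
   qed simp
   fix t assume t: "t \<in> secs (sheafify Y (tensor_presheaf F (Ob M n))) U"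
   show "Dsh (sheaf_tensor Y F M) n U (s \<otimes>\<^bsub>sect (sheafify Y (tensor_presheaf F (Ob M n))) U\<^esub> t) =
     Dsh (sheaf_tensor Y F M) n U s \<otimes>\<^bsub>sect (sheafify Y (tensor_presheaf F (Ob M (n + 1)))) U\<^esub> Dsh (sheaf_tensor Y F M) n U t"
    unfolding mult_sheafify sheaf_tensor_simps tensor_presheaf_simps
    by (rule restrict_ext) (use hom_mult[OF hom[OF xY] comp(1)[OF s] comp(1)[OF t]] in simp)
  qed
 qed
 show ?thesis
  unfolding is_sheaf_complex_def sheaf_tensor_simps(1)
 proof (intro conjI allI impI ballI)
  fix n
  show "sheaf Y (sheafify Y (tensor_presheaf F (Ob M n)))" by (rule sheaf_sheafify[OF fin sf])
  show "sheaf_morphism Y (sheafify Y (tensor_presheaf F (Ob M n))) (sheafify Y (tensor_presheaf F (Ob M (n + 1))))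
    (Dsh (sheaf_tensor Y F M) n)"
   unfolding sheaf_morphism_def
  proof (intro conjI allI impI ballI)
   show "Dsh (sheaf_tensor Y F M) n U \<in> hom (sect (sheafify Y (tensor_presheaf F (Ob M n))) U)
     (sect (sheafify Y (tensor_presheaf F (Ob M (n + 1)))) U)" if "openin Y U" for U by (rule dhom[OF that])
  next
   fix U V s assume "openin Y U \<and> openin Y V \<and> V \<subseteq> U"
   then show "Dsh (sheaf_tensor Y F M) n V (rest (sheafify Y (tensor_presheaf F (Ob M n))) U V s) =
     rest (sheafify Y (tensor_presheaf F (Ob M (n + 1)))) U V (Dsh (sheaf_tensor Y F M) n U s)"
    unfolding sheaf_tensor_simps by (auto simp: rest_sheafify fun_eq_iff restrict_def)
  qed
  fix U s assume U: "openin Y U" and s: "s \<in> secs (sheafify Y (tensor_presheaf F (Ob M n))) U"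
  have e: "n + 2 = n + 1 + 1" by simp
  show "Dsh (sheaf_tensor Y F M) (n + 1) U (Dsh (sheaf_tensor Y F M) n U s) =
    \<one>\<^bsub>sect (sheafify Y (tensor_presheaf F (Ob M (n + 2)))) U\<^esub>"
   unfolding sheaf_tensor_simps one_sheafify e tensor_presheaf_simps
  proof (rule restrict_ext)
   fix x assume x: "x \<in> U"
   then have "x \<in> topspace Y" using openin_subset[OF U] by auto
   from dd[OF this comp(1)[OF s x]] x
   show "?t (n + 1) x ((\<lambda>x\<in>U. ?t n x (s x)) x) = \<one>\<^bsub>tensor_group (stalk Y F x) (Ob M (n + 1 + 1))\<^esub>" by simp
  qed
 qed
qed

text \<open>Surjectivity holds since moving an integer across the tensor sign turns
  \<open>\<kappa> i \<otimes> m\<close> into \<open>\<kappa> 1 \<otimes> m^i\<close>. For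
  injectivity, a homomorphism to \<open>M\<close> is defined on the free group; it kills the
  relations and recovers \<open>m\<close> from \<open>\<kappa> 1 \<otimes> m\<close>.\<close>

lemma tensor_group_infinite_cyclic:
 assumes A: "group A" and \<kappa>: "\<kappa> \<in> iso integer_group A" and M: "comm_group M"
 shows "bij_betw (pure_tensor A M (\<kappa> 1)) (carrier M) (carrier (tensor_group A M))"
proof -
 interpret A: group A by (rule A)
 interpret M: comm_group M by (rule M)
 interpret T: comm_group "tensor_group A M" by (rule comm_group_tensor_group[OF A.is_monoid M.is_monoid])
 have \<kappa>h: "\<kappa> \<in> hom integer_group A" and \<kappa>b: "bij_betw \<kappa> UNIV (carrier A)" using \<kappa> by (auto simp: iso_def)
 interpret k: group_hom integer_group A \<kappa>
  using \<kappa>h A by (simp add: group_hom_def group_hom_axioms_def)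
 have \<kappa>1: "\<kappa> 1 \<in> carrier A" using hom_in_carrier[OF \<kappa>h, of 1] by simp
 let ?\<mu> = "pure_tensor A M (\<kappa> 1)"
 have \<mu>: "?\<mu> \<in> hom M (tensor_group A M)"
  by (rule homI) (simp_all add: pure_tensor_carrier[OF \<kappa>1] pure_tensor_mult_right[OF A.is_monoid M.is_monoid \<kappa>1])
 interpret \<mu>: group_hom M "tensor_group A M" ?\<mu>
  using \<mu> by (simp add: group_hom_def group_hom_axioms_def T.is_group M.is_group)
 have "carrier (tensor_group A M) \<subseteq> ?\<mu> ` carrier M"
 proof (rule tensor_group_subgroup_eq[OF A.is_monoid M.is_monoid \<mu>.img_is_subgroup])
  fix a m assume a: "a \<in> carrier A" and m: "m \<in> carrier M"
  have "(\<lambda>a. pure_tensor A M a m) \<in> hom A (tensor_group A M)"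
   by (rule homI) (simp_all add: pure_tensor_carrier m pure_tensor_mult_left[OF A.is_monoid M.is_monoid _ _ m])
  then interpret p: group_hom A "tensor_group A M" "\<lambda>a. pure_tensor A M a m"
   by (simp add: group_hom_def group_hom_axioms_def T.is_group A)
  obtain i where "a = \<kappa> i" using a \<kappa>b by (auto simp: bij_betw_def)
  then have "a = \<kappa> 1 [^]\<^bsub>A\<^esub> i" using k.hom_int_pow[of 1 i] by simp
  then have "pure_tensor A M a m = ?\<mu> m [^]\<^bsub>tensor_group A M\<^esub> i" using p.hom_int_pow[OF \<kappa>1] by simp
  also have "\<dots> = ?\<mu> (m [^]\<^bsub>M\<^esub> i)" using \<mu>.hom_int_pow[OF m] by simp
  finally show "pure_tensor A M a m \<in> ?\<mu> ` carrier M" using m by simp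
 qed
 moreover have "inj_on ?\<mu> (carrier M)"
 proof (rule inj_onI)
  fix m m' assume m: "m \<in> carrier M" and m': "m' \<in> carrier M" and eq: "?\<mu> m = ?\<mu> m'"
  \<comment> \<open>\<open>j\<close> reads an element of \<open>A\<close> as an integer, so that
    \<open>(a, m) \<mapsto> m^(j a)\<close> is bilinear and takes \<open>(\<kappa> 1, m)\<close> to
    \<open>m\<close>.\<close>
  define j where "j = inv_into UNIV \<kappa>"
  have j\<kappa>: "j (\<kappa> i) = i" for i using \<kappa>b by (simp add: j_def bij_betw_def)
  have jadd: "j (a \<otimes>\<^bsub>A\<^esub> a') = j a + j a'" if "a \<in> carrier A" "a' \<in> carrier A" for a a'
  proof -
   have "a \<in> range \<kappa>" "a' \<in> range \<kappa>" using \<kappa>b that by (simp_all add: bij_betw_def)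
   then obtain i i' where "a = \<kappa> i" "a' = \<kappa> i'" by (elim rangeE)
   then show ?thesis using hom_mult[OF \<kappa>h, of i i'] j\<kappa>[of "i + i'"] by (simp add: j\<kappa>)
  qed
  obtain h where h: "h \<in> hom (tensor_free A M) M"
   and hf: "\<And>x. x \<in> carrier A \<times> carrier M \<Longrightarrow> h (frag_of x) = (\<lambda>(a, m). m [^]\<^bsub>M\<^esub> j a) x"
  proof (rule M.free_Abelian_group_universal[of "\<lambda>(a, m). m [^]\<^bsub>M\<^esub> j a" "carrier A \<times> carrier M"])
   show "(\<lambda>(a, m). m [^]\<^bsub>M\<^esub> j a) ` (carrier A \<times> carrier M) \<subseteq> carrier M" by auto
   fix h assume 1: "h \<in> hom (tensor_free A M) M"
    and 2: "\<And>x. x \<in> carrier A \<times> carrier M \<Longrightarrow> h (frag_of x) = (case x of (a, m) \<Rightarrow> m [^]\<^bsub>M\<^esub> j a)"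
   show thesis by (rule that[OF 1 2])
  qed
  have hf: "h (frag_of (a, m)) = m [^]\<^bsub>M\<^esub> j a" if "a \<in> carrier A" "m \<in> carrier M" for a m
   using hf[of "(a, m)"] that by simp
  interpret h: group_hom "tensor_free A M" M h
   using h by (simp add: group_hom_def group_hom_axioms_def M.is_group)
  have hd: "h (x - y) = h x \<otimes>\<^bsub>M\<^esub> inv\<^bsub>M\<^esub> h y" if "x \<in> carrier (tensor_free A M)" "y \<in> carrier (tensor_free A M)" for x y
  proof -
   have "x - y = x \<otimes>\<^bsub>tensor_free A M\<^esub> inv\<^bsub>tensor_free A M\<^esub> y" using that by simp
   then have "h (x - y) = h (x \<otimes>\<^bsub>tensor_free A M\<^esub> inv\<^bsub>tensor_free A M\<^esub> y)" by (rule arg_cong)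
   then show ?thesis unfolding h.hom_mult[OF that(1) h.G.inv_closed[OF that(2)]] h.hom_inv[OF that(2)] .
  qed
  have dc: "x - y \<in> carrier (tensor_free A M)" if "x \<in> carrier (tensor_free A M)" "y \<in> carrier (tensor_free A M)" for x y
   using that by (auto dest!: subsetD[OF keys_diff])
  have cancel: "y \<otimes>\<^bsub>M\<^esub> x \<otimes>\<^bsub>M\<^esub> inv\<^bsub>M\<^esub> x = y" if "x \<in> carrier M" "y \<in> carrier M" for x y
   using that by (simp add: M.m_assoc)
  have "tensor_generators A M \<subseteq> kernel (tensor_free A M) M h"
  proof
   fix w assume w: "w \<in> tensor_generators A M"
   have wc: "w \<in> carrier (tensor_free A M)" using tensor_generators_carrier[OF A.is_monoid M.is_monoid] w by blast
   have "h w = \<one>\<^bsub>M\<^esub>"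
    using w unfolding tensor_generators_def
   proof (elim UnE CollectE exE conjE)
    fix a a' b assume w: "w = frag_of (a \<otimes>\<^bsub>A\<^esub> a', b) - frag_of (a, b) - frag_of (a', b)"
     and c: "a \<in> carrier A" "a' \<in> carrier A" "b \<in> carrier M"
    have "frag_of (a \<otimes>\<^bsub>A\<^esub> a', b) - frag_of (a, b) \<in> carrier (tensor_free A M)" using c by (intro dc) simp_all
    then have "h w = (b [^]\<^bsub>M\<^esub> j (a \<otimes>\<^bsub>A\<^esub> a') \<otimes>\<^bsub>M\<^esub> inv\<^bsub>M\<^esub> (b [^]\<^bsub>M\<^esub> j a)) \<otimes>\<^bsub>M\<^esub> inv\<^bsub>M\<^esub> (b [^]\<^bsub>M\<^esub> j a')"
     using c by (simp add: w hd hf)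
    also have "b [^]\<^bsub>M\<^esub> j (a \<otimes>\<^bsub>A\<^esub> a') = b [^]\<^bsub>M\<^esub> j a' \<otimes>\<^bsub>M\<^esub> b [^]\<^bsub>M\<^esub> j a"
     using c by (simp add: jadd M.int_pow_mult add.commute)
    finally show ?thesis using c by (simp add: cancel)
   next
    fix a b b' assume w: "w = frag_of (a, b \<otimes>\<^bsub>M\<^esub> b') - frag_of (a, b) - frag_of (a, b')"
     and c: "a \<in> carrier A" "b \<in> carrier M" "b' \<in> carrier M"
    have "frag_of (a, b \<otimes>\<^bsub>M\<^esub> b') - frag_of (a, b) \<in> carrier (tensor_free A M)" using c by (intro dc) simp_all
    then have "h w = ((b \<otimes>\<^bsub>M\<^esub> b') [^]\<^bsub>M\<^esub> j a \<otimes>\<^bsub>M\<^esub> inv\<^bsub>M\<^esub> (b [^]\<^bsub>M\<^esub> j a)) \<otimes>\<^bsub>M\<^esub> inv\<^bsub>M\<^esub> (b' [^]\<^bsub>M\<^esub> j a)"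
     using c by (simp add: w hd hf)
    also have "(b \<otimes>\<^bsub>M\<^esub> b') [^]\<^bsub>M\<^esub> j a = b' [^]\<^bsub>M\<^esub> j a \<otimes>\<^bsub>M\<^esub> b [^]\<^bsub>M\<^esub> j a"
     using M.int_pow_mult_distrib[OF M.m_comm[OF c(2,3)] c(2,3)] c M.m_comm by simp
    finally show ?thesis using c by (simp add: cancel)
   qed
   then show "w \<in> kernel (tensor_free A M) M h" using wc by (simp add: kernel_def)
  qed
  then have rel: "tensor_relations A M \<subseteq> kernel (tensor_free A M) M h"
   by (rule tensor_relations_subset[OF A.is_monoid M.is_monoid h.subgroup_kernel])
  have f: "frag_of (\<kappa> 1, m) \<in> carrier (tensor_free A M)" "frag_of (\<kappa> 1, m') \<in> carrier (tensor_free A M)"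
   using \<kappa>1 m m' by simp_all
  have "frag_of (\<kappa> 1, m) - frag_of (\<kappa> 1, m') \<in> tensor_relations A M"
   using eq unfolding pure_tensor_eq tensor_class_eq_iff[OF A.is_monoid M.is_monoid f] .
  then have "h (frag_of (\<kappa> 1, m) - frag_of (\<kappa> 1, m')) = \<one>\<^bsub>M\<^esub>" using rel by (auto simp: kernel_def)
  then have "m \<otimes>\<^bsub>M\<^esub> inv\<^bsub>M\<^esub> m' = \<one>\<^bsub>M\<^esub>"
   unfolding hd[OF f] hf[OF \<kappa>1 m] hf[OF \<kappa>1 m'] j\<kappa> using m m' by (simp add: M.int_pow_1)
  then show "m = m'" using m m' M.inv_solve_right'[of "\<one>\<^bsub>M\<^esub>" m m'] by simp
 qed
 ultimately show ?thesis using hom_in_carrier[OF \<mu>] by (auto simp: bij_betw_def)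
qed

text \<open>If \<open>y\<close> is strictly below \<open>c\<close>, closedness of the support forces
  the value at \<open>c\<close> to be the value 0 at \<open>y\<close>. So the stalk is the integers
  at \<open>c\<close> and zero elsewhere, even at points whose smallest neighbourhood contains
  \<open>c\<close>.\<close>

lemma point_sheaf_sections:
 assumes fin: "finite_space Y" and c: "c \<in> topspace Y" and y: "y \<in> topspace Y"
 shows "germs Y (const_sheaf Y {c}) y =
  (if y = c then range (\<lambda>(k::int) x. if x = c then k else 0) else {\<lambda>x. 0})"
proof -
 have o: "openin Y (min_nbhd Y y)" by (rule openin_min_nbhd[OF fin y])
 have s0: "s x = 0" if "s \<in> germs Y (const_sheaf Y {c}) y" "x \<noteq> c" for s x
  using that unfolding mem_const_sheaf[OF fin o] by blast
 have sc: "s c = 0" if s: "s \<in> germs Y (const_sheaf Y {c}) y" and "y \<noteq> c" for s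
 proof (cases "c \<in> min_nbhd Y y")
  case True
  then have "s c = s y" using s min_nbhd_refl[of y Y] unfolding mem_const_sheaf[OF fin o] by blast
  then show ?thesis using s0[OF s \<open>y \<noteq> c\<close>] by simp
 next
  case False
  then show ?thesis using s unfolding mem_const_sheaf[OF fin o] by blast
 qed
 have mem: "s \<in> range (\<lambda>(k::int) x. if x = c then k else 0)" if "\<And>x. x \<noteq> c \<Longrightarrow> s x = 0" for s
  by (rule range_eqI[of _ _ "s c"]) (use that in auto)
 have z: "(\<lambda>x. 0) \<in> germs Y (const_sheaf Y {c}) y"
  unfolding mem_const_sheaf[OF fin o] by simp
 have k: "(\<lambda>x. if x = c then k else 0) \<in> germs Y (const_sheaf Y {c}) y" if "y = c" for k :: int
  unfolding mem_const_sheaf[OF fin o]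
  using min_nbhd_refl[of c Y] min_nbhd_antisym[OF fin c] by (auto simp: that)
 show ?thesis
 proof (cases "y = c")
  case True
  have "germs Y (const_sheaf Y {c}) y = range (\<lambda>(k::int) x. if x = c then k else 0)"
  proof (rule subset_antisym)
   show "germs Y (const_sheaf Y {c}) y \<subseteq> range (\<lambda>(k::int) x. if x = c then k else 0)"
    by (rule subsetI, rule mem, rule s0)
   show "range (\<lambda>(k::int) x. if x = c then k else 0) \<subseteq> germs Y (const_sheaf Y {c}) y"
    by (rule image_subsetI, rule k[OF True])
  qed
  then show ?thesis using True by simp
 next
  case False
  have "s = (\<lambda>x. 0)" if "s \<in> germs Y (const_sheaf Y {c}) y" for s
  proof (rule ext)
   show "s x = 0" for x using s0[OF that, of x] sc[OF that False] by (cases "x = c") simp_all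
  qed
  then have "germs Y (const_sheaf Y {c}) y = {\<lambda>x. 0}"
   by (intro subset_antisym subsetI) (simp_all add: z)
  then show ?thesis using False by simp
 qed
qed

lemma point_sheaf_iso_integer_group:
 assumes fin: "finite_space Y" and c: "c \<in> topspace Y"
 shows "(\<lambda>k x. if x = c then k else 0) \<in> iso integer_group (stalk Y (const_sheaf Y {c}) c)"
proof -
 have "inj (\<lambda>(k::int) x. if x = c then k else 0)" by (rule injI) (drule fun_cong[of _ _ c], simp)
 then have "bij_betw (\<lambda>k x. if x = c then k else 0) (carrier integer_group) (germs Y (const_sheaf Y {c}) c)"
  by (simp add: bij_betw_def point_sheaf_sections[OF fin c c])
 moreover have "(\<lambda>k x. if x = c then k else 0) \<in> hom integer_group (stalk Y (const_sheaf Y {c}) c)"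
  by (rule homI) (simp_all add: point_sheaf_sections[OF fin c c] const_sheaf_simps fun_eq_iff)
 ultimately show ?thesis by (simp add: iso_def)
qed

text \<open>A section of the sheafification over the smallest neighbourhood of \<open>c\<close> is
  determined by its germ at \<open>c\<close>, where the point sheaf is free on the function with
  value 1. Hence tensoring gives back \<open>M\<close> at \<open>c\<close>; elsewhere the left
  factor is trivial.\<close>

lemma point_tensor_stalk:
 fixes M :: "'b group_complex"
 assumes fin: "finite_space Y" and c: "c \<in> topspace Y" and M: "group_complex M"
 defines "\<tau> \<equiv> \<lambda>n. tensor_section Y (const_sheaf Y {c}) (Ob M n) (min_nbhd Y c) (\<lambda>y. if y = c then 1 else 0)"
  and "T \<equiv> sheaf_tensor Y (const_sheaf Y {c}) M"
 shows "chain_map M (stalks Y T c) \<tau>"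
  and "bij_betw (\<tau> n) (obs M n) (germs Y (Sh T n) c)"
  and "y \<in> topspace Y \<Longrightarrow> y \<noteq> c \<Longrightarrow> s \<in> germs Y (Sh T n) y \<Longrightarrow>
   s = one_sect (Sh T n) (min_nbhd Y y)"
proof -
 let ?F = "const_sheaf Y {c}" and ?U = "min_nbhd Y c" and ?e = "\<lambda>y. if y = c then 1 else 0 :: int"
 have F: "presheaf Y ?F" by (rule sheaf_imp_presheaf[OF sheaf_const_sheaf[OF fin]])
 note o = openin_min_nbhd[OF fin]
 have nY: "x \<in> topspace Y" if "x \<in> ?U" for x using min_nbhd_in_topspace[OF c that] .
 note mM = complexD(3)[OF M] and d = complexD(4)[OF M]
 have mF: "monoid (stalk Y ?F x)" if "x \<in> topspace Y" for x using presheafD(3)[OF F o[OF that]] .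
 have e: "?e \<in> secs ?F ?U" unfolding point_sheaf_sections[OF fin c c] by (auto intro: range_eqI[of _ _ 1])
 have r: "rest ?F ?U (min_nbhd Y x) \<in> hom (sect ?F ?U) (stalk Y ?F x)" if "x \<in> ?U" for x
  using presheafD(4)[OF F o[OF c] o[OF nY[OF that]] min_nbhd_mono[OF fin c that]] .
 have i: "id \<in> hom (Ob M n) (Ob M n)" "id \<in> hom (sect ?F W) (sect ?F W)" for n W by (simp_all add: hom_def)
 have Te: "Sh T n = sheafify Y (tensor_presheaf ?F (Ob M n))" for n by (simp add: T_def sheaf_tensor_simps)
 note sf = stalk_functor_tensor_presheaf[OF fin F mM]
 have \<mu>: "pure_tensor (sect ?F ?U) (Ob M n) ?e \<in> hom (Ob M n) (tensor_group (sect ?F ?U) (Ob M n))" for n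
  by (rule homI) (simp_all add: pure_tensor_carrier[OF e] pure_tensor_mult_right[OF mF[OF c] mM e])
 have \<tau>: "\<tau> n m = germ_section Y (tensor_presheaf ?F (Ob M n)) c (pure_tensor (sect ?F ?U) (Ob M n) ?e m)"
  if "m \<in> obs M n" for n m
  unfolding \<tau>_def tensor_section_def germ_section_def tensor_presheaf_simps
  by (rule restrict_ext) (simp add: tensor_map_pure[OF mF[OF c] mM mF[OF nY] mM r i(1) e that])
 let ?S = "\<lambda>n. sheafify Y (tensor_presheaf ?F (Ob M n))"
 have gh: "germ_section Y (tensor_presheaf ?F (Ob M n)) c \<in> hom (tensor_group (sect ?F ?U) (Ob M n)) (sect (?S n) ?U)" for n
  using germ_section_hom[OF fin sf c, of n] unfolding tensor_presheaf_simps .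
 have gb: "bij_betw (germ_section Y (tensor_presheaf ?F (Ob M n)) c) (carrier (tensor_group (sect ?F ?U) (Ob M n))) (secs (?S n) ?U)" for n
 proof (rule bij_betw_byWitness[where f' = "\<lambda>s. s c"])
  show "\<forall>a\<in>carrier (tensor_group (sect ?F ?U) (Ob M n)). germ_section Y (tensor_presheaf ?F (Ob M n)) c a c = a"
   using germ_section_self[OF sf c, of _ n] by (simp add: tensor_presheaf_simps)
  show "\<forall>s\<in>secs (?S n) ?U. germ_section Y (tensor_presheaf ?F (Ob M n)) c (s c) = s"
   using germ_section_eq by auto
  show "germ_section Y (tensor_presheaf ?F (Ob M n)) c ` carrier (tensor_group (sect ?F ?U) (Ob M n)) \<subseteq> secs (?S n) ?U"
   using hom_in_carrier[OF gh] by auto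
  show "(\<lambda>s. s c) ` secs (?S n) ?U \<subseteq> carrier (tensor_group (sect ?F ?U) (Ob M n))"
   using min_nbhd_refl[of c Y] by (auto simp: carrier_sheafify compatible_germs_def tensor_presheaf_simps)
 qed
 have "bij_betw (pure_tensor (sect ?F ?U) (Ob M n) ?e) (obs M n) (carrier (tensor_group (sect ?F ?U) (Ob M n)))" for n
  using tensor_group_infinite_cyclic[OF presheafD(2)[OF F o[OF c]] point_sheaf_iso_integer_group[OF fin c] complexD(1)[OF M]] .
 from bij_betw_trans[OF this gb]
 show "bij_betw (\<tau> n) (obs M n) (secs (Sh T n) ?U)" for n
  unfolding Te by (subst bij_betw_cong[where g = "germ_section Y (tensor_presheaf ?F (Ob M n)) c \<circ> pure_tensor (sect ?F ?U) (Ob M n) ?e"])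
   (simp_all add: \<tau>)
 show "chain_map M (sections T ?U) \<tau>"
  unfolding chain_map_def sections_simps
 proof (intro conjI allI ballI)
  fix n
  have "germ_section Y (tensor_presheaf ?F (Ob M n)) c \<circ> pure_tensor (sect ?F ?U) (Ob M n) ?e \<in> hom (Ob M n) (sect (Sh T n) ?U)"
   using hom_compose[OF \<mu> gh] unfolding Te .
  then show "\<tau> n \<in> hom (Ob M n) (sect (Sh T n) ?U)"
   using monoid.m_closed[OF mM] by (auto simp: hom_def \<tau>)
  fix m assume m: "m \<in> obs M n"
  show "\<tau> (n + 1) (Df M n m) = Dsh T n ?U (\<tau> n m)"
   unfolding T_def sheaf_tensor_simps \<tau>_def tensor_section_def
  proof (rule restrict_ext)
   fix x assume x: "x \<in> ?U"
   have "rest ?F ?U (min_nbhd Y x) ?e \<in> germs Y ?F x" using hom_in_carrier[OF r[OF x] e] .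
   then show "pure_tensor (stalk Y ?F x) (Ob M (n + 1)) (rest ?F ?U (min_nbhd Y x) ?e) (Df M n m) =
     tensor_map (stalk Y ?F x) (Ob M (n + 1)) id (Df M n)
      ((\<lambda>x\<in>?U. pure_tensor (stalk Y ?F x) (Ob M n) (rest ?F ?U (min_nbhd Y x) ?e) m) x)"
    using tensor_map_pure[OF mF[OF nY[OF x]] mM mF[OF nY[OF x]] mM i(2) d _ m] x by simp
  qed
 qed
 assume y: "y \<in> topspace Y" "y \<noteq> c" and s: "s \<in> germs Y (Sh T n) y"
 have one: "(one_sect (Sh T n) (min_nbhd Y y)) \<in> germs Y (Sh T n) y"
  unfolding T_def
  by (rule monoid.one_closed[OF presheafD(3)[OF is_sheaf_complexD(2)[OF is_sheaf_complex_tensor[OF fin F M]] o[OF y(1)]]])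
 have "carrier (tensor_group (stalk Y ?F y) (Ob M n)) = {\<one>\<^bsub>tensor_group (stalk Y ?F y) (Ob M n)\<^esub>}"
  using point_sheaf_sections[OF fin c y(1)] y(2)
  by (intro tensor_group_trivial_left[OF presheafD(2)[OF F o[OF y(1)]] mM]) (simp add: const_sheaf_simps)
 then have "t y = \<one>\<^bsub>tensor_group (stalk Y ?F y) (Ob M n)\<^esub>" if "t \<in> germs Y (Sh T n) y" for t
  using that min_nbhd_refl[of y Y] by (auto simp: Te carrier_sheafify compatible_germs_def tensor_presheaf_simps)
 from this[OF s] this[OF one] have "s y = one_sect (Sh T n) (min_nbhd Y y) y" by simp
 then have "germ_section Y (tensor_presheaf ?F (Ob M n)) y (s y) =
   germ_section Y (tensor_presheaf ?F (Ob M n)) y ((one_sect (Sh T n) (min_nbhd Y y)) y)" by (rule arg_cong)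
 then show "s = one_sect (Sh T n) (min_nbhd Y y)"
  unfolding germ_section_eq[OF s[unfolded Te]] germ_section_eq[OF one[unfolded Te], folded Te] .
qed

subsection \<open>Complexes concentrated at one point\<close>

lemma quasi_iso_cong:
 assumes "quasi_iso A B \<phi>" and eq: "\<And>n a. a \<in> obs A n \<Longrightarrow> \<psi> n a = \<phi> n a"
 shows "quasi_iso A B \<psi>"
proof -
 have "\<psi> n a = \<phi> n a" if "a \<in> cocycles A n" for n a using that eq by (simp add: cocycles_def)
 then show ?thesis using assms(1) unfolding quasi_iso_def by simp
qed

lemma quasi_isomorphism_iff:
 assumes fin: "finite_space X"
 shows "quasi_isomorphism X K L \<phi> \<longleftrightarrow> complex_morphism X K L \<phi> \<and>
  (\<forall>x\<in>topspace X. quasi_iso (stalks X K x) (stalks X L x) (\<lambda>n. \<phi> n (min_nbhd X x)))"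
proof (cases "complex_morphism X K L \<phi>")
 case True
 note o = openin_min_nbhd[OF fin]
 have "quasi_iso (stalks X K x) (stalks X L x) (\<lambda>n. \<phi> n (min_nbhd X x)) \<longleftrightarrow>
   (\<forall>n. cohomology_map (stalks X L x) (\<lambda>m. \<phi> m (min_nbhd X x)) n
    \<in> iso (cohomology (stalks X K x) n) (cohomology (stalks X L x) n))"
  if "x \<in> topspace X" for x
  by (rule quasi_iso_iff_cohomology[OF group_complex_sections[OF complex_morphismD(1)[OF True] o[OF that]]
     group_complex_sections[OF complex_morphismD(2)[OF True] o[OF that]] chain_map_sections[OF True o[OF that]]])
 then show ?thesis unfolding quasi_isomorphism_def Let_def using True by simp
qed (simp add: quasi_isomorphism_def)

text \<open>The map on stalks is \<open>b\<close> at \<open>c\<close> and trivial elsewhere. It is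
  natural because the stalks of \<open>L\<close> other than the one at \<open>c\<close> are trivial,
  and because \<open>bz\<close> makes the values of \<open>b\<close> die on restriction to points
  above \<open>c\<close>.\<close>

lemma skyscraper_quasi_isomorphism:
 fixes K :: "('y, 'a) sheaf_complex" and L :: "('y, 'b) sheaf_complex"
 assumes fin: "finite_space Y" and c: "c \<in> topspace Y"
  and L: "is_sheaf_complex Y L" and K: "is_sheaf_complex Y K"
  and triv: "\<And>n y s. y \<in> topspace Y \<Longrightarrow> y \<noteq> c \<Longrightarrow> s \<in> germs Y (Sh L n) y \<Longrightarrow>
   s = one_sect (Sh L n) (min_nbhd Y y)"
  and ex: "\<And>y. y \<in> topspace Y \<Longrightarrow> y \<noteq> c \<Longrightarrow> exact_complex (stalks Y K y)"
  and b: "chain_map (stalks Y L c) (stalks Y K c) b"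
  and q: "quasi_iso (stalks Y L c) (stalks Y K c) b"
  and bz: "\<And>n y s. y \<in> min_nbhd Y c \<Longrightarrow> y \<noteq> c \<Longrightarrow> s \<in> germs Y (Sh L n) c \<Longrightarrow>
   germ Y (Sh K n) c y (b n s) = one_sect (Sh K n) (min_nbhd Y y)"
 obtains \<beta> where "quasi_isomorphism Y L K \<beta>"
  and "\<And>n s. s \<in> germs Y (Sh L n) c \<Longrightarrow> \<beta> n (min_nbhd Y c) s = b n s"
proof -
 note o = openin_min_nbhd[OF fin] and mono = min_nbhd_mono[OF fin]
 note pL = is_sheaf_complexD(2)[OF L] and pK = is_sheaf_complexD(2)[OF K]
 have nY: "y \<in> topspace Y" if "x \<in> topspace Y" "y \<in> min_nbhd Y x" for x y using min_nbhd_in_topspace[OF that] .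
 have gL: "group (stalk Y (Sh L n) y)" and gK: "group (stalk Y (Sh K n) y)" if "y \<in> topspace Y" for n y
  using presheafD(2)[OF pL o[OF that]] presheafD(2)[OF pK o[OF that]] .
 have b_hom: "b n \<in> hom (stalk Y (Sh L n) c) (stalk Y (Sh K n) c)" for n
  using chain_mapD(1)[OF b, of n] by simp
 define h where "h n y s = (if y = c then b n s else (one_sect (Sh K n) (min_nbhd Y y)))" for n y s
 have hc: "h n c = b n" for n by (simp add: h_def fun_eq_iff)
 have "stalk_map Y (Sh L n) (Sh K n) (h n)" for n
  unfolding stalk_map_def
 proof (intro conjI ballI)
  fix x assume x: "x \<in> topspace Y"
  interpret Kx: group "stalk Y (Sh K n) x" by (rule gK[OF x])
  show "h n x \<in> hom (stalk Y (Sh L n) x) (stalk Y (Sh K n) x)"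
  proof (cases "x = c")
   case True
   then show ?thesis using b_hom by (simp add: hc)
  next
   case False
   then show ?thesis by (intro homI) (simp_all add: h_def)
  qed
  fix y s assume y: "y \<in> min_nbhd Y x" and s: "s \<in> germs Y (Sh L n) x"
  show "h n y (germ Y (Sh L n) x y s) = germ Y (Sh K n) x y (h n x s)"
  proof (cases "x = c")
   case xc: True
   note s = s[unfolded xc] and y = y[unfolded xc]
   show ?thesis
   proof (cases "y = c")
    case True
    show ?thesis
     unfolding xc True hc presheafD(6)[OF pL o[OF c] s] presheafD(6)[OF pK o[OF c] hom_in_carrier[OF b_hom s]] ..
   next
    case False
    then show ?thesis using bz[OF y False s] by (simp add: xc h_def)
   qed
  next
   case False
   have s1: "s = one_sect (Sh L n) (min_nbhd Y x)" using triv[OF x False s] .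
   have "h n y (one_sect (Sh L n) (min_nbhd Y y)) = one_sect (Sh K n) (min_nbhd Y y)"
    using hom_one[OF b_hom gL[OF c] gK[OF c]] by (simp add: h_def)
   then show ?thesis
    using presheaf_rest_one[OF pL o[OF x] o[OF nY[OF x y]] mono[OF x y], of n]
     presheaf_rest_one[OF pK o[OF x] o[OF nY[OF x y]] mono[OF x y], of n] False
    by (simp add: s1 h_def[of n x])
  qed
 qed
 then have "\<exists>\<phi>. sheaf_morphism Y (Sh L n) (Sh K n) \<phi> \<and>
   (\<forall>x s. x \<in> topspace Y \<longrightarrow> s \<in> germs Y (Sh L n) x \<longrightarrow> \<phi> (min_nbhd Y x) s = h n x s)" for n
 proof (rule stalk_map_extends[OF fin pL is_sheaf_complexD(1)[OF K]])
  fix \<phi> assume 1: "sheaf_morphism Y (Sh L n) (Sh K n) \<phi>"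
   and 2: "\<And>x s. x \<in> topspace Y \<Longrightarrow> s \<in> germs Y (Sh L n) x \<Longrightarrow> \<phi> (min_nbhd Y x) s = h n x s"
  show ?thesis by (rule exI[of _ \<phi>]) (simp add: 1 2)
 qed
 then have "\<forall>n. \<exists>\<phi>. sheaf_morphism Y (Sh L n) (Sh K n) \<phi> \<and>
   (\<forall>x s. x \<in> topspace Y \<longrightarrow> s \<in> germs Y (Sh L n) x \<longrightarrow> \<phi> (min_nbhd Y x) s = h n x s)" ..
 from choice[OF this] obtain \<beta> where \<beta>_all: "\<forall>n. sheaf_morphism Y (Sh L n) (Sh K n) (\<beta> n) \<and>
   (\<forall>x s. x \<in> topspace Y \<longrightarrow> s \<in> germs Y (Sh L n) x \<longrightarrow> \<beta> n (min_nbhd Y x) s = h n x s)" ..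
 have \<beta>: "sheaf_morphism Y (Sh L n) (Sh K n) (\<beta> n)" for n using \<beta>_all by simp
 have \<beta>h: "\<beta> n (min_nbhd Y x) s = h n x s" if "x \<in> topspace Y" "s \<in> germs Y (Sh L n) x" for n x s
  using \<beta>_all that by simp
 note mL = is_sheaf_complexD(3)[OF L] and mK = is_sheaf_complexD(3)[OF K]
 have dst: "\<beta> (n + 1) (min_nbhd Y x) (Dsh L n (min_nbhd Y x) s) = Dsh K n (min_nbhd Y x) (\<beta> n (min_nbhd Y x) s)"
  if x: "x \<in> topspace Y" and s: "s \<in> germs Y (Sh L n) x" for n x s
 proof (cases "x = c")
  case True
  then show ?thesis
   using chain_mapD(2)[OF b, of s n] s \<beta>h[OF x s] \<beta>h[OF x morphismD(2)[OF mL o[OF x] s]] by (simp add: hc)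
 next
  case False
  then show ?thesis
   using \<beta>h[OF x s] \<beta>h[OF x morphismD(2)[OF mL o[OF x] s]]
    hom_one[OF morphismD(1)[OF mK o[OF x]] gK[OF x] gK[OF x], of n] by (simp add: h_def)
 qed
 have cm: "complex_morphism Y L K \<beta>"
  unfolding complex_morphism_def
 proof (intro conjI allI impI ballI)
  show "is_sheaf_complex Y L" "is_sheaf_complex Y K" by fact+
  show "sheaf_morphism Y (Sh L n) (Sh K n) (\<beta> n)" for n by (rule \<beta>)
  fix n U s assume U: "openin Y U" and s: "s \<in> secs (Sh L n) U"
  show "\<beta> (n + 1) U (Dsh L n U s) = Dsh K n U (\<beta> n U s)"
  proof (rule sheaf_eqI[OF fin is_sheaf_complexD(1)[OF K] U])
   have ds: "Dsh L n U s \<in> secs (Sh L (n + 1)) U" by (rule morphismD(2)[OF mL U s])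
   show "\<beta> (n + 1) U (Dsh L n U s) \<in> secs (Sh K (n + 1)) U" by (rule morphismD(2)[OF \<beta> U ds])
   show "Dsh K n U (\<beta> n U s) \<in> secs (Sh K (n + 1)) U"
    by (rule morphismD(2)[OF mK U morphismD(2)[OF \<beta> U s]])
   fix x assume x: "x \<in> U"
   have xY: "x \<in> topspace Y" using x openin_subset[OF U] by auto
   note xU = min_nbhd_subset[OF U x]
   show "rest (Sh K (n + 1)) U (min_nbhd Y x) (\<beta> (n + 1) U (Dsh L n U s)) =
     rest (Sh K (n + 1)) U (min_nbhd Y x) (Dsh K n U (\<beta> n U s))"
    unfolding morphismD(3)[OF \<beta> U o[OF xY] xU ds, symmetric] morphismD(3)[OF mL U o[OF xY] xU s, symmetric]
     morphismD(3)[OF mK U o[OF xY] xU morphismD(2)[OF \<beta> U s], symmetric]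
     morphismD(3)[OF \<beta> U o[OF xY] xU s, symmetric]
    by (rule dst[OF xY presheafD(5)[OF pL U o[OF xY] xU s]])
  qed
 qed
 show thesis
 proof (rule that)
  show "\<beta> n (min_nbhd Y c) s = b n s" if "s \<in> germs Y (Sh L n) c" for n s
   using \<beta>h[OF c that] by (simp add: hc)
  show "quasi_isomorphism Y L K \<beta>"
   unfolding quasi_isomorphism_iff[OF fin]
  proof (intro conjI ballI)
   show "complex_morphism Y L K \<beta>" by (rule cm)
   fix x assume x: "x \<in> topspace Y"
   show "quasi_iso (stalks Y L x) (stalks Y K x) (\<lambda>n. \<beta> n (min_nbhd Y x))"
   proof (cases "x = c")
    case True
    show ?thesis unfolding True by (rule quasi_iso_cong[OF q]) (simp add: \<beta>h[OF c] hc)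
   next
    case False
    note GL = group_complex_sections[OF L o[OF x]] and GK = group_complex_sections[OF K o[OF x]]
    have one: "(one_sect (Sh L n) (min_nbhd Y x)) \<in> cocycles (stalks Y L x) n"
     "(one_sect (Sh L n) (min_nbhd Y x)) \<in> coboundaries (stalks Y L x) n" for n
     using subgroup.one_closed[OF subgroup_cocycles[OF GL, of n]] subgroup.one_closed[OF subgroup_coboundaries[OF GL, of n]]
     by simp_all
    show ?thesis
     unfolding quasi_iso_def
    proof (intro allI conjI ballI impI)
     fix n a assume "a \<in> cocycles (stalks Y L x) n"
     then have "a = one_sect (Sh L n) (min_nbhd Y x)" using triv[OF x False] by (simp add: cocycles_def)
     then show "a \<in> coboundaries (stalks Y L x) n" using one(2) by simp
    next
     fix n a assume a: "a \<in> cocycles (stalks Y K x) n"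
     then have ac: "a \<in> coboundaries (stalks Y K x) n" using ex[OF x False] by (auto simp: exact_complex_def)
     have oc: "(one_sect (Sh L n) (min_nbhd Y x)) \<in> germs Y (Sh L n) x"
      using one(1)[of n] by (simp add: cocycles_def)
     have "a = \<beta> n (min_nbhd Y x) (one_sect (Sh L n) (min_nbhd Y x)) \<otimes>\<^bsub>stalk Y (Sh K n) x\<^esub> a"
      using a False group.is_monoid[OF gK[OF x]] by (simp add: \<beta>h[OF x oc] h_def cocycles_def monoid.l_one)
     then show "\<exists>a'\<in>cocycles (stalks Y L x) n. \<exists>r\<in>coboundaries (stalks Y K x) n.
       a = \<beta> n (min_nbhd Y x) a' \<otimes>\<^bsub>Ob (stalks Y K x) n\<^esub> r"
      using one(1)[of n] ac unfolding sections_simps by blast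
    qed
   qed
  qed
 qed
qed

subsection \<open>The canonical morphism on stalks\<close>

lemma group_complex_shift:
 assumes A: "group_complex A"
 shows "group_complex (group_shift k A)"
 unfolding group_complex_def
proof (intro conjI allI ballI)
 fix n
 have e: "n + 1 + k = n + k + 1" "n + 2 + k = n + k + 2" "n + k + 1 + 1 = n + k + 2" by simp_all
 interpret H: comm_group "Ob A (n + k + 1)" by (rule complexD(1)[OF A])
 interpret H2: comm_group "Ob A (n + k + 2)" by (rule complexD(1)[OF A])
 interpret d: group_hom "Ob A (n + k)" "Ob A (n + k + 1)" "Df A (n + k)"
  using complexD(4)[OF A, of "n + k"] complexD(2)[OF A] by (simp add: group_hom_def group_hom_axioms_def)
 interpret d2: group_hom "Ob A (n + k + 1)" "Ob A (n + k + 2)" "Df A (n + k + 1)"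
  using complexD(4)[OF A, of "n + k + 1"] complexD(2)[OF A] unfolding e
  by (simp add: group_hom_def group_hom_axioms_def)
 show "comm_group (Ob (group_shift k A) n)" using complexD(1)[OF A] by (simp add: group_shift_simps)
 show "Df (group_shift k A) n \<in> hom (Ob (group_shift k A) n) (Ob (group_shift k A) (n + 1))"
  unfolding group_shift_simps(1) e by (rule homI) (simp_all add: group_shift_simps H.inv_mult)
 fix a assume "a \<in> obs (group_shift k A) n"
 then have a: "a \<in> obs A (n + k)" by (simp add: group_shift_simps)
 show "Df (group_shift k A) (n + 1) (Df (group_shift k A) n a) = one_ob (group_shift k A) (n + 2)"
  using complexD(5)[OF A a] d.hom_closed[OF a] unfolding group_shift_simps e by simp
qed

lemma chain_map_inv_into:
 assumes A: "group_complex A" and B: "group_complex B" and \<phi>: "chain_map A B \<phi>"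
  and bij: "\<And>n. bij_betw (\<phi> n) (obs A n) (obs B n)"
 shows "chain_map B A (\<lambda>n. inv_into (obs A n) (\<phi> n))"
 unfolding chain_map_def
proof (intro conjI allI ballI)
 fix n
 have "\<phi> n \<in> iso (Ob A n) (Ob B n)" using chain_mapD(1)[OF \<phi>] bij by (simp add: iso_def)
 from group.iso_set_sym[OF complexD(2)[OF A] this]
 show "inv_into (obs A n) (\<phi> n) \<in> hom (Ob B n) (Ob A n)" by (simp add: iso_def)
 fix b assume b: "b \<in> obs B n"
 let ?a = "inv_into (obs A n) (\<phi> n) b"
 have a: "?a \<in> obs A n" "\<phi> n ?a = b"
  using bij_betw_inv_into_right[OF bij b] bij_betwE[OF bij_betw_inv_into[OF bij]] b by auto
 have "inv_into (obs A (n + 1)) (\<phi> (n + 1)) (\<phi> (n + 1) (Df A n ?a)) = Df A n ?a"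
  by (rule bij_betw_inv_into_left[OF bij hom_in_carrier[OF complexD(4)[OF A] a(1)]])
 then show "inv_into (obs A (n + 1)) (\<phi> (n + 1)) (Df B n b) = Df A n ?a"
  unfolding chain_mapD(2)[OF \<phi> a(1)] a(2) .
qed

text \<open>The homotopy is trivial; that the values lie in \<open>B\<close> makes multiplication by
  the unit harmless.\<close>

lemma chain_homotopic_if_eq:
 assumes A: "group_complex A" and B: "group_complex B"
  and eq: "\<And>n a. a \<in> obs A n \<Longrightarrow> \<phi> n a = \<psi> n a \<and> \<psi> n a \<in> obs B n"
 shows "chain_homotopic A B \<phi> \<psi>"
 unfolding chain_homotopic_def
proof (intro exI[of _ "\<lambda>n a. (one_ob B (n - 1))"] conjI allI ballI)
 fix n
 show "(\<lambda>a. (one_ob B (n - 1))) \<in> hom (Ob A n) (Ob B (n - 1))"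
  using complexD(3)[OF B] by (intro homI) (simp_all add: monoid.one_closed monoid.l_one)
 fix a assume a: "a \<in> obs A n"
 interpret Bn: group "Ob B n" by (rule complexD(2)[OF B])
 have "Df B (n - 1) (one_ob B (n - 1)) = one_ob B n"
  using hom_one[OF complexD(4)[OF B, of "n - 1"] complexD(2)[OF B] complexD(2)[OF B]] by simp
 then show "\<phi> n a = \<psi> n a \<otimes>\<^bsub>Ob B n\<^esub> (Df B (n - 1) (one_ob B (n - 1)) \<otimes>\<^bsub>Ob B n\<^esub> (one_ob B (n + 1 - 1)))"
  using eq[OF a] by simp
qed

lemma chain_map_id: "group_complex A \<Longrightarrow> chain_map A A (\<lambda>n a. a)"
 by (simp add: chain_map_def hom_def)

text \<open>All points of \<open>G\<close> lie below \<open>p\<close>, so a global section takes its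
  value at \<open>p\<close> everywhere on \<open>G\<close>.\<close>

lemma closure_sheaf_sections:
 assumes fin: "finite_space E" and p: "p \<in> topspace E" and G: "G = {x \<in> topspace E. p \<in> min_nbhd E x}"
 shows "secs (const_sheaf E G) (topspace E) = range (\<lambda>(k::int) x. if x \<in> G then k else 0)"
proof (rule subset_antisym)
 have pG: "p \<in> G" using p min_nbhd_refl[of p E] by (simp add: G)
 show "secs (const_sheaf E G) (topspace E) \<subseteq> range (\<lambda>(k::int) x. if x \<in> G then k else 0)"
 proof (rule subsetI)
  fix s assume "s \<in> secs (const_sheaf E G) (topspace E)"
  note s = this[unfolded mem_const_sheaf[OF fin openin_topspace]]
  have "s x = (if x \<in> G then s p else 0)" for x
  proof (cases "x \<in> G")
   case True
   then have "x \<in> topspace E" "p \<in> min_nbhd E x \<inter> G" using pG by (simp_all add: G)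
   then show ?thesis using bspec[OF bspec[OF conjunct2[OF s]], of x p] True by simp
  next
   case False
   then show ?thesis using spec[OF conjunct1[OF s], of x] by simp
  qed
  then show "s \<in> range (\<lambda>(k::int) x. if x \<in> G then k else 0)" by (intro range_eqI[of _ _ "s p"] ext)
 qed
 show "range (\<lambda>(k::int) x. if x \<in> G then k else 0) \<subseteq> secs (const_sheaf E G) (topspace E)"
 proof (rule image_subsetI)
  fix k :: int
  show "(\<lambda>x. if x \<in> G then k else 0) \<in> secs (const_sheaf E G) (topspace E)"
   unfolding mem_const_sheaf[OF fin openin_topspace]
  proof (intro conjI allI impI ballI)
   show "(if x \<in> G then k else 0) = 0" if "x \<notin> topspace E \<inter> G" for x
   proof -
    have "G \<subseteq> topspace E" unfolding G by blast
    then have "x \<notin> G" using that by blast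
    then show ?thesis by simp
   qed
   fix x y assume x: "x \<in> topspace E" and y: "y \<in> min_nbhd E x \<inter> G"
   then have yx: "y \<in> min_nbhd E x" "p \<in> min_nbhd E y" by (simp_all add: G)
   have "x \<in> G" using x subsetD[OF min_nbhd_mono[OF fin x yx(1)] yx(2)] by (simp add: G)
   then show "(if y \<in> G then k else 0) = (if x \<in> G then k else 0)" using y by simp
  qed
 qed
qed

lemma closure_sheaf_sections_bij:
 assumes "finite_space E" "p \<in> topspace E" "G = {x \<in> topspace E. p \<in> min_nbhd E x}"
 shows "bij_betw (\<lambda>(k::int) x. if x \<in> G then k else 0) UNIV (secs (const_sheaf E G) (topspace E))"
proof -
 have pG: "p \<in> G" using assms min_nbhd_refl[of p E] by simp
 have "inj (\<lambda>(k::int) x. if x \<in> G then k else 0)" by (rule injI) (drule fun_cong[of _ _ p], simp add: pG)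
 then show ?thesis by (simp add: bij_betw_def closure_sheaf_sections[OF assms])
qed

context point_boundary
begin

text \<open>The global sections of the relative complex are the shifted reduced complex itself: an
  integer stands for the constant section on \<open>G\<close>, and the other component consists of
  sections of \<open>J\<close> over \<open>B\<close> on both sides. The signs agree because the same
  shift is applied to cones of the same shape.\<close>

lemma RGamma_red_shift_map:
 fixes M \<kappa>
 defines "M \<equiv> group_shift (-1) (RGamma_red dG J \<eta>)"
  and "\<kappa> \<equiv> \<lambda>n::int. \<lambda>(k::int, b). (\<lambda>x. if x \<in> G then k else 0, b)"
 shows "bij_betw (\<kappa> n) (obs M n) (secs (Sh R n) (topspace E))"
  and "chain_map M (sections R (topspace E)) \<kappa>"
proof -
 let ?D = "group_deg0 integer_group"
 have EB: "topspace E \<inter> B = B" by (auto simp: B_eq G)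
 have e: "n + - 1 + 1 = n" "n + - 1 + 2 = n + 1" "n + - 1 = n - 1" for n :: int by simp_all
 have Mn: "Ob M n = Ob ?D n \<times>\<times> sect (Sh J (n - 1)) B" for n
  unfolding M_def group_shift_simps RGamma_red_def group_cone_simps e by simp
 have Rn: "sect (Sh R n) (topspace E) = sect (Sh K n) (topspace E) \<times>\<times> sect (Sh J (n - 1)) B" for n
  unfolding R_sect EB ..
 let ?\<delta> = "\<lambda>(k::int) x. if x \<in> G then k else 0"
 have \<delta>0: "?\<delta> 0 = (\<lambda>x. 0)" by auto
 have \<delta>: "bij_betw ?\<delta> (obs ?D n) (secs (Sh K n) (topspace E))" for n
  using closure_sheaf_sections_bij[OF fin p G] \<delta>0
  by (cases "n = 0") (simp_all add: group_deg0_simps sheaf_deg0_simps const_sheaf_simps bij_betw_def)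
 have \<kappa>m: "\<kappa> n = map_prod ?\<delta> id" for n by (auto simp: \<kappa>_def fun_eq_iff)
 show "bij_betw (\<kappa> n) (obs M n) (secs (Sh R n) (topspace E))" for n
  unfolding \<kappa>m Mn Rn carrier_DirProd by (rule bij_betw_map_prod[OF \<delta>]) simp
 note o = openin_topspace[of E]
 have gJ: "group (sect (Sh J n) B)" for n using J_group[OF o] unfolding EB .
 have dJ: "Dsh J n B \<in> hom (sect (Sh J n) B) (sect (Sh J (n + 1)) B)" for n
  using J_d_hom[OF o] unfolding EB .
 show "chain_map M (sections R (topspace E)) \<kappa>"
  unfolding chain_map_def sections_simps
 proof (intro conjI allI ballI)
  fix n
  show "\<kappa> n \<in> hom (Ob M n) (sect (Sh R n) (topspace E))"
  proof (rule homI)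
   fix a assume a: "a \<in> obs M n"
   show "\<kappa> n a \<in> secs (Sh R n) (topspace E)"
    unfolding \<kappa>m Rn using a bij_betwE[OF \<delta>, of n] by (auto simp: Mn)
   fix a' assume a': "a' \<in> obs M n"
   have "?\<delta> (k \<otimes>\<^bsub>Ob ?D n\<^esub> l) = ?\<delta> k \<otimes>\<^bsub>sect (Sh K n) (topspace E)\<^esub> ?\<delta> l"
    if "k \<in> obs ?D n" "l \<in> obs ?D n" for k l
    using that
    by (cases "n = 0") (auto simp: group_deg0_simps sheaf_deg0_simps singleton_group_def const_sheaf_simps)
   then show "\<kappa> n (a \<otimes>\<^bsub>Ob M n\<^esub> a') = \<kappa> n a \<otimes>\<^bsub>sect (Sh R n) (topspace E)\<^esub> \<kappa> n a'"
    unfolding \<kappa>m Rn Mn using a a' by (cases a; cases a') (simp add: Mn)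
  qed
  fix a assume a: "a \<in> obs M n"
  obtain k b where kb: "a = (k, b)" by (cases a)
  have k: "k \<in> obs ?D n" and b: "b \<in> secs (Sh J (n - 1)) B" using a by (simp_all add: Mn kb)
  have \<delta>k: "?\<delta> k \<in> secs (Sh K n) (topspace E)" using bij_betwE[OF \<delta>, of n] k by blast
  let ?w = "augmentation J \<eta> n B (\<lambda>x. if x \<in> B then k else 0) \<otimes>\<^bsub>sect (Sh J n) B\<^esub> Dsh J (n - 1) B b"
  have rest: "(\<lambda>x. if x \<in> B then ?\<delta> k x else 0) = (\<lambda>x. if x \<in> B then k else 0)" by (auto simp: B_eq)
  have f: "augmentation J \<eta> n B (\<lambda>x. if x \<in> B then k else 0) \<in> secs (Sh J n) B"
   using morphismD(2)[OF complex_morphismD(3)[OF \<phi>_morphism] o \<delta>k] unfolding L_simps EB rest .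
  have db: "Dsh J (n - 1) B b \<in> secs (Sh J n) B"
   using hom_in_carrier[OF dJ[of "n - 1"] b] by simp
  have w: "?w \<in> secs (Sh J n) B" using monoid.m_closed[OF group.is_monoid[OF gJ] f db] .
  have gD: "group (Ob ?D m)" for m by (simp add: group_deg0_simps)
  have i: "inv\<^bsub>Ob ?D m\<^esub> 0 = 0" for m
   using monoid.inv_one[OF group.is_monoid[OF gD[of m]]] by simp
  have z: "0 \<in> obs ?D m" for m
   using monoid.one_closed[OF group.is_monoid[OF gD[of m]]] by simp
  have "Df M n a = inv\<^bsub>Ob ?D (n + 1) \<times>\<times> sect (Sh J n) B\<^esub> (inv\<^bsub>Ob ?D (n + 1)\<^esub> 0, ?w)"
   unfolding kb M_def group_shift_simps RGamma_red_def e group_cone_simps sections_simps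
   by (simp add: group_deg0_simps(2) e add.commute[of 1 n])
  also have "\<dots> = (0, inv\<^bsub>sect (Sh J n) B\<^esub> ?w)" unfolding i using inv_DirProd[OF gD gJ z w] i by simp
  finally have "\<kappa> (n + 1) (Df M n a) = ((\<lambda>x. 0), inv\<^bsub>sect (Sh J n) B\<^esub> ?w)" by (simp add: \<kappa>m \<delta>0)
  moreover have "Dsh R n (topspace E) (\<kappa> n a) = ((\<lambda>x. 0), inv\<^bsub>sect (Sh J n) B\<^esub> ?w)"
   using R_d[OF o \<delta>k, of b] b unfolding EB rest kb \<kappa>m by simp
  ultimately show "\<kappa> (n + 1) (Df M n a) = Dsh R n (topspace E) (\<kappa> n a)" by simp
 qed
qed

text \<open>The relative complex is supported on \<open>G\<close>: away from it the sheaf on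
  \<open>G\<close> has only the zero section, and \<open>J\<close> is evaluated on the empty
  set.\<close>

lemma R_restrict_one:
 assumes U: "openin E U" and W: "openin E W" and WU: "W \<subseteq> U" and WG: "W \<inter> G = {}" and a: "a \<in> secs (Sh R n) U"
 shows "rest (Sh R n) U W a = one_sect (Sh R n) W"
proof -
 obtain s b where sb: "a = (s, b)" by (cases a)
 have WB: "W \<inter> B = {}" using WG by (auto simp: B_eq)
 have s: "s \<in> secs (Sh K n) U" and b: "b \<in> secs (Sh J (n - 1)) (U \<inter> B)" using a by (simp_all add: R_sect sb)
 have "s x = 0" if "x \<in> W" for x
 proof (cases "n = 0")
  case True
  then show ?thesis using s that WG unfolding sheaf_deg0_simps by (auto simp: mem_const_sheaf[OF fin U])
 next
  case False
  then show ?thesis using s by (simp add: sheaf_deg0_simps const_sheaf_simps)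
 qed
 then have "rest (Sh K n) U W s = one_sect (Sh K n) W"
  by (auto simp: sheaf_deg0_simps const_sheaf_simps singleton_group_def)
 moreover have "rest (Sh J (n - 1)) (U \<inter> B) {} b \<in> carrier (sect (Sh J (n - 1)) {})"
  using presheafD(5)[OF is_sheaf_complexD(2)[OF resolutionD(1)[OF J]] openin_B[OF U] openin_empty _ b] by simp
 from sheaf_empty_trivial[OF fin_dG is_sheaf_complexD(1)[OF resolutionD(1)[OF J]] this]
 have "rest (Sh J (n - 1)) (U \<inter> B) {} b = \<one>\<^bsub>sect (Sh J (n - 1)) {}\<^esub>" .
 ultimately show ?thesis unfolding sb R_rest R_sect WB by simp
qed

end

text \<open>Sections of the sheaf on \<open>G\<close> are integer functions on a finite set, hence
  countably many, and \<open>J\<close> already has values in \<open>'a\<close>; an infinite type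
  absorbs the product.\<close>

lemma relative_complex_small:
 fixes J :: "('s, 'a::infinite) sheaf_complex"
 assumes "point_boundary E p G dG J \<eta>" and x: "x \<in> topspace E"
 shows "germs E (Sh (relative_complex E G dG J \<eta>) n) x \<lesssim> (UNIV :: 'a set)"
proof -
 interpret point_boundary E p G dG J \<eta> by fact
 have S: "germs E (const_sheaf E G) x \<lesssim> (UNIV :: 'a set)"
  by (rule const_sheaf_small[OF fin openin_min_nbhd[OF fin x]])
 have "(one_sect (const_sheaf E G) (min_nbhd E x)) \<in> germs E (const_sheaf E G) x"
  by (rule monoid.one_closed[OF presheafD(3)[OF sheaf_imp_presheaf[OF sheaf_const_sheaf[OF fin]] openin_min_nbhd[OF fin x]]])
 then have "germs E (Sh K n) x \<subseteq> germs E (const_sheaf E G) x"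
  by (simp add: sheaf_deg0_simps)
 then have "germs E (Sh K n) x \<lesssim> (UNIV :: 'a set)"
  by (rule lepoll_trans[OF subset_imp_lepoll S])
 then show ?thesis unfolding R_sect carrier_DirProd by (rule lepoll_infinite_type_Times) (simp_all add: subset_imp_lepoll)
qed

subsection \<open>Direct images of point sheaves under c-proper maps\<close>

text \<open>For a flasque \<open>F\<close> this trivial resolution already computes sections; it is
  used when \<open>p\<close> is closed in its fibre.\<close>

lemma resolution_deg0:
 assumes fin: "finite_space X" and F: "sheaf X F"
 shows "resolution X F (sheaf_deg0 F) (\<lambda>U s. s)"
proof -
 note pF = sheaf_imp_presheaf[OF F]
 have one: "(one_sect (Sh (sheaf_deg0 F) n) U) = one_sect F U" for n U
  by (simp add: sheaf_deg0_simps singleton_group_def)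
 show ?thesis
  unfolding resolution_def one Let_def
 proof (intro conjI allI impI ballI)
  show "is_sheaf_complex X (sheaf_deg0 F)" by (rule is_sheaf_complex_deg0[OF fin F])
  show "presheaf X F" by (rule pF)
  show "secs (Sh (sheaf_deg0 F) n) U \<subseteq> {(one_sect F U)}" if "n < 0" for n U
   using that by (simp add: sheaf_deg0_simps)
  show "sheaf_morphism X F (Sh (sheaf_deg0 F) 0) (\<lambda>U s. s)"
   by (simp add: sheaf_deg0_simps sheaf_morphism_def hom_def)
  show "Dsh (sheaf_deg0 F) 0 U s = one_sect F U" for U s by (simp add: sheaf_deg0_simps)
  show "s = one_sect F (min_nbhd X x)" if "s = one_sect F (min_nbhd X x)" for s x by (rule that)
  show "a \<in> (\<lambda>s. s) ` germs X F x"
   if "a \<in> germs X (Sh (sheaf_deg0 F) 0) x" for a x using that by (simp add: sheaf_deg0_simps)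
  fix x n a assume x: "x \<in> topspace X" and n: "0 \<le> n" and a: "a \<in> germs X (Sh (sheaf_deg0 F) (n + 1)) x"
  have "a = one_sect F (min_nbhd X x)" using a n by (simp add: sheaf_deg0_simps)
  moreover have "(one_sect F (min_nbhd X x)) \<in> germs X (Sh (sheaf_deg0 F) n) x"
   using monoid.one_closed[OF presheafD(3)[OF pF openin_min_nbhd[OF fin x]]] by (simp add: sheaf_deg0_simps)
  ultimately show "a \<in> Dsh (sheaf_deg0 F) n (min_nbhd X x) ` germs X (Sh (sheaf_deg0 F) n) x"
   by (intro image_eqI[of _ _ "(one_sect F (min_nbhd X x))"]) (simp_all add: sheaf_deg0_simps)
 qed
qed

locale c_proper_point =
 fixes X :: "'x topology" and Y :: "'y topology" and f :: "'x \<Rightarrow> 'y" and p :: 'x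
  and I :: "('x, 'a::infinite) sheaf_complex" and \<epsilon> :: "'x set \<Rightarrow> ('x \<Rightarrow> int) \<Rightarrow> 'a"
 assumes finX: "finite_space X" and finY: "finite_space Y"
  and cp: "c_proper TYPE('a) X Y f" and p: "p \<in> topspace X"
  and I: "injective_resolution X (const_sheaf X {p}) I \<epsilon>"
begin

abbreviation c :: 'y where "c \<equiv> f p"
abbreviation Uc :: "'y set" where "Uc \<equiv> min_nbhd Y c"
abbreviation pre :: "'y set \<Rightarrow> 'x set" where "pre W \<equiv> {x \<in> topspace X. f x \<in> W}"
abbreviation V :: "'x set" where "V \<equiv> pre Uc"
abbreviation XV :: "'x topology" where "XV \<equiv> subtopology X V"
abbreviation P :: "('y, 'a) sheaf_complex" where "P \<equiv> pushforward X f I"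

lemma cont: "continuous_map X Y f"
 using cp by (simp add: c_proper_def)

lemma c_in: "c \<in> topspace Y"
 using continuous_map_image_subset_topspace[OF cont] p by blast

lemma openin_pre: "openin Y W \<Longrightarrow> openin X (pre W)"
 by (rule openin_continuous_map_preimage[OF cont])

lemma openV: "openin X V"
 by (rule openin_pre[OF openin_min_nbhd[OF finY c_in]])

lemma topV: "topspace XV = V"
 by (rule topspace_subtopology_subset[OF openin_subset[OF openV]])

lemma finV: "finite_space XV"
 by (rule finite_space_subtopology[OF finX])

lemma openV_self: "openin XV V"
 using openin_topspace[of XV] unfolding topV .

lemma pV: "p \<in> V"
 using p min_nbhd_refl[of c Y] by simp

text \<open>A point of \<open>V\<close> below \<open>p\<close> maps below \<open>c\<close> by
  continuity and above \<open>c\<close> by the choice of \<open>V\<close>.\<close>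

lemma fibre_if_closure: "f x = c" if x: "x \<in> V" "p \<in> min_nbhd X x"
proof -
 have "c \<in> min_nbhd Y (f x)" using continuous_map_min_nbhd[OF cont finY _ x(2)] x(1) by simp
 then show ?thesis using min_nbhd_antisym[OF finY c_in, of "f x"] x(1) by simp
qed

lemma min_nbhd_XV: "x \<in> V \<Longrightarrow> min_nbhd XV x = min_nbhd X x"
 by (rule min_nbhd_open_subtopology[OF finX openV])

text \<open>By \<open>fibre_if_closure\<close> the closure of \<open>p\<close> in \<open>V\<close>
  stays inside the fibre over \<open>c\<close>. This places \<open>G\<close> in an open subspace, to
  which sheaves on \<open>X\<close> restrict without change of data.\<close>

lemma fibre_closure_eq: "fibre_closure X f p = {x \<in> topspace XV. p \<in> min_nbhd XV x}"
proof (rule Set.set_eqI)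
 fix x
 let ?S = "{x \<in> topspace X. f x = c}"
 have top: "topspace (subtopology X ?S) = ?S" by auto
 have pS: "p \<in> topspace (subtopology X ?S)" unfolding top using p by simp
 have "x \<in> fibre_closure X f p \<longleftrightarrow> x \<in> ?S \<and> p \<in> min_nbhd (subtopology X ?S) x"
  unfolding fibre_closure_def in_closure_of_iff_min_nbhd[OF finite_space_subtopology[OF finX] pS] top ..
 also have "\<dots> \<longleftrightarrow> x \<in> ?S \<and> p \<in> min_nbhd X x"
 proof (cases "x \<in> ?S")
  case True
  then have "min_nbhd (subtopology X ?S) x = min_nbhd X x \<inter> ?S" by (intro min_nbhd_subtopology[OF finX]) simp_all
  then show ?thesis using p by simp
 next
  case False
  then show ?thesis by (simp only: simp_thms)
 qed
 also have "\<dots> \<longleftrightarrow> x \<in> V \<and> p \<in> min_nbhd X x"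
 proof
  assume a: "x \<in> ?S \<and> p \<in> min_nbhd X x"
  then have "x \<in> topspace X" "f x = c" by simp_all
  then have "x \<in> V" using min_nbhd_refl[of c Y] by simp
  then show "x \<in> V \<and> p \<in> min_nbhd X x" by (rule conjI[OF _ conjunct2[OF a]])
 next
  assume a: "x \<in> V \<and> p \<in> min_nbhd X x"
  have "f x = c" by (rule fibre_if_closure[OF conjunct1[OF a] conjunct2[OF a]])
  then have "x \<in> ?S" using conjunct1[OF a] by simp
  then show "x \<in> ?S \<and> p \<in> min_nbhd X x" by (rule conjI[OF _ conjunct2[OF a]])
 qed
 also have "\<dots> \<longleftrightarrow> x \<in> topspace XV \<and> p \<in> min_nbhd XV x"
 proof (cases "x \<in> V")
  case True
  show ?thesis unfolding topV min_nbhd_XV[OF True] by (rule refl)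
 next
  case False
  then show ?thesis unfolding topV by (simp only: simp_thms)
 qed
 also have "\<dots> \<longleftrightarrow> x \<in> {x \<in> topspace XV. p \<in> min_nbhd XV x}" by (simp only: mem_Collect_eq)
 finally show "x \<in> fibre_closure X f p \<longleftrightarrow> x \<in> {x \<in> topspace XV. p \<in> min_nbhd XV x}" .
qed

lemma fibre_boundary_eq: "fibre_boundary X f p = subtopology XV (fibre_closure X f p - {p})"
proof -
 have "fibre_closure X f p \<subseteq> V" unfolding fibre_closure_eq topV by (rule Collect_subset)
 then have "V \<inter> (fibre_closure X f p - {p}) = fibre_closure X f p - {p}" by blast
 then show ?thesis by (simp only: fibre_boundary_def subtopology_subtopology)
qed

lemma I_complex: "is_sheaf_complex X I"
 by (rule resolutionD(1)[OF injective_resolution_imp_resolution[OF finX I]])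

lemma I_injective: "injective_sheaf X (Sh I n)"
 using I by (simp add: injective_resolution_def)

text \<open>The point sheaf formed on \<open>V\<close> and the one formed on \<open>X\<close> have
  the same sections over open subsets of \<open>V\<close> but are given by different records, which
  is why \<open>resolution_cong\<close> is applied.\<close>

lemma I_resolution: "resolution XV (const_sheaf XV {p}) I \<epsilon>"
proof (rule resolution_cong[OF resolution_open_subtopology[OF finX openV injective_resolution_imp_resolution[OF finX I]]])
 show "presheaf XV (const_sheaf XV {p})" by (rule sheaf_imp_presheaf[OF sheaf_const_sheaf[OF finV]])
 show "rest (const_sheaf XV {p}) = rest (const_sheaf X {p})" by (simp add: const_sheaf_def)
 show "finite_space XV" by (rule finV)
 fix U assume UV: "openin XV U"
 then have U: "openin X U" "U \<subseteq> V" unfolding openin_open_subtopology[OF openV] by auto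
 let ?rec = "\<lambda>C. \<lparr>carrier = C, monoid.mult = (\<lambda>s t x. s x + t x), one = (\<lambda>x. 0)\<rparr> :: ('x \<Rightarrow> int) monoid"
 have eq: "sect (const_sheaf Z {p}) U = ?rec (secs (const_sheaf Z {p}) U)" for Z
  by (simp add: const_sheaf_def)
 have "min_nbhd XV x = min_nbhd X x" if "x \<in> U" for x by (rule min_nbhd_XV[OF subsetD[OF U(2) that]])
 then have carr: "secs (const_sheaf XV {p}) U = secs (const_sheaf X {p}) U"
  by (intro Set.set_eqI) (simp only: mem_const_sheaf[OF finV UV] mem_const_sheaf[OF finX U(1)] cong: ball_cong)
 have "sect (const_sheaf XV {p}) U = ?rec (secs (const_sheaf XV {p}) U)" by (rule eq)
 also have "\<dots> = ?rec (secs (const_sheaf X {p}) U)" by (simp only: carr)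
 also have "\<dots> = sect (const_sheaf X {p}) U" by (rule eq[symmetric])
 finally show "sect (const_sheaf XV {p}) U = sect (const_sheaf X {p}) U" .
qed

lemma P_complex: "is_sheaf_complex Y P"
 by (rule is_sheaf_complex_pushforward[OF cont I_complex])

text \<open>The direct image itself serves as the apex, with the identity as the second leg.\<close>

lemma roof:
 assumes "quasi_isomorphism Y L P \<beta>"
 shows "derived_iso_roof Y L P P \<beta> (\<lambda>n U s. s)"
proof -
 have G: "group_complex (sections P U)" if "openin Y U" for U by (rule group_complex_sections[OF P_complex that])
 have "quasi_isomorphism Y P P (\<lambda>n U s. s)"
  unfolding quasi_isomorphism_iff[OF finY]
 proof (intro conjI ballI)
  show "complex_morphism Y P P (\<lambda>n U s. s)"
   by (simp add: complex_morphism_def P_complex sheaf_morphism_def hom_def)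
  fix y assume "y \<in> topspace Y"
  note g = G[OF openin_min_nbhd[OF finY this]]
  show "quasi_iso (stalks Y P y) (stalks Y P y) (\<lambda>n s. s)"
   by (rule quasi_iso_bij[OF g g chain_map_id[OF g]]) (simp add: bij_betw_def)
 qed
 then show ?thesis using assms by (simp add: derived_iso_roof_def)
qed

text \<open>The common core of both claims. The stalk of the direct image at \<open>c\<close> is the
  complex of sections over \<open>V\<close>, so a complex \<open>R\<close> that computes it, is
  supported on the closure of \<open>p\<close>, and is identified by \<open>\<tau>\<close> with the
  stalk of \<open>L\<close>, yields the map at \<open>c\<close>. At other points the direct image is
  exact by c-properness.\<close>

lemma point_quasi_isomorphism:
 fixes R :: "('x, 'r) sheaf_complex" and L :: "('y, 'b) sheaf_complex"
 assumes \<theta>: "complex_morphism XV R I \<theta>" and q: "quasi_iso (sections R V) (sections I V) (\<lambda>n. \<theta> n V)"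
  and Rz: "\<And>n W s. openin XV W \<Longrightarrow> W \<inter> fibre_closure X f p = {} \<Longrightarrow> s \<in> secs (Sh R n) V \<Longrightarrow>
   rest (Sh R n) V W s = one_sect (Sh R n) W"
  and L: "is_sheaf_complex Y L"
  and Lz: "\<And>n y s. y \<in> topspace Y \<Longrightarrow> y \<noteq> c \<Longrightarrow> s \<in> germs Y (Sh L n) y \<Longrightarrow>
   s = one_sect (Sh L n) (min_nbhd Y y)"
  and \<tau>: "chain_map (sections L Uc) (sections R V) \<tau>"
  and bij: "\<And>n. bij_betw (\<tau> n) (secs (Sh L n) Uc) (secs (Sh R n) V)"
 obtains \<beta> where "quasi_isomorphism Y L P \<beta>"
  and "\<And>n s. s \<in> secs (Sh L n) Uc \<Longrightarrow> \<beta> n Uc s = \<theta> n V (\<tau> n s)"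
proof (rule skyscraper_quasi_isomorphism[where b = "\<lambda>n s. \<theta> n V (\<tau> n s)", OF finY c_in L P_complex Lz])
 note oc = openin_min_nbhd[OF finY c_in]
 note gL = group_complex_sections[OF L oc] and gR = group_complex_sections[OF complex_morphismD(1)[OF \<theta>] openV_self]
  and gI = group_complex_sections[OF complex_morphismD(2)[OF \<theta>] openV_self]
 note \<theta>V = chain_map_sections[OF \<theta> openV_self]
 show "exact_complex (stalks Y P y)" if "y \<in> topspace Y" "y \<noteq> c" for y
  unfolding sections_pushforward by (rule c_proper_point_exact[OF finX finY cp p I that])
 show "chain_map (sections L Uc) (sections P Uc) (\<lambda>n s. \<theta> n V (\<tau> n s))"
  unfolding sections_pushforward by (rule chain_map_compose[OF \<tau> \<theta>V])
 have "quasi_iso (sections L Uc) (sections R V) \<tau>" by (rule quasi_iso_bij[OF gL gR \<tau>]) (simp add: bij)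
 then show "quasi_iso (sections L Uc) (sections P Uc) (\<lambda>n s. \<theta> n V (\<tau> n s))"
  unfolding sections_pushforward by (rule quasi_iso_compose[OF gL gR gI \<tau> \<theta>V _ q])
 fix n y s assume y: "y \<in> Uc" "y \<noteq> c" and s: "s \<in> secs (Sh L n) Uc"
 have yY: "y \<in> topspace Y" using min_nbhd_in_topspace[OF c_in y(1)] .
 let ?W = "pre (min_nbhd Y y)"
 have WV: "?W \<subseteq> V" using min_nbhd_mono[OF finY c_in y(1)] by auto
 have W: "openin XV ?W"
  unfolding openin_open_subtopology[OF openV] using openin_pre[OF openin_min_nbhd[OF finY yY]] WV by simp
 \<comment> \<open>\<open>y\<close> lies strictly above \<open>c\<close>, so the inverse image of
   its smallest neighbourhood misses the fibre over \<open>c\<close>, and with it the closure of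
   \<open>p\<close> on which \<open>R\<close> lives.\<close>
 have "c \<notin> min_nbhd Y y" using min_nbhd_antisym[OF finY c_in y(1)] y(2) by auto
 have WG: "?W \<inter> fibre_closure X f p = {}"
 proof (rule equals0I)
  fix x assume x: "x \<in> ?W \<inter> fibre_closure X f p"
  then have "x \<in> {x \<in> V. p \<in> min_nbhd XV x}" unfolding fibre_closure_eq topV by (rule IntD2)
  then have xV: "x \<in> V" and px: "p \<in> min_nbhd XV x" by simp_all
  have "f x = c" by (rule fibre_if_closure[OF xV px[unfolded min_nbhd_XV[OF xV]]])
  then show False using x \<open>c \<notin> min_nbhd Y y\<close> by simp
 qed
 have \<tau>s: "\<tau> n s \<in> secs (Sh R n) V" using bij_betwE[OF bij] s by blast
 have "rest (Sh I n) V ?W (\<theta> n V (\<tau> n s)) = \<theta> n ?W (rest (Sh R n) V ?W (\<tau> n s))"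
  using morphismD(3)[OF complex_morphismD(3)[OF \<theta>] openV_self W WV \<tau>s] by simp
 also have "\<dots> = \<theta> n ?W (one_sect (Sh R n) ?W)" unfolding Rz[OF W WG \<tau>s] ..
 also have "\<dots> = one_sect (Sh I n) ?W"
  using hom_one[OF morphismD(1)[OF complex_morphismD(3)[OF \<theta>] W]
    presheafD(2)[OF is_sheaf_complexD(2)[OF complex_morphismD(1)[OF \<theta>]] W]
    presheafD(2)[OF is_sheaf_complexD(2)[OF complex_morphismD(2)[OF \<theta>]] W]] .
 finally show "rest (Sh P n) Uc (min_nbhd Y y) (\<theta> n V (\<tau> n s)) = one_sect (Sh P n) (min_nbhd Y y)"
  unfolding pushforward_simps .
next
 fix \<beta> assume 1: "quasi_isomorphism Y L P \<beta>"
  and 2: "\<And>n s. s \<in> secs (Sh L n) Uc \<Longrightarrow> \<beta> n Uc s = \<theta> n V (\<tau> n s)"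
 show thesis by (rule that[OF 1 2])
qed

text \<open>The relative complex on \<open>V\<close> serves as the flasque resolution. Its
  comparison map \<open>\<theta>\<close> is also the witness for naturality, so the isomorphism
  induces the canonical map on the stalk at \<open>c\<close> by construction.\<close>

lemma natural_isomorphism:
 fixes J :: "('x, 'a) sheaf_complex" and \<eta> :: "'x set \<Rightarrow> ('x \<Rightarrow> int) \<Rightarrow> 'a"
 defines "dG \<equiv> fibre_boundary X f p"
 defines "M \<equiv> group_shift (-1) (RGamma_red dG J \<eta>)"
 assumes J: "injective_resolution dG (const_sheaf dG (topspace dG)) J \<eta>"
 obtains \<beta> where "derived_iso_roof Y (sheaf_tensor Y (const_sheaf Y {c}) M) P P \<beta> (\<lambda>n U s. s)"
  and "natural_roof X Y f p I \<epsilon> J \<eta> P \<beta> (\<lambda>n U s. s)"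
proof -
 let ?G = "fibre_closure X f p"
 let ?L = "sheaf_tensor Y (const_sheaf Y {c}) M"
 have fin_dG: "finite_space dG" unfolding dG_def fibre_boundary_def by (rule finite_space_subtopology[OF finX])
 note JR = injective_resolution_imp_resolution[OF fin_dG J]
 have Jinj: "injective_sheaf dG (Sh J n)" for n using J by (simp add: injective_resolution_def)
 have pb: "point_boundary XV p ?G dG J \<eta>"
 proof
  show "p \<in> topspace XV" unfolding topV by (rule pV)
  show "dG = subtopology XV (?G - {p})" unfolding dG_def by (rule fibre_boundary_eq)
  show "flasque dG (Sh J n)" for n
   by (rule injective_imp_flasque[OF fin_dG Jinj])
 qed (rule finV fibre_closure_eq JR)+
 interpret pb: point_boundary XV p ?G dG J \<eta> by (rule pb)
 let ?R = "relative_complex XV ?G dG J \<eta>"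
 have small: "germs X (Sh ?R n) x \<lesssim> (UNIV :: 'a set)" if "x \<in> V" for n x
  by (rule relative_complex_small[OF pb, of x n, unfolded topV min_nbhd_XV[OF that], OF that])
 obtain \<theta> where \<theta>: "complex_morphism XV ?R I \<theta>"
  and \<theta>\<epsilon>: "\<And>U s. openin XV U \<Longrightarrow> s \<in> secs (const_sheaf XV {p}) U \<Longrightarrow>
   \<theta> 0 U (s, (one_sect (Sh J (- 1)) (U \<inter> topspace dG))) = \<epsilon> U s"
  and \<theta>q: "\<And>W. openin XV W \<Longrightarrow> quasi_iso (sections ?R W) (sections I W) (\<lambda>n. \<theta> n W)"
 proof (rule resolution_comparison[OF finX openV I_injective I_complex I_resolution pb.R_resolution pb.R_flasque small])
  fix \<theta> assume 1: "complex_morphism XV ?R I \<theta>"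
   and 2: "\<And>U s. openin XV U \<Longrightarrow> s \<in> secs (const_sheaf XV {p}) U \<Longrightarrow>
    \<theta> 0 U (s, (one_sect (Sh J (- 1)) (U \<inter> topspace dG))) = \<epsilon> U s"
   and 3: "\<And>W. openin XV W \<Longrightarrow> quasi_iso (sections ?R W) (sections I W) (\<lambda>n. \<theta> n W)"
  show thesis by (rule that[OF 1 2 3])
 qed
 have M: "group_complex M" unfolding M_def by (rule group_complex_shift[OF group_complex_RGamma_red[OF fin_dG JR]])
 define \<sigma> where "\<sigma> n = tensor_section Y (const_sheaf Y {c}) (Ob M n) Uc (\<lambda>y. if y = c then 1 else 0)" for n
 note st = point_tensor_stalk[OF finY c_in M]
 have \<sigma>: "chain_map M (sections ?L Uc) \<sigma>" "\<And>n. bij_betw (\<sigma> n) (obs M n) (secs (Sh ?L n) Uc)"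
  using st(1,2) unfolding \<sigma>_def[abs_def] .
 let ?\<kappa> = "\<lambda>n::int. \<lambda>(k::int, b). (\<lambda>x. if x \<in> ?G then k else 0, b)"
 note \<kappa> = pb.RGamma_red_shift_map[folded M_def, unfolded topV]
 have LC: "is_sheaf_complex Y ?L"
  by (rule is_sheaf_complex_tensor[OF finY sheaf_imp_presheaf[OF sheaf_const_sheaf[OF finY]] M])
 note gL = group_complex_sections[OF LC openin_min_nbhd[OF finY c_in]]
 \<comment> \<open>Undoes the tensoring with the generator at \<open>c\<close> and then reads the
   reduced complex as sections of the relative complex over \<open>V\<close>.\<close>
 define \<tau> where "\<tau> n s = ?\<kappa> n (inv_into (obs M n) (\<sigma> n) s)" for n s
 have \<sigma>i: "chain_map (sections ?L Uc) M (\<lambda>n. inv_into (obs M n) (\<sigma> n))"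
  by (rule chain_map_inv_into[OF M gL \<sigma>(1)]) (simp only: sections_simps \<sigma>(2))
 have \<tau>: "chain_map (sections ?L Uc) (sections ?R V) \<tau>"
  unfolding \<tau>_def[abs_def] by (rule chain_map_compose[OF \<sigma>i \<kappa>(2)])
 have \<tau>b: "bij_betw (\<tau> n) (secs (Sh ?L n) Uc) (secs (Sh ?R n) V)" for n
  using bij_betw_trans[OF bij_betw_inv_into[OF \<sigma>(2)] \<kappa>(1)] unfolding \<tau>_def[abs_def] comp_def .
 have Rz: "rest (Sh ?R n) V W s = one_sect (Sh ?R n) W"
  if "openin XV W" "W \<inter> ?G = {}" "s \<in> secs (Sh ?R n) V" for n W s
  using pb.R_restrict_one[OF openV_self that(1) _ that(2,3)] openin_subset[OF that(1)] unfolding topV by simp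
 obtain \<beta> where \<beta>: "quasi_isomorphism Y ?L P \<beta>"
  and \<beta>\<tau>: "\<And>n s. s \<in> secs (Sh ?L n) Uc \<Longrightarrow> \<beta> n Uc s = \<theta> n V (\<tau> n s)"
 proof (rule point_quasi_isomorphism[OF \<theta> \<theta>q[OF openV_self] Rz LC st(3) \<tau> \<tau>b])
  fix \<beta> assume 1: "quasi_isomorphism Y ?L P \<beta>"
   and 2: "\<And>n s. s \<in> secs (Sh ?L n) Uc \<Longrightarrow> \<beta> n Uc s = \<theta> n V (\<tau> n s)"
  show thesis by (rule that[OF 1 2])
 qed
 \<comment> \<open>On the image of \<open>\<sigma>\<close> the map \<open>\<beta>\<close> is
   \<open>\<theta>\<close> after \<open>?\<kappa>\<close>, so the two chain maps are equal and not
   only homotopic.\<close>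
 have hom: "chain_homotopic M (sections P Uc) (\<lambda>n m. \<beta> n Uc (\<sigma> n m)) (\<lambda>n (k, b). \<theta> n V (\<lambda>x. if x \<in> ?G then k else 0, b))"
 proof (rule chain_homotopic_if_eq[OF M group_complex_sections[OF P_complex openin_min_nbhd[OF finY c_in]]])
  fix n m assume m: "m \<in> obs M n"
  obtain k b where kb: "m = (k, b)" by (cases m)
  have s: "\<sigma> n m \<in> secs (Sh ?L n) Uc" using bij_betwE[OF \<sigma>(2)] m by blast
  have \<kappa>m: "?\<kappa> n m \<in> secs (Sh ?R n) V" using bij_betwE[OF \<kappa>(1)] m by blast
  have "inv_into (obs M n) (\<sigma> n) (\<sigma> n m) = m" by (rule bij_betw_inv_into_left[OF \<sigma>(2) m])
  then have "\<beta> n Uc (\<sigma> n m) = \<theta> n V (?\<kappa> n m)" unfolding \<beta>\<tau>[OF s] \<tau>_def by simp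
  moreover have "\<theta> n V (?\<kappa> n m) \<in> secs (Sh I n) V"
   by (rule morphismD(2)[OF complex_morphismD(3)[OF \<theta>] openV_self \<kappa>m])
  ultimately show "\<beta> n Uc (\<sigma> n m) = (case m of (k, b) \<Rightarrow> \<theta> n V (\<lambda>x. if x \<in> ?G then k else 0, b)) \<and>
    (case m of (k, b) \<Rightarrow> \<theta> n V (\<lambda>x. if x \<in> ?G then k else 0, b)) \<in> obs (sections P Uc) n"
   unfolding sections_simps pushforward_simps kb by simp
 qed
 have "natural_roof X Y f p I \<epsilon> J \<eta> P \<beta> (\<lambda>n U s. s)"
  unfolding natural_roof_def Let_def
 proof (intro exI[of _ \<theta>] conjI allI impI ballI)
  show "complex_morphism XV (relative_complex XV ?G (fibre_boundary X f p) J \<eta>) I \<theta>" using \<theta> unfolding dG_def .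
  show "\<theta> 0 U (s, (one_sect (Sh J (- 1)) (U \<inter> topspace (fibre_boundary X f p)))) = \<epsilon> U s"
   if "openin XV U" "s \<in> secs (const_sheaf XV {p}) U" for U s using \<theta>\<epsilon>[OF that] unfolding dG_def .
  show "chain_homotopic (group_shift (- 1) (RGamma_red (fibre_boundary X f p) J \<eta>)) (sections P Uc)
    (\<lambda>n m. \<beta> n Uc (tensor_section Y (const_sheaf Y {c}) (Ob (group_shift (- 1) (RGamma_red (fibre_boundary X f p) J \<eta>)) n) Uc
     (\<lambda>y. if y = c then 1 else 0) m))
    (\<lambda>n (k, b). \<theta> n V (\<lambda>x. if x \<in> ?G then k else 0, b))"
   using hom unfolding \<sigma>_def M_def dG_def .
 qed
 from that[OF roof[OF \<beta>] this] show thesis .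
qed

lemma closed_isomorphism:
 assumes "closedin (subtopology X {x \<in> topspace X. f x = c}) {p}"
 shows "derived_isomorphic Y (sheaf_deg0 (const_sheaf Y {c})) P"
proof -
 let ?F = "const_sheaf XV {p}" and ?R = "sheaf_deg0 (const_sheaf XV {p})" and ?L = "sheaf_deg0 (const_sheaf Y {c})"
 \<comment> \<open>The closure of \<open>p\<close> in \<open>V\<close> is thus \<open>p\<close>
   alone, so the point sheaf on \<open>V\<close> is the sheaf on the closure of a point, hence a
   flasque skyscraper and its own resolution.\<close>
 have Gp: "fibre_closure X f p = {p}" using closure_of_closedin[OF assms] by (simp add: fibre_closure_def)
 note pG = fibre_closure_eq[unfolded Gp]
 have pXV: "p \<in> topspace XV" unfolding topV by (rule pV)
 note F = sheaf_const_sheaf[OF finV, of "{p}"] and FY = sheaf_const_sheaf[OF finY, of "{c}"]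
 have flF: "flasque XV ?F" using flasque_const_sheaf_closure[OF finV pXV] unfolding pG[symmetric] .
 have small: "germs X (Sh ?R n) x \<lesssim> (UNIV :: 'a set)" if "x \<in> V" for n x
 proof -
  have o: "openin XV (min_nbhd X x)"
   using openin_min_nbhd[OF finV, of x] that unfolding topV min_nbhd_XV[OF that] by simp
  have "germs X (Sh ?R n) x \<subseteq> germs X ?F x"
   using monoid.one_closed[OF presheafD(3)[OF sheaf_imp_presheaf[OF F] o]] by (simp add: sheaf_deg0_simps)
  then show ?thesis by (rule lepoll_trans[OF subset_imp_lepoll const_sheaf_small[OF finV o]])
 qed
 obtain \<theta> where \<theta>: "complex_morphism XV ?R I \<theta>"
  and \<theta>q: "\<And>W. openin XV W \<Longrightarrow> quasi_iso (sections ?R W) (sections I W) (\<lambda>n. \<theta> n W)"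
 proof (rule resolution_comparison[OF finX openV I_injective I_complex I_resolution resolution_deg0[OF finV F]
    flasque_deg0[OF sheaf_imp_presheaf[OF F] flF] small])
  fix \<theta> assume 1: "complex_morphism XV ?R I \<theta>"
   and 3: "\<And>W. openin XV W \<Longrightarrow> quasi_iso (sections ?R W) (sections I W) (\<lambda>n. \<theta> n W)"
  show thesis by (rule that[OF 1 3])
 qed
 have LC: "is_sheaf_complex Y ?L" by (rule is_sheaf_complex_deg0[OF finY FY])
 have Lz: "s = one_sect (Sh ?L n) (min_nbhd Y y)"
  if "y \<in> topspace Y" "y \<noteq> c" "s \<in> germs Y (Sh ?L n) y" for n y s
  using that point_sheaf_sections[OF finY c_in that(1)]
  by (auto simp: sheaf_deg0_simps const_sheaf_simps singleton_group_def split: if_splits)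
 have Rz: "rest (Sh ?R n) V W s = one_sect (Sh ?R n) W"
  if W: "openin XV W" "W \<inter> fibre_closure X f p = {}" and s: "s \<in> secs (Sh ?R n) V" for n W s
 proof -
  have "s x = 0" if "x \<in> W" for x
   using s that W(2) unfolding sheaf_deg0_simps Gp
   by (cases "n = 0") (auto simp: mem_const_sheaf[OF finV openV_self] const_sheaf_simps)
  then show ?thesis by (auto simp: sheaf_deg0_simps const_sheaf_simps singleton_group_def)
 qed
 \<comment> \<open>Both groups are the integers in degree 0, and the value at \<open>c\<close> is
   moved to \<open>p\<close>. In the other degrees only the zero function occurs.\<close>
 let ?\<tau> = "\<lambda>(n::int) (s :: 'y \<Rightarrow> int) x. if x = p then s c else 0"
 have cL: "secs (const_sheaf Y {c}) Uc = range (\<lambda>(k::int) y. if y = c then k else 0)"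
  using point_sheaf_sections[OF finY c_in c_in] by simp
 have cR: "secs ?F V = range (\<lambda>(k::int) x. if x = p then k else 0)"
  using closure_sheaf_sections[OF finV pXV pG] unfolding topV by simp
 have b0: "bij_betw (?\<tau> 0) (secs (const_sheaf Y {c}) Uc) (secs ?F V)"
  by (rule bij_betw_byWitness[where f' = "\<lambda>s y. if y = c then s p else 0"]) (auto simp: cL cR)
 have b: "bij_betw (?\<tau> n) (secs (Sh ?L n) Uc) (secs (Sh ?R n) V)" for n
  using b0 by (cases "n = 0") (simp_all add: sheaf_deg0_simps const_sheaf_simps bij_betw_def)
 have \<tau>: "chain_map (sections ?L Uc) (sections ?R V) ?\<tau>"
  unfolding chain_map_def sections_simps
 proof (intro conjI allI ballI)
  fix n
  show "?\<tau> n \<in> hom (sect (Sh ?L n) Uc) (sect (Sh ?R n) V)"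
  proof (rule homI)
   show "?\<tau> n s \<in> secs (Sh ?R n) V" if "s \<in> secs (Sh ?L n) Uc" for s
    using bij_betwE[OF b[of n]] that by blast
   show "?\<tau> n (s \<otimes>\<^bsub>sect (Sh ?L n) Uc\<^esub> t) = ?\<tau> n s \<otimes>\<^bsub>sect (Sh ?R n) V\<^esub> ?\<tau> n t" for s t
    by (cases "n = 0") (auto simp: sheaf_deg0_simps const_sheaf_simps singleton_group_def)
  qed
  show "?\<tau> (n + 1) (Dsh ?L n Uc s) = Dsh ?R n V (?\<tau> n s)" for s
   by (auto simp: sheaf_deg0_simps const_sheaf_simps)
 qed
 obtain \<beta> where "quasi_isomorphism Y ?L P \<beta>"
  by (rule point_quasi_isomorphism[OF \<theta> \<theta>q[OF openV_self] Rz LC Lz \<tau> b])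
 from roof[OF this] show ?thesis unfolding derived_isomorphic_def by blast
qed

end

theorem proposition1p30:
  fixes X :: "'x topology" and Y :: "'y topology" and f :: "'x \<Rightarrow> 'y" and p :: 'x
    and I :: "('x, 'a::infinite) sheaf_complex" and \<epsilon> :: "'x set \<Rightarrow> ('x \<Rightarrow> int) \<Rightarrow> 'a"
  assumes "finite_space X" and "finite_space Y"
    and "c_proper TYPE('a) X Y f"
    and "p \<in> topspace X"
    and "injective_resolution X (const_sheaf X {p}) I \<epsilon>"
  shows "(\<forall>(J :: ('x, 'a) sheaf_complex) \<eta>.
           injective_resolution (fibre_boundary X f p)
             (const_sheaf (fibre_boundary X f p) (topspace (fibre_boundary X f p))) J \<eta> \<longrightarrow>
           (\<exists>P \<beta> \<alpha>.
             derived_iso_roof Y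
               (sheaf_tensor Y (const_sheaf Y {f p})
                 (group_shift (-1) (RGamma_red (fibre_boundary X f p) J \<eta>)))
               P
               (pushforward X f I) \<beta> \<alpha> \<and>
             natural_roof X Y f p I \<epsilon> J \<eta> P \<beta> \<alpha>)) \<and>
         (closedin (subtopology X {x \<in> topspace X. f x = f p}) {p} \<longrightarrow>
           derived_isomorphic Y (sheaf_deg0 (const_sheaf Y {f p})) (pushforward X f I))"
proof (intro conjI allI impI)
 interpret c_proper_point X Y f p I \<epsilon> using assms by (simp add: c_proper_point_def)
 show "derived_isomorphic Y (sheaf_deg0 (const_sheaf Y {f p})) (pushforward X f I)"
  if "closedin (subtopology X {x \<in> topspace X. f x = f p}) {p}" by (rule closed_isomorphism[OF that])
 fix J :: "('x, 'a) sheaf_complex" and \<eta>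
 assume "injective_resolution (fibre_boundary X f p)
  (const_sheaf (fibre_boundary X f p) (topspace (fibre_boundary X f p))) J \<eta>"
 then show "\<exists>P \<beta> \<alpha>.
   derived_iso_roof Y
    (sheaf_tensor Y (const_sheaf Y {f p}) (group_shift (-1) (RGamma_red (fibre_boundary X f p) J \<eta>)))
    P (pushforward X f I) \<beta> \<alpha> \<and>
   natural_roof X Y f p I \<epsilon> J \<eta> P \<beta> \<alpha>"
  by (rule natural_isomorphism) blast
qed

end
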